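(* Let $0 \leq \alpha < 1$, $0 < p, q \leq \infty$ and $s \in \mathbb{R}$. Then all pseudodifferential operators with symbols in $S_{\alpha,\alpha}^0$ are bounded on $M_{p,q}^{s,\alpha}(\mathbb{R}^n)$.
   Context: Notation: $\langle x\rangle = 1+|x|$ for $x\in\mathbb{R}^n$. $\mathcal{S}=\mathcal{S}(\mathbb{R}^n)$ is the Schwartz space, $\mathcal{S}'=\mathcal{S}'(\mathbb{R}^n)$ the space of tempered distributions; $\mathcal{F}f(\xi)=\widehat f(\xi)=\int_{\mathbb{R}^n} e^{-i\xi\cdot x}f(x)\,dx$ and $\mathcal{F}^{-1}f(x)=(2\pi)^{-n}\int_{\mathbb{R}^n}e^{ix\cdot\xi}f(\xi)\,d\xi$. For a function $m$, the Fourier multiplier is $m(D)f=\mathcal{F}^{-1}[m\cdot\mathcal{F}f]$. Symbol class: for $b\in\mathbb{R}$ and $0\le\delta\le\rho\le1$, $S^b_{\rho,\delta}$ is the set of all $\sigma\in C^\infty(\mathbb{R}^n\times\mathbb{R}^n)$ such that for all multi-indices $\beta,\gamma\in\mathbb{Z}_+^n$ there is a constant $C_{\beta,\gamma}$ with $|\partial_x^\beta\partial_\xi^\gamma\sigma(x,\xi)|\le C_{\beta,\gamma}\langle\xi\rangle^{b+\delta|\beta|-\rho|\gamma|}$ for all $x,\xi$. The pseudodifferential operator with symbol $\sigma$ is $\sigma(X,D)f(x)=(2\pi)^{-n}\int_{\mathbb{R}^n}e^{ix\cdot\xi}\sigma(x,\xi)\widehat f(\xi)\,d\xi$ for $f\in\mathcal{S}(\mathbb{R}^n)$.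 $\alpha$-modulation spaces ($0\le\alpha<1$): let $C>1$ be a suitable constant depending on $n$ and $\alpha$, and let $\{\eta_k^\alpha\}_{k\in\mathbb{Z}^n}$ be a sequence of Schwartz functions such that (i) $\mathrm{supp}\,\eta_k^\alpha\subset\{\xi\in\mathbb{R}^n:|\xi-\langle k\rangle^{\alpha/(1-\alpha)}k|\le C\langle k\rangle^{\alpha/(1-\alpha)}\}$; (ii) for every multi-index $\beta$ there is a constant $C'_\beta$ with $|\partial_\xi^\beta\eta_k^\alpha(\xi)|\le C'_\beta\langle k\rangle^{-|\beta|\alpha/(1-\alpha)}$ for all $k,\xi$; (iii) $\sum_{k\in\mathbb{Z}^n}\eta_k^\alpha(\xi)=1$ for all $\xi\in\mathbb{R}^n$. For $0<p,q\le\infty$ and $s\in\mathbb{R}$, $M_{p,q}^{s,\alpha}(\mathbb{R}^n)$ is the set of $f\in\mathcal{S}'(\mathbb{R}^n)$ with $\|f\|_{M_{p,q}^{s,\alpha}}=\big\|\langle k\rangle^{s/(1-\alpha)}\|\eta_k^\alpha(D)f\|_{L^p}\big\|_{\ell^q(\mathbb{Z}^n_k)}<\infty$. Different admissible choices of $\{\eta_k^\alpha\}$ give equivalent (quasi-)norms. Boundedness convention: $\sigma(X,D)$ is said to be bounded from $M_{p,q}^{s,\alpha}$ to $M_{p,q}^{t,\alpha}$ if there is a constant $C_\sigma$ such that $\|\sigma(X,D)f\|_{M_{p,q}^{t,\alpha}}\le C_\sigma\|f\|_{M_{p,q}^{s,\alpha}}$ for all $f\in\mathcal{S}(\mathbb{R}^n)$;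 if $s=t$ it is said to be bounded on $M_{p,q}^{s,\alpha}$. *)

theory Defs
  imports "HOL-Analysis.Analysis" "HOL-Probability.Essential_Supremum"
begin

section \<open>Smooth functions and multi-index derivatives\<close>

definition jap :: "'a::real_normed_vector \<Rightarrow> real" where
  "jap x = 1 + norm x"

definition partial_deriv ::
    "'a::real_normed_vector \<Rightarrow> ('a \<Rightarrow> complex) \<Rightarrow> 'a \<Rightarrow> complex" where
  "partial_deriv v f x = frechet_derivative f (at x) v"

text \<open>\<open>C\<^sup>\<infinity>\<close>: every iterated partial derivative is (totally) differentiable everywhere.\<close>

definition smooth :: "('a::euclidean_space \<Rightarrow> complex) \<Rightarrow> bool" where
  "smooth f \<longleftrightarrow>
     (\<forall>vs. set vs \<subseteq> Basis \<longrightarrow> (\<forall>x. foldr partial_deriv vs f differentiable (at x)))"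

text \<open>Multi-indices are vectors \<open>\<beta> :: nat ^ 'n\<close>. A finite index type carries no canonical order, so
  the coordinate derivatives in \<open>\<partial>\<^sup>\<beta>\<close> are composed along an arbitrarily chosen enumeration; for
  smooth functions the choice is immaterial.\<close>

definition coords :: "'n::finite list" where
  "coords = (SOME js. distinct js \<and> set js = UNIV)"

definition morder :: "nat ^ 'n::finite \<Rightarrow> nat" where
  "morder \<beta> = (\<Sum>j\<in>UNIV. \<beta> $ j)"

text \<open>\<open>e j\<close> is the direction in which the \<open>j\<close>-th coordinate derivative is taken. This lets the same
  operator act on functions on \<open>\<real>\<^sup>n\<close> and, separately in either variable, on functions on
  \<open>\<real>\<^sup>n \<times> \<real>\<^sup>n\<close>.\<close>

definition mderiv_dir ::
    "('n::finite \<Rightarrow> 'a::real_normed_vector) \<Rightarrow> nat ^ 'n \<Rightarrow> ('a \<Rightarrow> complex) \<Rightarrow> 'a \<Rightarrow> complex" where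
  "mderiv_dir e \<beta> f = foldr (\<lambda>j. partial_deriv (e j) ^^ (\<beta> $ j)) coords f"

definition mderiv :: "nat ^ 'n::finite \<Rightarrow> (real ^ 'n \<Rightarrow> complex) \<Rightarrow> real ^ 'n \<Rightarrow> complex" where
  "mderiv = mderiv_dir (\<lambda>j. axis j 1)"

definition mderiv_fst :: "nat ^ 'n::finite \<Rightarrow> ((real ^ 'n) \<times> (real ^ 'n) \<Rightarrow> complex) \<Rightarrow>
    (real ^ 'n) \<times> (real ^ 'n) \<Rightarrow> complex" where
  "mderiv_fst = mderiv_dir (\<lambda>j. (axis j 1, 0))"

definition mderiv_snd :: "nat ^ 'n::finite \<Rightarrow> ((real ^ 'n) \<times> (real ^ 'n) \<Rightarrow> complex) \<Rightarrow>
    (real ^ 'n) \<times> (real ^ 'n) \<Rightarrow> complex" where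
  "mderiv_snd = mderiv_dir (\<lambda>j. (0, axis j 1))"


section \<open>Schwartz functions and tempered distributions\<close>

definition schwartz :: "(real ^ 'n::finite \<Rightarrow> complex) set" where
  "schwartz = {f. smooth f \<and>
     (\<forall>(N::nat) \<beta>. \<exists>B. \<forall>x. jap x ^ N * norm (mderiv \<beta> f x) \<le> B)}"

definition schwartz_seminorm ::
    "nat \<Rightarrow> nat ^ 'n::finite \<Rightarrow> (real ^ 'n \<Rightarrow> complex) \<Rightarrow> real" where
  "schwartz_seminorm N \<beta> f = (SUP x. jap x ^ N * norm (mderiv \<beta> f x))"

text \<open>Distributions are functionals on all functions; only their values on \<open>schwartz\<close> are ever
  used. Continuity is boundedness by finitely many of the defining seminorms.\<close>

type_synonym 'n dist = "(real ^ 'n \<Rightarrow> complex) \<Rightarrow> complex"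

definition tempered_distributions :: "'n::finite dist set" where
  "tempered_distributions = {T.
     (\<forall>\<phi>\<in>schwartz. \<forall>\<psi>\<in>schwartz. T (\<lambda>x. \<phi> x + \<psi> x) = T \<phi> + T \<psi>) \<and>
     (\<forall>c. \<forall>\<phi>\<in>schwartz. T (\<lambda>x. c * \<phi> x) = c * T \<phi>) \<and>
     (\<exists>N::nat. \<exists>B. \<forall>\<phi>\<in>schwartz.
        norm (T \<phi>) \<le> B * (\<Sum>\<beta> | morder \<beta> \<le> N. schwartz_seminorm N \<beta> \<phi>))}"

definition represents :: "(real ^ 'n::finite \<Rightarrow> complex) \<Rightarrow> 'n dist \<Rightarrow> bool" where
  "represents g T \<longleftrightarrow> g \<in> borel_measurable lborel \<and>
     (\<forall>\<phi>\<in>schwartz. integrable lborel (\<lambda>x. g x * \<phi> x) \<and> T \<phi> = (LINT x|lborel. g x * \<phi> x))"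

definition dist_of :: "(real ^ 'n::finite \<Rightarrow> complex) \<Rightarrow> 'n dist" where
  "dist_of g = (\<lambda>\<phi>. LINT x|lborel. g x * \<phi> x)"

definition tempered_function :: "(real ^ 'n::finite \<Rightarrow> complex) \<Rightarrow> bool" where
  "tempered_function g \<longleftrightarrow> represents g (dist_of g) \<and> dist_of g \<in> tempered_distributions"


section \<open>Fourier transform, multipliers and pseudodifferential operators\<close>

definition fourier :: "(real ^ 'n::finite \<Rightarrow> complex) \<Rightarrow> real ^ 'n \<Rightarrow> complex" where
  "fourier f \<xi> = (LINT x|lborel. exp (- \<i> * complex_of_real (\<xi> \<bullet> x)) * f x)"

definition inv_fourier :: "(real ^ 'n::finite \<Rightarrow> complex) \<Rightarrow> real ^ 'n \<Rightarrow> complex" where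
  "inv_fourier f x = complex_of_real (1 / (2 * pi) ^ CARD('n)) *
     (LINT \<xi>|lborel. exp (\<i> * complex_of_real (x \<bullet> \<xi>)) * f \<xi>)"

definition dist_fourier :: "'n::finite dist \<Rightarrow> 'n dist" where
  "dist_fourier T = (\<lambda>\<phi>. T (fourier \<phi>))"

definition dist_inv_fourier :: "'n::finite dist \<Rightarrow> 'n dist" where
  "dist_inv_fourier T = (\<lambda>\<phi>. T (inv_fourier \<phi>))"

definition dist_mult :: "(real ^ 'n::finite \<Rightarrow> complex) \<Rightarrow> 'n dist \<Rightarrow> 'n dist" where
  "dist_mult m T = (\<lambda>\<phi>. T (\<lambda>x. m x * \<phi> x))"

definition fourier_multiplier :: "(real ^ 'n::finite \<Rightarrow> complex) \<Rightarrow> 'n dist \<Rightarrow> 'n dist" where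
  "fourier_multiplier m T = dist_inv_fourier (dist_mult m (dist_fourier T))"

definition symbol_class ::
    "real \<Rightarrow> real \<Rightarrow> real \<Rightarrow> ((real ^ 'n::finite) \<times> (real ^ 'n) \<Rightarrow> complex) set" where
  "symbol_class b \<rho> \<delta> = {\<sigma>. smooth \<sigma> \<and>
     (\<forall>\<beta> \<gamma>. \<exists>B. \<forall>x \<xi>. norm (mderiv_fst \<beta> (mderiv_snd \<gamma> \<sigma>) (x, \<xi>))
        \<le> B * jap \<xi> powr (b + \<delta> * real (morder \<beta>) - \<rho> * real (morder \<gamma>)))}"

definition pseudo_diff_op :: "((real ^ 'n::finite) \<times> (real ^ 'n) \<Rightarrow> complex) \<Rightarrow>
    (real ^ 'n \<Rightarrow> complex) \<Rightarrow> real ^ 'n \<Rightarrow> complex" where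
  "pseudo_diff_op \<sigma> f x = complex_of_real (1 / (2 * pi) ^ CARD('n)) *
     (LINT \<xi>|lborel. exp (\<i> * complex_of_real (x \<bullet> \<xi>)) * \<sigma> (x, \<xi>) * fourier f \<xi>)"


section \<open>Lebesgue quasi-norms\<close>

text \<open>Power of an extended nonnegative number by a positive real exponent.\<close>

definition epowr :: "ennreal \<Rightarrow> real \<Rightarrow> ennreal" where
  "epowr x a = (if x = \<infinity> then \<infinity> else ennreal (enn2real x powr a))"

text \<open>The \<open>L\<^sup>p(M)\<close> quasi-norm, \<open>0 < p \<le> \<infinity>\<close>, of a nonnegative function; for a counting measure
  this is the \<open>\<ell>\<^sup>p\<close> quasi-norm.\<close>

definition Lp_norm :: "'a measure \<Rightarrow> ennreal \<Rightarrow> ('a \<Rightarrow> ennreal) \<Rightarrow> ennreal" where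
  "Lp_norm M p f =
     (if p = \<infinity> then esssup M f
      else epowr (\<integral>\<^sup>+x. epowr (f x) (enn2real p) \<partial>M) (1 / enn2real p))"

text \<open>The \<open>L\<^sup>p\<close> quasi-norm of a distribution is that of the function representing it. This function
  is unique almost everywhere, so the infimum only serves to pick it, and yields \<open>\<infinity>\<close> if there
  is none.\<close>

definition dist_Lp_norm :: "ennreal \<Rightarrow> 'n::finite dist \<Rightarrow> ennreal" where
  "dist_Lp_norm p T = (INF g\<in>{g. represents g T}. Lp_norm lborel p (\<lambda>x. ennreal (norm (g x))))"


section \<open>\<open>\<alpha>\<close>-modulation spaces\<close>

definition ivec :: "int ^ 'n::finite \<Rightarrow> real ^ 'n" where
  "ivec k = (\<chi> j. real_of_int (k $ j))"

definition alpha_decomposition ::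
    "real \<Rightarrow> real \<Rightarrow> (int ^ 'n::finite \<Rightarrow> real ^ 'n \<Rightarrow> complex) \<Rightarrow> bool" where
  "alpha_decomposition \<alpha> C \<eta> \<longleftrightarrow>
     (\<forall>k. \<eta> k \<in> schwartz) \<and>
     (\<forall>k. closure {\<xi>. \<eta> k \<xi> \<noteq> 0} \<subseteq>
        {\<xi>. norm (\<xi> - jap (ivec k) powr (\<alpha> / (1 - \<alpha>)) *\<^sub>R ivec k)
              \<le> C * jap (ivec k) powr (\<alpha> / (1 - \<alpha>))}) \<and>
     (\<forall>\<beta>. \<exists>B. \<forall>k \<xi>. norm (mderiv \<beta> (\<eta> k) \<xi>)
        \<le> B * jap (ivec k) powr (- real (morder \<beta>) * \<alpha> / (1 - \<alpha>))) \<and>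
     (\<forall>\<xi>. ((\<lambda>k. \<eta> k \<xi>) has_sum 1) UNIV)"

definition alpha_mod_norm :: "(int ^ 'n::finite \<Rightarrow> real ^ 'n \<Rightarrow> complex) \<Rightarrow> real \<Rightarrow>
    ennreal \<Rightarrow> ennreal \<Rightarrow> real \<Rightarrow> 'n dist \<Rightarrow> ennreal" where
  "alpha_mod_norm \<eta> \<alpha> p q s T =
     Lp_norm (count_space UNIV) q
       (\<lambda>k. ennreal (jap (ivec k) powr (s / (1 - \<alpha>))) *
            dist_Lp_norm p (fourier_multiplier (\<eta> k) T))"

definition alpha_mod_space :: "(int ^ 'n::finite \<Rightarrow> real ^ 'n \<Rightarrow> complex) \<Rightarrow> real \<Rightarrow>
    ennreal \<Rightarrow> ennreal \<Rightarrow> real \<Rightarrow> 'n dist set" where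
  "alpha_mod_space \<eta> \<alpha> p q s =
     {T \<in> tempered_distributions. alpha_mod_norm \<eta> \<alpha> p q s T < \<infinity>}"

text \<open>Boundedness from \<open>M\<^bsub>p,q\<^esub>\<^bsup>s,\<alpha>\<^esup>\<close> to \<open>M\<^bsub>p,q\<^esub>\<^bsup>t,\<alpha>\<^esup>\<close>, tested on Schwartz functions. The requirement
  that \<open>\<sigma>(X,D)f\<close> is a tempered function makes the left-hand norm meaningful: without it
  \<open>dist_of\<close> could be a junk value.\<close>

definition bounded_alpha_mod :: "(int ^ 'n::finite \<Rightarrow> real ^ 'n \<Rightarrow> complex) \<Rightarrow> real \<Rightarrow>
    ennreal \<Rightarrow> ennreal \<Rightarrow> real \<Rightarrow> real \<Rightarrow> ((real ^ 'n) \<times> (real ^ 'n) \<Rightarrow> complex) \<Rightarrow> bool" where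
  "bounded_alpha_mod \<eta> \<alpha> p q s t \<sigma> \<longleftrightarrow>
     (\<exists>B::real. \<forall>f\<in>schwartz. tempered_function (pseudo_diff_op \<sigma> f) \<and>
        alpha_mod_norm \<eta> \<alpha> p q t (dist_of (pseudo_diff_op \<sigma> f))
          \<le> ennreal B * alpha_mod_norm \<eta> \<alpha> p q s (dist_of f))"

end

theory Submission
  imports Defs "HOL-Probability.Distributions"
begin

text \<open>Write \<open>f\<^sub>l = \<eta>\<^sub>l(D) f\<close> and \<open>r\<^sub>l = \<langle>l\<rangle>\<^sup>\<alpha>\<^sup>/\<^sup>(\<^sup>1\<^sup>-\<^sup>\<alpha>\<^sup>)\<close> for the size of the \<open>l\<close>-th frequency block. On that
  block \<open>\<sigma>\<close> varies at scale \<open>r\<^sub>l\<close> in \<open>\<xi>\<close> and at scale \<open>1 / r\<^sub>l\<close> in \<open>x\<close>, since \<open>\<langle>\<xi>\<rangle>\<^sup>\<alpha>\<close> is comparable to \<open>r\<^sub>l\<close>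
  there. Each integration by parts in \<open>x\<close> against \<open>\<eta>\<^sub>k(D)\<close> therefore gains \<open>r\<^sub>l\<close> divided by the
  distance of the blocks, and the centres satisfy
  \<open>|c\<^sub>k - c\<^sub>l| \<ge> (r\<^sub>k + r\<^sub>l) |k - l| / 2\<close>. Together with the kernel decay of \<open>\<sigma>(x, D) \<eta>\<^sub>l(D)\<close> this bounds
  \<open>|\<eta>\<^sub>k(D) \<sigma>(X, D) f (x)|\<close> by a sum over \<open>l\<close> of \<open>\<langle>k - l\<rangle>\<^sup>-\<^sup>N\<close> times the Peetre maximal function of \<open>f\<^sub>l\<close>
  at \<open>x\<close>, with \<open>N\<close> arbitrary. The maximal inequality handles every \<open>0 < p \<le> \<infinity>\<close>; the rapid decay in
  \<open>k - l\<close> handles every \<open>0 < q \<le> \<infinity>\<close> and the moderate weight \<open>\<langle>k\<rangle>\<^sup>s\<^sup>/\<^sup>(\<^sup>1\<^sup>-\<^sup>\<alpha>\<^sup>)\<close>.\<close>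

section \<open>Directional derivatives\<close>

text \<open>Both convolution kernels are measured at the scale r_l of the input block, although
  \<open>\<eta> k\<close> lives at scale r_k. The two scales differ by at most <k-l>^e, so this
  costs <k-l> to the power e L + e n, repaid by as many additional integrations by parts. Dividing
  by the frequency distance would break down for neighbouring blocks; each integration by parts
  divides by 1 + i t instead, with t the distance along one coordinate in units of r_l, so near and
  far blocks are treated alike. Below exponent 1 neither Minkowski nor Young is available: the sum
  over l is replaced by a supremum times a convergent lattice sum, and the power of a supremum is at
  most the sum of the powers, for every positive exponent. The norms are infima over representing
  functions: an upper bound needs one representative, a lower bound its uniqueness almost
  everywhere. Derivative bounds concern iterated derivatives in one coordinate direction, which
  avoids multi-index Leibniz formulas. Derivatives are a relation, so that they can be exhibited by
  the product and chain rules.\<close>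

definition dirderiv :: "'a::real_normed_vector \<Rightarrow> ('a \<Rightarrow> complex) \<Rightarrow> ('a \<Rightarrow> complex) \<Rightarrow> bool" where
  "dirderiv v f f' \<longleftrightarrow> (\<forall>x. ((\<lambda>t. f (x + t *\<^sub>R v)) has_vector_derivative f' x) (at 0))"

lemma dirderiv_at:
  assumes "dirderiv v f f'"
  shows "((\<lambda>t. f (x + t *\<^sub>R v)) has_vector_derivative f' (x + s *\<^sub>R v)) (at s)"
proof -
  have "((\<lambda>t. f ((x + s *\<^sub>R v) + t *\<^sub>R v)) has_vector_derivative f' (x + s *\<^sub>R v)) (at 0)"
    using assms by (auto simp: dirderiv_def)
  then have "(((\<lambda>t. f ((x + s *\<^sub>R v) + t *\<^sub>R v)) \<circ> (\<lambda>t. t - s)) has_vector_derivative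
      (1 *\<^sub>R f' (x + s *\<^sub>R v))) (at s)"
    by (intro vector_diff_chain_at) (auto intro!: derivative_eq_intros)
  moreover have "(\<lambda>t. f ((x + s *\<^sub>R v) + t *\<^sub>R v)) \<circ> (\<lambda>t. t - s) = (\<lambda>t. f (x + t *\<^sub>R v))"
    by (auto simp: algebra_simps)
  ultimately show ?thesis by simp
qed

lemma dirderiv_unique:
  assumes "dirderiv v f f'" "dirderiv v f f''"
  shows "f' = f''"
  using assms unfolding dirderiv_def by (auto intro!: ext vector_derivative_unique_at)

lemma dirderiv_const: "dirderiv v (\<lambda>_. c) (\<lambda>_. 0)"
  by (simp add: dirderiv_def)

lemma dirderiv_add:
  assumes "dirderiv v f f'" "dirderiv v g g'"
  shows "dirderiv v (\<lambda>x. f x + g x) (\<lambda>x. f' x + g' x)"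
  using assms unfolding dirderiv_def by (auto intro!: has_vector_derivative_add)

lemma dirderiv_mult:
  assumes "dirderiv v f f'" "dirderiv v g g'"
  shows "dirderiv v (\<lambda>x. f x * g x) (\<lambda>x. f' x * g x + f x * g' x)"
  unfolding dirderiv_def
proof
  fix x
  have "((\<lambda>t. f (x + t *\<^sub>R v) * g (x + t *\<^sub>R v)) has_vector_derivative
      f (x + 0 *\<^sub>R v) * g' x + f' x * g (x + 0 *\<^sub>R v)) (at 0)"
    using assms unfolding dirderiv_def by (intro has_vector_derivative_mult) auto
  then show "((\<lambda>t. f (x + t *\<^sub>R v) * g (x + t *\<^sub>R v)) has_vector_derivative
      f' x * g x + f x * g' x) (at 0)"
    by (simp add: add.commute)
qed

lemma dirderiv_cmult:
  assumes "dirderiv v f f'"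
  shows "dirderiv v (\<lambda>x. c * f x) (\<lambda>x. c * f' x)"
  using dirderiv_mult[OF dirderiv_const[of v c] assms] by simp

lemma dirderiv_of_linear:
  assumes "bounded_linear h"
  shows "dirderiv v (\<lambda>x. h (x - c)) (\<lambda>_. h v)"
proof -
  interpret bounded_linear h by fact
  have "((\<lambda>t. h (x + t *\<^sub>R v - c)) has_vector_derivative h v) (at 0)" for x
  proof -
    have "(\<lambda>t. h (x + t *\<^sub>R v - c)) = (\<lambda>t. h (x - c) + t *\<^sub>R h v)"
      by (simp add: add diff scaleR algebra_simps)
    then show ?thesis by (auto intro!: derivative_eq_intros)
  qed
  then show ?thesis by (simp add: dirderiv_def)
qed

lemma dirderiv_field:
  assumes "dirderiv v f f'" and "\<And>z. z \<in> range f \<Longrightarrow> (h has_field_derivative h' z) (at z)"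
  shows "dirderiv v (\<lambda>x. h (f x)) (\<lambda>x. f' x * h' (f x))"
  unfolding dirderiv_def
proof
  fix x
  have "((h \<circ> (\<lambda>t. f (x + t *\<^sub>R v))) has_vector_derivative (f' x * h' (f (x + 0 *\<^sub>R v)))) (at 0)"
    using assms by (intro field_vector_diff_chain_at) (auto simp: dirderiv_def)
  then show "((\<lambda>t. h (f (x + t *\<^sub>R v))) has_vector_derivative (f' x * h' (f x))) (at 0)"
    by (simp add: o_def)
qed

lemma dirderiv_frechet:
  assumes "\<And>x. f differentiable (at x)"
  shows "dirderiv v f (partial_deriv v f)"
  unfolding dirderiv_def
proof
  fix x
  have 1: "(f has_derivative frechet_derivative f (at x)) (at x)"
    using assms frechet_derivative_works by blast
  have 2: "((\<lambda>t. x + t *\<^sub>R v) has_derivative (\<lambda>t. t *\<^sub>R v)) (at 0)"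
    by (auto intro!: derivative_eq_intros)
  have "((\<lambda>t. f (x + t *\<^sub>R v)) has_derivative (\<lambda>t. frechet_derivative f (at x) (t *\<^sub>R v))) (at 0)"
    using diff_chain_at[OF 2, of f "frechet_derivative f (at x)"] 1 by (simp add: o_def)
  moreover have "frechet_derivative f (at x) (t *\<^sub>R v) = t *\<^sub>R partial_deriv v f x" for t
    unfolding partial_deriv_def using linear_frechet_derivative[OF assms] by (simp add: linear_scale)
  ultimately show "((\<lambda>t. f (x + t *\<^sub>R v)) has_vector_derivative partial_deriv v f x) (at 0)"
    by (simp add: has_vector_derivative_def)
qed

text \<open>\<open>frechet_derivative\<close> is a choice operator that is meaningful only at points
  of differentiability. This is the bridge by which explicitly computed directional derivatives are
  identified with \<open>partial_deriv\<close>.\<close>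

lemma partial_deriv_eq:
  assumes "\<And>x. f differentiable (at x)" "dirderiv v f f'"
  shows "partial_deriv v f = f'"
  using dirderiv_unique[OF dirderiv_frechet[OF assms(1)] assms(2)] .

lemma dirderiv_ftc:
  assumes "dirderiv v f f'" "continuous_on UNIV f'" "0 \<le> s"
  shows "((\<lambda>t. f' (x + t *\<^sub>R v)) has_integral f (x + s *\<^sub>R v) - f x) {0..s}"
  using fundamental_theorem_of_calculus[OF assms(3), of "\<lambda>t. f (x + t *\<^sub>R v)" "\<lambda>t. f' (x + t *\<^sub>R v)"]
  by (simp add: dirderiv_at[OF assms(1)] has_vector_derivative_at_within)

text \<open>Both \<open>\<partial>\<^sub>v f\<close> and its increments along \<open>w\<close> are integrals along \<open>w\<close>; differentiating
  under the integral sign gives the interchange.\<close>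
lemma dirderiv_swap:
  assumes f: "dirderiv v f fv" "dirderiv w f fw"
    and fwv: "dirderiv v fw fwv" "continuous_on UNIV fw" "continuous_on UNIV fwv"
  shows "dirderiv w fv fwv"
  unfolding dirderiv_def
proof
  fix x
  have line: "fv (x + t *\<^sub>R w) - fv x = integral {0..t} (\<lambda>s. fwv (x + s *\<^sub>R w))" if "0 \<le> t" for t x
  proof -
    have "((\<lambda>\<tau>. integral (cbox 0 t) (\<lambda>s. fw (x + s *\<^sub>R w + \<tau> *\<^sub>R v))) has_vector_derivative
        integral (cbox 0 t) (\<lambda>s. fwv (x + s *\<^sub>R w + 0 *\<^sub>R v))) (at 0 within UNIV)"
    proof (rule leibniz_rule_vector_derivative)
      fix \<tau> s :: real
      show "((\<lambda>\<tau>. fw (x + s *\<^sub>R w + \<tau> *\<^sub>R v)) has_vector_derivative fwv (x + s *\<^sub>R w + \<tau> *\<^sub>R v)) (at \<tau> within UNIV)"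
        using dirderiv_at[OF fwv(1)] by simp
      show "(\<lambda>s. fw (x + s *\<^sub>R w + \<tau> *\<^sub>R v)) integrable_on cbox 0 t"
        by (intro integrable_continuous continuous_intros continuous_on_compose2[OF fwv(2)]) auto
      show "continuous_on (UNIV \<times> cbox 0 t) (\<lambda>(\<tau>, s). fwv (x + s *\<^sub>R w + \<tau> *\<^sub>R v))"
        unfolding split_beta by (intro continuous_intros continuous_on_compose2[OF fwv(3)]) auto
    qed auto
    moreover have "integral (cbox 0 t) (\<lambda>s. fw (x + s *\<^sub>R w + \<tau> *\<^sub>R v)) =
        f ((x + t *\<^sub>R w) + \<tau> *\<^sub>R v) - f (x + \<tau> *\<^sub>R v)" for \<tau>
      using integral_unique[OF dirderiv_ftc[OF f(2) fwv(2) that, of "x + \<tau> *\<^sub>R v"]]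
      by (simp add: algebra_simps)
    ultimately have "((\<lambda>\<tau>. f ((x + t *\<^sub>R w) + \<tau> *\<^sub>R v) - f (x + \<tau> *\<^sub>R v)) has_vector_derivative
        integral {0..t} (\<lambda>s. fwv (x + s *\<^sub>R w))) (at 0)"
      by simp
    moreover have "((\<lambda>\<tau>. f ((x + t *\<^sub>R w) + \<tau> *\<^sub>R v) - f (x + \<tau> *\<^sub>R v)) has_vector_derivative
        fv (x + t *\<^sub>R w) - fv x) (at 0)"
      using f(1) by (auto simp: dirderiv_def intro!: has_vector_derivative_diff)
    ultimately show ?thesis by (rule vector_derivative_unique_at[symmetric])
  qed
  \<comment> \<open>\<open>line\<close> covers only nonnegative times and would give a one-sided
    derivative at 0. From the base point \<open>x - w\<close> the point \<open>x\<close> is reached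
    at the interior time 1.\<close>
  define y where "y = x - w"
  have "((\<lambda>t. integral {0..t} (\<lambda>s. fwv (y + s *\<^sub>R w))) has_vector_derivative fwv (y + 1 *\<^sub>R w)) (at 1 within {0..2})"
    by (rule integral_has_vector_derivative)
       (auto intro!: continuous_intros continuous_on_compose2[OF fwv(3)])
  then have 1: "((\<lambda>t. integral {0..t} (\<lambda>s. fwv (y + s *\<^sub>R w))) has_vector_derivative fwv x) (at 1)"
    by (subst (asm) at_within_interior) (auto simp: y_def)
  have "((\<lambda>t. fv (y + t *\<^sub>R w)) has_vector_derivative fwv x) (at 1)"
  proof (rule has_vector_derivative_transform_within_open)
    show "((\<lambda>t. fv y + integral {0..t} (\<lambda>s. fwv (y + s *\<^sub>R w))) has_vector_derivative fwv x) (at 1)"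
      using 1 by (auto intro!: derivative_eq_intros)
    show "fv y + integral {0..t} (\<lambda>s. fwv (y + s *\<^sub>R w)) = fv (y + t *\<^sub>R w)" if "t \<in> {0<..}" for t
      using line[of t y] that by (simp add: algebra_simps)
  qed auto
  then have "(((\<lambda>t. fv (y + t *\<^sub>R w)) \<circ> (\<lambda>t. 1 + t)) has_vector_derivative 1 *\<^sub>R fwv x) (at 0)"
    by (intro vector_diff_chain_at) (auto intro!: derivative_eq_intros)
  then show "((\<lambda>t. fv (x + t *\<^sub>R w)) has_vector_derivative fwv x) (at 0)"
    by (simp add: o_def y_def algebra_simps)
qed

lemma partial_deriv_commute:
  assumes "\<And>x. f differentiable (at x)" "\<And>x. partial_deriv v f differentiable (at x)"
    "\<And>x. partial_deriv w f differentiable (at x)" "\<And>x. partial_deriv v (partial_deriv w f) differentiable (at x)"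
  shows "partial_deriv w (partial_deriv v f) = partial_deriv v (partial_deriv w f)"
proof -
  have "dirderiv w (partial_deriv v f) (partial_deriv v (partial_deriv w f))"
    by (rule dirderiv_swap[OF dirderiv_frechet dirderiv_frechet dirderiv_frechet])
       (use assms in \<open>auto intro!: continuous_at_imp_continuous_on differentiable_imp_continuous_within\<close>)
  then show ?thesis using partial_deriv_eq assms(2) by blast
qed

section \<open>Derivative bounds adapted to a scale\<close>

text \<open>\<open>|(\<partial>\<^sub>v)\<^sup>b f| \<le> r\<^sup>-\<^sup>b B\<close> for all \<open>b \<le> N\<close>, with the derivatives continuous.\<close>
fun deriv_bounds :: "nat \<Rightarrow> 'a::real_normed_vector \<Rightarrow> real \<Rightarrow> ('a \<Rightarrow> real) \<Rightarrow> ('a \<Rightarrow> complex) \<Rightarrow> bool" where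
  "deriv_bounds 0 v r B f \<longleftrightarrow> continuous_on UNIV f \<and> (\<forall>x. norm (f x) \<le> B x)"
| "deriv_bounds (Suc N) v r B f \<longleftrightarrow> continuous_on UNIV f \<and> (\<forall>x. norm (f x) \<le> B x) \<and>
     (\<exists>f'. dirderiv v f f' \<and> deriv_bounds N v r (\<lambda>x. B x / r) f')"

lemma deriv_bounds_base:
  assumes "deriv_bounds N v r B f"
  shows "continuous_on UNIV f" "norm (f x) \<le> B x"
  using assms by (cases N; auto)+

lemma deriv_bounds_mono:
  assumes "deriv_bounds N v r B f" "\<And>x. B x \<le> B' x" "0 < r"
  shows "deriv_bounds N v r B' f"
  using assms
proof (induction N arbitrary: B B' f)
  case (Suc N)
  then obtain f' where f': "dirderiv v f f'" "deriv_bounds N v r (\<lambda>x. B x / r) f'" by auto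
  have "deriv_bounds N v r (\<lambda>x. B' x / r) f'"
    by (rule Suc.IH[OF f'(2)]) (use Suc.prems in \<open>auto intro: divide_right_mono\<close>)
  with f'(1) Suc.prems show ?case by (auto intro: order_trans)
qed (auto intro: order_trans)

lemma deriv_bounds_le:
  assumes "deriv_bounds N v r B f" "M \<le> N"
  shows "deriv_bounds M v r B f"
  using assms
proof (induction N arbitrary: M B f)
  case (Suc N)
  then show ?case by (cases M) auto
qed auto

lemma deriv_bounds_add:
  assumes "deriv_bounds N v r B f" "deriv_bounds N v r B' g"
  shows "deriv_bounds N v r (\<lambda>x. B x + B' x) (\<lambda>x. f x + g x)"
  using assms
proof (induction N arbitrary: B B' f g)
  case 0 then show ?case by (auto intro!: continuous_intros norm_triangle_le add_mono)
next
  case (Suc N)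
  then obtain f' g' where "dirderiv v f f'" "deriv_bounds N v r (\<lambda>x. B x / r) f'"
    "dirderiv v g g'" "deriv_bounds N v r (\<lambda>x. B' x / r) g'" by auto
  then have "dirderiv v (\<lambda>x. f x + g x) (\<lambda>x. f' x + g' x)"
    "deriv_bounds N v r (\<lambda>x. (B x + B' x) / r) (\<lambda>x. f' x + g' x)"
    using Suc.IH by (auto simp: add_divide_distrib intro: dirderiv_add)
  with Suc.prems show ?case by (auto intro!: continuous_intros norm_triangle_le add_mono)
qed

lemma deriv_bounds_const: 
  assumes "\<And>x. norm c \<le> B x" "0 < r"
  shows "deriv_bounds N v r B (\<lambda>_. c)"
proof -
  have *: "deriv_bounds N v r (\<lambda>_. 0) (\<lambda>_. 0)"
  proof (induction N)
    case (Suc N)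
    then show ?case using dirderiv_const[of v 0] by auto
  qed auto
  show ?thesis
  proof (cases N)
    case (Suc M)
    have "deriv_bounds M v r (\<lambda>x. B x / r) (\<lambda>_. 0)"
    proof (rule deriv_bounds_mono)
      show "deriv_bounds M v r (\<lambda>_. 0) (\<lambda>_. 0)"
        using * deriv_bounds_le[of N v r "\<lambda>_. 0" "\<lambda>_. 0" M] Suc by auto
      show "0 \<le> B x / r" for x using assms(1)[of x] assms(2) by (meson divide_nonneg_pos norm_ge_zero order_trans)
    qed fact
    then show ?thesis using assms Suc dirderiv_const[of v c] by auto
  qed (use assms in auto)
qed

text \<open>Leibniz with crude counting: every derivative at most doubles the number of terms,
  whence \<open>2 ^ N\<close>.\<close>

lemma deriv_bounds_mult:
  assumes "deriv_bounds N v r B f" "deriv_bounds N v r B' g" "0 < r"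
  shows "deriv_bounds N v r (\<lambda>x. 2 ^ N * B x * B' x) (\<lambda>x. f x * g x)"
  using assms
proof (induction N arbitrary: B B' f g)
  case 0 then show ?case
    by (auto intro!: continuous_intros simp: norm_mult) (metis mult_mono' norm_ge_zero)
next
  case (Suc N)
  then obtain f' g' where fg: "dirderiv v f f'" "deriv_bounds N v r (\<lambda>x. B x / r) f'"
    "dirderiv v g g'" "deriv_bounds N v r (\<lambda>x. B' x / r) g'" by auto
  have fg2: "deriv_bounds N v r B f" "deriv_bounds N v r B' g"
    using deriv_bounds_le[OF Suc.prems(1), of N] deriv_bounds_le[OF Suc.prems(2), of N] by auto
  have "deriv_bounds N v r (\<lambda>x. 2 ^ N * (B x / r) * B' x + 2 ^ N * B x * (B' x / r)) (\<lambda>x. f' x * g x + f x * g' x)"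
    using Suc.IH[OF fg(2) fg2(2) Suc.prems(3)] Suc.IH[OF fg2(1) fg(4) Suc.prems(3)] by (rule deriv_bounds_add)
  then have "deriv_bounds N v r (\<lambda>x. 2 ^ Suc N * B x * B' x / r) (\<lambda>x. f' x * g x + f x * g' x)"
    by (simp add: field_simps)
  moreover have "norm (f x * g x) \<le> 2 ^ Suc N * B x * B' x" for x
  proof -
    have b: "norm (f x) \<le> B x" "norm (g x) \<le> B' x" using Suc.prems by auto
    then have "norm (f x * g x) \<le> 1 * (B x * B' x)"
      unfolding norm_mult by (simp add: mult_mono')
    also have "\<dots> \<le> 2 ^ Suc N * (B x * B' x)"
      using b by (intro mult_right_mono one_le_power mult_nonneg_nonneg) (auto intro: order_trans[OF norm_ge_zero])
    finally show ?thesis by (simp add: mult.assoc)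
  qed
  moreover have "continuous_on UNIV (\<lambda>x. f x * g x)"
    using Suc.prems by (auto intro!: continuous_intros)
  ultimately show ?case using dirderiv_mult[OF fg(1,3)] by auto
qed

lemma deriv_bounds_cmult:
  assumes "deriv_bounds N v r B f"
  shows "deriv_bounds N v r (\<lambda>x. norm c * B x) (\<lambda>x. c * f x)"
  using assms
proof (induction N arbitrary: B f)
  case 0
  then show ?case by (auto intro!: continuous_intros simp: norm_mult mult_left_mono)
next
  case (Suc N)
  then obtain f' where "dirderiv v f f'" "deriv_bounds N v r (\<lambda>x. B x / r) f'"
    by auto
  with Suc.IH have "dirderiv v f f'" "deriv_bounds N v r (\<lambda>x. norm c * (B x / r)) (\<lambda>x. c * f' x)"
    by blast+
  then have "\<exists>f'. dirderiv v (\<lambda>x. c * f x) f' \<and> deriv_bounds N v r (\<lambda>x. norm c * B x / r) f'"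
    using dirderiv_cmult by force
  with Suc.prems show ?case by (auto intro!: continuous_intros simp: norm_mult mult_left_mono)
qed

lemma deriv_bounds_sum:
  assumes "finite I" "\<And>i. i \<in> I \<Longrightarrow> deriv_bounds N v r (B i) (f i)" "0 < r"
  shows "deriv_bounds N v r (\<lambda>x. \<Sum>i\<in>I. B i x) (\<lambda>x. \<Sum>i\<in>I. f i x)"
  using assms
proof (induction rule: finite_induct)
  case empty
  then show ?case using deriv_bounds_const[of 0 "\<lambda>_. 0" r N v] by simp
next
  case (insert i I)
  then show ?case using deriv_bounds_add[of N v r "B i" "f i"] by simp
qed

text \<open>Because 1/r <= rho/r', each of the at most \<open>N\<close> derivatives costs one factor
  \<open>\<rho>\<close>. This is how a frequency cutoff is measured at the scale of another
  block.\<close>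

lemma deriv_bounds_rescale:
  assumes "deriv_bounds N v r B f" "0 < r" "0 < r'" "r' \<le> \<rho> * r" "1 \<le> \<rho>"
  shows "deriv_bounds N v r' (\<lambda>x. \<rho> ^ N * B x) f"
  using assms
proof (induction N arbitrary: B f)
  case (Suc N)
  then obtain f' where "dirderiv v f f'" "deriv_bounds N v r (\<lambda>x. B x / r) f'"
    by auto
  with Suc have f': "dirderiv v f f'" "deriv_bounds N v r' (\<lambda>x. \<rho> ^ N * (B x / r)) f'"
    by blast+
  have B0: "0 \<le> B x" for x using Suc.prems(1) by (auto intro: order_trans[OF norm_ge_zero])
  have "deriv_bounds N v r' (\<lambda>x. \<rho> ^ Suc N * B x / r') f'"
  proof (rule deriv_bounds_mono[OF f'(2)])
    fix x
    have "1 / r \<le> \<rho> / r'" using Suc.prems by (simp add: field_simps)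
    then have "(\<rho> ^ N * B x) * (1 / r) \<le> (\<rho> ^ N * B x) * (\<rho> / r')"
      using Suc.prems B0[of x] by (intro mult_left_mono) auto
    then show "\<rho> ^ N * (B x / r) \<le> \<rho> ^ Suc N * B x / r'" by (simp add: field_simps)
  qed fact
  moreover have "norm (f x) \<le> \<rho> ^ Suc N * B x" for x
  proof -
    have "norm (f x) \<le> 1 * B x" using Suc.prems(1) by auto
    also have "\<dots> \<le> \<rho> ^ Suc N * B x" using B0 Suc.prems by (intro mult_right_mono one_le_power) auto
    finally show ?thesis .
  qed
  ultimately show ?case using f'(1) Suc.prems(1) by auto
qed auto

lemma deriv_bounds_power:
  assumes "deriv_bounds L v r B f" "0 < r"
  shows "deriv_bounds L v r (\<lambda>x. (2 ^ L) ^ m * B x ^ m) (\<lambda>x. f x ^ m)"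
proof (induction m)
  case 0 then show ?case by (simp add: deriv_bounds_const assms)
next
  case (Suc m)
  then show ?case using deriv_bounds_mult[OF assms(1) Suc assms(2)] by (simp add: algebra_simps)
qed

section \<open>Decay of oscillatory integrals\<close>

lemma lborel_distr_reflect: "distr lborel borel (\<lambda>x. t - x) = (lborel :: 'a::euclidean_space measure)"
proof -
  show ?thesis
    using lborel_affine[of "-1" t] by (simp add: density_1 one_ennreal_def[symmetric])
qed

lemma
  fixes f :: "'a::euclidean_space \<Rightarrow> ennreal"
  assumes [measurable]: "f \<in> borel_measurable borel"
  shows nn_integral_shift: "(\<integral>\<^sup>+x. f (x + t) \<partial>lborel) = (\<integral>\<^sup>+x. f x \<partial>lborel)"
    and nn_integral_reflect: "(\<integral>\<^sup>+x. f (t - x) \<partial>lborel) = (\<integral>\<^sup>+x. f x \<partial>lborel)"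
proof -
  show "(\<integral>\<^sup>+x. f (x + t) \<partial>lborel) = (\<integral>\<^sup>+x. f x \<partial>lborel)"
    by (subst lborel_distr_plus[of t, symmetric], subst nn_integral_distr) (auto simp: add.commute)
  show "(\<integral>\<^sup>+x. f (t - x) \<partial>lborel) = (\<integral>\<^sup>+x. f x \<partial>lborel)"
    by (subst lborel_distr_reflect[of t, symmetric], subst nn_integral_distr) auto
qed

lemma
  fixes f :: "'a::euclidean_space \<Rightarrow> 'b::{banach, second_countable_topology}"
  assumes [measurable]: "f \<in> borel_measurable borel"
  shows integral_shift: "(LINT x|lborel. f (x + t)) = (LINT x|lborel. f x)"
    and integral_reflect: "(LINT x|lborel. f (t - x)) = (LINT x|lborel. f x)"
proof -
  show "(LINT x|lborel. f (x + t)) = (LINT x|lborel. f x)"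
    by (subst lborel_distr_plus[of t, symmetric], subst integral_distr) (auto simp: add.commute)
  show "(LINT x|lborel. f (t - x)) = (LINT x|lborel. f x)"
    by (subst lborel_distr_reflect[of t, symmetric], subst integral_distr) auto
qed

lemma
  fixes f :: "'a::euclidean_space \<Rightarrow> 'b::{banach, second_countable_topology}"
  assumes "integrable lborel f"
  shows integrable_shift: "integrable lborel (\<lambda>x. f (x + t))"
    and integrable_reflect: "integrable lborel (\<lambda>x. f (t - x))"
proof -
  have [measurable]: "f \<in> borel_measurable borel" using borel_measurable_integrable[OF assms] by simp
  show "integrable lborel (\<lambda>x. f (x + t))"
    using assms integrable_distr_eq[of "(+) t" lborel borel f] by (simp add: lborel_distr_plus add.commute)
  show "integrable lborel (\<lambda>x. f (t - x))"
    using assms integrable_distr_eq[of "\<lambda>x. t - x" lborel borel f] by (simp add: lborel_distr_reflect)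
qed

lemma norm_integral_le_nn_integral: "ennreal (norm (LINT x|M. f x)) \<le> (\<integral>\<^sup>+x. ennreal (norm (f x)) \<partial>M)"
  by (cases "integrable M f") (auto simp: integral_norm_bound_ennreal not_integrable_integral_eq)

lemma norm_integral_bound:
  assumes "\<And>x. norm (f x) \<le> B x" "(\<integral>\<^sup>+x. ennreal (B x) \<partial>M) \<le> ennreal c" "0 \<le> c"
  shows "norm (LINT x|M. f x) \<le> c"
proof -
  have "ennreal (norm (LINT x|M. f x)) \<le> (\<integral>\<^sup>+x. ennreal (B x) \<partial>M)"
    using assms(1) by (intro order_trans[OF norm_integral_le_nn_integral] nn_integral_mono ennreal_leI)
  with assms show ?thesis by (metis ennreal_le_iff order_trans)
qed

lemma integrable_bounded_by:
  fixes f :: "'a \<Rightarrow> 'b::{banach, second_countable_topology}"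
  assumes "f \<in> borel_measurable M" "\<And>x. norm (f x) \<le> B x" "(\<integral>\<^sup>+x. ennreal (B x) \<partial>M) < \<infinity>"
  shows "integrable M f"
proof (rule integrableI_bounded)
  have "(\<integral>\<^sup>+x. ennreal (norm (f x)) \<partial>M) \<le> (\<integral>\<^sup>+x. ennreal (B x) \<partial>M)"
    using assms(2) by (intro nn_integral_mono ennreal_leI)
  with assms(3) show "(\<integral>\<^sup>+x. ennreal (norm (f x)) \<partial>M) < \<infinity>" by simp
qed fact

section \<open>Integrals of negative powers\<close>

lemma emeasure_cball_le:
  assumes "0 \<le> R"
  shows "emeasure lborel (cball c R :: 'a::euclidean_space set) \<le> ennreal ((2 * R) ^ DIM('a))"
proof -
  have "cball c R \<subseteq> cbox (c - R *\<^sub>R One) (c + R *\<^sub>R One)"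
  proof
    fix x assume "x \<in> cball c R"
    then have "\<bar>(x - c) \<bullet> b\<bar> \<le> R" if "b \<in> Basis" for b
      using Basis_le_norm[OF that, of "x - c"] by (simp add: dist_norm norm_minus_commute)
    then show "x \<in> cbox (c - R *\<^sub>R One) (c + R *\<^sub>R One)"
      by (force simp: mem_box inner_diff_left inner_add_left abs_le_iff)
  qed
  then have "emeasure lborel (cball c R) \<le> emeasure lborel (cbox (c - R *\<^sub>R One) (c + R *\<^sub>R One))"
    by (intro emeasure_mono) auto
  also have "\<dots> = (\<Prod>b\<in>Basis. ((c + R *\<^sub>R One) - (c - R *\<^sub>R One)) \<bullet> b)"
    using assms by (intro emeasure_lborel_cbox) (auto simp: inner_diff_left inner_add_left)
  also have "(\<Prod>b\<in>Basis. ((c + R *\<^sub>R One) - (c - R *\<^sub>R One)) \<bullet> b) = (\<Prod>b\<in>(Basis::'a set). 2 * R)"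
    by (intro prod.cong) (auto simp: inner_diff_left inner_add_left)
  finally show ?thesis by simp
qed

text \<open>Cut along the integer part m of \<open>\<rho>\<close>: there the integrand is at most
  (m+1)^-(d+2), while the sublevel set has measure at most c (m+1)^d, so inverse squares remain. An
  abstract measure is used because the same argument serves Lebesgue measure and counting measure on
  the lattice.\<close>

lemma nn_integral_decay_layers:
  assumes m: "\<And>m. {x \<in> space M. \<rho> x \<le> real (Suc m)} \<in> sets M"
    and e: "\<And>m. emeasure M {x \<in> space M. \<rho> x \<le> real (Suc m)} \<le> ennreal (c * real (Suc m) ^ d)"
    and \<rho>: "\<And>x. 0 \<le> \<rho> x" and c: "0 \<le> c"
  shows "(\<integral>\<^sup>+x. ennreal (1 / (1 + \<rho> x) ^ (d + 2)) \<partial>M) \<le> ennreal (c * (\<Sum>m. 1 / real (Suc m) ^ 2))"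
proof -
  let ?A = "\<lambda>m. {x \<in> space M. \<rho> x \<le> real (Suc m)}"
  have summ: "summable (\<lambda>m. 1 / real (Suc m) ^ 2)"
    using sums_summable[OF inverse_squares_sums] by simp
  have "ennreal (1 / (1 + \<rho> x) ^ (d + 2)) \<le> (\<Sum>m. ennreal (1 / real (Suc m) ^ (d + 2)) * indicator (?A m) x)"
    if x: "x \<in> space M" for x
  proof -
    define m where "m = nat \<lfloor>\<rho> x\<rfloor>"
    have m: "real m \<le> \<rho> x" "\<rho> x \<le> real (Suc m)"
      using \<rho>[of x] by (simp_all add: m_def) linarith
    have "ennreal (1 / (1 + \<rho> x) ^ (d + 2)) \<le> ennreal (1 / real (Suc m) ^ (d + 2))"
      using m by (intro ennreal_leI divide_left_mono power_mono mult_pos_pos zero_less_power) auto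
    also have "\<dots> = ennreal (1 / real (Suc m) ^ (d + 2)) * indicator (?A m) x"
      using m x by (simp add: indicator_def)
    also have "\<dots> \<le> (\<Sum>m. ennreal (1 / real (Suc m) ^ (d + 2)) * indicator (?A m) x)"
      using sum_le_suminf[of "\<lambda>m. ennreal (1 / real (Suc m) ^ (d + 2)) * indicator (?A m) x" "{m}"]
      by (simp del: sum_mult_indicator of_nat_Suc)
    finally show ?thesis .
  qed
  then have "(\<integral>\<^sup>+x. ennreal (1 / (1 + \<rho> x) ^ (d + 2)) \<partial>M) \<le>
      (\<integral>\<^sup>+x. (\<Sum>m. ennreal (1 / real (Suc m) ^ (d + 2)) * indicator (?A m) x) \<partial>M)"
    by (intro nn_integral_mono)
  also have "\<dots> = (\<Sum>m. \<integral>\<^sup>+x. ennreal (1 / real (Suc m) ^ (d + 2)) * indicator (?A m) x \<partial>M)"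
  proof (rule nn_integral_suminf)
    fix k
    note [measurable] = m[of k]
    show "(\<lambda>x. ennreal (1 / real (Suc k) ^ (d + 2)) * indicator (?A k) x) \<in> borel_measurable M"
      by measurable
  qed
  also have "\<dots> = (\<Sum>m. ennreal (1 / real (Suc m) ^ (d + 2)) * emeasure M (?A m))"
    by (subst nn_integral_cmult_indicator[OF m]) simp
  also have "\<dots> \<le> (\<Sum>m. ennreal (c * (1 / real (Suc m) ^ 2)))"
  proof (intro suminf_le)
    fix m
    have "ennreal (1 / real (Suc m) ^ (d + 2)) * emeasure M (?A m)
        \<le> ennreal (1 / real (Suc m) ^ (d + 2)) * ennreal (c * real (Suc m) ^ d)"
      by (intro mult_left_mono e) auto
    also have "\<dots> = ennreal (1 / real (Suc m) ^ (d + 2) * (c * real (Suc m) ^ d))"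
      using c by (intro ennreal_mult[symmetric]) auto
    also have "1 / real (Suc m) ^ (d + 2) * (c * real (Suc m) ^ d) = c * (1 / real (Suc m) ^ 2)"
      by (simp add: power_add power2_eq_square del: of_nat_Suc)
    finally show "ennreal (1 / real (Suc m) ^ (d + 2)) * emeasure M (?A m) \<le> ennreal (c * (1 / real (Suc m) ^ 2))" .
  qed auto
  also have "\<dots> = ennreal (\<Sum>m. c * (1 / real (Suc m) ^ 2))"
    using c by (intro suminf_ennreal2 summable_mult summ) auto
  also have "(\<Sum>m. c * (1 / real (Suc m) ^ 2)) = c * (\<Sum>m. 1 / real (Suc m) ^ 2)"
    by (rule suminf_mult[OF summ])
  finally show ?thesis .
qed

text \<open>The layers are balls of radius (m+1)/r, whose volume supplies the factor r^-d. The
  exponent d + 2 instead of d + 1 is the price of estimating a layer by the whole ball containing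
  it.\<close>

lemma nn_integral_decay:
  "\<exists>K>0. \<forall>r>0. (\<integral>\<^sup>+x. ennreal (1 / (1 + r * norm (x::'a::euclidean_space)) ^ (DIM('a) + 2)) \<partial>lborel)
     \<le> ennreal (K / r ^ DIM('a))"
proof -
  let ?d = "DIM('a)"
  define S where "S = (\<Sum>m. 1 / real (Suc m) ^ 2)"
  have S0: "0 < S" unfolding S_def using sums_summable[OF inverse_squares_sums] by (intro suminf_pos) auto
  show ?thesis
  proof (intro exI[of _ "2 ^ ?d * S"] conjI allI impI)
    fix r :: real assume r: "0 < r"
    have eq: "{x \<in> space lborel. r * norm x \<le> real (Suc m)} = cball (0::'a) (real (Suc m) / r)" for m
      using r by (auto simp: field_simps)
    have "(\<integral>\<^sup>+x. ennreal (1 / (1 + r * norm (x::'a)) ^ (?d + 2)) \<partial>lborel) \<le> ennreal ((2 / r) ^ ?d * S)"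
      unfolding S_def
    proof (rule nn_integral_decay_layers)
      fix m
      show "emeasure lborel {x \<in> space lborel. r * norm (x::'a) \<le> real (Suc m)} \<le> ennreal ((2 / r) ^ ?d * real (Suc m) ^ ?d)"
        unfolding eq using emeasure_cball_le[of "real (Suc m) / r" "0::'a"] r
        by (simp add: power_mult_distrib[symmetric] del: of_nat_Suc)
      show "{x \<in> space lborel. r * norm (x::'a) \<le> real (Suc m)} \<in> sets lborel"
        unfolding eq by simp
    qed (use r in auto)
    then show "(\<integral>\<^sup>+x. ennreal (1 / (1 + r * norm (x::'a)) ^ (?d + 2)) \<partial>lborel) \<le> ennreal (2 ^ ?d * S / r ^ ?d)"
      by (simp add: power_divide mult.commute)
  qed (use S0 in simp)
qed

text \<open>Integrating the fundamental theorem of calculus over the whole space and using translation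
  invariance avoids splitting off one coordinate.\<close>
lemma integral_dirderiv_zero:
  fixes g :: "'a::euclidean_space \<Rightarrow> complex"
  assumes d: "dirderiv v g g'" and c: "continuous_on UNIV g'"
    and g: "integrable lborel g" and g': "integrable lborel g'"
  shows "(LINT x|lborel. g' x) = 0"
proof -
  let ?H = "\<lambda>x t. indicator {0..1} t *\<^sub>R g' (x + t *\<^sub>R v)"
  have [measurable]: "g \<in> borel_measurable borel" "g' \<in> borel_measurable borel"
    using borel_measurable_integrable[OF g] borel_measurable_integrable[OF g'] by simp_all
  have int: "integrable (lborel \<Otimes>\<^sub>M lborel) (\<lambda>(x, t). ?H x t)"
  proof (rule integrableI_bounded)
    show "(\<lambda>(x, t). ?H x t) \<in> borel_measurable (lborel \<Otimes>\<^sub>M lborel)" by measurable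
    have "(\<integral>\<^sup>+p. ennreal (norm (case p of (x, t) \<Rightarrow> ?H x t)) \<partial>(lborel \<Otimes>\<^sub>M lborel)) =
      (\<integral>\<^sup>+t. (\<integral>\<^sup>+x. ennreal (norm (?H x t)) \<partial>lborel) \<partial>lborel)"
      by (subst lborel_pair.nn_integral_snd[symmetric]) (auto simp: split_beta')
    also have "\<dots> = (\<integral>\<^sup>+t. (\<integral>\<^sup>+x. ennreal (norm (g' x)) \<partial>lborel) * indicator {0..1::real} t \<partial>lborel)"
    proof (rule nn_integral_cong, goal_cases)
      case (1 t)
      have "(\<integral>\<^sup>+x. ennreal (norm (g' (x + t *\<^sub>R v))) \<partial>lborel) = (\<integral>\<^sup>+x. ennreal (norm (g' x)) \<partial>lborel)"
        by (rule nn_integral_shift) auto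
      then show ?case
        by (auto simp: indicator_def)
    qed
    also have "\<dots> = (\<integral>\<^sup>+x. ennreal (norm (g' x)) \<partial>lborel)"
      by (simp add: nn_integral_cmult_indicator)
    also have "\<dots> < \<infinity>" using g' by (simp add: integrable_iff_bounded)
    finally show "(\<integral>\<^sup>+p. ennreal (norm (case p of (x, t) \<Rightarrow> ?H x t)) \<partial>(lborel \<Otimes>\<^sub>M lborel)) < \<infinity>" .
  qed
  have "(LINT t|lborel. LINT x|lborel. ?H x t) = (LINT x|lborel. LINT t|lborel. ?H x t)"
    using lborel_pair.Fubini_integral[OF int] .
  moreover have "(LINT t|lborel. LINT x|lborel. ?H x t) = (LINT t|lborel. indicator {0..1::real} t *\<^sub>R (LINT x|lborel. g' x))"
  proof (rule Bochner_Integration.integral_cong[OF refl])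
    fix t :: real
    show "(LINT x|lborel. ?H x t) = indicator {0..1} t *\<^sub>R (LINT x|lborel. g' x)"
      using integral_shift[of g' "t *\<^sub>R v"] by (auto simp: indicator_def)
  qed
  moreover have "(LINT t|lborel. indicator {0..1::real} t *\<^sub>R (LINT x|lborel. g' x)) = (LINT x|lborel. g' x)"
    by simp
  moreover have "(LINT t|lborel. ?H x t) = g (x + v) - g x" for x
  proof -
    have "(LINT t|lborel. ?H x t) = g (x + 1 *\<^sub>R v) - g (x + 0 *\<^sub>R v)"
      by (rule integral_FTC_atLeastAtMost)
         (auto intro!: has_vector_derivative_at_within[OF dirderiv_at[OF d]] continuous_intros continuous_on_compose2[OF c])
    then show ?thesis by simp
  qed
  moreover have "(LINT x|lborel. g (x + v) - g x) = 0"
    using g integrable_shift[OF g, of v] by (simp add: integral_shift)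
  ultimately show ?thesis by simp
qed

lemma integral_by_parts_dir:
  fixes f g :: "'a::euclidean_space \<Rightarrow> complex"
  assumes "dirderiv v f f'" "dirderiv v g g'"
    and "continuous_on UNIV f" "continuous_on UNIV f'" "continuous_on UNIV g" "continuous_on UNIV g'"
    and "integrable lborel (\<lambda>x. f x * g x)" "integrable lborel (\<lambda>x. f' x * g x)" "integrable lborel (\<lambda>x. f x * g' x)"
  shows "(LINT x|lborel. f' x * g x) = - (LINT x|lborel. f x * g' x)"
proof -
  have "(LINT x|lborel. f' x * g x + f x * g' x) = 0"
    using assms by (intro integral_dirderiv_zero[OF dirderiv_mult[OF assms(1,2)]] continuous_intros) auto
  with assms show ?thesis by (simp add: add_eq_0_iff2)
qed

text \<open>Differentiation under the integral sign, by dominated convergence along sequences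
  applied to the remainder of the difference quotient.\<close>

lemma has_vector_derivative_integral:
  fixes F :: "real \<Rightarrow> 'a \<Rightarrow> complex"
  assumes F: "\<And>t x. x \<in> space M \<Longrightarrow> ((\<lambda>t. F t x) has_vector_derivative F' t x) (at t)"
    and int: "\<And>t. integrable M (F t)" and B: "\<And>t x. x \<in> space M \<Longrightarrow> norm (F' t x) \<le> B x" "integrable M B"
    and m: "F' t0 \<in> borel_measurable M"
  shows "((\<lambda>t. LINT x|M. F t x) has_vector_derivative (LINT x|M. F' t0 x)) (at t0)"
proof -
  have int': "integrable M (F' t0)"
    by (rule Bochner_Integration.integrable_bound[OF B(2) m]) (use B(1)[of _ t0] in \<open>auto intro!: AE_I2 order_trans[OF _ abs_ge_self]\<close>)
  \<comment> \<open>The remainder of first order over |t - t0|. It tends to 0 pointwise and is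
    bounded by 2 B through the mean value inequality; at \<open>t = t0\<close> division by zero
    gives the value 0.\<close>
  define q where "q t x = ((F t x - F t0 x) - (t - t0) *\<^sub>R F' t0 x) /\<^sub>R norm (t - t0)" for t x
  have q: "(LINT x|M. q t x) = (((LINT x|M. F t x) - (LINT x|M. F t0 x)) - (t - t0) *\<^sub>R (LINT x|M. F' t0 x)) /\<^sub>R norm (t - t0)" for t
    unfolding q_def using int int' by simp
  have qb: "norm (q t x) \<le> 2 * B x" if x: "x \<in> space M" for t x
  proof (cases "t = t0")
    case False
    have "norm (F t x - F t0 x) \<le> norm (t - t0) * B x"
    proof -
      have "0 \<le> B x" using B(1)[OF x] norm_ge_zero order_trans by blast
      have "norm (F t x - F t0 x) \<le> B x * norm (t - t0)"
        by (rule differentiable_bound[of UNIV _ "\<lambda>t h. h *\<^sub>R F' t x"])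
           (use F[OF x] B(1)[OF x] \<open>0 \<le> B x\<close> in
             \<open>auto simp: has_vector_derivative_def mult.commute[of "\<bar>_\<bar>"] intro!: onorm_bound mult_right_mono\<close>)
      then show ?thesis by (simp add: mult.commute)
    qed
    moreover have "norm ((t - t0) *\<^sub>R F' t0 x) \<le> norm (t - t0) * B x"
      using B(1)[OF x] by (simp add: mult_left_mono)
    ultimately have "norm ((F t x - F t0 x) - (t - t0) *\<^sub>R F' t0 x) \<le> norm (t - t0) * (2 * B x)"
      by (intro order_trans[OF norm_triangle_ineq4]) (simp add: algebra_simps)
    with False show ?thesis
      unfolding q_def by (simp add: divide_inverse_commute[symmetric] pos_divide_le_eq mult.commute)
  qed (use B(1)[OF x, of t0] in \<open>simp add: q_def order_trans[OF norm_ge_zero]\<close>)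
  have "((\<lambda>t. LINT x|M. q t x) \<longlongrightarrow> (LINT x|M. 0)) (at t0)"
    unfolding tendsto_at_iff_sequentially
  proof (intro allI impI)
    fix X :: "nat \<Rightarrow> real" assume X: "\<forall>i. X i \<in> UNIV - {t0}" "X \<longlonglongrightarrow> t0"
    have "(\<lambda>i. LINT x|M. q (X i) x) \<longlonglongrightarrow> (LINT x|M. 0)"
    proof (rule integral_dominated_convergence[where w="\<lambda>x. 2 * B x"])
      show "(\<lambda>x. q (X i) x) \<in> borel_measurable M" for i
        unfolding q_def using int m borel_measurable_integrable[OF int] by measurable
      show "AE x in M. (\<lambda>i. q (X i) x) \<longlonglongrightarrow> 0"
      proof (rule AE_I2)
        fix x assume x: "x \<in> space M"
        have "((\<lambda>t. q t x) \<longlongrightarrow> 0) (at t0)"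
          using F[OF x, of t0] unfolding has_vector_derivative_def has_derivative_at_within q_def by simp
        then show "(\<lambda>i. q (X i) x) \<longlonglongrightarrow> 0"
          using X unfolding tendsto_at_iff_sequentially by (auto simp: o_def)
      qed
    qed (use qb B(2) in auto)
    then show "((\<lambda>t. LINT x|M. q t x) \<circ> X) \<longlonglongrightarrow> (LINT x|M. 0)" by (simp add: o_def)
  qed
  then show ?thesis
    unfolding has_vector_derivative_def has_derivative_at_within q
    by (auto intro!: bounded_linear_intros)
qed

lemma dirderiv_exp_i:
  fixes w :: "'a::euclidean_space"
  shows "dirderiv v (\<lambda>x. exp (\<i> * complex_of_real (w \<bullet> x)))
    (\<lambda>x. \<i> * complex_of_real (w \<bullet> v) * exp (\<i> * complex_of_real (w \<bullet> x)))"
proof -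
  have "dirderiv v (\<lambda>x. complex_of_real (w \<bullet> (x - 0))) (\<lambda>_. complex_of_real (w \<bullet> v))"
    by (rule dirderiv_of_linear)
       (auto intro!: bounded_linear_compose[OF bounded_linear_of_real] bounded_linear_inner_right)
  then have "dirderiv v (\<lambda>x. \<i> * complex_of_real (w \<bullet> x)) (\<lambda>_. \<i> * complex_of_real (w \<bullet> v))"
    using dirderiv_cmult by fastforce
  from dirderiv_field[OF this, of exp exp] show ?thesis by (auto intro: DERIV_exp)
qed

text \<open>Each integration by parts trades a factor w . v, produced by differentiating the phase,
  for a derivative of the amplitude, which gains 1/r. The majorant and its integral are divided by
  \<open>r\<close> at the same time.\<close>

lemma fourier_integral_decay_dir:
  fixes a :: "'a::euclidean_space \<Rightarrow> complex"
  assumes "deriv_bounds L v r B a" "0 < r" "(\<integral>\<^sup>+\<xi>. ennreal (B \<xi>) \<partial>lborel) \<le> ennreal I" "0 \<le> I"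
    and "B \<in> borel_measurable borel"
  shows "(r * \<bar>w \<bullet> v\<bar>) ^ L * norm (LINT \<xi>|lborel. exp (\<i> * complex_of_real (w \<bullet> \<xi>)) * a \<xi>) \<le> I"
  using assms
proof (induction L arbitrary: a B I)
  case 0
  then show ?case using norm_integral_bound[of "\<lambda>\<xi>. exp (\<i> * complex_of_real (w \<bullet> \<xi>)) * a \<xi>" B]
    by (simp add: norm_mult)
next
  case (Suc L)
  then obtain a' where a': "dirderiv v a a'" "deriv_bounds L v r (\<lambda>x. B x / r) a'" by auto
  let ?e = "\<lambda>\<xi>. exp (\<i> * complex_of_real (w \<bullet> \<xi>))"
  have ca: "continuous_on UNIV a" "continuous_on UNIV a'" and na: "\<And>x. norm (a x) \<le> B x" "\<And>x. norm (a' x) \<le> B x / r"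
    using deriv_bounds_base[OF Suc.prems(1)] deriv_bounds_base[OF a'(2)] by auto
  note [measurable] = borel_measurable_continuous_onI[OF ca(1)] borel_measurable_continuous_onI[OF ca(2)]
  have B0: "0 \<le> B x" for x using na(1) norm_ge_zero order_trans by blast

  have IB: "(\<integral>\<^sup>+\<xi>. ennreal (B \<xi> / r) \<partial>lborel) \<le> ennreal (I / r)"
  proof -
    have "(\<integral>\<^sup>+\<xi>. ennreal (B \<xi> / r) \<partial>lborel) = (\<integral>\<^sup>+\<xi>. ennreal (1 / r) * ennreal (B \<xi>) \<partial>lborel)"
      using Suc.prems B0 by (simp add: ennreal_mult[symmetric])
    also have "\<dots> = ennreal (1 / r) * (\<integral>\<^sup>+\<xi>. ennreal (B \<xi>) \<partial>lborel)"
      using Suc.prems by (intro nn_integral_cmult) auto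
    also have "\<dots> \<le> ennreal (1 / r) * ennreal I"
      using Suc.prems by (intro mult_left_mono) auto
    finally show ?thesis using Suc.prems by (simp add: ennreal_mult[symmetric])
  qed
  have ia: "integrable lborel (\<lambda>\<xi>. ?e \<xi> * a \<xi>)"
    by (rule integrable_bounded_by[where B=B])
       (use na Suc.prems in \<open>auto simp: norm_mult intro: le_less_trans\<close>)
  have ia': "integrable lborel (\<lambda>\<xi>. ?e \<xi> * a' \<xi>)"
    by (rule integrable_bounded_by[where B="\<lambda>x. B x / r"])
       (use na IB in \<open>auto simp: norm_mult intro: le_less_trans\<close>)
  have "(LINT \<xi>|lborel. (\<i> * complex_of_real (w \<bullet> v) * ?e \<xi>) * a \<xi>) = - (LINT \<xi>|lborel. ?e \<xi> * a' \<xi>)"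
    by (rule integral_by_parts_dir[OF dirderiv_exp_i a'(1)])
       (use ca ia ia' in \<open>auto intro!: continuous_intros simp: mult.assoc\<close>)
  then have "\<i> * complex_of_real (w \<bullet> v) * (LINT \<xi>|lborel. ?e \<xi> * a \<xi>) = - (LINT \<xi>|lborel. ?e \<xi> * a' \<xi>)"
    by (simp add: mult.assoc)
  then have "\<bar>w \<bullet> v\<bar> * norm (LINT \<xi>|lborel. ?e \<xi> * a \<xi>) = norm (LINT \<xi>|lborel. ?e \<xi> * a' \<xi>)"
    by (metis (no_types, lifting) norm_minus_cancel norm_mult norm_ii mult_1 norm_of_real)
  moreover have "(r * \<bar>w \<bullet> v\<bar>) ^ L * norm (LINT \<xi>|lborel. ?e \<xi> * a' \<xi>) \<le> I / r"
    using Suc.IH[OF a'(2) Suc.prems(2) IB] Suc.prems by (auto intro!: borel_measurable_divide)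
  ultimately have "r * ((r * \<bar>w \<bullet> v\<bar>) ^ L * (\<bar>w \<bullet> v\<bar> * norm (LINT \<xi>|lborel. ?e \<xi> * a \<xi>))) \<le> I"
    using Suc.prems by (simp add: field_simps)
  then show ?case by (simp add: mult_ac)
qed

text \<open>Only derivatives in coordinate directions are controlled, so the integration by parts is
  made along the coordinate in which \<open>w\<close> is largest; the l^1 bound of the norm loses
  the factor 1 + d per power.\<close>

lemma fourier_integral_decay:
  fixes a :: "'a::euclidean_space \<Rightarrow> complex"
  assumes a: "\<And>v. v \<in> Basis \<Longrightarrow> deriv_bounds L v r B a" and r: "0 < r"
    and I: "(\<integral>\<^sup>+\<xi>. ennreal (B \<xi>) \<partial>lborel) \<le> ennreal I" "0 \<le> I" "B \<in> borel_measurable borel"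
  shows "norm (LINT \<xi>|lborel. exp (\<i> * complex_of_real (w \<bullet> \<xi>)) * a \<xi>)
    \<le> (1 + real DIM('a)) ^ Suc L * I / (1 + r * norm w) ^ L"
proof -
  let ?N = "norm (LINT \<xi>|lborel. exp (\<i> * complex_of_real (w \<bullet> \<xi>)) * a \<xi>)"
  let ?d = "real DIM('a)"
  \<comment> \<open>The entry 1 stands for small \<open>w\<close>, where the plain bound of the
    integral is used and no integration by parts is made.\<close>
  define m where "m = Max (insert 1 ((\<lambda>b. r * \<bar>w \<bullet> b\<bar>) ` Basis))"
  have m: "m \<in> insert 1 ((\<lambda>b. r * \<bar>w \<bullet> b\<bar>) ` Basis)"
    unfolding m_def by (rule Max_in) auto
  have m1: "1 \<le> m" "\<And>b. b \<in> Basis \<Longrightarrow> r * \<bar>w \<bullet> b\<bar> \<le> m" unfolding m_def by (rule Max_ge; force)+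
  have "r * norm w \<le> (\<Sum>b\<in>Basis. r * \<bar>w \<bullet> b\<bar>)"
    using norm_le_l1[of w] r by (simp add: sum_distrib_left[symmetric])
  also have "\<dots> \<le> (\<Sum>b\<in>(Basis::'a set). m)" by (intro sum_mono m1)
  finally have "1 + r * norm w \<le> (1 + ?d) * m" using m1(1) by (simp add: algebra_simps)
  then have "(1 + r * norm w) ^ L \<le> ((1 + ?d) * m) ^ L" using r by (intro power_mono) auto
  moreover have "m ^ L * ?N \<le> I"
  proof (cases "m = 1")
    case True
    obtain v :: 'a where "v \<in> Basis" using nonempty_Basis by blast
    then have "deriv_bounds 0 v r B a" using deriv_bounds_le[OF a] by blast
    from fourier_integral_decay_dir[OF this r I] True show ?thesis by simp
  next
    case False
    with m obtain b where b: "b \<in> Basis" "m = r * \<bar>w \<bullet> b\<bar>" by auto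
    show ?thesis using fourier_integral_decay_dir[OF a[OF b(1)] r I] b(2) by simp
  qed
  ultimately have "(1 + r * norm w) ^ L * ?N \<le> (1 + ?d) ^ L * I"
    by (smt (verit, ccfv_SIG) mult.assoc mult_left_mono mult_right_mono norm_ge_zero of_nat_0_le_iff
      power_mult_distrib zero_le_power)
  also have "\<dots> \<le> (1 + ?d) ^ Suc L * I" using I(2) by (intro mult_right_mono power_increasing) auto
  finally show ?thesis using r by (subst pos_le_divide_eq) (auto simp: mult.commute intro!: zero_less_power add_pos_nonneg)
qed

section \<open>Fourier inversion\<close>

lemma Fubini_prod_bound:
  fixes H :: "'a::euclidean_space \<Rightarrow> 'b::euclidean_space \<Rightarrow> complex"
  assumes m: "(\<lambda>(x, y). H x y) \<in> borel_measurable (lborel \<Otimes>\<^sub>M lborel)"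
    and H: "\<And>x y. norm (H x y) \<le> A x * B y" and A: "integrable lborel A" and B: "integrable lborel B"
  shows "(LINT y|lborel. LINT x|lborel. H x y) = (LINT x|lborel. LINT y|lborel. H x y)"
    and "integrable (lborel \<Otimes>\<^sub>M lborel) (\<lambda>(x, y). H x y)"
proof -
  have [measurable]: "A \<in> borel_measurable lborel" "B \<in> borel_measurable lborel" using A B by auto
  show int: "integrable (lborel \<Otimes>\<^sub>M lborel) (\<lambda>(x, y). H x y)"
  proof (rule integrableI_bounded[OF m])
    have "(\<integral>\<^sup>+p. ennreal (norm (case p of (x, y) \<Rightarrow> H x y)) \<partial>(lborel \<Otimes>\<^sub>M lborel)) \<le>
        (\<integral>\<^sup>+p. ennreal (norm (A (fst p))) * ennreal (norm (B (snd p))) \<partial>(lborel \<Otimes>\<^sub>M lborel))"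
      using order_trans[OF H abs_ge_self]
      by (intro nn_integral_mono) (auto simp: ennreal_mult[symmetric] abs_mult[symmetric] intro!: ennreal_leI)
    also have "\<dots> = (\<integral>\<^sup>+y. (\<integral>\<^sup>+x. ennreal (norm (A x)) * ennreal (norm (B y)) \<partial>lborel) \<partial>lborel)"
      by (subst lborel_pair.nn_integral_snd[symmetric]) auto
    also have "\<dots> = (\<integral>\<^sup>+y. (\<integral>\<^sup>+x. ennreal (norm (A x)) \<partial>lborel) * ennreal (norm (B y)) \<partial>lborel)"
      by (intro nn_integral_cong nn_integral_multc) auto
    also have "\<dots> = (\<integral>\<^sup>+x. ennreal (norm (A x)) \<partial>lborel) * (\<integral>\<^sup>+y. ennreal (norm (B y)) \<partial>lborel)"
      by (intro nn_integral_cmult) auto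
    also have "\<dots> < \<infinity>"
      using A B by (auto simp: integrable_iff_bounded ennreal_mult_less_top)
    finally show "(\<integral>\<^sup>+p. ennreal (norm (case p of (x, y) \<Rightarrow> H x y)) \<partial>(lborel \<Otimes>\<^sub>M lborel)) < \<infinity>" .
  qed
  show "(LINT y|lborel. LINT x|lborel. H x y) = (LINT x|lborel. LINT y|lborel. H x y)"
    using lborel_pair.Fubini_integral[OF int] .
qed

lemma integral_scale:
  fixes f :: "'a::euclidean_space \<Rightarrow> complex"
  assumes [measurable]: "f \<in> borel_measurable borel" and c: "0 < c"
  shows "(LINT x|lborel. f x) = of_real (c ^ DIM('a)) * (LINT x|lborel. f (t + c *\<^sub>R x))"
proof -
  have "(LINT x|lborel. f x) = (LINT x|density (distr lborel borel (\<lambda>x. t + c *\<^sub>R x)) (\<lambda>_. ennreal (\<bar>c\<bar>^DIM('a))). f x)"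
    using c by (subst lborel_affine[of c t]) (auto simp: ennreal_power)
  also have "\<dots> = (LINT x|distr lborel borel (\<lambda>x. t + c *\<^sub>R x). (\<bar>c\<bar>^DIM('a)) *\<^sub>R f x)"
    by (subst integral_density) auto
  also have "\<dots> = (LINT x|lborel. (\<bar>c\<bar>^DIM('a)) *\<^sub>R f (t + c *\<^sub>R x))"
    by (subst integral_distr) auto
  finally show ?thesis using c by (simp add: scaleR_conv_of_real)
qed

lemma integrable_scale:
  fixes f :: "'a::euclidean_space \<Rightarrow> complex"
  assumes f: "integrable lborel f" and c: "0 < c"
  shows "integrable lborel (\<lambda>x. f (t + c *\<^sub>R x))"
proof -
  have [measurable]: "f \<in> borel_measurable borel" using borel_measurable_integrable[OF f] by simp
  have "integrable (density (distr lborel borel (\<lambda>x. t + c *\<^sub>R x)) (\<lambda>_. ennreal (\<bar>c\<bar> ^ DIM('a)))) f"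
    using f c lborel_affine[of c t] by (simp add: ennreal_power)
  then have "integrable (distr lborel borel (\<lambda>x. t + c *\<^sub>R x)) (\<lambda>x. (\<bar>c\<bar> ^ DIM('a)) *\<^sub>R f x)"
    by (subst (asm) integrable_density) auto
  then have "integrable lborel (\<lambda>x. (\<bar>c\<bar> ^ DIM('a)) *\<^sub>R f (t + c *\<^sub>R x))"
    by (subst (asm) integrable_distr_eq) auto
  from integrable_scaleR_right[OF this, of "inverse (\<bar>c\<bar> ^ DIM('a))"] show ?thesis using c by simp
qed

text \<open>One term of the exponential series: y^m / m! <= exp y at y = t + t s^2, after 1 + s <= 2
  (1 + s^2).\<close>

lemma power_exp_bound:
  assumes "0 < t"
  shows "\<exists>K>0. \<forall>s\<ge>0. (1 + s) ^ m * exp (- (t * s\<^sup>2)) \<le> (K::real)"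
proof (intro exI conjI allI impI)
  show "0 < 2 ^ m * fact m * exp t / t ^ m" using assms by simp
  fix s :: real assume s: "0 \<le> s"
  have pow: "x ^ m / fact m \<le> exp x" if "0 \<le> x" for x :: real
  proof -
    have "(\<Sum>n\<in>{m}. inverse (fact n) * x ^ n) \<le> (\<Sum>n. inverse (fact n) * x ^ n)"
      using that by (intro sum_le_suminf summable_exp) auto
    then show ?thesis by (simp add: exp_def field_simps scaleR_conv_of_real)
  qed
  have "1 + s \<le> 2 * (1 + s\<^sup>2)"
  proof -
    have "0 \<le> (s - 1)\<^sup>2 + 3 * s\<^sup>2 + 1" by simp
    then show ?thesis by (simp add: power2_eq_square algebra_simps)
  qed
  then have "(1 + s) ^ m \<le> (2 * (1 + s\<^sup>2)) ^ m" using s by (intro power_mono) auto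
  also have "2 * (1 + s\<^sup>2) = (2 / t) * (t + t * s\<^sup>2)"
    using assms by (simp add: field_simps)
  also have "((2 / t) * (t + t * s\<^sup>2)) ^ m = 2 ^ m / t ^ m * (t + t * s\<^sup>2) ^ m"
    by (simp only: power_mult_distrib power_divide)
  also have "\<dots> \<le> 2 ^ m / t ^ m * (fact m * exp (t + t * s\<^sup>2))"
    using pow[of "t + t * s\<^sup>2"] assms by (intro mult_left_mono) (auto simp: field_simps)
  finally have "(1 + s) ^ m * exp (- (t * s\<^sup>2)) \<le> 2 ^ m / t ^ m * (fact m * exp (t + t * s\<^sup>2)) * exp (- (t * s\<^sup>2))"
    by (intro mult_right_mono) auto
  also have "\<dots> = 2 ^ m / t ^ m * fact m * exp t" by (simp add: exp_add exp_minus field_simps)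
  finally show "(1 + s) ^ m * exp (- (t * s\<^sup>2)) \<le> 2 ^ m * fact m * exp t / t ^ m" by simp
qed

lemma integrable_decay:
  "integrable lborel (\<lambda>x::'a::euclidean_space. 1 / (1 + norm x) ^ (DIM('a) + 2))"
proof (rule integrableI_bounded)
  obtain K where "\<forall>r>0. (\<integral>\<^sup>+x. ennreal (1 / (1 + r * norm (x::'a)) ^ (DIM('a) + 2)) \<partial>lborel) \<le> ennreal (K / r ^ DIM('a))"
    using nn_integral_decay by blast
  then have "(\<integral>\<^sup>+x. ennreal (1 / (1 + norm (x::'a)) ^ (DIM('a) + 2)) \<partial>lborel) \<le> ennreal K"
    by (auto dest!: spec[of _ 1])
  then show "(\<integral>\<^sup>+x. ennreal (norm (1 / (1 + norm (x::'a)) ^ (DIM('a) + 2))) \<partial>lborel) < \<infinity>"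
    by (simp add: le_less_trans)
qed simp

lemma integrable_poly_decay:
  fixes f :: "'a::euclidean_space \<Rightarrow> 'b::{banach, second_countable_topology}"
  assumes "f \<in> borel_measurable borel" "\<And>x. (1 + norm x) ^ (DIM('a) + 2) * norm (f x) \<le> K"
  shows "integrable lborel f"
proof (rule Bochner_Integration.integrable_bound)
  show "integrable lborel (\<lambda>x::'a. K * (1 / (1 + norm x) ^ (DIM('a) + 2)))"
    by (intro integrable_mult_right integrable_decay)
  show "AE x in lborel. norm (f x) \<le> norm (K * (1 / (1 + norm x) ^ (DIM('a) + 2)))"
  proof (rule AE_I2)
    fix x :: 'a
    have "0 < (1 + norm x) ^ (DIM('a) + 2)" by (intro zero_less_power add_pos_nonneg) auto
    then have "norm (f x) \<le> K * (1 / (1 + norm x) ^ (DIM('a) + 2))"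
      using assms(2)[of x] by (simp add: pos_le_divide_eq mult.commute)
    then show "norm (f x) \<le> norm (K * (1 / (1 + norm x) ^ (DIM('a) + 2)))"
      unfolding real_norm_def by (rule order_trans[OF _ abs_ge_self])
  qed
qed (use assms(1) in simp)

section \<open>The Gaussian and its Fourier transform\<close>

definition gauss :: "'a::euclidean_space \<Rightarrow> complex" where
  "gauss x = complex_of_real (exp (- ((norm x)\<^sup>2 / 2)))"

lemma continuous_gauss [continuous_intros]: "continuous_on UNIV gauss"
  unfolding gauss_def by (intro continuous_intros) simp

lemma gauss_measurable [measurable]: "gauss \<in> borel_measurable borel"
  by (rule borel_measurable_continuous_onI[OF continuous_gauss])

lemma norm_gauss: "norm (gauss x) = exp (- ((norm x)\<^sup>2 / 2))" "norm (gauss x) \<le> 1"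
  by (simp_all add: gauss_def)

lemma gauss_decay: "\<exists>K. \<forall>x::'a::euclidean_space. (1 + norm x) ^ m * norm (gauss x) \<le> K"
proof -
  obtain K :: real where "\<forall>s\<ge>0. (1 + s) ^ m * exp (- (1/2 * s\<^sup>2)) \<le> K"
    using power_exp_bound[of "1/2" m] by auto
  then show ?thesis by (intro exI[of _ K]) (auto simp: norm_gauss)
qed

lemma integrable_gauss: "integrable lborel gauss"
proof -
  obtain K where "\<forall>x::'a::euclidean_space. (1 + norm x) ^ (DIM('a) + 2) * norm (gauss x) \<le> K"
    using gauss_decay by blast
  then show ?thesis by (intro integrable_poly_decay[of gauss K]) auto
qed

lemma integrable_inner_gauss: "integrable lborel (\<lambda>x. complex_of_real (w \<bullet> x) * gauss x)"
proof -
  obtain K where K: "\<forall>x::'a::euclidean_space. (1 + norm x) ^ (DIM('a) + 3) * norm (gauss x) \<le> K"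
    using gauss_decay by blast
  have "(1 + norm x) ^ (DIM('a) + 2) * norm (complex_of_real (w \<bullet> x) * gauss x) \<le> norm w * K" for x :: 'a
  proof -
    have "norm (complex_of_real (w \<bullet> x) * gauss x) \<le> norm w * (1 + norm x) * norm (gauss x)"
      unfolding norm_mult norm_of_real
      by (intro mult_right_mono order_trans[OF Cauchy_Schwarz_ineq2] mult_left_mono) auto
    then have "(1 + norm x) ^ (DIM('a) + 2) * norm (complex_of_real (w \<bullet> x) * gauss x) \<le>
       (1 + norm x) ^ (DIM('a) + 2) * (norm w * (1 + norm x) * norm (gauss x))"
      by (intro mult_left_mono) auto
    also have "\<dots> = norm w * ((1 + norm x) ^ (DIM('a) + 3) * norm (gauss x))"
      by (simp add: power_add eval_nat_numeral algebra_simps)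
    also have "\<dots> \<le> norm w * K" using K by (intro mult_left_mono) auto
    finally show ?thesis .
  qed
  then show ?thesis by (intro integrable_poly_decay) auto
qed

lemma dirderiv_norm_sq: "dirderiv v (\<lambda>x. complex_of_real ((norm (x - y))\<^sup>2)) (\<lambda>x. complex_of_real (2 * ((x - y) \<bullet> v)))"
  unfolding dirderiv_def
proof
  fix x
  have "((\<lambda>t. complex_of_real ((x + t *\<^sub>R v - y) \<bullet> (x + t *\<^sub>R v - y))) has_vector_derivative
      complex_of_real (v \<bullet> (x + 0 *\<^sub>R v - y) + (x + 0 *\<^sub>R v - y) \<bullet> v)) (at 0)"
    by (auto intro!: has_vector_derivative_of_real derivative_eq_intros
      simp: has_real_derivative_iff_has_vector_derivative[symmetric] has_field_derivative_def inner_commute algebra_simps)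
  then show "((\<lambda>t. complex_of_real ((norm (x + t *\<^sub>R v - y))\<^sup>2)) has_vector_derivative complex_of_real (2 * ((x - y) \<bullet> v))) (at 0)"
    by (simp add: power2_norm_eq_inner inner_commute)
qed

lemma dirderiv_gauss: "dirderiv v gauss (\<lambda>x. - complex_of_real (v \<bullet> x) * gauss x)"
proof -
  have "dirderiv v (\<lambda>x. complex_of_real ((norm (x - 0))\<^sup>2)) (\<lambda>x. complex_of_real (2 * ((x - 0) \<bullet> v)))"
    by (rule dirderiv_norm_sq)
  from dirderiv_field[OF dirderiv_cmult[OF this, of "-1/2"], of exp exp]
  have "dirderiv v (\<lambda>x. exp (-1/2 * complex_of_real ((norm x)\<^sup>2)))
     (\<lambda>x. -1/2 * complex_of_real (2 * (x \<bullet> v)) * exp (-1/2 * complex_of_real ((norm x)\<^sup>2)))"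
    by (auto intro: DERIV_exp)
  moreover have "exp (-1/2 * complex_of_real ((norm x)\<^sup>2)) = gauss x" for x :: 'a
    by (simp add: gauss_def exp_of_real[symmetric])
  ultimately show ?thesis by (simp add: inner_commute)
qed

text \<open>Along the ray s w the transform solves the differential equation phi' = - s |w|^2 phi,
  and the integrating factor exp (s^2 |w|^2 / 2) makes it constant. The total mass stays a symbolic
  factor and is evaluated in \<open>integral_gauss\<close>.\<close>

lemma gauss_transform:
  fixes w :: "'a::euclidean_space"
  shows "(LINT x|lborel. exp (\<i> * complex_of_real (w \<bullet> x)) * gauss x) = (LINT x|lborel. gauss (x::'a)) * gauss w"
proof -
  let ?e = "\<lambda>s x. exp (\<i> * complex_of_real ((s *\<^sub>R w) \<bullet> x))"
  define \<phi> where "\<phi> s = (LINT x|lborel. ?e s x * gauss x)" for s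
  have int: "integrable lborel (\<lambda>x. ?e s x * gauss x)" for s
    by (rule integrable_bounded_by[where B="\<lambda>x. norm (gauss x)"])
       (use integrable_gauss in \<open>auto simp: norm_mult integrable_iff_bounded\<close>)
  have int2: "integrable lborel (\<lambda>x. ?e s x * (complex_of_real (w \<bullet> x) * gauss x))" for s
    by (rule integrable_bounded_by[where B="\<lambda>x. norm (complex_of_real (w \<bullet> x) * gauss x)"])
       (use integrable_inner_gauss[of w] in \<open>auto simp: norm_mult integrable_iff_bounded\<close>)
  have deriv: "(\<phi> has_vector_derivative (- complex_of_real (s * (norm w)\<^sup>2) * \<phi> s)) (at s)" for s
  proof -
    have "(\<phi> has_vector_derivative (LINT x|lborel. \<i> * (?e s x * (complex_of_real (w \<bullet> x) * gauss x)))) (at s)"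
      unfolding \<phi>_def
    proof (rule has_vector_derivative_integral[where B="\<lambda>x. norm (complex_of_real (w \<bullet> x) * gauss x)"])
      fix s x
      have "dirderiv 1 (\<lambda>s::real. exp (\<i> * complex_of_real ((w \<bullet> x) \<bullet> s))) (\<lambda>s. \<i> * complex_of_real ((w \<bullet> x) \<bullet> 1) * exp (\<i> * complex_of_real ((w \<bullet> x) \<bullet> s)))"
        by (rule dirderiv_exp_i)
      from dirderiv_at[OF this, of 0 s]
      have "((\<lambda>s. ?e s x) has_vector_derivative \<i> * complex_of_real (w \<bullet> x) * ?e s x) (at s)"
        by (simp add: mult.commute)
      from has_vector_derivative_mult[OF this has_vector_derivative_const[of "gauss x"]]
      show "((\<lambda>s. ?e s x * gauss x) has_vector_derivative \<i> * (?e s x * (complex_of_real (w \<bullet> x) * gauss x))) (at s)"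
        by (simp add: algebra_simps)
    qed (use int integrable_norm[OF integrable_inner_gauss[of w]] in \<open>auto simp: norm_mult\<close>)
    \<comment> \<open>Minus w . x times the Gaussian is its own derivative along \<open>w\<close>;
      integrating by parts turns the derivative of \<open>\<phi>\<close> back into a multiple of
      \<open>\<phi>\<close>.\<close>
    moreover have "(LINT x|lborel. (- complex_of_real (w \<bullet> x) * gauss x) * ?e s x) =
       - (LINT x|lborel. gauss x * (\<i> * complex_of_real ((s *\<^sub>R w) \<bullet> w) * ?e s x))"
      by (rule integral_by_parts_dir[OF dirderiv_gauss dirderiv_exp_i])
         (use int[of s] int2[of s] integrable_mult_right[OF int[of s], of "\<i> * complex_of_real ((s *\<^sub>R w) \<bullet> w)"]
           in \<open>auto intro!: continuous_intros simp: mult_ac\<close>)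
    then have "(LINT x|lborel. ?e s x * (complex_of_real (w \<bullet> x) * gauss x)) =
       (LINT x|lborel. (\<i> * complex_of_real ((s *\<^sub>R w) \<bullet> w)) * (?e s x * gauss x))"
      by (simp add: mult_ac)
    then have "(LINT x|lborel. ?e s x * (complex_of_real (w \<bullet> x) * gauss x)) = \<i> * complex_of_real (s * (norm w)\<^sup>2) * \<phi> s"
      by (simp add: \<phi>_def power2_norm_eq_inner mult.assoc)
    ultimately have "(\<phi> has_vector_derivative \<i> * (\<i> * complex_of_real (s * (norm w)\<^sup>2) * \<phi> s)) (at s)"
      by (simp only: integral_mult_right_zero)
    moreover have "\<i> * (\<i> * A * B) = - A * B" for A B :: complex by (simp flip: mult.assoc)
    ultimately show ?thesis by (simp only:)
  qed
  define \<psi> where "\<psi> s = exp (complex_of_real (s\<^sup>2 * (norm w)\<^sup>2 / 2)) * \<phi> s" for s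
  have "(\<psi> has_vector_derivative 0) (at s)" for s
  proof -
    have "((\<lambda>s. complex_of_real (s\<^sup>2 * (norm w)\<^sup>2 / 2)) has_vector_derivative complex_of_real (s * (norm w)\<^sup>2)) (at s)"
      by (rule has_vector_derivative_of_real)
         (auto intro!: derivative_eq_intros simp: has_real_derivative_iff_has_vector_derivative[symmetric])
    from field_vector_diff_chain_at[OF this DERIV_exp]
    have "((\<lambda>s. exp (complex_of_real (s\<^sup>2 * (norm w)\<^sup>2 / 2))) has_vector_derivative
       complex_of_real (s * (norm w)\<^sup>2) * exp (complex_of_real (s\<^sup>2 * (norm w)\<^sup>2 / 2))) (at s)"
      by (simp add: o_def)
    from has_vector_derivative_mult[OF this deriv[of s]]
    show ?thesis unfolding \<psi>_def by (simp add: algebra_simps)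
  qed
  then have "\<psi> 1 = \<psi> 0"
    using has_vector_derivative_zero_constant[of UNIV \<psi>] by (metis UNIV_I convex_UNIV has_vector_derivative_at_within)
  then have "exp (complex_of_real ((norm w)\<^sup>2 / 2)) * \<phi> 1 = \<phi> 0"
    by (simp add: \<psi>_def)
  then have "\<phi> 1 = \<phi> 0 * exp (- complex_of_real ((norm w)\<^sup>2 / 2))"
    by (simp add: exp_minus field_simps)
  then show ?thesis by (simp add: \<phi>_def gauss_def exp_of_real[symmetric])
qed

text \<open>The normalising constant of the standard normal density, one factor per
  coordinate.\<close>

lemma integral_gauss:
  "(LINT x|lborel. gauss (x::'a::euclidean_space)) = complex_of_real (sqrt (2 * pi) ^ DIM('a))"
proof -
  have one: "(\<integral>\<^sup>+x. ennreal (exp (- (x\<^sup>2 / 2))) \<partial>lborel) = ennreal (sqrt (2 * pi))"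
  proof -
    have "(\<integral>\<^sup>+x. ennreal (exp (- (x\<^sup>2 / 2))) \<partial>lborel) = (\<integral>\<^sup>+x. ennreal (sqrt (2 * pi)) * ennreal (normal_density 0 1 x) \<partial>lborel)"
      by (intro nn_integral_cong) (simp add: normal_density_def ennreal_mult[symmetric])
    also have "\<dots> = ennreal (sqrt (2 * pi)) * (\<integral>\<^sup>+x. ennreal (normal_density 0 1 x) \<partial>lborel)"
      by (intro nn_integral_cmult) auto
    also have "(\<integral>\<^sup>+x. ennreal (normal_density 0 1 x) \<partial>lborel) = ennreal (LINT x|lborel. normal_density 0 1 x)"
      by (intro nn_integral_eq_integral) auto
    finally show ?thesis by simp
  qed
  have "(\<integral>\<^sup>+x. ennreal (exp (- ((norm (x::'a))\<^sup>2 / 2))) \<partial>lborel) =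
      (\<integral>\<^sup>+x. (\<Prod>b\<in>(Basis::'a set). ennreal (exp (- ((x \<bullet> b)\<^sup>2 / 2)))) \<partial>lborel)"
  proof (rule nn_integral_cong)
    fix x :: 'a
    have "(norm x)\<^sup>2 = (\<Sum>b\<in>Basis. (x \<bullet> b)\<^sup>2)"
      using euclidean_inner[of x x] by (simp add: power2_norm_eq_inner[of x] power2_eq_square[of "x \<bullet> _"])
    then have "exp (- ((norm x)\<^sup>2 / 2)) = (\<Prod>b\<in>Basis. exp (- ((x \<bullet> b)\<^sup>2 / 2)))"
      by (simp add: exp_sum[symmetric] sum_negf sum_divide_distrib)
    then show "ennreal (exp (- ((norm x)\<^sup>2 / 2))) = (\<Prod>b\<in>(Basis::'a set). ennreal (exp (- ((x \<bullet> b)\<^sup>2 / 2))))"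
      by (simp add: prod_ennreal)
  qed
  also have "\<dots> = (\<Prod>b\<in>(Basis::'a set). (\<integral>\<^sup>+x. ennreal (exp (- (x\<^sup>2 / 2))) \<partial>lborel))"
    by (rule nn_integral_lborel_prod) auto
  also have "\<dots> = ennreal (sqrt (2 * pi) ^ DIM('a))"
    by (simp only: one prod_constant) (simp add: ennreal_power)
  finally have "(\<integral>\<^sup>+x. ennreal (exp (- ((norm (x::'a))\<^sup>2 / 2))) \<partial>lborel) = ennreal (sqrt (2 * pi) ^ DIM('a))" .
  then have "(LINT x|lborel. exp (- ((norm (x::'a))\<^sup>2 / 2))) = sqrt (2 * pi) ^ DIM('a)"
    by (subst integral_eq_nn_integral) auto
  then show ?thesis unfolding gauss_def by (simp only: integral_complex_of_real)
qed

text \<open>Gaussian regularisation of the iterated integral.\<close>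
lemma fourier_integral_inversion:
  fixes b :: "'a::euclidean_space \<Rightarrow> complex"
  assumes cont: "continuous_on UNIV b" and bd: "\<And>x. norm (b x) \<le> M" and ib: "integrable lborel b"
    and ik: "integrable lborel (\<lambda>w. LINT \<xi>|lborel. exp (\<i> * complex_of_real (w \<bullet> \<xi>)) * b \<xi>)"
  shows "(LINT w|lborel. exp (- \<i> * complex_of_real (\<xi>0 \<bullet> w)) * (LINT \<xi>|lborel. exp (\<i> * complex_of_real (w \<bullet> \<xi>)) * b \<xi>))
    = complex_of_real ((2 * pi) ^ DIM('a)) * b \<xi>0"
proof -
  let ?k = "\<lambda>w. LINT \<xi>|lborel. exp (\<i> * complex_of_real (w \<bullet> \<xi>)) * b \<xi>"
  let ?P = "LINT x|lborel. gauss (x::'a)"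
  have [measurable]: "b \<in> borel_measurable borel" by (rule borel_measurable_continuous_onI[OF cont])
  have [measurable]: "?k \<in> borel_measurable borel" using borel_measurable_integrable[OF ik] by simp
  \<comment> \<open>The Gaussian factor makes the double integral absolutely convergent, so that
    Fubini applies; it tends to 1 as \<open>n\<close> grows.\<close>
  define R where "R n = (LINT w|lborel. exp (- \<i> * complex_of_real (\<xi>0 \<bullet> w)) * ?k w * gauss ((1 / real (Suc n)) *\<^sub>R w))" for n
  have lim0: "(\<lambda>n. (1 / real (Suc n)) *\<^sub>R w) \<longlonglongrightarrow> 0" for w :: 'a
    using tendsto_scaleR[OF LIMSEQ_inverse_real_of_nat tendsto_const[of w]] by (simp add: inverse_eq_divide)
  have glim: "(\<lambda>n. gauss ((1 / real (Suc n)) *\<^sub>R w)) \<longlonglongrightarrow> 1" for w :: 'a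
    using continuous_on_tendsto_compose[OF continuous_gauss lim0[of w]] by (simp add: gauss_def)
  have lim1: "R \<longlonglongrightarrow> (LINT w|lborel. exp (- \<i> * complex_of_real (\<xi>0 \<bullet> w)) * ?k w)"
    unfolding R_def
  proof (rule integral_dominated_convergence[where w="\<lambda>w. norm (?k w)"])
    show "AE w in lborel. (\<lambda>n. exp (- \<i> * complex_of_real (\<xi>0 \<bullet> w)) * ?k w * gauss ((1 / real (Suc n)) *\<^sub>R w))
        \<longlonglongrightarrow> exp (- \<i> * complex_of_real (\<xi>0 \<bullet> w)) * ?k w"
      using tendsto_mult[OF tendsto_const glim] by (intro AE_I2) fastforce
    show "AE w in lborel. norm (exp (- \<i> * complex_of_real (\<xi>0 \<bullet> w)) * ?k w * gauss ((1 / real (Suc n)) *\<^sub>R w)) \<le> norm (?k w)" for n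
      by (intro AE_I2) (simp add: norm_mult mult_left_le norm_gauss(2))
  qed (use ik in auto)
  \<comment> \<open>The inner integral is a Gaussian again, concentrated at \<open>\<xi>0\<close> at
    scale 1/(n+1). The substitution \<xi> = \<xi>0 + \<zeta>/(n+1) cancels the powers of n+1 and
    leaves a Gaussian average of \<open>b\<close> around \<open>\<xi>0\<close>.\<close>
  have R: "R n = (LINT \<zeta>|lborel. b (\<xi>0 + (1 / real (Suc n)) *\<^sub>R \<zeta>) * (?P * gauss \<zeta>))" for n
  proof -
    let ?n = "real (Suc n)"
    have ig: "integrable lborel (\<lambda>w::'a. norm (gauss ((1 / ?n) *\<^sub>R w)))"
    proof (intro integrable_norm)
      show "integrable lborel (\<lambda>w::'a. gauss ((1 / ?n) *\<^sub>R w))"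
        using integrable_scale[OF integrable_gauss, of "1 / ?n" 0] by simp
    qed
    have "R n = (LINT w|lborel. LINT \<xi>|lborel. exp (- \<i> * complex_of_real (\<xi>0 \<bullet> w)) *
        (exp (\<i> * complex_of_real (w \<bullet> \<xi>)) * b \<xi>) * gauss ((1 / ?n) *\<^sub>R w))"
      unfolding R_def
      by (intro Bochner_Integration.integral_cong refl) (simp only: integral_mult_right_zero integral_mult_left_zero)
    also have "\<dots> = (LINT \<xi>|lborel. LINT w|lborel. exp (- \<i> * complex_of_real (\<xi>0 \<bullet> w)) *
        (exp (\<i> * complex_of_real (w \<bullet> \<xi>)) * b \<xi>) * gauss ((1 / ?n) *\<^sub>R w))"
      by (rule Fubini_prod_bound(1)[where A="\<lambda>\<xi>. norm (b \<xi>)" and B="\<lambda>w. norm (gauss ((1 / ?n) *\<^sub>R w))"])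
         (use ib ig in \<open>auto simp: norm_mult\<close>)
    also have "\<dots> = (LINT \<xi>|lborel. b \<xi> * (LINT w|lborel. exp (\<i> * complex_of_real ((\<xi> - \<xi>0) \<bullet> w)) * gauss ((1 / ?n) *\<^sub>R w)))"
    proof (intro Bochner_Integration.integral_cong refl)
      fix \<xi> :: 'a
      have "exp (- \<i> * complex_of_real (\<xi>0 \<bullet> w)) * (exp (\<i> * complex_of_real (w \<bullet> \<xi>)) * b \<xi>) * gauss ((1 / ?n) *\<^sub>R w)
          = b \<xi> * (exp (\<i> * complex_of_real ((\<xi> - \<xi>0) \<bullet> w)) * gauss ((1 / ?n) *\<^sub>R w))" for w
      proof -
        have "exp (- \<i> * complex_of_real (\<xi>0 \<bullet> w)) * exp (\<i> * complex_of_real (w \<bullet> \<xi>)) = exp (\<i> * complex_of_real ((\<xi> - \<xi>0) \<bullet> w))"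
          by (simp add: exp_add[symmetric] inner_diff_left inner_commute algebra_simps)
        then show ?thesis by (simp only: mult_ac)
      qed
      then show "(LINT w|lborel. exp (- \<i> * complex_of_real (\<xi>0 \<bullet> w)) * (exp (\<i> * complex_of_real (w \<bullet> \<xi>)) * b \<xi>) * gauss ((1 / ?n) *\<^sub>R w))
          = b \<xi> * (LINT w|lborel. exp (\<i> * complex_of_real ((\<xi> - \<xi>0) \<bullet> w)) * gauss ((1 / ?n) *\<^sub>R w))"
        by (simp only: integral_mult_right_zero)
    qed
    also have "\<dots> = (LINT \<xi>|lborel. b \<xi> * (of_real (?n ^ DIM('a)) * (?P * gauss (?n *\<^sub>R (\<xi> - \<xi>0)))))"
    proof (intro Bochner_Integration.integral_cong refl arg_cong2[where f="(*)"])
      fix \<xi> :: 'a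
      have "(LINT w|lborel. exp (\<i> * complex_of_real ((\<xi> - \<xi>0) \<bullet> w)) * gauss ((1 / ?n) *\<^sub>R w)) =
         of_real (?n ^ DIM('a)) * (LINT w|lborel. exp (\<i> * complex_of_real ((\<xi> - \<xi>0) \<bullet> (0 + ?n *\<^sub>R w))) * gauss ((1 / ?n) *\<^sub>R (0 + ?n *\<^sub>R w)))"
        by (rule integral_scale) auto
      also have "\<dots> = of_real (?n ^ DIM('a)) * (LINT w|lborel. exp (\<i> * complex_of_real ((?n *\<^sub>R (\<xi> - \<xi>0)) \<bullet> w)) * gauss w)"
        by (simp del: of_nat_Suc)
      finally show "(LINT w|lborel. exp (\<i> * complex_of_real ((\<xi> - \<xi>0) \<bullet> w)) * gauss ((1 / ?n) *\<^sub>R w)) =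
         of_real (?n ^ DIM('a)) * (?P * gauss (?n *\<^sub>R (\<xi> - \<xi>0)))"
        by (simp only: gauss_transform)
    qed
    also have "\<dots> = of_real ((1 / ?n) ^ DIM('a)) * (LINT \<zeta>|lborel. b (\<xi>0 + (1 / ?n) *\<^sub>R \<zeta>) *
        (of_real (?n ^ DIM('a)) * (?P * gauss (?n *\<^sub>R ((\<xi>0 + (1 / ?n) *\<^sub>R \<zeta>) - \<xi>0)))))"
      by (rule integral_scale) auto
    also have "\<dots> = of_real ((1 / ?n) ^ DIM('a)) * (LINT \<zeta>|lborel. of_real (?n ^ DIM('a)) * (b (\<xi>0 + (1 / ?n) *\<^sub>R \<zeta>) * (?P * gauss \<zeta>)))"
      by (simp add: mult_ac del: of_nat_Suc)
    also have "\<dots> = (of_real ((1 / ?n) ^ DIM('a)) * of_real (?n ^ DIM('a))) * (LINT \<zeta>|lborel. (b (\<xi>0 + (1 / ?n) *\<^sub>R \<zeta>) * (?P * gauss \<zeta>)))"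
      by (simp only: integral_mult_right_zero mult.assoc)
    also have "of_real ((1 / ?n) ^ DIM('a)) * of_real (?n ^ DIM('a)) = (1::complex)"
      by (simp add: power_divide del: of_nat_Suc)
    finally show ?thesis by simp
  qed
  have "R \<longlonglongrightarrow> (LINT \<zeta>|lborel. b \<xi>0 * (?P * gauss (\<zeta>::'a)))"
    unfolding R
  proof (rule integral_dominated_convergence[where w="\<lambda>\<zeta>. M * norm (?P * gauss \<zeta>)"])
    show "integrable lborel (\<lambda>\<zeta>::'a. M * norm (?P * gauss \<zeta>))"
      by (intro integrable_mult_right integrable_norm integrable_gauss)
    show "AE \<zeta> in lborel. (\<lambda>n. b (\<xi>0 + (1 / real (Suc n)) *\<^sub>R \<zeta>) * (?P * gauss \<zeta>)) \<longlonglongrightarrow> b \<xi>0 * (?P * gauss \<zeta>)"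
    proof (rule AE_I2)
      fix \<zeta>
      have "(\<lambda>n. b (\<xi>0 + (1 / real (Suc n)) *\<^sub>R \<zeta>)) \<longlonglongrightarrow> b (\<xi>0 + 0)"
        by (intro continuous_on_tendsto_compose[OF cont] tendsto_intros lim0) auto
      then show "(\<lambda>n. b (\<xi>0 + (1 / real (Suc n)) *\<^sub>R \<zeta>) * (?P * gauss \<zeta>)) \<longlonglongrightarrow> b \<xi>0 * (?P * gauss \<zeta>)"
        by (intro tendsto_mult) auto
    qed
    show "AE \<zeta> in lborel. norm (b (\<xi>0 + (1 / real (Suc n)) *\<^sub>R \<zeta>) * (?P * gauss \<zeta>)) \<le> M * norm (?P * gauss \<zeta>)" for n
      unfolding norm_mult[of "b _"] using bd by (intro AE_I2 mult_right_mono) auto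
  qed auto
  then have "(LINT w|lborel. exp (- \<i> * complex_of_real (\<xi>0 \<bullet> w)) * ?k w) = b \<xi>0 * (?P * ?P)"
    using LIMSEQ_unique[OF lim1] by simp
  \<comment> \<open>One factor comes from the transform of the Gaussian, the other from the total
    mass of the averaging Gaussian.\<close>
  also have "?P * ?P = complex_of_real ((2 * pi) ^ DIM('a))"
  proof -
    have "sqrt (2 * pi) ^ DIM('a) * sqrt (2 * pi) ^ DIM('a) = (2 * pi) ^ DIM('a)"
      by (simp only: power_mult_distrib[symmetric] real_sqrt_mult_self) simp
    then show ?thesis by (simp only: integral_gauss of_real_mult[symmetric])
  qed
  finally show ?thesis by (simp add: mult.commute)
qed

section \<open>Schwartz functions and convolution\<close>

lemma foldr_funpow_single:
  assumes "distinct xs"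
  shows "foldr (\<lambda>i. D i ^^ (if i = j then b else 0)) xs f = (if j \<in> set xs then (D j ^^ b) f else f)"
  using assms by (induction xs) auto

lemma coords_distinct: "distinct (coords :: 'n::finite list)" and set_coords: "set (coords :: 'n::finite list) = UNIV"
proof -
  obtain xs :: "'n list" where "distinct xs \<and> set xs = UNIV"
    using finite_distinct_list[OF finite_class.finite_UNIV] by blast
  then have "distinct (coords :: 'n list) \<and> set (coords :: 'n list) = UNIV"
    unfolding coords_def by (rule someI)
  then show "distinct (coords :: 'n list)" "set (coords :: 'n list) = UNIV" by auto
qed

text \<open>Multi-indices concentrated in one coordinate. They are all that coordinatewise decay
  requires, and for them the arbitrary enumeration \<open>coords\<close> has no influence on the
  derivative.\<close>

definition msingle :: "'n::finite \<Rightarrow> nat \<Rightarrow> nat ^ 'n" where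
  "msingle j b = (\<chi> i. if i = j then b else 0)"

lemma mderiv_dir_msingle: "mderiv_dir e (msingle j b) f = (partial_deriv (e j) ^^ b) f"
proof -
  have "mderiv_dir e (msingle j b) f = foldr (\<lambda>i. partial_deriv (e i) ^^ (if i = j then b else 0)) coords f"
    by (simp add: mderiv_dir_def msingle_def)
  then show ?thesis using foldr_funpow_single[OF coords_distinct] by (simp add: set_coords)
qed

lemma morder_msingle: "morder (msingle j b) = b"
  by (simp add: morder_def msingle_def)

lemma Basis_vec_cases:
  assumes "v \<in> (Basis :: (real ^ 'n::finite) set)"
  obtains j where "v = axis j 1"
  using assms by (auto simp: Basis_vec_def)

lemma smooth_funpow:
  assumes "smooth f" "v \<in> Basis"
  shows "(partial_deriv v ^^ b) f differentiable (at x)"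
proof -
  have "(partial_deriv v ^^ b) f = foldr partial_deriv (replicate b v) f"
    by (induction b) auto
  moreover have "set (replicate b v) \<subseteq> Basis" using assms by (auto simp: set_replicate_conv_if)
  ultimately show ?thesis using assms(1) unfolding smooth_def by metis
qed

lemma deriv_bounds_funpow:
  assumes "\<And>b x. b \<le> N \<Longrightarrow> (partial_deriv v ^^ b) f differentiable (at x)"
    and "\<And>b x. b \<le> N \<Longrightarrow> norm ((partial_deriv v ^^ b) f x) \<le> B x / r ^ b"
  shows "deriv_bounds N v r B f"
  using assms
proof (induction N arbitrary: f B)
  case 0
  then show ?case using 0(1)[of 0] 0(2)[of 0]
    by (auto intro!: continuous_at_imp_continuous_on differentiable_imp_continuous_within)
next
  case (Suc N)
  have "deriv_bounds N v r (\<lambda>x. B x / r) (partial_deriv v f)"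
  proof (rule Suc.IH)
    fix b x assume "b \<le> N"
    then show "(partial_deriv v ^^ b) (partial_deriv v f) differentiable (at x)"
      using Suc.prems(1)[of "Suc b"] by (simp add: funpow_swap1)
    show "norm ((partial_deriv v ^^ b) (partial_deriv v f) x) \<le> B x / r / r ^ b"
      using Suc.prems(2)[of "Suc b" x] \<open>b \<le> N\<close> by (simp add: funpow_swap1 mult.commute)
  qed
  moreover have "dirderiv v f (partial_deriv v f)"
    using Suc.prems(1)[of 0] by (intro dirderiv_frechet) auto
  ultimately show ?case using Suc.prems(1)[of 0] Suc.prems(2)[of 0]
    by (auto intro!: continuous_at_imp_continuous_on differentiable_imp_continuous_within)
qed

lemma schwartz_decay:
  fixes f :: "real ^ 'n::finite \<Rightarrow> complex"
  assumes "f \<in> schwartz"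
  shows "\<exists>K>0. \<forall>x. (1 + norm x) ^ m * norm (f x) \<le> K"
proof -
  have "mderiv 0 f = f"
  proof -
    have "foldr (\<lambda>j. partial_deriv (axis j 1) ^^ 0) xs f = f" for xs :: "'n list" by (induction xs) auto
    then show ?thesis by (simp add: mderiv_def mderiv_dir_def)
  qed
  moreover obtain B where "\<forall>x. jap x ^ m * norm (mderiv 0 f x) \<le> B"
    using assms unfolding schwartz_def by blast
  ultimately show ?thesis by (intro exI[of _ "max 1 B"]) (auto simp: jap_def le_max_iff_disj)
qed

lemma schwartz_continuous: "f \<in> schwartz \<Longrightarrow> continuous_on UNIV f"
  using smooth_funpow[of f "SOME v. v \<in> Basis" 0] some_in_eq nonempty_Basis
  by (fastforce simp: schwartz_def intro!: continuous_at_imp_continuous_on differentiable_imp_continuous_within)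

lemma schwartz_measurable: "f \<in> schwartz \<Longrightarrow> f \<in> borel_measurable borel"
  by (intro borel_measurable_continuous_onI schwartz_continuous)

lemma schwartz_integrable:
  assumes "f \<in> schwartz"
  shows "integrable lborel f"
proof -
  obtain K where "\<forall>x. (1 + norm x) ^ (DIM(real ^ 'a) + 2) * norm (f x) \<le> K"
    using schwartz_decay[OF assms] by blast
  then show ?thesis by (intro integrable_poly_decay schwartz_measurable assms) blast
qed

lemma schwartz_bounded:
  assumes "f \<in> schwartz"
  obtains K where "0 < K" "\<And>x. norm (f x) \<le> K"
  using schwartz_decay[OF assms, of 0] by auto

lemma schwartz_deriv_bounds:
  fixes f :: "real ^ 'n::finite \<Rightarrow> complex"
  assumes f: "f \<in> schwartz"
  shows "\<exists>K>0. \<forall>v\<in>Basis. deriv_bounds N v 1 (\<lambda>x. K * (1 / (1 + norm x) ^ m)) f"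
proof -
  have sm: "smooth f" using f by (simp add: schwartz_def)
  have "\<exists>B. \<forall>x. jap x ^ m * norm (mderiv (msingle j b) f x) \<le> B" for j b
    using f unfolding schwartz_def by blast
  then obtain B where B: "\<And>j b x. jap x ^ m * norm (mderiv (msingle j b) f x) \<le> B j b" by metis
  define K where "K = 1 + (\<Sum>j\<in>UNIV. \<Sum>b\<le>N. \<bar>B j b\<bar>)"
  have K: "B j b \<le> K" if "b \<le> N" for j b
  proof -
    have "\<bar>B j b\<bar> \<le> (\<Sum>b\<le>N. \<bar>B j b\<bar>)" using that by (intro member_le_sum) auto
    also have "\<dots> \<le> (\<Sum>j\<in>UNIV. \<Sum>b\<le>N. \<bar>B j b\<bar>)"
      by (rule member_le_sum[of j UNIV "\<lambda>j. \<Sum>b\<le>N. \<bar>B j b\<bar>"]) (auto intro: sum_nonneg)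
    finally show ?thesis unfolding K_def by linarith
  qed
  have "deriv_bounds N v 1 (\<lambda>x. K * (1 / (1 + norm x) ^ m)) f" if v: "v \<in> Basis" for v
  proof (rule deriv_bounds_funpow)
    fix b and x :: "real ^ 'n" assume b: "b \<le> N"
    obtain j where j: "v = axis j 1" using v by (rule Basis_vec_cases)
    have "0 < (1 + norm x) ^ m" by (intro zero_less_power add_pos_nonneg) auto
    moreover have "(1 + norm x) ^ m * norm ((partial_deriv v ^^ b) f x) \<le> K"
      using order_trans[OF B[of x j b] K[OF b]] by (simp add: j mderiv_def mderiv_dir_msingle jap_def)
    ultimately show "norm ((partial_deriv v ^^ b) f x) \<le> K * (1 / (1 + norm x) ^ m) / 1 ^ b"
      by (simp add: pos_le_divide_eq mult.commute)
  qed (use smooth_funpow[OF sm v] in auto)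
  moreover have "0 < K" unfolding K_def by (intro add_pos_nonneg sum_nonneg) auto
  ultimately show ?thesis by blast
qed

lemma schwartz_fourier_integral_decay:
  fixes f :: "real ^ 'n::finite \<Rightarrow> complex"
  assumes f: "f \<in> schwartz"
  shows "\<exists>K>0. \<forall>w. norm (LINT x|lborel. exp (\<i> * complex_of_real (w \<bullet> x)) * f x) \<le> K / (1 + norm w) ^ L"
proof -
  let ?d = "DIM(real ^ 'n)"
  obtain K where K: "K > 0" "\<And>v. v \<in> Basis \<Longrightarrow> deriv_bounds L v 1 (\<lambda>x. K * (1 / (1 + norm x) ^ (?d + 2))) f"
    using schwartz_deriv_bounds[OF f] by blast
  define I where "I = (LINT x|lborel. K * (1 / (1 + norm (x :: real ^ 'n)) ^ (?d + 2)))"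
  have I: "(\<integral>\<^sup>+x. ennreal (K * (1 / (1 + norm (x :: real ^ 'n)) ^ (?d + 2))) \<partial>lborel) \<le> ennreal I"
    unfolding I_def using K(1)
    by (intro eq_refl nn_integral_eq_integral integrable_mult_right integrable_decay) auto
  have I0: "0 \<le> I" unfolding I_def using K(1) by (intro Bochner_Integration.integral_nonneg) auto
  have "norm (LINT x|lborel. exp (\<i> * complex_of_real (w \<bullet> x)) * f x) \<le> ((1 + real ?d) ^ Suc L * I + 1) / (1 + norm w) ^ L" for w
  proof -
    have "norm (LINT x|lborel. exp (\<i> * complex_of_real (w \<bullet> x)) * f x) \<le> (1 + real ?d) ^ Suc L * I / (1 + 1 * norm w) ^ L"
      by (rule fourier_integral_decay[OF K(2) _ I I0]) auto
    also have "\<dots> \<le> ((1 + real ?d) ^ Suc L * I + 1) / (1 + 1 * norm w) ^ L"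
      by (intro divide_right_mono) auto
    finally show ?thesis by simp
  qed
  moreover have "0 < (1 + real ?d) ^ Suc L * I + 1" using I0 by (intro add_nonneg_pos mult_nonneg_nonneg) auto
  ultimately show ?thesis by blast
qed

lemma continuous_fourier_integral:
  fixes a :: "'a::euclidean_space \<Rightarrow> complex"
  assumes "integrable lborel a"
  shows "continuous_on UNIV (\<lambda>w. LINT \<xi>|lborel. exp (\<i> * complex_of_real (w \<bullet> \<xi>)) * a \<xi>)"
proof -
  have [measurable]: "a \<in> borel_measurable borel" using borel_measurable_integrable[OF assms] by simp
  have "isCont (\<lambda>w. LINT \<xi>|lborel. exp (\<i> * complex_of_real (w \<bullet> \<xi>)) * a \<xi>) w" for w
    unfolding continuous_at_sequentially o_def
  proof (intro allI impI)
    fix X :: "nat \<Rightarrow> 'a" assume X: "X \<longlonglongrightarrow> w"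
    show "(\<lambda>n. LINT \<xi>|lborel. exp (\<i> * complex_of_real (X n \<bullet> \<xi>)) * a \<xi>) \<longlonglongrightarrow> (LINT \<xi>|lborel. exp (\<i> * complex_of_real (w \<bullet> \<xi>)) * a \<xi>)"
      by (rule integral_dominated_convergence[where w="\<lambda>\<xi>. norm (a \<xi>)"])
         (use assms X in \<open>auto intro!: AE_I2 tendsto_intros simp: norm_mult\<close>)
  qed
  then show ?thesis by (simp add: continuous_on_eq_continuous_at)
qed

lemma continuous_inv_fourier: "integrable lborel a \<Longrightarrow> continuous_on UNIV (inv_fourier a)"
  unfolding inv_fourier_def by (intro continuous_intros continuous_fourier_integral)

lemma fourier_eq: "fourier f \<xi> = (LINT x|lborel. exp (\<i> * complex_of_real ((- \<xi>) \<bullet> x)) * f x)"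
  by (simp add: fourier_def)

lemma continuous_fourier: "integrable lborel f \<Longrightarrow> continuous_on UNIV (fourier f)"
  unfolding fourier_eq[abs_def]
  by (rule continuous_on_compose2[OF continuous_fourier_integral]) (auto intro!: continuous_intros)

lemma fourier_decay:
  assumes "f \<in> schwartz"
  shows "\<exists>K>0. \<forall>\<xi>. norm (fourier f \<xi>) \<le> K / (1 + norm \<xi>) ^ L"
proof -
  obtain K where K: "K > 0" "\<And>w. norm (LINT x|lborel. exp (\<i> * complex_of_real (w \<bullet> x)) * f x) \<le> K / (1 + norm w) ^ L"
    using schwartz_fourier_integral_decay[OF assms] by blast
  have "norm (fourier f \<xi>) \<le> K / (1 + norm \<xi>) ^ L" for \<xi>
    unfolding fourier_eq using K(2)[of "- \<xi>"] by (simp only: norm_minus_cancel)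
  with K(1) show ?thesis by blast
qed

lemma inv_fourier_decay:
  assumes "f \<in> schwartz"
  shows "\<exists>K>0. \<forall>x. norm (inv_fourier f x) \<le> K / (1 + norm x) ^ L"
proof -
  obtain K where K: "K > 0" "\<And>w. norm (LINT x|lborel. exp (\<i> * complex_of_real (w \<bullet> x)) * f x) \<le> K / (1 + norm w) ^ L"
    using schwartz_fourier_integral_decay[OF assms] by blast
  let ?c = "1 / (2 * pi) ^ CARD('a)"
  have "norm (inv_fourier f x) \<le> ?c * K / (1 + norm x) ^ L" for x
    unfolding inv_fourier_def norm_mult norm_of_real
    using mult_left_mono[OF K(2)[of x], of ?c] by simp
  then show ?thesis using K(1) by (intro exI[of _ "?c * K"]) auto
qed

lemma integrable_inv_fourier:
  assumes "f \<in> schwartz"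
  shows "integrable lborel (inv_fourier f)"
proof -
  let ?m = "DIM(real ^ 'a) + 2"
  obtain K where K: "K > 0" "\<And>x. norm (inv_fourier f x) \<le> K / (1 + norm x) ^ ?m"
    using inv_fourier_decay[OF assms] by blast
  have "(1 + norm x) ^ ?m * norm (inv_fourier f x) \<le> K" for x
  proof -
    have "0 < (1 + norm x) ^ ?m" by (intro zero_less_power add_pos_nonneg) auto
    then show ?thesis using K(2)[of x] by (simp add: pos_le_divide_eq mult.commute)
  qed
  then show ?thesis
    by (intro integrable_poly_decay borel_measurable_continuous_onI continuous_inv_fourier schwartz_integrable assms)
qed

text \<open>For a convolution one factor is merely bounded, so there is no majorant of product form
  as in \<open>Fubini_prod_bound\<close>; integrability in \<open>x\<close> comes from the
  kernel.\<close>

lemma Fubini_convolution: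
  fixes H :: "'a::euclidean_space \<Rightarrow> 'a \<Rightarrow> complex" and A k :: "'a \<Rightarrow> complex"
  assumes m: "(\<lambda>(x, y). H x y) \<in> borel_measurable (lborel \<Otimes>\<^sub>M lborel)"
    and H: "\<And>x y. norm (H x y) \<le> norm (k (y - x)) * norm (A y)"
    and A: "integrable lborel A" and k: "integrable lborel k"
  shows "(LINT y|lborel. LINT x|lborel. H x y) = (LINT x|lborel. LINT y|lborel. H x y)"
    and "integrable (lborel \<Otimes>\<^sub>M lborel) (\<lambda>(x, y). H x y)"
proof -
  have [measurable]: "A \<in> borel_measurable lborel" "k \<in> borel_measurable borel" using A k by auto
  show int: "integrable (lborel \<Otimes>\<^sub>M lborel) (\<lambda>(x, y). H x y)"
  proof (rule integrableI_bounded[OF m])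
    have "(\<integral>\<^sup>+p. ennreal (norm (case p of (x, y) \<Rightarrow> H x y)) \<partial>(lborel \<Otimes>\<^sub>M lborel)) \<le>
        (\<integral>\<^sup>+p. ennreal (norm (k (snd p - fst p))) * ennreal (norm (A (snd p))) \<partial>(lborel \<Otimes>\<^sub>M lborel))"
      using H by (intro nn_integral_mono) (auto simp: ennreal_mult[symmetric] intro!: ennreal_leI)
    also have "\<dots> = (\<integral>\<^sup>+y. (\<integral>\<^sup>+x. ennreal (norm (k (y - x))) * ennreal (norm (A y)) \<partial>lborel) \<partial>lborel)"
      by (subst lborel_pair.nn_integral_snd[symmetric]) auto
    also have "\<dots> = (\<integral>\<^sup>+y. (\<integral>\<^sup>+x. ennreal (norm (k x)) \<partial>lborel) * ennreal (norm (A y)) \<partial>lborel)"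
      using nn_integral_reflect[of "\<lambda>x. ennreal (norm (k x))"]
      by (intro nn_integral_cong) (subst nn_integral_multc, auto)
    also have "\<dots> = (\<integral>\<^sup>+x. ennreal (norm (k x)) \<partial>lborel) * (\<integral>\<^sup>+y. ennreal (norm (A y)) \<partial>lborel)"
      by (intro nn_integral_cmult) auto
    also have "\<dots> < \<infinity>"
      using A k by (auto simp: integrable_iff_bounded ennreal_mult_less_top)
    finally show "(\<integral>\<^sup>+p. ennreal (norm (case p of (x, y) \<Rightarrow> H x y)) \<partial>(lborel \<Otimes>\<^sub>M lborel)) < \<infinity>" .
  qed
  show "(LINT y|lborel. LINT x|lborel. H x y) = (LINT x|lborel. LINT y|lborel. H x y)"
    using lborel_pair.Fubini_integral[OF int] .
qed

definition convolve :: "('a::euclidean_space \<Rightarrow> complex) \<Rightarrow> ('a \<Rightarrow> complex) \<Rightarrow> 'a \<Rightarrow> complex" where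
  "convolve k u y = (LINT x|lborel. k (y - x) * u x)"

lemma convolve_bound:
  assumes "integrable lborel k" "\<And>x. norm (u x) \<le> M"
  shows "norm (convolve k u y) \<le> M * (LINT x|lborel. norm (k x))"
proof -
  have M: "0 \<le> M" using assms(2) norm_ge_zero order_trans by blast
  have [measurable]: "k \<in> borel_measurable borel" using assms(1) borel_measurable_integrable by fastforce
  have int: "integrable lborel (\<lambda>x. norm (k (y - x)) * M)"
    using integrable_reflect[OF assms(1)] by auto
  have "(LINT x|lborel. norm (k (y - x)) * M) = M * (LINT x|lborel. norm (k x))"
    using integral_reflect[of "\<lambda>x. norm (k x)" y] by simp
  with int M have "(\<integral>\<^sup>+x. ennreal (norm (k (y - x)) * M) \<partial>lborel) \<le> ennreal (M * (LINT x|lborel. norm (k x)))"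
    by (subst nn_integral_eq_integral) auto
  then show ?thesis
    unfolding convolve_def using assms(2) M
    by (intro norm_integral_bound) (auto simp: norm_mult intro!: mult_left_mono mult_nonneg_nonneg Bochner_Integration.integral_nonneg)
qed

section \<open>Functions representing a distribution\<close>

lemma convolve_measurable:
  assumes [measurable]: "k \<in> borel_measurable borel" "u \<in> borel_measurable borel"
  shows "convolve k u \<in> borel_measurable borel"
proof -
  have "(\<lambda>y. LINT x|lborel. k (y - x) * u x) \<in> borel_measurable lborel"
    by (rule lborel.borel_measurable_lebesgue_integral) measurable
  then show ?thesis by (simp add: convolve_def[abs_def])
qed

text \<open>A multiplier acts on a distribution through its test functions; on that side it is the
  transpose of convolution with \<open>inv_fourier \<eta>\<close>, which explains the argument
  \<open>y - x\<close>.\<close>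

lemma fourier_inv_fourier_mult:
  assumes \<eta>: "\<eta> \<in> schwartz" and \<phi>: "\<phi> \<in> schwartz"
  shows "fourier (\<lambda>\<xi>. \<eta> \<xi> * inv_fourier \<phi> \<xi>) x = (LINT y|lborel. inv_fourier \<eta> (y - x) * \<phi> y)"
proof -
  note [measurable] = schwartz_measurable[OF \<eta>] schwartz_measurable[OF \<phi>]
  define c where "c = complex_of_real (1 / (2 * pi) ^ CARD('a))"
  let ?c = c
  let ?H = "\<lambda>y \<xi>. exp (- \<i> * complex_of_real (x \<bullet> \<xi>)) * (\<eta> \<xi> * (?c * (exp (\<i> * complex_of_real (\<xi> \<bullet> y)) * \<phi> y)))"
  have "fourier (\<lambda>\<xi>. \<eta> \<xi> * inv_fourier \<phi> \<xi>) x = (LINT \<xi>|lborel. LINT y|lborel. ?H y \<xi>)"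
    unfolding fourier_def inv_fourier_def by (simp only: integral_mult_right_zero c_def)
  also have "\<dots> = (LINT y|lborel. LINT \<xi>|lborel. ?H y \<xi>)"
    by (rule Fubini_prod_bound(1)[where A="\<lambda>y. norm (\<phi> y)" and B="\<lambda>\<xi>. norm (?c * \<eta> \<xi>)"])
       (use integrable_norm[OF schwartz_integrable[OF \<phi>]] integrable_norm[OF integrable_mult_right[OF schwartz_integrable[OF \<eta>], of ?c]]
         in \<open>auto simp: norm_mult\<close>)
  also have "\<dots> = (LINT y|lborel. inv_fourier \<eta> (y - x) * \<phi> y)"
  proof (intro Bochner_Integration.integral_cong refl)
    fix y :: "real ^ 'a"
    have "?H y \<xi> = ?c * (exp (\<i> * complex_of_real ((y - x) \<bullet> \<xi>)) * \<eta> \<xi>) * \<phi> y" for \<xi>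
    proof -
      have "exp (- \<i> * complex_of_real (x \<bullet> \<xi>)) * exp (\<i> * complex_of_real (\<xi> \<bullet> y)) = exp (\<i> * complex_of_real ((y - x) \<bullet> \<xi>))"
        by (simp add: exp_add[symmetric] inner_diff_left inner_commute algebra_simps)
      then show ?thesis by (simp only: mult_ac)
    qed
    then show "(LINT \<xi>|lborel. ?H y \<xi>) = inv_fourier \<eta> (y - x) * \<phi> y"
      unfolding inv_fourier_def by (simp only: integral_mult_right_zero integral_mult_left_zero c_def)
  qed
  finally show ?thesis .
qed

text \<open>Stated for bounded \<open>u\<close> because this is what is known of sigma(X,D) f. The
  interchange of integrals rests on the integrability of the kernel and of the test
  function.\<close>

lemma represents_fourier_multiplier:
  assumes \<eta>: "\<eta> \<in> schwartz" and um: "u \<in> borel_measurable borel" and u: "\<And>x. norm (u x) \<le> M"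
  shows "represents (convolve (inv_fourier \<eta>) u) (fourier_multiplier \<eta> (dist_of u))"
  unfolding represents_def
proof (intro conjI ballI)
  note ik = integrable_inv_fourier[OF \<eta>]
  have [measurable]: "inv_fourier \<eta> \<in> borel_measurable borel" "u \<in> borel_measurable borel"
    using borel_measurable_integrable[OF ik] um by auto
  have cm[measurable]: "convolve (inv_fourier \<eta>) u \<in> borel_measurable borel" by (rule convolve_measurable) auto
  then show "convolve (inv_fourier \<eta>) u \<in> borel_measurable lborel" by simp
  fix \<phi> :: "real ^ 'a \<Rightarrow> complex" assume \<phi>: "\<phi> \<in> schwartz"
  note [measurable] = schwartz_measurable[OF \<phi>]
  have M: "0 \<le> M" using u norm_ge_zero order_trans by blast
  show "integrable lborel (\<lambda>x. convolve (inv_fourier \<eta>) u x * \<phi> x)"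
  proof (rule Bochner_Integration.integrable_bound)
    let ?I = "M * (LINT x|lborel. norm (inv_fourier \<eta> x))"
    show "integrable lborel (\<lambda>x. ?I * norm (\<phi> x))"
      using schwartz_integrable[OF \<phi>] by auto
    have "norm (convolve (inv_fourier \<eta>) u x * \<phi> x) \<le> ?I * norm (\<phi> x)" for x
      unfolding norm_mult by (intro mult_right_mono convolve_bound[OF ik u]) auto
    then show "AE x in lborel. norm (convolve (inv_fourier \<eta>) u x * \<phi> x) \<le> norm (?I * norm (\<phi> x))"
      using M by (intro AE_I2) (simp add: abs_mult)
  qed simp
  let ?H = "\<lambda>x y. u x * (inv_fourier \<eta> (y - x) * \<phi> y)"
  have "fourier_multiplier \<eta> (dist_of u) \<phi> = (LINT x|lborel. u x * fourier (\<lambda>\<xi>. \<eta> \<xi> * inv_fourier \<phi> \<xi>) x)"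
    by (simp add: fourier_multiplier_def dist_inv_fourier_def dist_mult_def dist_fourier_def dist_of_def)
  also have "\<dots> = (LINT x|lborel. LINT y|lborel. ?H x y)"
    by (simp only: fourier_inv_fourier_mult[OF \<eta> \<phi>] integral_mult_right_zero)
  also have "\<dots> = (LINT y|lborel. LINT x|lborel. ?H x y)"
  proof (rule Fubini_convolution(1)[symmetric, where k="inv_fourier \<eta>" and A="\<lambda>y. M * \<phi> y"])
    show "norm (?H x y) \<le> norm (inv_fourier \<eta> (y - x)) * norm (M * \<phi> y)" for x y
      using mult_right_mono[OF u[of x], of "norm (inv_fourier \<eta> (y - x)) * norm (\<phi> y)"] M
      by (simp add: norm_mult mult_ac)
  qed (use ik schwartz_integrable[OF \<phi>] in auto)
  also have "\<dots> = (LINT y|lborel. convolve (inv_fourier \<eta>) u y * \<phi> y)"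
  proof (intro Bochner_Integration.integral_cong refl)
    fix y
    have "(LINT x|lborel. ?H x y) = (LINT x|lborel. (inv_fourier \<eta> (y - x) * u x) * \<phi> y)"
      by (simp add: mult_ac)
    then show "(LINT x|lborel. ?H x y) = convolve (inv_fourier \<eta>) u y * \<phi> y"
      by (simp only: convolve_def integral_mult_left_zero)
  qed
  finally show "fourier_multiplier \<eta> (dist_of u) \<phi> = (LINT y|lborel. convolve (inv_fourier \<eta>) u y * \<phi> y)" .
qed

section \<open>Uniqueness of the representing function\<close>

text \<open>Polynomial multiples of \<open>exp (- t |x - y|\<^sup>2 - |x|\<^sup>2)\<close>; closed under partial derivatives, hence Schwartz.\<close>
inductive_set gaussians :: "real \<Rightarrow> real ^ 'n \<Rightarrow> (real ^ 'n::finite \<Rightarrow> complex) set" for t y where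
  base: "(\<lambda>x. exp (complex_of_real (- (t * ((x - y) \<bullet> (x - y)) + x \<bullet> x)))) \<in> gaussians t y"
| add: "f \<in> gaussians t y \<Longrightarrow> g \<in> gaussians t y \<Longrightarrow> (\<lambda>x. f x + g x) \<in> gaussians t y"
| cmul: "f \<in> gaussians t y \<Longrightarrow> (\<lambda>x. c * f x) \<in> gaussians t y"
| coord: "f \<in> gaussians t y \<Longrightarrow> (\<lambda>x. complex_of_real (x \<bullet> v) * f x) \<in> gaussians t y"

lemma gaussians_derivative:
  assumes "f \<in> gaussians t y"
  shows "(\<forall>x. f differentiable (at x)) \<and> partial_deriv w f \<in> gaussians t y"
  using assms
proof induction
  case base
  let ?f = "\<lambda>x. exp (complex_of_real (- (t * ((x - y) \<bullet> (x - y)) + x \<bullet> x)))"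
  have d: "(?f has_derivative (\<lambda>h. complex_of_real (- (t * (2 * (h \<bullet> (x - y))) + 2 * (h \<bullet> x))) * ?f x)) (at x)" for x
  proof -
    have "((\<lambda>x. - (t * ((x - y) \<bullet> (x - y)) + x \<bullet> x)) has_derivative
        (\<lambda>h. - (t * (2 * (h \<bullet> (x - y))) + 2 * (h \<bullet> x)))) (at x)"
      by (auto intro!: derivative_eq_intros simp: inner_commute algebra_simps)
    from has_derivative_compose[OF has_derivative_of_real[OF this] DERIV_exp[unfolded has_field_derivative_def]]
    show ?thesis by (simp only: mult.commute)
  qed
  have "partial_deriv w ?f = (\<lambda>x. (\<lambda>x. (- complex_of_real (2 * t) - 2) * (complex_of_real (x \<bullet> w) * ?f x)) x
      + (\<lambda>x. complex_of_real (2 * t * (w \<bullet> y)) * ?f x) x)"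
    unfolding partial_deriv_def frechet_derivative_at[OF d, symmetric]
    by (rule ext) (simp add: inner_diff_right inner_commute algebra_simps)
  then have "partial_deriv w ?f \<in> gaussians t y"
    by (simp only:) (intro gaussians.intros)
  with d show ?case unfolding differentiable_def by blast
next
  case (add f g)
  have "partial_deriv w (\<lambda>x. f x + g x) = (\<lambda>x. partial_deriv w f x + partial_deriv w g x)"
    by (intro partial_deriv_eq dirderiv_add dirderiv_frechet) (use add in \<open>auto intro: differentiable_add\<close>)
  then show ?case using add by (auto intro: gaussians.intros differentiable_add)
next
  case (cmul f c)
  have "partial_deriv w (\<lambda>x. c * f x) = (\<lambda>x. c * partial_deriv w f x)"
    by (intro partial_deriv_eq dirderiv_cmult dirderiv_frechet) (use cmul in \<open>auto intro: differentiable_mult\<close>)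
  then show ?case using cmul by (auto intro: gaussians.intros differentiable_mult)
next
  case (coord f v)
  have lin: "bounded_linear (\<lambda>x. complex_of_real (x \<bullet> v))"
    by (intro bounded_linear_compose[OF bounded_linear_of_real] bounded_linear_inner_left)
  have d: "(\<lambda>x. complex_of_real (x \<bullet> v) * f x) differentiable (at x)" for x
    using coord bounded_linear_imp_differentiable[OF lin] by (intro differentiable_mult) auto
  have "partial_deriv w (\<lambda>x. complex_of_real (x \<bullet> v) * f x) =
      (\<lambda>x. complex_of_real (w \<bullet> v) * f x + complex_of_real (x \<bullet> v) * partial_deriv w f x)"
    using dirderiv_of_linear[OF lin, of w 0] coord
    by (intro partial_deriv_eq[OF d] dirderiv_mult dirderiv_frechet) auto
  then show ?case using coord d by (auto intro: gaussians.intros)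
qed

lemma gaussians_decay:
  assumes "f \<in> gaussians t y" "0 \<le> t"
  shows "\<exists>K. \<forall>x. (1 + norm x) ^ m * norm (f x) \<le> K"
  using assms
proof (induction arbitrary: m)
  case base
  obtain K :: real where K: "\<And>s. s \<ge> 0 \<Longrightarrow> (1 + s) ^ m * exp (- (1 * s\<^sup>2)) \<le> K"
    using power_exp_bound[of 1 m] by auto
  have "(1 + norm x) ^ m * norm (exp (complex_of_real (- (t * ((x - y) \<bullet> (x - y)) + x \<bullet> x)))) \<le> K" for x
  proof -
    have "norm (exp (complex_of_real (- (t * ((x - y) \<bullet> (x - y)) + x \<bullet> x)))) \<le> exp (- (1 * (norm x)\<^sup>2))"
      using base by (simp add: norm_exp_eq_Re power2_norm_eq_inner)
    then show ?thesis
      using K[of "norm x"] mult_left_mono[of _ _ "(1 + norm x) ^ m"] by (smt (verit) norm_ge_zero zero_le_power)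
  qed
  then show ?case by blast
next
  case (add f g)
  obtain K L where "\<And>x. (1 + norm x) ^ m * norm (f x) \<le> K" "\<And>x. (1 + norm x) ^ m * norm (g x) \<le> L"
    using add by metis
  then have "(1 + norm x) ^ m * norm (f x + g x) \<le> K + L" for x
    using mult_left_mono[OF norm_triangle_ineq[of "f x" "g x"], of "(1 + norm x) ^ m"]
    by (smt (verit, best) distrib_left norm_ge_zero zero_le_power)
  then show ?case by blast
next
  case (cmul f c)
  obtain K where "\<And>x. (1 + norm x) ^ m * norm (f x) \<le> K" using cmul by metis
  then have "norm c * ((1 + norm x) ^ m * norm (f x)) \<le> norm c * K" for x
    by (intro mult_left_mono) auto
  then have "(1 + norm x) ^ m * norm (c * f x) \<le> norm c * K" for x by (simp add: norm_mult mult_ac)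
  then show ?case by blast
next
  case (coord f v)
  obtain K where K: "\<And>x. (1 + norm x) ^ Suc m * norm (f x) \<le> K" using coord by metis
  have "(1 + norm x) ^ m * norm (complex_of_real (x \<bullet> v) * f x) \<le> norm v * K" for x
  proof -
    have "\<bar>x \<bullet> v\<bar> \<le> norm x * norm v" by (rule Cauchy_Schwarz_ineq2)
    also have "\<dots> \<le> norm v * (1 + norm x)" by (simp add: algebra_simps)
    finally have "(1 + norm x) ^ m * (\<bar>x \<bullet> v\<bar> * norm (f x)) \<le> (1 + norm x) ^ m * ((norm v * (1 + norm x)) * norm (f x))"
      by (intro mult_left_mono mult_right_mono) auto
    also have "\<dots> = norm v * ((1 + norm x) ^ Suc m * norm (f x))" by simp
    also have "\<dots> \<le> norm v * K" by (intro mult_left_mono K) auto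
    finally show ?thesis by (simp add: norm_mult)
  qed
  then show ?case by blast
qed

lemma gaussians_schwartz:
  assumes f: "f \<in> gaussians t y" and t: "0 \<le> t"
  shows "f \<in> schwartz"
proof -
  have 1: "foldr partial_deriv vs f \<in> gaussians t y" for vs
    using f gaussians_derivative by (induction vs) auto
  have 2: "(partial_deriv v ^^ b) g \<in> gaussians t y" if "g \<in> gaussians t y" for g v b
    using that gaussians_derivative by (induction b) auto
  have 3: "foldr (\<lambda>j. partial_deriv (e j) ^^ b j) js f \<in> gaussians t y" for e js and b :: "'c \<Rightarrow> nat"
    using f 2 by (induction js) auto
  have 4: "mderiv \<beta> f \<in> gaussians t y" for \<beta>
    unfolding mderiv_def mderiv_dir_def by (rule 3)
  show ?thesis
    unfolding schwartz_def smooth_def jap_def mem_Collect_eq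
    using gaussians_derivative[OF 1] gaussians_decay[OF 4 t] by blast
qed

text \<open>Boxes generate the Borel sets and are stable under intersection, so Dynkin's argument
  carries the vanishing to all Borel sets. Its complement step needs the integral over the whole
  space, obtained as a limit over growing boxes.\<close>

lemma AE_zero_if_box_integrals_zero:
  fixes v :: "'a::euclidean_space \<Rightarrow> complex"
  assumes v: "integrable lborel v" and box: "\<And>a b. (LINT x:box a b|lborel. v x) = 0"
  shows "AE x in lborel. v x = 0"
proof -
  have si: "set_integrable lborel A v" if "A \<in> sets lborel" for A
    using v that by (auto simp: set_integrable_def intro: integrable_mult_indicator)
  have whole: "(LINT x|lborel. v x) = 0"
  proof -
    let ?A = "\<lambda>n::nat. box (- (real n *\<^sub>R One)) (real n *\<^sub>R One) :: 'a set"
    have "(\<lambda>n. LINT x:?A n|lborel. v x) \<longlonglongrightarrow> (LINT x:(\<Union>n. ?A n)|lborel. v x)"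
    proof (rule set_integral_cont_up)
      show "incseq ?A"
        by (intro incseq_SucI subset_box_imp) auto
    qed (use si in auto)
    then have "(\<lambda>n. 0) \<longlonglongrightarrow> (LINT x:UNIV|lborel. v x)" by (simp only: box UN_box_eq_UNIV)
    from LIMSEQ_unique[OF tendsto_const this] show ?thesis by (simp add: set_lebesgue_integral_def)
  qed
  have all: "(LINT x:A|lborel. v x) = 0" if "A \<in> sets lborel" for A
  proof -
    let ?E = "range (\<lambda>(a, b). box a b :: 'a set)"
    have A: "A \<in> sigma_sets UNIV ?E" using that by (simp add: borel_eq_box)
    have sets: "B \<in> sets lborel" if "B \<in> sigma_sets UNIV ?E" for B using that by (simp add: borel_eq_box)
    have "Int_stable ?E" by (auto simp: Int_stable_def box_Int_box)
    moreover have "?E \<subseteq> Pow UNIV" by simp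
    ultimately show ?thesis using A
    proof (induction rule: sigma_sets_induct_disjoint)
      case (compl B)
      have "(LINT x:UNIV|lborel. v x) = (LINT x:(UNIV - B)|lborel. v x) + (LINT x:B|lborel. v x)"
      proof -
        have d: "(UNIV - B) \<inter> B = {}" "(UNIV - B) \<union> B = UNIV" by auto
        have B: "B \<in> sets lborel" using sets[OF compl(1)] .
        then have "UNIV - B \<in> sets lborel" by simp
        from set_integral_Un[OF d(1) si[OF this] si[OF B]] show ?thesis unfolding d(2) .
      qed
      with whole compl show ?case by (simp add: set_lebesgue_integral_def)
    next
      case (union B)
      have "(LINT x:(\<Union>i. B i)|lborel. v x) = (\<Sum>i. LINT x:(B i)|lborel. v x)"
      proof (rule lebesgue_integral_countable_add)
        show B: "B i \<in> sets lborel" for i using union(2) sets by blast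
        then show "set_integrable lborel (\<Union>i. B i) v" by (intro si) auto
      qed (use union(1) in \<open>auto simp: disjoint_family_on_def\<close>)
      then show ?case using union by simp
    qed (use box in \<open>auto simp: set_lebesgue_integral_def\<close>)
  qed
  have re: "AE x in lborel. Re (v x) = 0"
  proof (rule density_unique_real[of lborel "\<lambda>x. Re (v x)" "\<lambda>_. 0"])
    fix A :: "'a set" assume A: "A \<in> sets lborel"
    have "(LINT x:A|lborel. Re (v x)) = Re (LINT x:A|lborel. v x)"
      unfolding set_lebesgue_integral_def using si[OF A] by (subst integral_Re[symmetric]) (auto simp: set_integrable_def)
    then show "(LINT x:A|lborel. Re (v x)) = (LINT x:A|lborel. 0)" using all[OF A] by simp
  qed (use v in auto)
  have im: "AE x in lborel. Im (v x) = 0"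
  proof (rule density_unique_real[of lborel "\<lambda>x. Im (v x)" "\<lambda>_. 0"])
    fix A :: "'a set" assume A: "A \<in> sets lborel"
    have "(LINT x:A|lborel. Im (v x)) = Im (LINT x:A|lborel. v x)"
      unfolding set_lebesgue_integral_def using si[OF A] by (subst integral_Im[symmetric]) (auto simp: set_integrable_def)
    then show "(LINT x:A|lborel. Im (v x)) = (LINT x:A|lborel. 0)" using all[OF A] by simp
  qed (use v in auto)
  from re im show ?thesis by eventually_elim (simp add: complex_eq_iff)
qed

lemma AE_not_in_box_boundary: "AE x in lborel. x \<notin> cbox a b - box a (b :: 'a::euclidean_space)"
proof (rule AE_not_in)
  have "emeasure lborel (cbox a b - box a b) = emeasure lborel (cbox a b) - emeasure lborel (box a b)"
    by (intro emeasure_Diff) (auto simp: box_subset_cbox emeasure_lborel_box_eq)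
  also have "\<dots> = 0" by (simp add: emeasure_lborel_box_eq emeasure_lborel_cbox_eq)
  finally show "cbox a b - box a b \<in> null_sets lborel" by auto
qed

text \<open>Integrate the hypothesis over centres \<open>y\<close> in the box and exchange the
  integrals: \<open>v\<close> is then tested against Gaussian averages of the indicator of the box.
  As the Gaussians narrow, these converge off the boundary, a null set, to the indicator times the
  total Gaussian mass.\<close>

lemma box_integral_zero_if_gauss:
  fixes v :: "'a::euclidean_space \<Rightarrow> complex"
  assumes v: "integrable lborel v"
    and g: "\<And>n y. (LINT x|lborel. v x * gauss (real (Suc n) *\<^sub>R (y - x))) = 0"
  shows "(LINT x:box a b|lborel. v x) = 0"
proof -
  have [measurable]: "v \<in> borel_measurable borel" using borel_measurable_integrable[OF v] by simp
  let ?P = "LINT x|lborel. gauss (x::'a)"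
  let ?I = "\<lambda>x. indicator (box a b) x :: complex"
  have 0: "(LINT x|lborel. v x * (LINT z|lborel. ?I (x + (1 / real (Suc n)) *\<^sub>R z) * gauss z)) = 0" for n
  proof -
    let ?n = "real (Suc n)"
    have igs: "integrable lborel (\<lambda>x::'a. gauss (?n *\<^sub>R x))"
      using integrable_scale[OF integrable_gauss, of ?n 0] by simp
    have iI: "integrable lborel ?I"
    proof -
      have "integrable lborel (\<lambda>x. complex_of_real (indicator (box a b) x))"
        using emeasure_bounded_finite[OF bounded_box[of a b]] by (intro integrable_of_real integrable_real_indicator) auto
      moreover have "(\<lambda>x. complex_of_real (indicator (box a b) x)) = ?I" by (auto simp: indicator_def)
      ultimately show ?thesis by simp
    qed
    let ?H = "\<lambda>y x. v x * (?I y * gauss (?n *\<^sub>R (y - x)))"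
    have "(LINT x|lborel. LINT y|lborel. ?H y x) = (LINT y|lborel. LINT x|lborel. ?H y x)"
    proof (rule Fubini_prod_bound(1)[where A="\<lambda>y. norm (?I y)" and B="\<lambda>x. norm (v x)"])
      show "norm (?H y x) \<le> norm (?I y) * norm (v x)" for y x
        using mult_left_mono[OF norm_gauss(2)[of "?n *\<^sub>R (y - x)"], of "norm (?I y) * norm (v x)"]
        by (simp add: norm_mult mult_ac del: of_nat_Suc)
    qed (use v iI in auto)
    also have "\<dots> = (LINT y|lborel. ?I y * (LINT x|lborel. v x * gauss (?n *\<^sub>R (y - x))))"
      by (simp only: integral_mult_right_zero[symmetric]) (simp only: mult_ac)
    also have "\<dots> = 0" by (simp only: g) simp
    finally have "(LINT x|lborel. LINT y|lborel. ?H y x) = 0" .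
    moreover have "(LINT y|lborel. ?H y x) = of_real ((1 / ?n) ^ DIM('a)) * (v x * (LINT z|lborel. ?I (x + (1 / ?n) *\<^sub>R z) * gauss z))" for x
    proof -
      have "(LINT y|lborel. ?H y x) = of_real ((1 / ?n) ^ DIM('a)) * (LINT z|lborel. ?H (x + (1 / ?n) *\<^sub>R z) x)"
        by (rule integral_scale) auto
      then show ?thesis by (simp only: integral_mult_right_zero) (simp del: of_nat_Suc)
    qed
    ultimately have "(LINT x|lborel. of_real ((1 / ?n) ^ DIM('a)) * (v x * (LINT z|lborel. ?I (x + (1 / ?n) *\<^sub>R z) * gauss z))) = 0"
      by (simp only:)
    then have "of_real ((1 / ?n) ^ DIM('a)) * (LINT x|lborel. v x * (LINT z|lborel. ?I (x + (1 / ?n) *\<^sub>R z) * gauss z)) = 0"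
      by (simp only: integral_mult_right_zero)
    moreover have "(of_real ((1 / ?n) ^ DIM('a)) :: complex) \<noteq> 0" by (simp del: of_nat_Suc)
    ultimately show ?thesis by (simp only: mult_eq_0_iff) auto
  qed
  have lim0: "(\<lambda>n. x + (1 / real (Suc n)) *\<^sub>R z) \<longlonglongrightarrow> x" for x z :: 'a
    using tendsto_add[OF tendsto_const[of x] tendsto_scaleR[OF LIMSEQ_inverse_real_of_nat tendsto_const[of z]]]
    by (simp add: inverse_eq_divide)
  have "(\<lambda>n. LINT x|lborel. v x * (LINT z|lborel. ?I (x + (1 / real (Suc n)) *\<^sub>R z) * gauss z)) \<longlonglongrightarrow>
      (LINT x|lborel. v x * (LINT z|lborel. ?I x * gauss (z::'a)))"
  proof (rule integral_dominated_convergence[where w="\<lambda>x. norm (v x) * (LINT z|lborel. norm (gauss (z::'a)))"])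
    show "integrable lborel (\<lambda>x. norm (v x) * (LINT z|lborel. norm (gauss (z::'a))))" using v by auto
    show "AE x in lborel. (\<lambda>n. v x * (LINT z|lborel. ?I (x + (1 / real (Suc n)) *\<^sub>R z) * gauss z)) \<longlonglongrightarrow> v x * (LINT z|lborel. ?I x * gauss (z::'a))"
      using AE_not_in_box_boundary[of a b]
    proof eventually_elim
      case (elim x)
      have "(\<lambda>n. LINT z|lborel. ?I (x + (1 / real (Suc n)) *\<^sub>R z) * gauss z) \<longlonglongrightarrow> (LINT z|lborel. ?I x * gauss (z::'a))"
      proof (rule integral_dominated_convergence[where w="\<lambda>z. norm (gauss z)"])
        show "AE z in lborel. (\<lambda>n. ?I (x + (1 / real (Suc n)) *\<^sub>R z) * gauss z) \<longlonglongrightarrow> ?I x * gauss z"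
        proof (rule AE_I2)
          fix z
          have "\<forall>\<^sub>F n in sequentially. ?I (x + (1 / real (Suc n)) *\<^sub>R z) = ?I x"
          proof (cases "x \<in> box a b")
            case True
            have "\<forall>\<^sub>F n in sequentially. x + (1 / real (Suc n)) *\<^sub>R z \<in> box a b"
              by (rule topological_tendstoD[OF lim0 open_box True])
            then show ?thesis by eventually_elim (use True in auto)
          next
            case False
            with elim have "x \<in> - cbox a b" by auto
            then have "\<forall>\<^sub>F n in sequentially. x + (1 / real (Suc n)) *\<^sub>R z \<in> - cbox a b"
              by (intro topological_tendstoD[OF lim0]) auto
            then show ?thesis
              by eventually_elim (use False subsetD[OF box_subset_cbox[of a b]] in \<open>auto simp: indicator_def\<close>)
          qed
          then show "(\<lambda>n. ?I (x + (1 / real (Suc n)) *\<^sub>R z) * gauss z) \<longlonglongrightarrow> ?I x * gauss z"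
            by (intro tendsto_mult tendsto_const tendsto_eventually) 
        qed
        show "AE z in lborel. norm (?I (x + (1 / real (Suc n)) *\<^sub>R z) * gauss z) \<le> norm (gauss z)" for n
          by (intro AE_I2) (auto simp: norm_mult indicator_def)
      qed (use integrable_gauss in auto)
      then show ?case by (intro tendsto_mult tendsto_const)
    qed
    show "AE x in lborel. norm (v x * (LINT z|lborel. ?I (x + (1 / real (Suc n)) *\<^sub>R z) * gauss z)) \<le> norm (v x) * (LINT z|lborel. norm (gauss (z::'a)))" for n
    proof (rule AE_I2)
      fix x :: 'a
      have "norm (LINT z|lborel. ?I (x + (1 / real (Suc n)) *\<^sub>R z) * gauss z) \<le> (LINT z|lborel. norm (gauss (z::'a)))"
      proof (rule norm_integral_bound[where B="\<lambda>z. norm (gauss z)"])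
        show "(\<integral>\<^sup>+z. ennreal (norm (gauss (z::'a))) \<partial>lborel) \<le> ennreal (LINT z|lborel. norm (gauss (z::'a)))"
          by (subst nn_integral_eq_integral) (use integrable_gauss in auto)
      qed (auto simp: norm_mult indicator_def)
      then show "norm (v x * (LINT z|lborel. ?I (x + (1 / real (Suc n)) *\<^sub>R z) * gauss z)) \<le> norm (v x) * (LINT z|lborel. norm (gauss (z::'a)))"
        unfolding norm_mult by (intro mult_left_mono) auto
    qed
  qed measurable
  then have "(LINT x|lborel. v x * (LINT z|lborel. ?I x * gauss (z::'a))) = 0"
    using 0 by (simp add: LIMSEQ_const_iff)
  then have "(LINT x|lborel. ?I x * v x) * ?P = 0"
    by (simp only: integral_mult_right_zero integral_mult_left_zero[symmetric]) (simp only: mult_ac)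
  moreover have "?P \<noteq> 0" by (simp add: integral_gauss)
  ultimately have "(LINT x|lborel. ?I x * v x) = 0" by simp
  moreover have "?I x * v x = indicator (box a b) x *\<^sub>R v x" for x by (simp add: indicator_def)
  ultimately show ?thesis by (simp add: set_lebesgue_integral_def)
qed

text \<open>The difference of two representatives annihilates Schwartz functions but need not be
  integrable. Multiplied by exp(-|x|^2) it is, since that factor is itself a Schwartz function, and
  its integrals against narrow Gaussians are again pairings with Schwartz functions.\<close>

lemma represents_unique_AE:
  assumes g: "represents g T" and h: "represents h T"
  shows "AE x in lborel. g x = h x"
proof -
  define u where "u x = g x - h x" for x
  have [measurable]: "g \<in> borel_measurable borel" "h \<in> borel_measurable borel"
    using g h by (auto simp: represents_def)
  have u: "integrable lborel (\<lambda>x. u x * \<phi> x)" "(LINT x|lborel. u x * \<phi> x) = 0" if "\<phi> \<in> schwartz" for \<phi>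
  proof -
    have "integrable lborel (\<lambda>x. g x * \<phi> x)" "integrable lborel (\<lambda>x. h x * \<phi> x)"
      "(LINT x|lborel. g x * \<phi> x) = (LINT x|lborel. h x * \<phi> x)"
      using g h that by (auto simp: represents_def)
    then show "integrable lborel (\<lambda>x. u x * \<phi> x)" "(LINT x|lborel. u x * \<phi> x) = 0"
      by (simp_all add: u_def left_diff_distrib)
  qed
  define v where "v x = u x * exp (complex_of_real (- (x \<bullet> x)))" for x
  have G: "(\<lambda>x. exp (complex_of_real (- (t * ((x - y) \<bullet> (x - y)) + x \<bullet> x)))) \<in> schwartz" if "0 \<le> t" for t and y :: "real ^ 'a"
    by (rule gaussians_schwartz[OF gaussians.base that])
  have iv: "integrable lborel v"
    unfolding v_def using u(1)[OF G[of 0]] by simp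
  have "AE x in lborel. v x = 0"
  proof (rule AE_zero_if_box_integrals_zero[OF iv box_integral_zero_if_gauss[OF iv]])
    fix n and y :: "real ^ 'a"
    let ?t = "(real (Suc n))\<^sup>2 / 2"
    have "v x * gauss (real (Suc n) *\<^sub>R (y - x)) = u x * exp (complex_of_real (- (?t * ((x - y) \<bullet> (x - y)) + x \<bullet> x)))" for x
    proof -
      have "(norm (real (Suc n) *\<^sub>R (y - x)))\<^sup>2 / 2 = ?t * ((x - y) \<bullet> (x - y))"
        by (simp add: power_mult_distrib norm_minus_commute[of y x] power2_norm_eq_inner[symmetric] del: of_nat_Suc)
      then have "gauss (real (Suc n) *\<^sub>R (y - x)) = exp (complex_of_real (- (?t * ((x - y) \<bullet> (x - y)))))"
        by (simp only: gauss_def exp_of_real)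
      then show ?thesis
        unfolding v_def by (simp only: mult.assoc exp_add[symmetric] of_real_add[symmetric] minus_add_distrib add.commute)
    qed
    then show "(LINT x|lborel. v x * gauss (real (Suc n) *\<^sub>R (y - x))) = 0"
      using u(2)[OF G[of ?t y]] by (simp del: of_nat_Suc)
  qed
  then show ?thesis by eventually_elim (simp add: v_def u_def)
qed

section \<open>Lattice sums and symbol estimates\<close>

lemma ivec_diff: "ivec (k - l) = ivec k - ivec l"
  by (simp add: ivec_def vec_eq_iff)



lemma jap_ge_1: "1 \<le> jap x"
  by (simp add: jap_def)

lemma jap_pos: "0 < jap x"
  using jap_ge_1[of x] by linarith

lemma jap_triangle: "jap x \<le> jap (x - y) * jap y"
proof -
  have "norm x \<le> norm (x - y) + norm y" by (metis diff_add_cancel norm_triangle_ineq)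
  moreover have "0 \<le> norm (x - y) * norm y" by simp
  ultimately have "1 + norm x \<le> 1 + norm (x - y) + norm y + norm (x - y) * norm y" by linarith
  then show ?thesis by (simp add: jap_def algebra_simps)
qed

section \<open>Counting lattice points\<close>

lemma lattice_ball:
  assumes "0 \<le> R"
  shows "finite {m :: int ^ 'n::finite. norm (ivec m) \<le> R}"
    and "real (card {m :: int ^ 'n::finite. norm (ivec m) \<le> R}) \<le> (2 * R + 1) ^ CARD('n)"
proof -
  let ?B = "{m :: int ^ 'n. norm (ivec m) \<le> R}" and ?P = "PiE (UNIV :: 'n set) (\<lambda>_. {-\<lfloor>R\<rfloor>..\<lfloor>R\<rfloor>})"
  have sub: "?B \<subseteq> (\<lambda>f. \<chi> j. f j) ` ?P"
  proof
    fix m assume m: "m \<in> ?B"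
    have "\<bar>m $ j\<bar> \<le> \<lfloor>R\<rfloor>" for j
    proof -
      have "real_of_int \<bar>m $ j\<bar> \<le> norm (ivec m)"
        using component_le_norm_cart[of "ivec m" j] by (simp add: ivec_def)
      with m show ?thesis by (simp add: le_floor_iff)
    qed
    then have "(\<lambda>j. m $ j) \<in> ?P" by (auto simp: PiE_def abs_le_iff) (smt (verit))
    then show "m \<in> (\<lambda>f. \<chi> j. f j) ` ?P" by (intro image_eqI[where x="\<lambda>j. m $ j"]) auto
  qed
  have fin: "finite ?P" by (intro finite_PiE) auto
  then show "finite ?B" using sub finite_surj by blast
  have "card ?B \<le> card ?P"
    using sub fin by (meson card_image_le card_mono finite_imageI order_trans)
  also have "card ?P = (card {-\<lfloor>R\<rfloor>..\<lfloor>R\<rfloor>}) ^ CARD('n)" by (simp add: card_PiE)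
  finally have "real (card ?B) \<le> real (card {-\<lfloor>R\<rfloor>..\<lfloor>R\<rfloor>}) ^ CARD('n)"
    using of_nat_mono by fastforce
  also have "\<dots> \<le> (2 * R + 1) ^ CARD('n)"
  proof (rule power_mono)
    have "0 \<le> \<lfloor>R\<rfloor>" using assms by simp
    then have "real (card {-\<lfloor>R\<rfloor>..\<lfloor>R\<rfloor>}) = 2 * real_of_int \<lfloor>R\<rfloor> + 1" by simp
    then show "real (card {-\<lfloor>R\<rfloor>..\<lfloor>R\<rfloor>}) \<le> 2 * R + 1" using of_int_floor_le[of R] by linarith
  qed simp
  finally show "real (card ?B) \<le> (2 * R + 1) ^ CARD('n)" .
qed

lemma lattice_ball_shift:
  assumes "0 \<le> R"
  shows "finite {k :: int ^ 'n::finite. norm (ivec k - ivec l) \<le> R}"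
    and "real (card {k :: int ^ 'n::finite. norm (ivec k - ivec l) \<le> R}) \<le> (2 * R + 1) ^ CARD('n)"
proof -
  have eq: "{k. norm (ivec k - ivec l) \<le> R} = (\<lambda>m. m + l) ` {m. norm (ivec m) \<le> R}"
  proof (intro equalityI subsetI)
    fix k assume "k \<in> {k. norm (ivec k - ivec l) \<le> R}"
    then show "k \<in> (\<lambda>m. m + l) ` {m. norm (ivec m) \<le> R}"
      by (intro image_eqI[where x="k - l"]) (auto simp: ivec_diff)
  next
    fix k assume "k \<in> (\<lambda>m. m + l) ` {m. norm (ivec m) \<le> R}"
    then show "k \<in> {k. norm (ivec k - ivec l) \<le> R}"
      by (auto simp flip: ivec_diff)
  qed
  show "finite {k. norm (ivec k - ivec l) \<le> R}"
    unfolding eq by (intro finite_imageI lattice_ball(1) assms)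
  have "card {k. norm (ivec k - ivec l) \<le> R} = card {m :: int ^ 'n. norm (ivec m) \<le> R}"
    unfolding eq by (rule card_image) simp
  then show "real (card {k. norm (ivec k - ivec l) \<le> R}) \<le> (2 * R + 1) ^ CARD('n)"
    using lattice_ball(2)[OF assms, where 'n='n] by simp
qed

text \<open>The layers are lattice balls with at most (2 (m+1) + 1)^n <= 3^n (m+1)^n points,
  whatever the centre.\<close>

lemma lattice_sum:
  "\<exists>K>0. \<forall>l. (\<integral>\<^sup>+k. ennreal (1 / jap (ivec k - ivec l :: real ^ 'n::finite) ^ (CARD('n) + 2)) \<partial>count_space UNIV) \<le> ennreal K"
proof -
  let ?K = "3 ^ CARD('n) * (\<Sum>m. 1 / real (Suc m) ^ 2)"
  have "(\<integral>\<^sup>+k. ennreal (1 / jap (ivec k - ivec l :: real ^ 'n) ^ (CARD('n) + 2)) \<partial>count_space UNIV) \<le> ennreal ?K" for l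
    unfolding jap_def
  proof (rule nn_integral_decay_layers)
    fix m
    let ?B = "{k :: int ^ 'n. norm (ivec k - ivec l) \<le> real (Suc m)}"
    have "real (card ?B) \<le> (2 * real (Suc m) + 1) ^ CARD('n)" by (rule lattice_ball_shift) simp
    also have "\<dots> \<le> (3 * real (Suc m)) ^ CARD('n)" by (intro power_mono) auto
    finally have "ennreal (real (card ?B)) \<le> ennreal (3 ^ CARD('n) * real (Suc m) ^ CARD('n))"
      by (intro ennreal_leI) (simp add: power_mult_distrib del: of_nat_Suc)
    then show "emeasure (count_space UNIV) {k \<in> space (count_space UNIV). norm (ivec k - ivec l :: real ^ 'n) \<le> real (Suc m)}
       \<le> ennreal (3 ^ CARD('n) * real (Suc m) ^ CARD('n))"
      using lattice_ball_shift(1)[of "real (Suc m)" l]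
      by (simp add: emeasure_count_space_finite ennreal_of_nat_eq_real_of_nat del: of_nat_Suc)
  qed auto
  moreover have "0 < ?K"
    using sums_summable[OF inverse_squares_sums] by (intro mult_pos_pos suminf_pos) auto
  ultimately show ?thesis by blast
qed

section \<open>Symbol estimates at one scale\<close>

text \<open>The S^0 estimates with rho = delta, frozen to one block: a derivative in x costs
  \<open>r\<close>, one in the frequency gains 1/r. Frequency derivatives are controlled in all
  coordinates, for the decay of kernels; the x-derivatives follow the one direction along which
  integration by parts is made.\<close>

fun symbol_bounds :: "nat \<Rightarrow> nat \<Rightarrow> 'a::euclidean_space \<Rightarrow> real \<Rightarrow> ('a \<times> 'a \<Rightarrow> real) \<Rightarrow> ('a \<times> 'a \<Rightarrow> complex) \<Rightarrow> bool" where
  "symbol_bounds 0 L w r B a \<longleftrightarrow> (\<forall>v\<in>Basis. deriv_bounds L (0, v) r B a)"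
| "symbol_bounds (Suc M) L w r B a \<longleftrightarrow> (\<forall>v\<in>Basis. deriv_bounds L (0, v) r B a) \<and>
     (\<exists>a'. dirderiv (w, 0) a a' \<and> symbol_bounds M L w r (\<lambda>x. r * B x) a')"

lemma symbol_bounds_base:
  assumes "symbol_bounds M L w r B a"
  shows "\<And>v. v \<in> Basis \<Longrightarrow> deriv_bounds L (0, v) r B a" "continuous_on UNIV a" "norm (a x) \<le> B x"
proof -
  show d: "\<And>v. v \<in> Basis \<Longrightarrow> deriv_bounds L (0, v) r B a" using assms by (cases M) auto
  obtain v :: 'a where "v \<in> Basis" using nonempty_Basis by blast
  from deriv_bounds_base[OF d[OF this]] show "continuous_on UNIV a" "norm (a x) \<le> B x" .
qed

lemma symbol_bounds_le:
  assumes "symbol_bounds M L w r B a" "N \<le> M"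
  shows "symbol_bounds N L w r B a"
  using assms
proof (induction M arbitrary: N B a)
  case (Suc M)
  then show ?case by (cases N) auto
qed auto

lemma symbol_bounds_mono:
  assumes "symbol_bounds M L w r B a" "\<And>x. B x \<le> B' x" "0 < r"
  shows "symbol_bounds M L w r B' a"
  using assms
proof (induction M arbitrary: B B' a)
  case 0
  then show ?case by (auto intro: deriv_bounds_mono)
next
  case (Suc M)
  then obtain a' where a': "dirderiv (w, 0) a a'" "symbol_bounds M L w r (\<lambda>x. r * B x) a'" by auto
  have "symbol_bounds M L w r (\<lambda>x. r * B' x) a'"
    by (rule Suc.IH[OF a'(2)]) (use Suc.prems in auto)
  with a'(1) Suc.prems show ?case by (auto intro: deriv_bounds_mono)
qed

lemma symbol_bounds_add:
  assumes "symbol_bounds M L w r B a" "symbol_bounds M L w r B' b"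
  shows "symbol_bounds M L w r (\<lambda>x. B x + B' x) (\<lambda>x. a x + b x)"
  using assms
proof (induction M arbitrary: B B' a b)
  case 0
  then show ?case by (auto intro: deriv_bounds_add)
next
  case (Suc M)
  then obtain a' b' where ab: "dirderiv (w, 0) a a'" "symbol_bounds M L w r (\<lambda>x. r * B x) a'"
    "dirderiv (w, 0) b b'" "symbol_bounds M L w r (\<lambda>x. r * B' x) b'" by auto
  have "symbol_bounds M L w r (\<lambda>x. r * (B x + B' x)) (\<lambda>x. a' x + b' x)"
    using Suc.IH[OF ab(2,4)] by (simp add: distrib_left)
  with dirderiv_add[OF ab(1,3)] Suc.prems show ?case by (auto intro: deriv_bounds_add)
qed

text \<open>The factor \<open>m\<close> does not vary in the direction of the x-derivatives, so the
  product rule is felt in the frequency only and costs \<open>2 ^ L\<close> for any number of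
  x-derivatives.\<close>

lemma symbol_bounds_mult:
  assumes "symbol_bounds M L w r B a" "\<And>v. v \<in> Basis \<Longrightarrow> deriv_bounds L (0, v) r W m"
    "dirderiv (w, 0) m (\<lambda>_. 0)" "0 < r"
  shows "symbol_bounds M L w r (\<lambda>x. 2 ^ L * W x * B x) (\<lambda>x. m x * a x)"
  using assms
proof (induction M arbitrary: B a)
  case 0
  then show ?case by (auto intro: deriv_bounds_mult)
next
  case (Suc M)
  then obtain a' where a': "dirderiv (w, 0) a a'" "symbol_bounds M L w r (\<lambda>x. r * B x) a'" by auto
  have "symbol_bounds M L w r (\<lambda>x. r * (2 ^ L * W x * B x)) (\<lambda>x. m x * a' x)"
    using Suc.IH[OF a'(2) Suc.prems(2-4)] by (simp add: algebra_simps)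
  moreover have "dirderiv (w, 0) (\<lambda>x. m x * a x) (\<lambda>x. m x * a' x)"
    using dirderiv_mult[OF Suc.prems(3) a'(1)] by simp
  ultimately show ?case using Suc.prems by (auto intro: deriv_bounds_mult)
qed

lemma dirderiv_snd:
  assumes "dirderiv v f f'"
  shows "dirderiv (w, v) (\<lambda>x. f (snd x)) (\<lambda>x. f' (snd x))"
  using assms by (auto simp: dirderiv_def)

lemma continuous_on_comp_snd: "continuous_on UNIV f \<Longrightarrow> continuous_on UNIV (\<lambda>x. f (snd x))"
  by (erule continuous_on_compose2) (auto intro!: continuous_intros)

lemma continuous_on_comp_Pair: "continuous_on UNIV f \<Longrightarrow> continuous_on UNIV (\<lambda>\<xi>. f (z, \<xi>))"
  by (erule continuous_on_compose2) (auto intro!: continuous_intros)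

lemma deriv_bounds_snd:
  assumes "deriv_bounds N v r B f"
  shows "deriv_bounds N (w, v) r (\<lambda>x. B (snd x)) (\<lambda>x. f (snd x))"
  using assms
proof (induction N arbitrary: B f)
  case 0
  then show ?case by (auto intro: continuous_on_comp_snd)
next
  case (Suc N)
  then obtain f' where "dirderiv v f f'" "deriv_bounds N v r (\<lambda>x. B x / r) f'" by auto
  then have "dirderiv (w, v) (\<lambda>x. f (snd x)) (\<lambda>x. f' (snd x))" "deriv_bounds N (w, v) r (\<lambda>x. B (snd x) / r) (\<lambda>x. f' (snd x))"
    using Suc.IH dirderiv_snd by blast+
  then show ?case using Suc.prems
    by (auto intro: continuous_on_comp_snd)
qed

lemma deriv_bounds_slice:
  assumes "deriv_bounds N (0, v) r B a"
  shows "deriv_bounds N v r (\<lambda>\<xi>. B (z, \<xi>)) (\<lambda>\<xi>. a (z, \<xi>))"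
  using assms
proof (induction N arbitrary: B a)
  case 0
  then show ?case by (auto intro: continuous_on_comp_Pair)
next
  case (Suc N)
  then obtain a' where a': "dirderiv (0, v) a a'" "deriv_bounds N (0, v) r (\<lambda>x. B x / r) a'" by auto
  have "dirderiv v (\<lambda>\<xi>. a (z, \<xi>)) (\<lambda>\<xi>. a' (z, \<xi>))"
    using a'(1) by (auto simp: dirderiv_def dest!: spec[of _ z])
  with Suc.IH[OF a'(2)] Suc.prems show ?case
    by (auto intro: continuous_on_comp_Pair)
qed

text \<open>One integration by parts in \<open>x\<close> replaces the symbol \<open>a\<close> by
  \<open>a + r\<^sup>-\<^sup>1 (i \<langle>\<xi> - c, w\<rangle> a + \<partial>\<^sub>w a)\<close>.\<close>
lemma symbol_bounds_step:
  assumes a: "symbol_bounds (Suc M) L w r (\<lambda>x. K * indicator (cball c (C * r)) (snd x)) a"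
    and r: "0 < r" and w: "w \<in> Basis" and C: "0 \<le> C" and K: "0 \<le> K"
  shows "\<exists>a'. dirderiv (w, 0) a a' \<and> continuous_on UNIV a' \<and> (\<forall>x. norm (a' x) \<le> r * (K * indicator (cball c (C * r)) (snd x))) \<and>
    symbol_bounds M L w r (\<lambda>x. (2 + 2 ^ L * (1 + C)) * K * indicator (cball c (C * r)) (snd x))
      (\<lambda>x. a x + complex_of_real (1 / r) * (\<i> * complex_of_real ((snd x - c) \<bullet> w) * a x + a' x))"
proof -
  let ?B = "\<lambda>x. K * indicator (cball c (C * r)) (snd x)"
  obtain a' where a': "dirderiv (w, 0) a a'" "symbol_bounds M L w r (\<lambda>x. r * ?B x) a'"
    using a by auto
  \<comment> \<open>Centring at \<open>c\<close> makes the factor harmless: it grows linearly in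
    |\<xi> - c| / r, which is at most \<open>C\<close> on the support of the symbol. Its global
    bound \<open>?W\<close> is unbounded and is cut off by the indicator afterwards.\<close>
  define lin where "lin \<xi> = \<i> * complex_of_real (1 / r) * complex_of_real ((\<xi> - c) \<bullet> w)" for \<xi>
  let ?W = "\<lambda>\<xi>. 1 + norm (\<xi> - c) / r"
  have dl: "dirderiv v lin (\<lambda>_. \<i> * complex_of_real (1 / r) * complex_of_real (v \<bullet> w))" for v
    unfolding lin_def
    by (intro dirderiv_cmult dirderiv_of_linear[of "\<lambda>x. complex_of_real (x \<bullet> w)"]
      bounded_linear_compose[OF bounded_linear_of_real] bounded_linear_inner_left)
  have linb: "deriv_bounds L v r ?W lin" if v: "v \<in> Basis" for v
  proof -
    have nl: "norm (lin \<xi>) \<le> ?W \<xi>" for \<xi>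
    proof -
      have "\<bar>(\<xi> - c) \<bullet> w\<bar> \<le> norm (\<xi> - c)" by (rule Basis_le_norm[OF w])
      then have "\<bar>(\<xi> - c) \<bullet> w\<bar> / r \<le> norm (\<xi> - c) / r" using r by (intro divide_right_mono) auto
      then show ?thesis using r by (simp add: lin_def norm_mult norm_divide add_increasing)
    qed
    have cl: "continuous_on UNIV lin" unfolding lin_def by (intro continuous_intros)
    show ?thesis
    proof (cases L)
      case 0
      then show ?thesis using nl cl by simp
    next
      case (Suc L')
      have "norm (\<i> * complex_of_real (1 / r) * complex_of_real (v \<bullet> w)) \<le> ?W \<xi> / r" for \<xi>
      proof -
        have "\<bar>v \<bullet> w\<bar> \<le> 1" using Basis_le_norm[OF w, of v] v by simp
        also have "1 \<le> ?W \<xi>" using r by simp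
        finally show ?thesis using r by (simp add: norm_mult norm_divide divide_right_mono)
      qed
      then have "deriv_bounds L' v r (\<lambda>x. ?W x / r) (\<lambda>_. \<i> * complex_of_real (1 / r) * complex_of_real (v \<bullet> w))"
        using r by (intro deriv_bounds_const) auto
      with nl cl dl Suc show ?thesis by auto
    qed
  qed
  have lz: "dirderiv (w, 0) (\<lambda>x. lin (snd x)) (\<lambda>_. 0)"
    by (simp add: dirderiv_def)
  have aM: "symbol_bounds M L w r ?B a" using symbol_bounds_le[OF a] by simp
  have 1: "symbol_bounds M L w r (\<lambda>x. 2 ^ L * ?W (snd x) * ?B x) (\<lambda>x. lin (snd x) * a x)"
    by (rule symbol_bounds_mult[OF aM deriv_bounds_snd[OF linb] lz r])
  have 2: "symbol_bounds M L w r (\<lambda>x. ?B x) (\<lambda>x. complex_of_real (1 / r) * a' x)"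
  proof -
    have "symbol_bounds N L w r (\<lambda>x. B x / r) (\<lambda>x. complex_of_real (1 / r) * b x)"
      if "symbol_bounds N L w r B b" for N B b
      using that
    proof (induction N arbitrary: B b)
      case 0
      have "deriv_bounds L (0, v) r (\<lambda>x. norm (complex_of_real (1 / r)) * B x) (\<lambda>x. complex_of_real (1 / r) * b x)" if "v \<in> Basis" for v
        using 0 that by (intro deriv_bounds_cmult) auto
      then show ?case using r by (simp add: norm_divide)
    next
      case (Suc N)
      then obtain b' where b': "dirderiv (w, 0) b b'" "symbol_bounds N L w r (\<lambda>x. r * B x) b'" by auto
      have "deriv_bounds L (0, v) r (\<lambda>x. norm (complex_of_real (1 / r)) * B x) (\<lambda>x. complex_of_real (1 / r) * b x)" if "v \<in> Basis" for v
        using Suc.prems that by (intro deriv_bounds_cmult) auto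
      moreover have "symbol_bounds N L w r (\<lambda>x. r * (B x / r)) (\<lambda>x. complex_of_real (1 / r) * b' x)"
        using Suc.IH[OF b'(2)] r by simp
      ultimately show ?case using dirderiv_cmult[OF b'(1), of "complex_of_real (1 / r)"] r
        by (auto simp: norm_divide)
    qed
    from this[OF a'(2)] r show ?thesis by simp
  qed
  have sum: "symbol_bounds M L w r (\<lambda>x. ?B x + (2 ^ L * ?W (snd x) * ?B x + ?B x)) (\<lambda>x. a x + (lin (snd x) * a x + complex_of_real (1 / r) * a' x))"
    by (intro symbol_bounds_add aM 1 2)
  \<comment> \<open>The symbol and its derivative divided by \<open>r\<close> contribute 1 each; the
    linear factor contributes at most 1 + C on the ball, times \<open>2 ^ L\<close> from the product
    rule.\<close>
  have "symbol_bounds M L w r (\<lambda>x. (2 + 2 ^ L * (1 + C)) * K * indicator (cball c (C * r)) (snd x))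
    (\<lambda>x. a x + (lin (snd x) * a x + complex_of_real (1 / r) * a' x))"
  proof (rule symbol_bounds_mono[OF sum _ r])
    fix x :: "'a \<times> 'a"
    have "2 ^ L * ?W (snd x) * ?B x \<le> 2 ^ L * (1 + C) * ?B x"
    proof (cases "snd x \<in> cball c (C * r)")
      case True
      then have "?W (snd x) \<le> 1 + C" using r by (simp add: dist_norm norm_minus_commute pos_divide_le_eq)
      then show ?thesis using K by (intro mult_right_mono mult_left_mono) auto
    qed simp
    then show "?B x + (2 ^ L * ?W (snd x) * ?B x + ?B x) \<le> (2 + 2 ^ L * (1 + C)) * K * indicator (cball c (C * r)) (snd x)"
      by (simp add: algebra_simps)
  qed
  moreover have "(\<lambda>x. a x + (lin (snd x) * a x + complex_of_real (1 / r) * a' x)) =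
      (\<lambda>x. a x + complex_of_real (1 / r) * (\<i> * complex_of_real ((snd x - c) \<bullet> w) * a x + a' x))"
    by (auto simp: lin_def algebra_simps)
  ultimately show ?thesis using a' symbol_bounds_base(2,3)[OF a'(2)] by auto
qed

lemma smooth_partial_deriv: "smooth f \<Longrightarrow> v \<in> Basis \<Longrightarrow> smooth (partial_deriv v f)"
proof -
  assume s: "smooth f" and v: "v \<in> Basis"
  show "smooth (partial_deriv v f)"
    unfolding smooth_def
  proof (intro allI impI)
    fix vs x assume "set vs \<subseteq> (Basis :: 'a set)"
    then have "set (vs @ [v]) \<subseteq> Basis" using v by simp
    then have "foldr partial_deriv (vs @ [v]) f differentiable (at x)" using s unfolding smooth_def by blast
    then show "foldr partial_deriv vs (partial_deriv v f) differentiable (at x)" by simp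
  qed
qed

lemma smooth_differentiable: "smooth f \<Longrightarrow> f differentiable (at x)"
  unfolding smooth_def by (drule spec[of _ "[]"]) simp

lemma smooth_funpow_smooth: "smooth f \<Longrightarrow> v \<in> Basis \<Longrightarrow> smooth ((partial_deriv v ^^ b) f)"
  by (induction b) (auto intro: smooth_partial_deriv)

lemma smooth_commute:
  assumes "smooth f" "v \<in> Basis" "w \<in> Basis"
  shows "partial_deriv w (partial_deriv v f) = partial_deriv v (partial_deriv w f)"
  using assms by (intro partial_deriv_commute smooth_differentiable smooth_partial_deriv)

text \<open>\<open>symbol_class\<close> applies the frequency derivatives first and
  \<open>symbol_bounds\<close> the x-derivatives first; this reconciles the two orders.\<close>

lemma smooth_commute_funpow:
  assumes "smooth f" "v \<in> Basis" "w \<in> Basis"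
  shows "(partial_deriv w ^^ a) ((partial_deriv v ^^ b) f) = (partial_deriv v ^^ b) ((partial_deriv w ^^ a) f)"
proof -
  have 1: "partial_deriv w ((partial_deriv v ^^ b) g) = (partial_deriv v ^^ b) (partial_deriv w g)" if "smooth g" for g b
    using that
  proof (induction b)
    case (Suc b)
    then show ?case using smooth_commute[OF smooth_funpow_smooth[OF Suc.prems assms(2)] assms(2,3)] by simp
  qed simp
  show ?thesis
  proof (induction a)
    case (Suc a)
    then show ?case using 1[OF smooth_funpow_smooth[OF assms(1,3)]] by simp
  qed simp
qed

lemma symbol_bounds_smooth:
  assumes sm: "smooth a" and w: "w \<in> Basis"
    and bd: "\<And>m b v x. m \<le> M \<Longrightarrow> b \<le> L \<Longrightarrow> v \<in> Basis \<Longrightarrow>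
      norm ((partial_deriv (0, v) ^^ b) ((partial_deriv (w, 0) ^^ m) a) x) \<le> B x * r ^ m / r ^ b"
  shows "symbol_bounds M L w r B a"
  using sm bd
proof (induction M arbitrary: a B)
  case 0
  have "deriv_bounds L (0, v) r B a" if v: "v \<in> Basis" for v
    using 0(2)[of 0] v smooth_funpow[OF 0(1)] by (intro deriv_bounds_funpow) (auto simp: Basis_prod_def)
  then show ?case by simp
next
  case (Suc M)
  have wB: "(w, 0) \<in> Basis" using w by (auto simp: Basis_prod_def)
  have "symbol_bounds M L w r (\<lambda>x. r * B x) (partial_deriv (w, 0) a)"
  proof (rule Suc.IH[OF smooth_partial_deriv[OF Suc.prems(1) wB]])
    fix m b v x assume "m \<le> M" "b \<le> L" "v \<in> (Basis :: 'a set)"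
    then show "norm ((partial_deriv (0, v) ^^ b) ((partial_deriv (w, 0) ^^ m) (partial_deriv (w, 0) a)) x) \<le> r * B x * r ^ m / r ^ b"
      using Suc.prems(2)[of "Suc m" b v x] by (simp add: funpow_swap1 mult_ac)
  qed
  moreover have "deriv_bounds L (0, v) r B a" if v: "v \<in> Basis" for v
    using Suc.prems(2)[of 0] v smooth_funpow[OF Suc.prems(1)] by (intro deriv_bounds_funpow) (auto simp: Basis_prod_def)
  moreover have "dirderiv (w, 0) a (partial_deriv (w, 0) a)"
    by (intro dirderiv_frechet smooth_differentiable Suc.prems(1))
  ultimately show ?case by auto
qed

section \<open>Band-limited functions and the Peetre maximal function\<close>

text \<open>The inverse Fourier transform without its constant, on any Euclidean space; symbols and
  cutoffs are inserted as amplitudes.\<close>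

definition osc :: "('a::euclidean_space \<Rightarrow> complex) \<Rightarrow> 'a \<Rightarrow> complex" where
  "osc a w = (LINT \<xi>|lborel. exp (\<i> * complex_of_real (w \<bullet> \<xi>)) * a \<xi>)"

lemma inv_fourier_osc: "inv_fourier a x = complex_of_real (1 / (2 * pi) ^ CARD('n)) * osc a (x :: real ^ 'n::finite)"
  by (simp add: inv_fourier_def osc_def)

text \<open>The radius \<open>R\<close> is kept apart from the scale \<open>r\<close>:
  \<open>\<eta> k\<close> lives on a ball of radius C rad k, but its derivatives will be measured at
  the scale of another block.\<close>

definition bump_bounds :: "nat \<Rightarrow> real \<Rightarrow> real \<Rightarrow> 'a::euclidean_space \<Rightarrow> real \<Rightarrow> ('a \<Rightarrow> complex) \<Rightarrow> bool" where
  "bump_bounds L r B c R a \<longleftrightarrow> (\<forall>v\<in>Basis. deriv_bounds L v r (\<lambda>\<xi>. B * indicator (cball c R) \<xi>) a)"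

lemma bump_bounds_base:
  assumes "bump_bounds L r B c R a"
  shows "continuous_on UNIV a" "norm (a \<xi>) \<le> B * indicator (cball c R) \<xi>" "0 \<le> B \<Longrightarrow> norm (a \<xi>) \<le> B"
proof -
  obtain v :: 'a where "v \<in> Basis" using nonempty_Basis by blast
  then have d: "deriv_bounds L v r (\<lambda>\<xi>. B * indicator (cball c R) \<xi>) a" using assms by (simp add: bump_bounds_def)
  from deriv_bounds_base[OF d] show c: "continuous_on UNIV a" and n: "norm (a \<xi>) \<le> B * indicator (cball c R) \<xi>" .
  show "norm (a \<xi>) \<le> B" if "0 \<le> B" using n that by (cases "\<xi> \<in> cball c R") (simp_all del: mem_cball)
qed

lemma bump_integral:
  assumes "0 \<le> R" "0 \<le> B"
  shows "(\<integral>\<^sup>+\<xi>. ennreal (B * indicator (cball c R) (\<xi>::'a::euclidean_space)) \<partial>lborel) \<le> ennreal (B * (2 * R) ^ DIM('a))"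
proof -
  have "(\<integral>\<^sup>+\<xi>. ennreal (B * indicator (cball c R) \<xi>) \<partial>lborel) = (\<integral>\<^sup>+\<xi>. ennreal B * indicator (cball c R) \<xi> \<partial>lborel)"
    using assms by (intro nn_integral_cong) (auto simp: indicator_def)
  also have "\<dots> = ennreal B * emeasure lborel (cball c R)"
    by (rule nn_integral_cmult_indicator) auto
  also have "\<dots> \<le> ennreal B * ennreal ((2 * R) ^ DIM('a))"
    using assms by (intro mult_left_mono emeasure_cball_le) auto
  finally show ?thesis using assms by (simp add: ennreal_mult)
qed

lemma bump_integrable:
  assumes "bump_bounds L r B c R a" "0 \<le> R" "0 \<le> B"
  shows "integrable lborel a"
  by (rule integrable_bounded_by[OF _ bump_bounds_base(2)[OF assms(1)]])
     (use bump_bounds_base(1)[OF assms(1)] bump_integral[OF assms(2,3), of c] in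
      \<open>auto intro: borel_measurable_continuous_onI le_less_trans\<close>)

lemma osc_decay:
  assumes "bump_bounds L r B c R (a :: 'a::euclidean_space \<Rightarrow> complex)" "0 < r" "0 \<le> R" "0 \<le> B"
  shows "norm (osc a w) \<le> (1 + real DIM('a)) ^ Suc L * (B * (2 * R) ^ DIM('a)) / (1 + r * norm w) ^ L"
  unfolding osc_def
proof -
  have [measurable]: "cball c R \<in> sets borel" by simp
  show "norm (LINT \<xi>|lborel. exp (\<i> * complex_of_real (w \<bullet> \<xi>)) * a \<xi>)
      \<le> (1 + real DIM('a)) ^ Suc L * (B * (2 * R) ^ DIM('a)) / (1 + r * norm w) ^ L"
    by (rule fourier_integral_decay[OF _ assms(2) bump_integral[OF assms(3,4)]])
       (use assms in \<open>auto simp: bump_bounds_def\<close>)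
qed

lemma decay_integrable:
  fixes k :: "'a::euclidean_space \<Rightarrow> complex"
  assumes [measurable]: "k \<in> borel_measurable borel" and k: "\<And>w. norm (k w) \<le> D / (1 + r * norm w) ^ (DIM('a) + 2)" and r: "0 < r"
  shows "integrable lborel k"
proof (rule integrable_bounded_by[OF _ k])
  have D: "0 \<le> D" using order_trans[OF norm_ge_zero k[of 0]] by simp
  obtain K where "\<forall>r>0. (\<integral>\<^sup>+x. ennreal (1 / (1 + r * norm (x::'a)) ^ (DIM('a) + 2)) \<partial>lborel) \<le> ennreal (K / r ^ DIM('a))"
    using nn_integral_decay by blast
  then have K: "(\<integral>\<^sup>+x. ennreal (1 / (1 + r * norm (x::'a)) ^ (DIM('a) + 2)) \<partial>lborel) \<le> ennreal (K / r ^ DIM('a))"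
    using r by blast
  have "(\<integral>\<^sup>+x. ennreal (D / (1 + r * norm (x::'a)) ^ (DIM('a) + 2)) \<partial>lborel) =
      (\<integral>\<^sup>+x. ennreal D * ennreal (1 / (1 + r * norm (x::'a)) ^ (DIM('a) + 2)) \<partial>lborel)"
    using D r by (intro nn_integral_cong) (simp add: ennreal_mult[symmetric])
  also have "\<dots> = ennreal D * (\<integral>\<^sup>+x. ennreal (1 / (1 + r * norm (x::'a)) ^ (DIM('a) + 2)) \<partial>lborel)"
    by (rule nn_integral_cmult) measurable
  also have "\<dots> < \<infinity>" using K by (auto simp: ennreal_mult_less_top intro: le_less_trans)
  finally show "(\<integral>\<^sup>+x. ennreal (D / (1 + r * norm (x::'a)) ^ (DIM('a) + 2)) \<partial>lborel) < \<infinity>" .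
qed simp

lemma osc_measurable:
  assumes "integrable lborel a"
  shows "osc a \<in> borel_measurable borel" "continuous_on UNIV (osc a)"
  using continuous_fourier_integral[OF assms] unfolding osc_def[abs_def]
  by (auto intro: borel_measurable_continuous_onI)

lemma osc_integrable:
  assumes a: "bump_bounds (DIM('a) + 2) r B c R (a :: 'a::euclidean_space \<Rightarrow> complex)" and r: "0 < r" and R: "0 \<le> R" and B: "0 \<le> B"
  shows "integrable lborel (osc a)"
  by (rule decay_integrable[OF osc_measurable(1)[OF bump_integrable[OF a R B]] osc_decay[OF a r R B] r])

text \<open>A product of amplitudes becomes a convolution. Fourier inversion is applied to the
  cutoff \<open>a\<close>, whose transform is integrable, while of \<open>g\<close> only
  integrability is known. With \<open>a\<close> equal to 1 on the support of \<open>g\<close> this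
  reproduces a band-limited function from itself.\<close>

lemma osc_reproducing:
  fixes a g :: "'a::euclidean_space \<Rightarrow> complex"
  assumes a: "bump_bounds (DIM('a) + 2) r B c R a" and r: "0 < r" and R: "0 \<le> R" and B: "0 \<le> B" and g: "integrable lborel g"
  shows "osc (\<lambda>\<xi>. a \<xi> * g \<xi>) z = (LINT y|lborel. osc a (z - y) * (complex_of_real (1 / (2 * pi) ^ DIM('a)) * osc g y))"
proof -
  have [measurable]: "g \<in> borel_measurable borel" "osc a \<in> borel_measurable borel"
    using borel_measurable_integrable[OF g] osc_measurable(1)[OF bump_integrable[OF a R B]] by auto
  have io: "integrable lborel (osc a)" by (rule osc_integrable[OF a r R B])
  define C where "C = complex_of_real (1 / (2 * pi) ^ DIM('a))"
  let ?H = "\<lambda>y \<xi>. osc a (z - y) * (C * (exp (\<i> * complex_of_real (y \<bullet> \<xi>)) * g \<xi>))"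
  have "(LINT y|lborel. osc a (z - y) * (C * osc g y)) = (LINT y|lborel. LINT \<xi>|lborel. ?H y \<xi>)"
    unfolding osc_def[of g] by (simp only: integral_mult_right_zero)
  also have "\<dots> = (LINT \<xi>|lborel. LINT y|lborel. ?H y \<xi>)"
    by (rule Fubini_prod_bound(1)[symmetric, where A="\<lambda>y. norm (osc a (z - y))" and B="\<lambda>\<xi>. norm (C * g \<xi>)"])
       (use integrable_norm[OF integrable_reflect[OF io, of z]] g in \<open>auto simp: norm_mult\<close>)
  also have "\<dots> = (LINT \<xi>|lborel. exp (\<i> * complex_of_real (z \<bullet> \<xi>)) * (a \<xi> * g \<xi>))"
  proof (intro Bochner_Integration.integral_cong refl)
    fix \<xi> :: 'a
    have "(LINT y|lborel. ?H y \<xi>) = (LINT w|lborel. ?H (z - w) \<xi>)"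
      by (rule integral_reflect[symmetric]) measurable
    also have "\<dots> = (LINT w|lborel. (C * exp (\<i> * complex_of_real (z \<bullet> \<xi>)) * g \<xi>) * (exp (- \<i> * complex_of_real (\<xi> \<bullet> w)) * osc a w))"
    proof (intro Bochner_Integration.integral_cong refl)
      fix w
      have "exp (\<i> * complex_of_real ((z - w) \<bullet> \<xi>)) = exp (\<i> * complex_of_real (z \<bullet> \<xi>)) * exp (- \<i> * complex_of_real (\<xi> \<bullet> w))"
        by (simp add: exp_add[symmetric] inner_diff_left inner_commute algebra_simps)
      then show "?H (z - w) \<xi> = (C * exp (\<i> * complex_of_real (z \<bullet> \<xi>)) * g \<xi>) * (exp (- \<i> * complex_of_real (\<xi> \<bullet> w)) * osc a w)"
        by simp
    qed
    also have "\<dots> = (C * exp (\<i> * complex_of_real (z \<bullet> \<xi>)) * g \<xi>) * (complex_of_real ((2 * pi) ^ DIM('a)) * a \<xi>)"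
      unfolding integral_mult_right_zero
      using fourier_integral_inversion[OF bump_bounds_base(1)[OF a] bump_bounds_base(3)[OF a B] bump_integrable[OF a R B] io[unfolded osc_def[abs_def]], of \<xi>]
      by (simp add: osc_def)
    also have "\<dots> = exp (\<i> * complex_of_real (z \<bullet> \<xi>)) * (a \<xi> * g \<xi>)"
      by (simp add: C_def)
    finally show "(LINT y|lborel. ?H y \<xi>) = exp (\<i> * complex_of_real (z \<bullet> \<xi>)) * (a \<xi> * g \<xi>)" .
  qed
  finally show ?thesis by (simp only: osc_def[of "\<lambda>\<xi>. a \<xi> * g \<xi>"] C_def)
qed

section \<open>Peetre weights and the maximal inequality\<close>

lemma weight_triangle:
  assumes "0 < (r::real)"
  shows "1 + r * norm (x - y) \<le> (1 + r * norm (x - z)) * (1 + r * norm (z - y))"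
proof -
  have "norm (x - y) \<le> norm (x - z) + norm (z - y)" by (metis diff_add_cancel add_diff_eq norm_triangle_ineq)
  then have "r * norm (x - y) \<le> r * norm (x - z) + r * norm (z - y)"
    using assms by (metis distrib_left mult_left_mono less_imp_le)
  moreover have "0 \<le> (r * norm (x - z)) * (r * norm (z - y))" using assms by simp
  ultimately show ?thesis by (simp add: algebra_simps)
qed

text \<open>Moving the weight from \<open>y\<close> to \<open>z\<close> costs (1 + r |z - y|)^M,
  which is paid by \<open>M\<close> powers of the decay of the kernel. The remaining d + 2 powers
  are integrable with mass of order r^-d, against the factor r^d in the size of the kernel.\<close>

lemma convolution_weight_bound:
  "\<exists>K>0. \<forall>r>0. \<forall>D\<ge>0. \<forall>F\<ge>0. \<forall>k f x z. (\<forall>w. norm (k w) \<le> D * r ^ DIM('a) / (1 + r * norm w) ^ (M + (DIM('a) + 2))) \<longrightarrow>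
     (\<forall>y. norm (f y) \<le> F * (1 + r * norm (x - y)) ^ M) \<longrightarrow>
     norm (LINT y|lborel. k (z - y) * (f y :: complex)) \<le> K * D * F * (1 + r * norm (x - z :: 'a::euclidean_space)) ^ M"
proof -
  let ?d = "DIM('a)"
  obtain K where K: "K > 0" "\<And>r. r > 0 \<Longrightarrow> (\<integral>\<^sup>+x. ennreal (1 / (1 + r * norm (x::'a)) ^ (?d + 2)) \<partial>lborel) \<le> ennreal (K / r ^ ?d)"
    using nn_integral_decay by blast
  show ?thesis
  proof (intro exI[of _ K] conjI allI impI K(1))
    fix r D F :: real and k f :: "'a \<Rightarrow> complex" and x z :: 'a
    assume r: "r > 0" and D: "D \<ge> 0" and F: "F \<ge> 0"
      and k: "\<forall>w. norm (k w) \<le> D * r ^ ?d / (1 + r * norm w) ^ (M + (?d + 2))"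
      and f: "\<forall>y. norm (f y) \<le> F * (1 + r * norm (x - y)) ^ M"
    let ?E = "D * r ^ ?d * F * (1 + r * norm (x - z)) ^ M"
    have E0: "0 \<le> ?E" using r D F by (intro mult_nonneg_nonneg zero_le_power) auto
    show "norm (LINT y|lborel. k (z - y) * f y) \<le> K * D * F * (1 + r * norm (x - z)) ^ M"
    proof (rule norm_integral_bound)
      fix y
      let ?q = "1 + r * norm (z - y)"
      have q: "0 < ?q" using r by (simp add: add_pos_nonneg)
      have "norm (k (z - y) * f y) \<le> (D * r ^ ?d / ?q ^ (M + (?d + 2))) * (F * (1 + r * norm (x - y)) ^ M)"
        unfolding norm_mult using k f D r q by (intro mult_mono) auto
      also have "\<dots> \<le> (D * r ^ ?d / ?q ^ (M + (?d + 2))) * (F * ((1 + r * norm (x - z)) * ?q) ^ M)"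
        using D r q F weight_triangle[OF r] by (intro mult_left_mono power_mono) auto
      also have "\<dots> = ?E * (1 / ?q ^ (?d + 2))"
      proof -
        have "D * s / q ^ (M + e) * (F * (X * q) ^ M) = D * s * F * X ^ M * (1 / q ^ e)" if "0 < q" for s q X :: real and e
          using that by (simp add: power_mult_distrib power_add field_simps)
        from this[OF q] show ?thesis .
      qed
      finally show "norm (k (z - y) * f y) \<le> ?E * (1 / (1 + r * norm (z - y)) ^ (?d + 2))" .
    next
      have "(\<integral>\<^sup>+y. ennreal (?E * (1 / (1 + r * norm (z - y)) ^ (?d + 2))) \<partial>lborel) =
          (\<integral>\<^sup>+y. ennreal ?E * ennreal (1 / (1 + r * norm (z - y)) ^ (?d + 2)) \<partial>lborel)"
        using E0 r by (intro nn_integral_cong ennreal_mult) auto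
      also have "\<dots> = ennreal ?E * (\<integral>\<^sup>+y. ennreal (1 / (1 + r * norm (z - y)) ^ (?d + 2)) \<partial>lborel)"
        by (rule nn_integral_cmult) measurable
      also have "(\<integral>\<^sup>+y. ennreal (1 / (1 + r * norm (z - y)) ^ (?d + 2)) \<partial>lborel) = (\<integral>\<^sup>+y. ennreal (1 / (1 + r * norm (y::'a)) ^ (?d + 2)) \<partial>lborel)"
        by (rule nn_integral_reflect[of "\<lambda>y. ennreal (1 / (1 + r * norm y) ^ (?d + 2))"]) measurable
      also have "ennreal ?E * \<dots> \<le> ennreal ?E * ennreal (K / r ^ ?d)"
        by (intro mult_left_mono K(2) r) auto
      also have "\<dots> = ennreal (?E * (K / r ^ ?d))" using E0 K(1) r by (intro ennreal_mult[symmetric]) auto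
      also have "?E * (K / r ^ ?d) = K * D * F * (1 + r * norm (x - z)) ^ M" using r by simp
      finally show "(\<integral>\<^sup>+y. ennreal (?E * (1 / (1 + r * norm (z - y)) ^ (?d + 2))) \<partial>lborel) \<le> ennreal (K * D * F * (1 + r * norm (x - z)) ^ M)" .
    qed (use K(1) D F r in \<open>auto intro!: mult_nonneg_nonneg zero_le_power\<close>)
  qed
qed

text \<open>Above \<epsilon> write t = t^(1-p) t^p. The first factor is at most 1 if p <= 1, as t <=
  1, and at most \<epsilon>^(1-p) if p > 1.\<close>

lemma power_interpolation:
  fixes t p \<epsilon> :: real
  assumes "0 \<le> t" "t \<le> 1" "0 < p" "0 < \<epsilon>"
  shows "t \<le> \<epsilon> + max 1 (\<epsilon> powr (1 - p)) * t powr p"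
proof (cases "t \<le> \<epsilon>")
  case True
  then show ?thesis by (smt (verit) mult_nonneg_nonneg powr_ge_zero)
next
  case False
  then have t: "0 < t" "\<epsilon> < t" using assms by auto
  have "t = t powr (1 - p) * t powr p" using t by (simp add: powr_add[symmetric])
  also have "t powr (1 - p) \<le> max 1 (\<epsilon> powr (1 - p))"
  proof (cases "p \<le> 1")
    case True
    then have "t powr (1 - p) \<le> 1 powr (1 - p)" using t assms by (intro powr_mono2) auto
    then show ?thesis by simp
  next
    case False
    then have "t powr (1 - p) \<le> \<epsilon> powr (1 - p)" using t assms by (intro powr_mono2') auto
    then show ?thesis by simp
  qed
  finally have "t \<le> max 1 (\<epsilon> powr (1 - p)) * t powr p" by (simp add: mult_right_mono)
  with assms show ?thesis by linarith
qed

lemma ennreal_mult_add: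
  assumes "0 \<le> a" "0 \<le> b" "0 \<le> c" "0 \<le> d"
  shows "ennreal (a * b + c * d) = ennreal a * ennreal b + ennreal c * ennreal d"
  using assms by (simp add: ennreal_mult)

text \<open>A Peetre maximal function estimate: \<open>\<psi> \<le> \<epsilon> F + C F\<^sup>1\<^sup>-\<^sup>p \<psi>\<^sup>p\<close> with \<open>F = sup \<psi>\<close>, and the
  first term is absorbed; this covers all \<open>0 < p < \<infinity>\<close> without Hoelder's inequality.\<close>
lemma peetre_maximal:
  fixes p D :: real
  assumes p: "0 < p" and D: "0 < D"
  shows "\<exists>K>0. \<forall>r>0. \<forall>f x. f \<in> borel_measurable borel \<longrightarrow> (\<exists>B. \<forall>y. norm (f y) \<le> B) \<longrightarrow>
     (\<forall>z. ennreal (norm (f z)) \<le> (\<integral>\<^sup>+y. ennreal (D * r ^ DIM('a) / (1 + r * norm (z - y)) ^ (M + (DIM('a) + 2)) * norm (f y)) \<partial>lborel)) \<longrightarrow>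
     (\<exists>F\<ge>0. (\<forall>y. norm (f y) \<le> F * (1 + r * norm (x - y)) ^ M) \<and>
       ennreal (F powr p) \<le> ennreal (K * r ^ DIM('a)) * (\<integral>\<^sup>+y. ennreal ((norm (f y :: complex) / (1 + r * norm (x - y :: 'a::euclidean_space)) ^ M) powr p) \<partial>lborel))"
proof -
  let ?d = "DIM('a)"
  obtain Kd where Kd: "Kd > 0" "\<And>r. r > 0 \<Longrightarrow> (\<integral>\<^sup>+x. ennreal (1 / (1 + r * norm (x::'a)) ^ (?d + 2)) \<partial>lborel) \<le> ennreal (Kd / r ^ ?d)"
    using nn_integral_decay by blast
  \<comment> \<open>Chosen so that D times the kernel mass \<open>Kd\<close> times \<epsilon> is
    1/2: the first term of the interpolation then becomes F/2 and can be absorbed.\<close>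
  define \<epsilon> where "\<epsilon> = 1 / (2 * D * Kd)"
  define Q where "Q = max 1 (\<epsilon> powr (1 - p))"
  have \<epsilon>: "0 < \<epsilon>" and Q: "1 \<le> Q" using D Kd(1) by (auto simp: \<epsilon>_def Q_def)
  show ?thesis
  proof (rule exI[of _ "2 * D * Q"], intro conjI allI impI)
    show "0 < 2 * D * Q" using D Q by simp
    fix r :: real and f :: "'a \<Rightarrow> complex" and x :: 'a
    assume r: "0 < r" and m[measurable]: "f \<in> borel_measurable borel" and bdd: "\<exists>B. \<forall>y. norm (f y) \<le> B"
      and rep: "\<forall>z. ennreal (norm (f z)) \<le> (\<integral>\<^sup>+y. ennreal (D * r ^ ?d / (1 + r * norm (z - y)) ^ (M + (?d + 2)) * norm (f y)) \<partial>lborel)"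
    let ?q = "\<lambda>y. 1 + r * norm (x - y)"
    have q1: "1 \<le> ?q y" for y using r by simp
    have q: "0 < ?q y" for y using q1[of y] by linarith
    define \<psi> where "\<psi> y = norm (f y) / ?q y ^ M" for y
    have \<psi>0: "0 \<le> \<psi> y" for y using q[of y] by (simp add: \<psi>_def)
    have [measurable]: "\<psi> \<in> borel_measurable borel" unfolding \<psi>_def by measurable
    obtain B where B: "\<And>y. norm (f y) \<le> B" using bdd by blast
    have \<psi>B: "\<psi> y \<le> B" for y
    proof -
      have "\<psi> y \<le> norm (f y) / 1"
        unfolding \<psi>_def using q1[of y] by (intro divide_left_mono one_le_power) auto
      with B[of y] show ?thesis by simp
    qed
    have bd: "bdd_above (range \<psi>)" using \<psi>B by (auto intro!: bdd_aboveI[of _ B])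
    \<comment> \<open>Boundedness of \<open>f\<close> makes this supremum finite, without which F/2
      could not be subtracted from F.\<close>
    define F where "F = (SUP y. \<psi> y)"
    have \<psi>F: "\<psi> y \<le> F" for y unfolding F_def by (rule cSUP_upper[OF _ bd]) simp
    have F0: "0 \<le> F" using \<psi>0 \<psi>F order_trans by blast
    define I where "I = (\<integral>\<^sup>+y. ennreal (\<psi> y powr p) \<partial>lborel)"
    have fF: "norm (f y) \<le> F * ?q y ^ M" for y
      using \<psi>F[of y] q[of y] by (simp add: \<psi>_def pos_divide_le_eq)
    have main: "ennreal (F powr p) \<le> ennreal (2 * D * Q * r ^ ?d) * I"
    proof (cases "F = 0 \<or> I = \<infinity>")
      case True
      then show ?thesis using p D Q r by (auto simp: ennreal_mult_top)
    next
      case False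
      then have Fp: "0 < F" and "I \<noteq> \<infinity>" using F0 by auto
      then obtain J where J: "I = ennreal J" "0 \<le> J" by (cases I) auto
      have \<psi>int: "ennreal (\<psi> z) \<le> ennreal (F / 2 + D * r ^ ?d * Q * F powr (1 - p) * J)" for z
      proof -
        let ?s = "\<lambda>y. 1 + r * norm (z - y)"
        have s: "1 \<le> ?s y" for y using r by simp
        have "ennreal (\<psi> z) = ennreal (1 / ?q z ^ M) * ennreal (norm (f z))"
          using q[of z] by (simp add: \<psi>_def ennreal_mult[symmetric])
        also have "\<dots> \<le> ennreal (1 / ?q z ^ M) * (\<integral>\<^sup>+y. ennreal (D * r ^ ?d / ?s y ^ (M + (?d + 2)) * norm (f y)) \<partial>lborel)"
          using rep by (intro mult_left_mono) auto
        also have "\<dots> = (\<integral>\<^sup>+y. ennreal (1 / ?q z ^ M) * ennreal (D * r ^ ?d / ?s y ^ (M + (?d + 2)) * norm (f y)) \<partial>lborel)"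
          by (rule nn_integral_cmult[symmetric]) measurable
        also have "\<dots> \<le> (\<integral>\<^sup>+y. (ennreal (D * r ^ ?d * (\<epsilon> * F)) * ennreal (1 / ?s y ^ (?d + 2)) + ennreal (D * r ^ ?d * (Q * F powr (1 - p))) * ennreal (\<psi> y powr p)) \<partial>lborel)"
        proof (rule nn_integral_mono)
          fix y
          have sp: "0 < ?s y" "0 < ?q z" using s[of y] q[of z] by linarith+
          have "?q y ^ M \<le> (?q z * ?s y) ^ M"
            using weight_triangle[OF r, of x y z] q[of y] by (intro power_mono) auto
          then have "1 / (?q z ^ M * ?s y ^ M) \<le> 1 / ?q y ^ M"
            using q[of y] sp by (intro divide_left_mono) (auto simp: power_mult_distrib)
          then have 1: "norm (f y) * (1 / (?q z ^ M * ?s y ^ M)) \<le> \<psi> y"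
            unfolding \<psi>_def using mult_left_mono[of _ _ "norm (f y)"] by fastforce
          have 2: "\<psi> y \<le> \<epsilon> * F + Q * F powr (1 - p) * \<psi> y powr p"
          proof -
            have "\<psi> y / F \<le> \<epsilon> + Q * (\<psi> y / F) powr p"
              unfolding Q_def using \<psi>0 \<psi>F Fp p \<epsilon> by (intro power_interpolation) auto
            then have "F * (\<psi> y / F) \<le> F * (\<epsilon> + Q * (\<psi> y / F) powr p)" using Fp by (intro mult_left_mono) auto
            also have "\<dots> = \<epsilon> * F + Q * (F * (\<psi> y / F) powr p)" by (simp add: algebra_simps)
            also have "F * (\<psi> y / F) powr p = F powr (1 - p) * \<psi> y powr p"
              using Fp \<psi>0[of y] by (simp add: powr_divide powr_diff)
            finally show ?thesis using Fp by simp
          qed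
          have "1 / ?q z ^ M * (D * r ^ ?d / ?s y ^ (M + (?d + 2)) * norm (f y)) =
              D * r ^ ?d / ?s y ^ (?d + 2) * (norm (f y) * (1 / (?q z ^ M * ?s y ^ M)))"
            using sp by (simp add: power_add field_simps)
          also have "\<dots> \<le> D * r ^ ?d / ?s y ^ (?d + 2) * (\<epsilon> * F + Q * F powr (1 - p) * \<psi> y powr p)"
            using 1 2 D r sp by (intro mult_left_mono) auto
          also have "\<dots> = D * r ^ ?d * (\<epsilon> * F) * (1 / ?s y ^ (?d + 2)) + 1 / ?s y ^ (?d + 2) * (D * r ^ ?d * (Q * F powr (1 - p)) * \<psi> y powr p)"
          proof -
            have "A / s * (x + w * y) = A * x * (1 / s) + 1 / s * (A * w * y)" for A s x y w :: real
              by (simp add: algebra_simps add_divide_distrib)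
            from this[of "D * r ^ ?d" "?s y ^ (?d + 2)" "\<epsilon> * F" "Q * F powr (1 - p)" "\<psi> y powr p"] show ?thesis .
          qed
          \<comment> \<open>The kernel is kept in the first term, where it is integrated, and
            estimated by 1 in the second, where the integral of the power of \<open>\<psi>\<close>
            takes its place.\<close>
          also have "\<dots> \<le> D * r ^ ?d * (\<epsilon> * F) * (1 / ?s y ^ (?d + 2)) + 1 * (D * r ^ ?d * (Q * F powr (1 - p)) * \<psi> y powr p)"
            using D r Q Fp s[of y] one_le_power[OF s[of y], of "?d + 2"]
            by (intro add_left_mono mult_right_mono mult_nonneg_nonneg) auto
          finally have le: "1 / ?q z ^ M * (D * r ^ ?d / ?s y ^ (M + (?d + 2)) * norm (f y)) \<le>
            D * r ^ ?d * (\<epsilon> * F) * (1 / ?s y ^ (?d + 2)) + D * r ^ ?d * (Q * F powr (1 - p)) * \<psi> y powr p" by simp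
          have "ennreal (1 / ?q z ^ M) * ennreal (D * r ^ ?d / ?s y ^ (M + (?d + 2)) * norm (f y)) =
              ennreal (1 / ?q z ^ M * (D * r ^ ?d / ?s y ^ (M + (?d + 2)) * norm (f y)))"
            using D r sp by (intro ennreal_mult[symmetric]) auto
          also have "\<dots> \<le> ennreal (D * r ^ ?d * (\<epsilon> * F) * (1 / ?s y ^ (?d + 2)) + D * r ^ ?d * (Q * F powr (1 - p)) * \<psi> y powr p)"
            by (rule ennreal_leI[OF le])
          also have "\<dots> = ennreal (D * r ^ ?d * (\<epsilon> * F)) * ennreal (1 / ?s y ^ (?d + 2)) + ennreal (D * r ^ ?d * (Q * F powr (1 - p))) * ennreal (\<psi> y powr p)"
            using D r Q Fp \<epsilon> sp by (intro ennreal_mult_add) auto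
          finally show "ennreal (1 / ?q z ^ M) * ennreal (D * r ^ ?d / ?s y ^ (M + (?d + 2)) * norm (f y)) \<le>
            ennreal (D * r ^ ?d * (\<epsilon> * F)) * ennreal (1 / ?s y ^ (?d + 2)) + ennreal (D * r ^ ?d * (Q * F powr (1 - p))) * ennreal (\<psi> y powr p)" .
        qed
        also have "\<dots> = ennreal (D * r ^ ?d * (\<epsilon> * F)) * (\<integral>\<^sup>+y. ennreal (1 / ?s y ^ (?d + 2)) \<partial>lborel) + ennreal (D * r ^ ?d * (Q * F powr (1 - p))) * I"
          unfolding I_def by (subst nn_integral_add) (auto simp: nn_integral_cmult)
        also have "(\<integral>\<^sup>+y. ennreal (1 / ?s y ^ (?d + 2)) \<partial>lborel) = (\<integral>\<^sup>+y. ennreal (1 / (1 + r * norm (y::'a)) ^ (?d + 2)) \<partial>lborel)"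
          by (rule nn_integral_reflect[of "\<lambda>y. ennreal (1 / (1 + r * norm y) ^ (?d + 2))"]) measurable
        also have "ennreal (D * r ^ ?d * (\<epsilon> * F)) * \<dots> + ennreal (D * r ^ ?d * (Q * F powr (1 - p))) * I \<le>
            ennreal (D * r ^ ?d * (\<epsilon> * F)) * ennreal (Kd / r ^ ?d) + ennreal (D * r ^ ?d * (Q * F powr (1 - p))) * ennreal J"
          unfolding J(1) by (intro add_right_mono mult_left_mono Kd(2) r) auto
        also have "\<dots> = ennreal (D * r ^ ?d * (\<epsilon> * F) * (Kd / r ^ ?d) + D * r ^ ?d * (Q * F powr (1 - p)) * J)"
          using D r Q Fp \<epsilon> J Kd(1) by (intro ennreal_mult_add[symmetric]) auto
        also have "D * r ^ ?d * (\<epsilon> * F) * (Kd / r ^ ?d) + D * r ^ ?d * (Q * F powr (1 - p)) * J = F / 2 + D * r ^ ?d * Q * F powr (1 - p) * J"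
          using D r Kd(1) by (simp add: \<epsilon>_def)
        finally show ?thesis .
      qed
      have "(SUP y. \<psi> y) \<le> F / 2 + D * r ^ ?d * Q * F powr (1 - p) * J"
      proof (rule cSUP_least)
        fix z
        have "0 \<le> F / 2 + D * r ^ ?d * Q * F powr (1 - p) * J"
          using D r Q Fp J by (intro add_nonneg_nonneg mult_nonneg_nonneg) auto
        with \<psi>int[of z] show "\<psi> z \<le> F / 2 + D * r ^ ?d * Q * F powr (1 - p) * J"
          by (simp only: ennreal_le_iff)
      qed simp
      then have "F \<le> F / 2 + D * r ^ ?d * Q * F powr (1 - p) * J" by (simp only: F_def)
      then have "F \<le> 2 * D * Q * r ^ ?d * J * F powr (1 - p)" by (simp add: mult_ac)
      then have "F powr (p - 1) * F \<le> F powr (p - 1) * (2 * D * Q * r ^ ?d * J * F powr (1 - p))"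
        by (intro mult_left_mono) auto
      also have "\<dots> = 2 * D * Q * r ^ ?d * J * (F powr (p - 1) * F powr (1 - p))" by (simp add: mult_ac)
      also have "F powr (p - 1) * F powr (1 - p) = 1" using Fp by (simp add: powr_add[symmetric])
      also have "F powr (p - 1) * F = F powr p" using Fp by (simp add: powr_diff)
      finally have "F powr p \<le> 2 * D * Q * r ^ ?d * J" by simp
      then have "ennreal (F powr p) \<le> ennreal (2 * D * Q * r ^ ?d * J)" by (rule ennreal_leI)
      also have "\<dots> = ennreal (2 * D * Q * r ^ ?d) * I"
        unfolding J(1) using D Q r J(2) by (intro ennreal_mult) auto
      finally show ?thesis .
    qed
    show "\<exists>F\<ge>0. (\<forall>y. norm (f y) \<le> F * (1 + r * norm (x - y)) ^ M) \<and>
       ennreal (F powr p) \<le> ennreal (2 * D * Q * r ^ ?d) * (\<integral>\<^sup>+y. ennreal ((norm (f y) / (1 + r * norm (x - y)) ^ M) powr p) \<partial>lborel)"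
      using F0 fF main unfolding I_def \<psi>_def by blast
  qed
qed

section \<open>Integration by parts against a symbol\<close>

lemma continuous_integral_dominated:
  fixes H :: "'b::metric_space \<Rightarrow> 'a \<Rightarrow> complex"
  assumes m: "\<And>z. H z \<in> borel_measurable M" and c: "\<And>x. x \<in> space M \<Longrightarrow> continuous_on UNIV (\<lambda>z. H z x)"
    and b: "\<And>z x. x \<in> space M \<Longrightarrow> norm (H z x) \<le> B x" and B: "integrable M B"
  shows "continuous_on UNIV (\<lambda>z. LINT x|M. H z x)"
proof -
  have "isCont (\<lambda>z. LINT x|M. H z x) z" for z
    unfolding continuous_at_sequentially o_def
  proof (intro allI impI)
    fix X assume X: "X \<longlonglongrightarrow> z"
    show "(\<lambda>n. LINT x|M. H (X n) x) \<longlonglongrightarrow> (LINT x|M. H z x)"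
    proof (rule integral_dominated_convergence[where w=B])
      show "AE x in M. (\<lambda>n. H (X n) x) \<longlonglongrightarrow> H z x"
        by (intro AE_I2 continuous_on_tendsto_compose[OF c X]) auto
    qed (use m b B in auto)
  qed
  then show ?thesis by (simp add: continuous_on_eq_continuous_at)
qed

lemma osc_linear:
  assumes "integrable lborel a" "integrable lborel b"
  shows "osc (\<lambda>\<xi>. s * a \<xi> + t * b \<xi>) w = s * osc a w + t * osc b w"
proof -
  have i: "integrable lborel (\<lambda>\<xi>. exp (\<i> * complex_of_real (w \<bullet> \<xi>)) * a \<xi>)" if "integrable lborel a" for a
  proof (rule Bochner_Integration.integrable_bound[OF that])
    have [measurable]: "a \<in> borel_measurable borel" using that borel_measurable_integrable by fastforce
    show "(\<lambda>\<xi>. exp (\<i> * complex_of_real (w \<bullet> \<xi>)) * a \<xi>) \<in> borel_measurable lborel" by measurable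
  qed (simp add: norm_mult)
  have "osc (\<lambda>\<xi>. s * a \<xi> + t * b \<xi>) w = (LINT \<xi>|lborel. s * (exp (\<i> * complex_of_real (w \<bullet> \<xi>)) * a \<xi>) + t * (exp (\<i> * complex_of_real (w \<bullet> \<xi>)) * b \<xi>))"
    unfolding osc_def by (simp add: algebra_simps)
  also have "\<dots> = s * osc a w + t * osc b w"
    unfolding osc_def using i[OF assms(1)] i[OF assms(2)] by simp
  finally show ?thesis .
qed

text \<open>The variable \<open>z\<close> occurs in the phase and in the symbol, so its derivative
  produces i (\<xi> . w) a + a'. Compact frequency support keeps \<xi> . w bounded, so a constant
  multiple of \<open>g\<close> dominates everything. The sup bounds of \<open>T\<close> and
  \<open>T'\<close> serve the integrability in the next integration by parts.\<close>

lemma osc_symbol_derivative: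
  fixes a a' :: "'a::euclidean_space \<times> 'a \<Rightarrow> complex" and g :: "'a \<Rightarrow> complex"
  assumes d: "dirderiv (w, 0) a a'" and ca: "continuous_on UNIV a" "continuous_on UNIV a'"
    and b: "\<And>x. norm (a x) \<le> K * indicator (cball c R) (snd x)" "\<And>x. norm (a' x) \<le> K' * indicator (cball c R) (snd x)"
    and w: "w \<in> Basis" and R: "0 \<le> R" and K: "0 \<le> K" "0 \<le> K'" and g: "integrable lborel g"
  defines "T \<equiv> \<lambda>z. osc (\<lambda>\<xi>. a (z, \<xi>) * g \<xi>) z"
    and "T' \<equiv> \<lambda>z. osc (\<lambda>\<xi>. (\<i> * complex_of_real (\<xi> \<bullet> w) * a (z, \<xi>) + a' (z, \<xi>)) * g \<xi>) z"
  shows "dirderiv w T T'" "continuous_on UNIV T" "continuous_on UNIV T'"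
    "norm (T z) \<le> (LINT \<xi>|lborel. norm (complex_of_real K * g \<xi>))"
    "norm (T' z) \<le> (LINT \<xi>|lborel. norm (complex_of_real ((norm c + R) * K + K') * g \<xi>))"
proof -
  have gm[measurable]: "g \<in> borel_measurable borel" using borel_measurable_integrable[OF g] by simp
  let ?p = "\<lambda>z \<xi>. \<i> * complex_of_real (\<xi> \<bullet> w) * a (z, \<xi>) + a' (z, \<xi>)"
  have pc: "continuous_on UNIV (\<lambda>\<xi>. a (z, \<xi>))" "continuous_on UNIV (\<lambda>\<xi>. a' (z, \<xi>))" for z
    using ca by (auto intro: continuous_on_comp_Pair)
  have pz: "continuous_on UNIV (\<lambda>z. a (z, \<xi>))" "continuous_on UNIV (\<lambda>z. a' (z, \<xi>))" for \<xi>
    by (rule continuous_on_compose2[OF ca(1)] continuous_on_compose2[OF ca(2)]; auto intro!: continuous_intros)+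
  have [measurable]: "(\<lambda>\<xi>. a (z, \<xi>)) \<in> borel_measurable borel" "(\<lambda>\<xi>. a' (z, \<xi>)) \<in> borel_measurable borel" for z
    using pc by (auto intro: borel_measurable_continuous_onI)
  have na: "norm (a (z, \<xi>)) \<le> K" for z \<xi>
    using b(1)[of "(z, \<xi>)"] K by (cases "\<xi> \<in> cball c R") (auto simp del: mem_cball)
  have np: "norm (?p z \<xi>) \<le> (norm c + R) * K + K'" for z \<xi>
  proof (cases "\<xi> \<in> cball c R")
    case True
    have "\<bar>\<xi> \<bullet> w\<bar> \<le> norm \<xi>" by (rule Basis_le_norm[OF w])
    also have "norm \<xi> \<le> norm c + R"
      using True norm_triangle_ineq4[of c "c - \<xi>"] by (simp add: dist_norm)
    finally have "\<bar>\<xi> \<bullet> w\<bar> * norm (a (z, \<xi>)) \<le> (norm c + R) * K"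
      using na R by (intro mult_mono) auto
    moreover have "norm (a' (z, \<xi>)) \<le> K'" using b(2)[of "(z, \<xi>)"] True by simp
    ultimately show ?thesis by (intro norm_triangle_le add_mono) (auto simp: norm_mult)
  next
    case False
    then have "a (z, \<xi>) = 0" "a' (z, \<xi>) = 0" using b(1)[of "(z, \<xi>)"] b(2)[of "(z, \<xi>)"] by auto
    then show ?thesis using K R by (simp add: add_nonneg_nonneg)
  qed
  have npg: "norm (?p z \<xi> * g \<xi>) \<le> norm (complex_of_real ((norm c + R) * K + K') * g \<xi>)" for z \<xi>
  proof -
    have "0 \<le> (norm c + R) * K + K'" using K R by simp
    then show ?thesis using mult_right_mono[OF np[of \<xi> z], of "norm (g \<xi>)"] by (simp only: norm_mult norm_of_real abs_of_nonneg norm_ge_zero)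
  qed
  have nag: "norm (a (z, \<xi>) * g \<xi>) \<le> norm (complex_of_real K * g \<xi>)" for z \<xi>
    using mult_right_mono[OF na[of z \<xi>], of "norm (g \<xi>)"] K by (simp add: norm_mult)
  have ig: "integrable lborel (\<lambda>\<xi>. norm (complex_of_real s * g \<xi>))" for s using g by auto
  show "continuous_on UNIV T"
    unfolding T_def osc_def
  proof (rule continuous_integral_dominated[OF _ _ _ ig[of K]])
    show "continuous_on UNIV (\<lambda>z. exp (\<i> * complex_of_real (z \<bullet> \<xi>)) * (a (z, \<xi>) * g \<xi>))" for \<xi>
      by (intro continuous_intros pz)
    show "norm (exp (\<i> * complex_of_real (z \<bullet> \<xi>)) * (a (z, \<xi>) * g \<xi>)) \<le> norm (complex_of_real K * g \<xi>)" for z \<xi>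
      using nag[of z \<xi>] by (simp add: norm_mult)
  qed measurable
  show "continuous_on UNIV T'"
    unfolding T'_def osc_def
  proof (rule continuous_integral_dominated[OF _ _ _ ig[of "(norm c + R) * K + K'"]])
    show "continuous_on UNIV (\<lambda>z. exp (\<i> * complex_of_real (z \<bullet> \<xi>)) * (?p z \<xi> * g \<xi>))" for \<xi>
      by (intro continuous_intros pz)
    show "norm (exp (\<i> * complex_of_real (z \<bullet> \<xi>)) * (?p z \<xi> * g \<xi>)) \<le> norm (complex_of_real ((norm c + R) * K + K') * g \<xi>)" for z \<xi>
      using npg[of \<xi> z] by (simp add: norm_mult del: of_real_add of_real_mult)
  qed measurable
  have bnd: "norm (osc f z) \<le> (LINT \<xi>|lborel. norm (complex_of_real s * g \<xi>))" if "\<And>\<xi>. norm (f \<xi>) \<le> norm (complex_of_real s * g \<xi>)" for f z s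
    unfolding osc_def
  proof (rule norm_integral_bound[where B="\<lambda>\<xi>. norm (complex_of_real s * g \<xi>)"])
    show "(\<integral>\<^sup>+\<xi>. ennreal (norm (complex_of_real s * g \<xi>)) \<partial>lborel) \<le> ennreal (LINT \<xi>|lborel. norm (complex_of_real s * g \<xi>))"
      by (intro eq_refl nn_integral_eq_integral ig) auto
  qed (use that in \<open>auto simp: norm_mult\<close>)
  show "norm (T z) \<le> (LINT \<xi>|lborel. norm (complex_of_real K * g \<xi>))" unfolding T_def by (rule bnd[OF nag])
  show "norm (T' z) \<le> (LINT \<xi>|lborel. norm (complex_of_real ((norm c + R) * K + K') * g \<xi>))" unfolding T'_def by (rule bnd[OF npg])
  show "dirderiv w T T'"
    unfolding dirderiv_def
  proof
    fix z
    let ?F = "\<lambda>t \<xi>. exp (\<i> * complex_of_real ((z + t *\<^sub>R w) \<bullet> \<xi>)) * (a (z + t *\<^sub>R w, \<xi>) * g \<xi>)"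
    let ?F' = "\<lambda>t \<xi>. exp (\<i> * complex_of_real ((z + t *\<^sub>R w) \<bullet> \<xi>)) * (?p (z + t *\<^sub>R w) \<xi> * g \<xi>)"
    have "((\<lambda>t. LINT \<xi>|lborel. ?F t \<xi>) has_vector_derivative (LINT \<xi>|lborel. ?F' 0 \<xi>)) (at 0)"
    proof (rule has_vector_derivative_integral[where B="\<lambda>\<xi>. norm (complex_of_real ((norm c + R) * K + K') * g \<xi>)"])
      fix t \<xi>
      have e: "((\<lambda>t. exp (\<i> * complex_of_real ((z + t *\<^sub>R w) \<bullet> \<xi>))) has_vector_derivative
          \<i> * complex_of_real (\<xi> \<bullet> w) * exp (\<i> * complex_of_real ((z + t *\<^sub>R w) \<bullet> \<xi>))) (at t)"
        using dirderiv_at[OF dirderiv_exp_i[of w \<xi>], of z t] by (simp add: inner_commute)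
      have "((\<lambda>t. a ((z, \<xi>) + t *\<^sub>R (w, 0))) has_vector_derivative a' ((z, \<xi>) + t *\<^sub>R (w, 0))) (at t)"
        by (rule dirderiv_at[OF d])
      then have "((\<lambda>t. a (z + t *\<^sub>R w, \<xi>)) has_vector_derivative a' (z + t *\<^sub>R w, \<xi>)) (at t)" by simp
      from has_vector_derivative_mult[OF e has_vector_derivative_mult[OF this has_vector_derivative_const[of "g \<xi>"]]]
      show "((\<lambda>t. ?F t \<xi>) has_vector_derivative ?F' t \<xi>) (at t)" by (simp add: algebra_simps)
      show "norm (?F' t \<xi>) \<le> norm (complex_of_real ((norm c + R) * K + K') * g \<xi>)" using npg by (simp add: norm_mult del: of_real_add of_real_mult)
    next
      fix t
      show "integrable lborel (?F t)"
        by (rule Bochner_Integration.integrable_bound[OF ig[of K]]) (use nag in \<open>auto simp: norm_mult\<close>)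
      show "integrable lborel (\<lambda>\<xi>. norm (complex_of_real ((norm c + R) * K + K') * g \<xi>))" by (rule ig)
    qed measurable
    then show "((\<lambda>t. T (z + t *\<^sub>R w)) has_vector_derivative T' z) (at 0)"
      unfolding T_def T'_def osc_def by simp
  qed
qed

text \<open>In terms of kernels the relation between \<open>m\<close> and \<open>m1\<close> says
  that osc m = osc m1 + (1/r) (D - i c . w) osc m1, with D the derivative along \<open>w\<close>.
  Moving D to \<open>T\<close> changes the sign once, and the argument \<open>x - z\<close> changes
  it back.\<close>

lemma osc_by_parts_step:
  fixes m m1 :: "'a::euclidean_space \<Rightarrow> complex"
  assumes m: "\<And>\<theta>. m \<theta> = (1 + \<i> * complex_of_real ((\<theta> - c) \<bullet> w / r)) * m1 \<theta>"
    and b1: "bump_bounds (DIM('a) + 2) r B1 c1 R1 m1" and b: "bump_bounds (DIM('a) + 2) r B c1 R1 m"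
    and pos: "0 < r" "0 \<le> R1" "0 \<le> B1" "0 \<le> B" and w: "w \<in> Basis"
    and T: "dirderiv w T T'" "continuous_on UNIV T" "continuous_on UNIV T'"
      "\<And>z. norm (T z) \<le> K" "\<And>z. norm (T' z) \<le> K'"
  shows "(LINT z|lborel. osc m (x - z) * T z) =
    (LINT z|lborel. osc m1 (x - z) * (T z + complex_of_real (1 / r) * (T' z - \<i> * complex_of_real (c \<bullet> w) * T z)))"
proof -
  have im: "integrable lborel m" "integrable lborel m1"
    by (rule bump_integrable[OF b pos(2,4)], rule bump_integrable[OF b1 pos(2,3)])
  have iom: "integrable lborel (osc m)" "integrable lborel (osc m1)"
    by (rule osc_integrable[OF b pos(1,2,4)], rule osc_integrable[OF b1 pos(1-3)])
  define Q where "Q = osc (\<lambda>\<theta>. \<i> * complex_of_real (\<theta> \<bullet> w) * m1 \<theta>)"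
  define cw where "cw = \<i> * complex_of_real (c \<bullet> w)"
  have Qeq: "Q y = complex_of_real r * (osc m y - osc m1 y) + cw * osc m1 y" for y
  proof -
    have "(\<lambda>\<theta>. \<i> * complex_of_real (\<theta> \<bullet> w) * m1 \<theta>) = (\<lambda>\<theta>. complex_of_real r * m \<theta> + (cw - complex_of_real r) * m1 \<theta>)"
      using pos(1) by (intro ext) (simp add: m cw_def inner_diff_left field_simps)
    then have "Q y = complex_of_real r * osc m y + (cw - complex_of_real r) * osc m1 y"
      unfolding Q_def by (simp only: osc_linear[OF im])
    then show ?thesis by (simp add: algebra_simps)
  qed
  have iQ: "integrable lborel Q"
    unfolding Qeq[abs_def] using iom by auto
  have cQ: "continuous_on UNIV Q" "continuous_on UNIV (osc m1)" "continuous_on UNIV (osc m)"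
    unfolding Qeq[abs_def] using osc_measurable(2)[OF im(1)] osc_measurable(2)[OF im(2)] by (auto intro!: continuous_intros)
  have cx: "continuous_on UNIV (\<lambda>z. f (x - z))" if "continuous_on UNIV f" for f :: "'a \<Rightarrow> complex"
    by (rule continuous_on_compose2[OF that]) (auto intro!: continuous_intros)
  have dQ: "dirderiv w (osc m1) Q"
  proof -
    \<comment> \<open>The previous derivative formula for a symbol that does not vary in
      \<open>z\<close>. For \<open>g\<close> stands the indicator of the ball, which is integrable
      and leaves the product with \<open>m1\<close> unchanged.\<close>
    have "dirderiv w (\<lambda>z. osc (\<lambda>\<xi>. m1 \<xi> * indicator (cball c1 R1) \<xi>) z) (\<lambda>z. osc (\<lambda>\<xi>. (\<i> * complex_of_real (\<xi> \<bullet> w) * m1 \<xi> + 0) * indicator (cball c1 R1) \<xi>) z)"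
    proof (rule osc_symbol_derivative(1)[where a="\<lambda>x. m1 (snd x)" and a'="\<lambda>_. 0" and K=B1 and K'=0 and c=c1 and R=R1, simplified snd_conv])
      have "integrable lborel (\<lambda>x. complex_of_real (indicator (cball c1 R1) x))"
        using emeasure_bounded_finite[OF bounded_cball[of c1 R1]] by (intro integrable_of_real integrable_real_indicator) auto
      moreover have "(\<lambda>x. complex_of_real (indicator (cball c1 R1) x)) = indicator (cball c1 R1)" by (auto simp: indicator_def)
      ultimately show "integrable lborel (indicator (cball c1 R1) :: 'a \<Rightarrow> complex)" by simp
      show "dirderiv (w, 0) (\<lambda>x. m1 (snd x)) (\<lambda>_. 0)" by (simp add: dirderiv_def)
      show "continuous_on UNIV (\<lambda>x. m1 (snd x))" by (rule continuous_on_comp_snd[OF bump_bounds_base(1)[OF b1]])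
      show "norm (m1 (snd x)) \<le> B1 * indicator (cball c1 R1) (snd x)" for x :: "'a \<times> 'a" by (rule bump_bounds_base(2)[OF b1])
    qed (use pos w in auto)
    moreover have "m1 \<xi> * indicator (cball c1 R1) \<xi> = m1 \<xi>" for \<xi>
      using bump_bounds_base(2)[OF b1, of \<xi>] by (cases "\<xi> \<in> cball c1 R1") auto
    then have "(\<lambda>\<xi>. m1 \<xi> * indicator (cball c1 R1) \<xi>) = m1"
      "(\<lambda>\<xi>. (\<i> * complex_of_real (\<xi> \<bullet> w) * m1 \<xi> + 0) * indicator (cball c1 R1) \<xi>) = (\<lambda>\<xi>. \<i> * complex_of_real (\<xi> \<bullet> w) * m1 \<xi>)"
      by (auto simp: mult.assoc)
    ultimately show ?thesis by (simp only: Q_def)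
  qed
  have iT: "integrable lborel (\<lambda>z. f (x - z) * S z)"
    if "integrable lborel f" "continuous_on UNIV f" "continuous_on UNIV S" "\<And>z. norm (S z) \<le> k" for f S :: "'a \<Rightarrow> complex" and k
  proof (rule Bochner_Integration.integrable_bound)
    show "integrable lborel (\<lambda>z. norm (f (x - z)) * k)" using integrable_reflect[OF that(1), of x] by auto
    have "norm (f (x - z) * S z) \<le> norm (norm (f (x - z)) * k)" for z
    proof -
      have "norm (f (x - z) * S z) \<le> norm (f (x - z)) * k"
        unfolding norm_mult by (intro mult_left_mono that(4)) auto
      also have "\<dots> \<le> norm (norm (f (x - z)) * k)" unfolding real_norm_def by (rule abs_ge_self)
      finally show ?thesis .
    qed
    then show "AE z in lborel. norm (f (x - z) * S z) \<le> norm (norm (f (x - z)) * k)" by simp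
    have "continuous_on UNIV (\<lambda>z. f (x - z) * S z)" by (intro continuous_intros cx that)
    then show "(\<lambda>z. f (x - z) * S z) \<in> borel_measurable lborel" using borel_measurable_continuous_onI by fastforce
  qed
  have dx: "dirderiv w (\<lambda>z. osc m1 (x - z)) (\<lambda>z. - Q (x - z))"
    unfolding dirderiv_def
  proof
    fix z
    have "(((\<lambda>t. osc m1 ((x - z) + t *\<^sub>R w)) \<circ> uminus) has_vector_derivative (-1) *\<^sub>R Q (x - z)) (at 0)"
      using dQ by (intro vector_diff_chain_at) (auto simp: dirderiv_def intro!: derivative_eq_intros)
    then show "((\<lambda>t. osc m1 (x - (z + t *\<^sub>R w))) has_vector_derivative - Q (x - z)) (at 0)"
      by (simp add: o_def algebra_simps)
  qed
  have "(LINT z|lborel. - Q (x - z) * T z) = - (LINT z|lborel. osc m1 (x - z) * T' z)"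
    by (rule integral_by_parts_dir[OF dx T(1)])
       (use T cQ iT[OF iom(2) cQ(2) T(2,4)] iT[OF iQ cQ(1) T(2,4)] iT[OF iom(2) cQ(2) T(3,5)] in \<open>auto intro!: continuous_intros cx\<close>)
  then have parts: "(LINT z|lborel. Q (x - z) * T z) = (LINT z|lborel. osc m1 (x - z) * T' z)" by simp
  have "(LINT z|lborel. osc m (x - z) * T z) = (LINT z|lborel. osc m1 (x - z) * T z + complex_of_real (1 / r) * (Q (x - z) * T z - cw * (osc m1 (x - z) * T z)))"
    using pos(1) by (intro Bochner_Integration.integral_cong refl) (simp add: Qeq field_simps)
  also have "\<dots> = (LINT z|lborel. osc m1 (x - z) * T z) + complex_of_real (1 / r) * ((LINT z|lborel. Q (x - z) * T z) - cw * (LINT z|lborel. osc m1 (x - z) * T z))"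
    using iT[OF iom(2) cQ(2) T(2,4)] iT[OF iQ cQ(1) T(2,4)] by simp
  also have "\<dots> = (LINT z|lborel. osc m1 (x - z) * T z + complex_of_real (1 / r) * (osc m1 (x - z) * T' z - cw * (osc m1 (x - z) * T z)))"
    unfolding parts using iT[OF iom(2) cQ(2) T(2,4)] iT[OF iom(2) cQ(2) T(3,5)] by simp
  also have "\<dots> = (LINT z|lborel. osc m1 (x - z) * (T z + complex_of_real (1 / r) * (T' z - \<i> * complex_of_real (c \<bullet> w) * T z)))"
    by (simp add: cw_def algebra_simps)
  finally show ?thesis .
qed

section \<open>The damping factor\<close>

text \<open>Removing the factor \<open>1 / damp\<close> from a multiplier costs one derivative in \<open>x\<close>; on the \<open>k\<close>-th block,
  with \<open>c\<close> and \<open>r\<close> those of the \<open>l\<close>-th one, \<open>|damp|\<close> is of order \<open>1 / \<langle>k - l\<rangle>\<close> for a suitable direction \<open>w\<close>.\<close>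
definition damp :: "'a::euclidean_space \<Rightarrow> 'a \<Rightarrow> real \<Rightarrow> 'a \<Rightarrow> complex" where
  "damp c w r \<theta> = inverse (1 + \<i> * complex_of_real ((\<theta> - c) \<bullet> w / r))"

lemma damp_denominator: "1 + \<i> * complex_of_real t \<noteq> 0" "1 \<le> norm (1 + \<i> * complex_of_real t)" "\<bar>t\<bar> \<le> norm (1 + \<i> * complex_of_real t)"
proof -
  show 1: "1 \<le> norm (1 + \<i> * complex_of_real t)"
    using abs_Re_le_cmod[of "1 + \<i> * complex_of_real t"] by simp
  then show "1 + \<i> * complex_of_real t \<noteq> 0" by (metis norm_zero not_one_le_zero)
  show "\<bar>t\<bar> \<le> norm (1 + \<i> * complex_of_real t)"
    using abs_Im_le_cmod[of "1 + \<i> * complex_of_real t"] by simp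
qed

lemma damp_cancel: "(1 + \<i> * complex_of_real ((\<theta> - c) \<bullet> w / r)) * damp c w r \<theta> = 1"
  unfolding damp_def by (rule right_inverse[OF damp_denominator(1)])

lemma norm_damp_le_1: "norm (damp c w r \<theta>) \<le> 1"
  unfolding damp_def norm_inverse using damp_denominator(2) by (rule inverse_le_1_iff[THEN iffD2, OF disjI2])

lemma norm_damp_le:
  assumes "0 < s" "s \<le> \<bar>(\<theta> - c) \<bullet> w / r\<bar>"
  shows "norm (damp c w r \<theta>) \<le> 1 / s"
  unfolding damp_def norm_inverse
  using order_trans[OF assms(2) damp_denominator(3)] assms(1) by (simp add: inverse_eq_divide frac_le)

lemma dirderiv_damp:
  "dirderiv v (damp c w r) (\<lambda>\<theta>. - (\<i> * complex_of_real (v \<bullet> w / r)) * (damp c w r \<theta> * damp c w r \<theta>))"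
proof -
  have "dirderiv v (\<lambda>\<theta>. complex_of_real ((\<theta> - c) \<bullet> w / r)) (\<lambda>_. complex_of_real (v \<bullet> w / r))"
    by (rule dirderiv_of_linear[of "\<lambda>\<theta>. complex_of_real (\<theta> \<bullet> w / r)"])
       (intro bounded_linear_compose[OF bounded_linear_of_real] bounded_linear_compose[OF bounded_linear_divide] bounded_linear_inner_left)
  from dirderiv_add[OF dirderiv_const[of v 1] dirderiv_cmult[OF this, of \<i>]]
  have "dirderiv v (\<lambda>\<theta>. 1 + \<i> * complex_of_real ((\<theta> - c) \<bullet> w / r)) (\<lambda>_. \<i> * complex_of_real (v \<bullet> w / r))" by simp
  from dirderiv_field[OF this, of inverse "\<lambda>z. - (inverse z ^ Suc (Suc 0))", OF DERIV_inverse]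
  have "dirderiv v (\<lambda>\<theta>. inverse (1 + \<i> * complex_of_real ((\<theta> - c) \<bullet> w / r)))
     (\<lambda>\<theta>. \<i> * complex_of_real (v \<bullet> w / r) * - (inverse (1 + \<i> * complex_of_real ((\<theta> - c) \<bullet> w / r)) ^ Suc (Suc 0)))"
    by this (elim rangeE, simp only: damp_denominator(1) not_False_eq_True)
  then show ?thesis unfolding damp_def[abs_def] by simp
qed

lemma continuous_damp: "continuous_on UNIV (damp c w r)"
proof -
  have "continuous_on UNIV (\<lambda>\<theta>. 1 + \<i> * complex_of_real ((\<theta> - c) \<bullet> w / r))"
    unfolding divide_inverse by (intro continuous_intros)
  then show ?thesis
    unfolding damp_def[abs_def] by (rule continuous_on_inverse) (intro ballI damp_denominator(1))
qed

lemma damp_bounds: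
  "\<exists>K\<ge>1. \<forall>r>0. \<forall>c. \<forall>w\<in>Basis. \<forall>v\<in>(Basis :: 'a::euclidean_space set).
     deriv_bounds L v r (\<lambda>\<theta>. K * norm (damp c w r \<theta>)) (damp c w r)"
proof (induction L)
  case 0
  then show ?case by (intro exI[of _ 1]) (auto intro: continuous_damp)
next
  case (Suc L)
  then obtain K where K1: "K \<ge> 1" and Kall: "\<forall>r>0. \<forall>c. \<forall>w\<in>Basis. \<forall>v\<in>(Basis :: 'a set).
     deriv_bounds L v r (\<lambda>\<theta>. K * norm (damp c w r \<theta>)) (damp c w r)"
    by (elim exE conjE) (rule that)
  have K: "K \<ge> 1" "\<And>r c w v. r > 0 \<Longrightarrow> w \<in> Basis \<Longrightarrow> v \<in> (Basis :: 'a set) \<Longrightarrow>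
     deriv_bounds L v r (\<lambda>\<theta>. K * norm (damp c w r \<theta>)) (damp c w r)"
    using K1 Kall by simp_all
  define K' where "K' = 2 ^ L * K * K"
  have "1 * (1 * 1) \<le> 2 ^ L * (K * K)" using K(1) by (intro mult_mono) auto
  then have K': "K' \<ge> 1" by (simp add: K'_def mult.assoc)
  have "deriv_bounds (Suc L) v r (\<lambda>\<theta>. K' * norm (damp c w r \<theta>)) (damp c w r)"
    if r: "r > 0" and w: "w \<in> Basis" and v: "v \<in> Basis" for r c and w v :: 'a
  proof -
    let ?u = "damp c w r" and ?s = "- (\<i> * complex_of_real (v \<bullet> w / r))"
    have d: "deriv_bounds L v r (\<lambda>\<theta>. norm ?s * (2 ^ L * (K * norm (?u \<theta>)) * (K * norm (?u \<theta>)))) (\<lambda>\<theta>. ?s * (?u \<theta> * ?u \<theta>))"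
      by (intro deriv_bounds_cmult deriv_bounds_mult K(2) r w v)
    have "deriv_bounds L v r (\<lambda>\<theta>. K' * norm (?u \<theta>) / r) (\<lambda>\<theta>. ?s * (?u \<theta> * ?u \<theta>))"
    proof (rule deriv_bounds_mono[OF d _ r])
      fix \<theta>
      have "\<bar>v \<bullet> w\<bar> \<le> 1" using Basis_le_norm[OF w, of v] v by simp
      then have s: "norm ?s \<le> 1 / r" using r by (simp add: norm_mult norm_divide divide_right_mono)
      have "norm (?u \<theta>) * norm (?u \<theta>) \<le> norm (?u \<theta>)" using norm_damp_le_1 by (intro mult_left_le) auto
      then have "2 ^ L * (K * norm (?u \<theta>)) * (K * norm (?u \<theta>)) \<le> K' * norm (?u \<theta>)"
        unfolding K'_def using K(1) mult_left_mono[of _ _ "2 ^ L * K * K"] by (fastforce simp: mult_ac)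
      from mult_mono[OF s this]
      have "norm ?s * (2 ^ L * (K * norm (?u \<theta>)) * (K * norm (?u \<theta>))) \<le> 1 / r * (K' * norm (?u \<theta>))"
        using K(1) r by simp
      then show "norm ?s * (2 ^ L * (K * norm (?u \<theta>)) * (K * norm (?u \<theta>))) \<le> K' * norm (?u \<theta>) / r" by simp
    qed
    moreover have "norm (?u \<theta>) \<le> K' * norm (?u \<theta>)" for \<theta>
      using mult_right_mono[OF K', of "norm (?u \<theta>)"] by simp
    ultimately show ?thesis using dirderiv_damp[of v c w r] continuous_damp by auto
  qed
  with K' show ?case by blast
qed

lemma bump_bounds_le: "bump_bounds N r B c R a \<Longrightarrow> L \<le> N \<Longrightarrow> bump_bounds L r B c R a"
  by (auto simp: bump_bounds_def intro: deriv_bounds_le)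

text \<open>The constant depends on \<open>L\<close>, \<open>N\<close> and the dimension alone,
  hence is uniform over all pairs of blocks; the smallness enters through \<open>E ^ N\<close>, with
  \<open>E\<close> a bound of \<open>damp\<close> on the ball of the cutoff.\<close>

lemma bump_bounds_mult_damp_power:
  obtains K where "K \<ge> 0"
    "\<And>r c w B E c1 R m. r > 0 \<Longrightarrow> w \<in> Basis \<Longrightarrow> B \<ge> 0 \<Longrightarrow> bump_bounds L r B c1 R m \<Longrightarrow>
     (\<And>\<theta>. \<theta> \<in> cball c1 R \<Longrightarrow> norm (damp c w r \<theta>) \<le> E) \<Longrightarrow> 0 \<le> E \<Longrightarrow>
     bump_bounds L r (K * B * E ^ N) c1 R (\<lambda>\<theta>::'a::euclidean_space. m \<theta> * damp c w r \<theta> ^ N)"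
proof -
  from damp_bounds[of L] obtain K where K1: "K \<ge> 1" and Kall: "\<forall>r>0. \<forall>c. \<forall>w\<in>Basis. \<forall>v\<in>(Basis :: 'a set).
     deriv_bounds L v r (\<lambda>\<theta>. K * norm (damp c w r \<theta>)) (damp c w r)"
    by (elim exE conjE) (rule that)
  have K: "K \<ge> 1" "\<And>r c w v. r > 0 \<Longrightarrow> w \<in> Basis \<Longrightarrow> v \<in> (Basis :: 'a set) \<Longrightarrow>
     deriv_bounds L v r (\<lambda>\<theta>. K * norm (damp c w r \<theta>)) (damp c w r)"
    using K1 Kall by simp_all
  define K' where "K' = 2 ^ L * ((2 ^ L) ^ N * K ^ N)"
  have K'0: "K' \<ge> 0" using K(1) by (simp add: K'_def)
  have "bump_bounds L r (K' * B * E ^ N) c1 R (\<lambda>\<theta>. m \<theta> * damp c w r \<theta> ^ N)"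
    if r: "r > 0" and w: "w \<in> Basis" and B: "B \<ge> 0" and m: "bump_bounds L r B c1 R m"
      and E: "\<And>\<theta>. \<theta> \<in> cball c1 R \<Longrightarrow> norm (damp c w r \<theta>) \<le> E" "0 \<le> E" for r c B E c1 R m and w :: 'a
    unfolding bump_bounds_def
  proof
    fix v :: 'a assume v: "v \<in> Basis"
    have p: "deriv_bounds L v r (\<lambda>\<theta>. (2 ^ L) ^ N * (K * norm (damp c w r \<theta>)) ^ N) (\<lambda>\<theta>. damp c w r \<theta> ^ N)"
      by (rule deriv_bounds_power[OF K(2)[OF r w v] r])
    have "deriv_bounds L v r (\<lambda>\<theta>. 2 ^ L * (B * indicator (cball c1 R) \<theta>) * ((2 ^ L) ^ N * (K * norm (damp c w r \<theta>)) ^ N)) (\<lambda>\<theta>. m \<theta> * damp c w r \<theta> ^ N)"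
      using m v by (intro deriv_bounds_mult p r) (auto simp: bump_bounds_def)
    then show "deriv_bounds L v r (\<lambda>\<theta>. K' * B * E ^ N * indicator (cball c1 R) \<theta>) (\<lambda>\<theta>. m \<theta> * damp c w r \<theta> ^ N)"
    proof (rule deriv_bounds_mono[OF _ _ r])
      fix \<theta>
      show "2 ^ L * (B * indicator (cball c1 R) \<theta>) * ((2 ^ L) ^ N * (K * norm (damp c w r \<theta>)) ^ N) \<le> K' * B * E ^ N * indicator (cball c1 R) \<theta>"
      proof (cases "\<theta> \<in> cball c1 R")
        case True
        have "norm (damp c w r \<theta>) ^ N \<le> E ^ N" using E(1)[OF True] by (intro power_mono) auto
        then have "K' * B * norm (damp c w r \<theta>) ^ N \<le> K' * B * E ^ N" using K'0 B by (intro mult_left_mono) auto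
        with True show ?thesis by (simp add: K'_def power_mult_distrib mult_ac)
      qed simp
    qed
  qed
  then show ?thesis by (rule that[OF K'0])
qed

lemma bump_bounds_mult_damp:
  assumes "bump_bounds L r B c1 R m" "0 \<le> B" "0 < r" "w \<in> Basis"
  shows "\<exists>B1\<ge>0. bump_bounds L r B1 c1 R (\<lambda>\<theta>::'a::euclidean_space. m \<theta> * damp c w r \<theta>)"
proof (rule bump_bounds_mult_damp_power[where 'a='a and L=L and N=1])
  fix K assume K: "0 \<le> K" and H: "\<And>r c w B E c1 R m. r > 0 \<Longrightarrow> w \<in> Basis \<Longrightarrow> B \<ge> 0 \<Longrightarrow> bump_bounds L r B c1 R m \<Longrightarrow>
     (\<And>\<theta>. \<theta> \<in> cball c1 R \<Longrightarrow> norm (damp c w r \<theta>) \<le> E) \<Longrightarrow> 0 \<le> E \<Longrightarrow>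
     bump_bounds L r (K * B * E ^ 1) c1 R (\<lambda>\<theta>::'a. m \<theta> * damp c w r \<theta> ^ 1)"
  have "bump_bounds L r (K * B * 1 ^ 1) c1 R (\<lambda>\<theta>. m \<theta> * damp c w r \<theta> ^ 1)"
    by (rule H[OF assms(3,4,2,1)]) (auto intro: norm_damp_le_1)
  then show ?thesis using K assms(2) by (intro exI[of _ "K * B"]) simp
qed

lemma integrable_mult_bounded:
  fixes a g :: "'a::euclidean_space \<Rightarrow> complex"
  assumes "integrable lborel g" "a \<in> borel_measurable borel" "\<And>x. norm (a x) \<le> K"
  shows "integrable lborel (\<lambda>x. a x * g x)"
proof (rule Bochner_Integration.integrable_bound)
  have [measurable]: "g \<in> borel_measurable borel" "a \<in> borel_measurable borel"
    using assms borel_measurable_integrable by fastforce+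
  show "(\<lambda>x. a x * g x) \<in> borel_measurable lborel" by measurable
  show "integrable lborel (\<lambda>x. K * norm (g x))" using assms(1) by auto
  have "norm (a x * g x) \<le> norm (K * norm (g x))" for x
  proof -
    have "norm (a x * g x) \<le> K * norm (g x)" unfolding norm_mult by (intro mult_right_mono assms(3)) auto
    also have "\<dots> \<le> norm (K * norm (g x))" unfolding real_norm_def by (rule abs_ge_self)
    finally show ?thesis .
  qed
  then show "AE x in lborel. norm (a x * g x) \<le> norm (K * norm (g x))" by simp
qed

text \<open>Each of the \<open>N\<close> steps uses up one x-derivative of the symbol, multiplies
  its bound by a fixed constant and adds one factor \<open>damp\<close> to the cutoff. The direction
  \<open>w\<close> and the ball carrying the symbol never change.\<close>

lemma osc_by_parts:
  fixes a :: "'a::euclidean_space \<times> 'a \<Rightarrow> complex"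
  assumes "symbol_bounds N L w r (\<lambda>x. K * indicator (cball c (C * r)) (snd x)) a"
    and "bump_bounds (DIM('a) + 2) r B c1 R1 m" "0 \<le> B" "0 \<le> K"
    and r: "0 < r" and w: "w \<in> Basis" and C: "0 \<le> C" and g: "integrable lborel g" and R1: "0 \<le> R1"
  shows "\<exists>b. symbol_bounds 0 L w r (\<lambda>x. (2 + 2 ^ L * (1 + C)) ^ N * K * indicator (cball c (C * r)) (snd x)) b \<and>
    (\<forall>x. (LINT z|lborel. osc m (x - z) * osc (\<lambda>\<xi>. a (z, \<xi>) * g \<xi>) z) =
      (LINT z|lborel. osc (\<lambda>\<theta>. m \<theta> * damp c w r \<theta> ^ N) (x - z) * osc (\<lambda>\<xi>. b (z, \<xi>) * g \<xi>) z))"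
  using assms(1-4)
proof (induction N arbitrary: a K m B)
  case 0
  then show ?case by (intro exI[of _ a]) auto
next
  case (Suc N)
  let ?I = "\<lambda>x. indicator (cball c (C * r)) (snd x) :: real" and ?Q = "2 + 2 ^ L * (1 + C)"
  have Q0: "0 \<le> ?Q" using C by (simp add: add_nonneg_nonneg)
  obtain a' where a': "dirderiv (w, 0) a a'" "continuous_on UNIV a'" "\<And>x. norm (a' x) \<le> r * (K * ?I x)"
    "symbol_bounds N L w r (\<lambda>x. ?Q * K * ?I x)
      (\<lambda>x. a x + complex_of_real (1 / r) * (\<i> * complex_of_real ((snd x - c) \<bullet> w) * a x + a' x))"
    using symbol_bounds_step[OF Suc.prems(1) r w C Suc.prems(4)] by blast
  let ?a1 = "\<lambda>x. a x + complex_of_real (1 / r) * (\<i> * complex_of_real ((snd x - c) \<bullet> w) * a x + a' x)"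
  let ?m1 = "\<lambda>\<theta>. m \<theta> * damp c w r \<theta>"
  obtain B1 where B1: "0 \<le> B1" and m1: "bump_bounds (DIM('a) + 2) r B1 c1 R1 ?m1"
    using bump_bounds_mult_damp[OF Suc.prems(2,3) r w] by blast
  have ca: "continuous_on UNIV a" and na: "\<And>x. norm (a x) \<le> K * ?I x"
    using symbol_bounds_base(2,3)[OF Suc.prems(1)] by auto
  let ?T = "\<lambda>z. osc (\<lambda>\<xi>. a (z, \<xi>) * g \<xi>) z"
    and ?T' = "\<lambda>z. osc (\<lambda>\<xi>. (\<i> * complex_of_real (\<xi> \<bullet> w) * a (z, \<xi>) + a' (z, \<xi>)) * g \<xi>) z"
  have na': "norm (a' x) \<le> r * K * ?I x" for x using a'(3)[of x] by (simp add: mult.assoc)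
  have Cr: "0 \<le> C * r" "0 \<le> r * K" using C r Suc.prems(4) by auto
  note D = osc_symbol_derivative[OF a'(1) ca a'(2) na na' w Cr(1) Suc.prems(4) Cr(2) g]
  \<comment> \<open>Subtracting i (c . w) T recentres the frequency: i (\<xi> . w) becomes i ((\<xi>
    - c) . w), which is of the order of the scale on the support.\<close>
  have T1: "?T z + complex_of_real (1 / r) * (?T' z - \<i> * complex_of_real (c \<bullet> w) * ?T z) = osc (\<lambda>\<xi>. ?a1 (z, \<xi>) * g \<xi>) z" for z
  proof -
    have n1: "norm (a (z, \<xi>)) \<le> K" for \<xi>
      using na[of "(z, \<xi>)"] Suc.prems(4) by (cases "\<xi> \<in> cball c (C * r)") (auto simp del: mem_cball)
    have n2: "norm (a' (z, \<xi>)) \<le> r * K" for \<xi>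
      using na'[of "(z, \<xi>)"] Cr(2) by (cases "\<xi> \<in> cball c (C * r)") (auto simp del: mem_cball)
    have n3: "norm (\<i> * complex_of_real (\<xi> \<bullet> w) * a (z, \<xi>)) \<le> (norm c + C * r) * K" for \<xi>
    proof (cases "\<xi> \<in> cball c (C * r)")
      case True
      have "\<bar>\<xi> \<bullet> w\<bar> \<le> norm \<xi>" by (rule Basis_le_norm[OF w])
      also have "norm \<xi> \<le> norm c + C * r"
        using True norm_triangle_ineq4[of c "c - \<xi>"] by (simp add: dist_norm)
      finally show ?thesis using n1[of \<xi>] Cr by (auto simp: norm_mult intro: mult_mono)
    next
      case False
      then show ?thesis using na[of "(z, \<xi>)"] Cr Suc.prems(4) by simp
    qed
    have pm: "(\<lambda>\<xi>. a (z, \<xi>)) \<in> borel_measurable borel" "(\<lambda>\<xi>. a' (z, \<xi>)) \<in> borel_measurable borel"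
      using ca a'(2) by (auto intro: borel_measurable_continuous_onI continuous_on_comp_Pair)
    have i1: "integrable lborel (\<lambda>\<xi>. a (z, \<xi>) * g \<xi>)"
      by (rule integrable_mult_bounded[OF g pm(1) n1])
    have i2: "integrable lborel (\<lambda>\<xi>. (\<i> * complex_of_real (\<xi> \<bullet> w) * a (z, \<xi>) + a' (z, \<xi>)) * g \<xi>)"
    proof (rule integrable_mult_bounded[OF g])
      show "norm (\<i> * complex_of_real (\<xi> \<bullet> w) * a (z, \<xi>) + a' (z, \<xi>)) \<le> (norm c + C * r) * K + r * K" for \<xi>
        by (intro norm_triangle_le add_mono n2 n3)
    qed (use pm in measurable)
    have "?T z + complex_of_real (1 / r) * (?T' z - \<i> * complex_of_real (c \<bullet> w) * ?T z) =
       (1 - complex_of_real (1 / r) * (\<i> * complex_of_real (c \<bullet> w))) * ?T z + complex_of_real (1 / r) * ?T' z"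
      by (simp add: algebra_simps)
    also have "\<dots> = osc (\<lambda>\<xi>. (1 - complex_of_real (1 / r) * (\<i> * complex_of_real (c \<bullet> w))) * (a (z, \<xi>) * g \<xi>) +
        complex_of_real (1 / r) * ((\<i> * complex_of_real (\<xi> \<bullet> w) * a (z, \<xi>) + a' (z, \<xi>)) * g \<xi>)) z"
      by (rule osc_linear[OF i1 i2, symmetric])
    also have "\<dots> = osc (\<lambda>\<xi>. ?a1 (z, \<xi>) * g \<xi>) z"
      by (rule arg_cong[where f="\<lambda>f. osc f z"]) (auto simp: inner_diff_left algebra_simps)
    finally show ?thesis .
  qed
  have mm: "m \<theta> = (1 + \<i> * complex_of_real ((\<theta> - c) \<bullet> w / r)) * ?m1 \<theta>" for \<theta>
    using damp_cancel[of \<theta> c w r] by (metis mult.left_commute mult.right_neutral)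
  have step: "(LINT z|lborel. osc m (x - z) * ?T z) = (LINT z|lborel. osc ?m1 (x - z) * osc (\<lambda>\<xi>. ?a1 (z, \<xi>) * g \<xi>) z)" for x
    using osc_by_parts_step[OF mm m1 Suc.prems(2) r R1 B1 Suc.prems(3) w D] unfolding T1 .
  obtain b where b: "symbol_bounds 0 L w r (\<lambda>x. ?Q ^ N * (?Q * K) * ?I x) b"
    "\<And>x. (LINT z|lborel. osc ?m1 (x - z) * osc (\<lambda>\<xi>. ?a1 (z, \<xi>) * g \<xi>) z) =
      (LINT z|lborel. osc (\<lambda>\<theta>. ?m1 \<theta> * damp c w r \<theta> ^ N) (x - z) * osc (\<lambda>\<xi>. b (z, \<xi>) * g \<xi>) z)"
    using Suc.IH[OF a'(4) m1 B1] Suc.prems(4) Q0 by auto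
  have "?Q ^ N * (?Q * K) = ?Q ^ Suc N * K" by simp
  then have b1: "symbol_bounds 0 L w r (\<lambda>x. ?Q ^ Suc N * K * ?I x) b" using b(1) by (simp only:)
  have m2: "(\<lambda>\<theta>. ?m1 \<theta> * damp c w r \<theta> ^ N) = (\<lambda>\<theta>. m \<theta> * damp c w r \<theta> ^ Suc N)" by (simp add: mult.assoc)
  show ?case by (intro exI[of _ b] conjI allI b1) (simp only: step b(2) m2)
qed

lemma partial_deriv_zero_on_open:
  assumes "open U" "\<And>x. x \<in> U \<Longrightarrow> f x = 0" "x \<in> U"
  shows "(partial_deriv v ^^ b) f x = 0"
  using assms(3)
proof (induction b arbitrary: x)
  case (Suc b)
  have "((partial_deriv v ^^ b) f has_derivative (\<lambda>_. 0)) (at x)"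
    by (rule has_derivative_transform_within_open[OF has_derivative_const[of 0] assms(1) Suc.prems]) (simp add: Suc.IH)
  from frechet_derivative_at[OF this] have "frechet_derivative ((partial_deriv v ^^ b) f) (at x) v = 0" by metis
  then show ?case by (simp add: partial_deriv_def[of v "(partial_deriv v ^^ b) f"])
qed (use assms in auto)

section \<open>The frequency covering\<close>

locale alpha_partition =
  fixes \<alpha> C :: real and \<eta> :: "int ^ 'n::finite \<Rightarrow> real ^ 'n \<Rightarrow> complex"
  assumes \<alpha>: "0 \<le> \<alpha>" "\<alpha> < 1" and C: "1 < C" and dec: "alpha_decomposition \<alpha> C \<eta>"
begin

section \<open>Geometry of the blocks\<close>

definition A :: real where "A = \<alpha> / (1 - \<alpha>)"
definition rad :: "int ^ 'n \<Rightarrow> real" where "rad k = jap (ivec k) powr A"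
definition cen :: "int ^ 'n \<Rightarrow> real ^ 'n" where "cen k = rad k *\<^sub>R ivec k"
definition dst :: "int ^ 'n \<Rightarrow> int ^ 'n \<Rightarrow> real" where "dst k l = jap (ivec k - ivec l)"
text \<open>The exponent \<open>A\<close> rounded up, so that all losses are natural powers of
  \<open>dst\<close>.\<close>

definition e :: nat where "e = nat \<lceil>A\<rceil>"

lemma A_nonneg: "0 \<le> A" using \<alpha> by (simp add: A_def)

lemma dst_ge_1: "1 \<le> dst k l" and dst_pos: "0 < dst k l" and dst_commute: "dst k l = dst l k"
  using jap_ge_1[of "ivec k - ivec l"] jap_pos[of "ivec k - ivec l"] by (auto simp: dst_def jap_def norm_minus_commute)

lemma rad_ge_1: "1 \<le> rad k"
  using A_nonneg jap_ge_1[of "ivec k"] by (simp add: rad_def ge_one_powr_ge_zero)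

lemma rad_pos: "0 < rad k" using rad_ge_1[of k] by linarith

text \<open>The bracket is submultiplicative, and \<open>rad\<close> is its power with the
  nonnegative exponent \<open>A\<close>.\<close>

lemma rad_compare: "rad k \<le> dst k l ^ e * rad l"
proof -
  have "rad k \<le> (dst k l * jap (ivec l)) powr A"
    unfolding rad_def dst_def using A_nonneg jap_pos[of "ivec k"]
    by (intro powr_mono2 jap_triangle) auto
  also have "\<dots> = dst k l powr A * rad l"
    using dst_pos[of k l] jap_pos[of "ivec l"] by (simp add: rad_def powr_mult)
  finally have "rad k \<le> dst k l powr A * rad l" .
  moreover have "dst k l powr A \<le> dst k l ^ e"
  proof -
    have "A \<le> real e" unfolding e_def by (rule real_nat_ceiling_ge)
    then have "dst k l powr A \<le> dst k l powr real e" using dst_ge_1[of k l] by (rule powr_mono)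
    then show ?thesis using dst_pos[of k l] by (simp add: powr_realpow)
  qed
  then have "dst k l powr A * rad l \<le> dst k l ^ e * rad l" using rad_pos[of l] by (intro mult_right_mono) auto
  ultimately show ?thesis by linarith
qed

text \<open>Pairing \<open>cen k - cen l\<close> with \<open>k - l\<close>: the cross term has a sign because \<open>rad\<close> increases with \<open>|k|\<close>.\<close>
lemma cen_separation: "(rad k + rad l) / 2 * norm (ivec k - ivec l) \<le> norm (cen k - cen l)"
proof (cases "ivec k = ivec l")
  case False
  let ?x = "ivec k" and ?y = "ivec l"
  have "(cen k - cen l) \<bullet> (?x - ?y) = (rad k + rad l) / 2 * (norm (?x - ?y))\<^sup>2 + (rad k - rad l) * ((norm ?x)\<^sup>2 - (norm ?y)\<^sup>2) / 2"
    unfolding power2_norm_eq_inner cen_def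
    by (simp add: inner_diff_left inner_diff_right inner_commute[of ?y ?x] field_simps)
  moreover have "0 \<le> (rad k - rad l) * ((norm ?x)\<^sup>2 - (norm ?y)\<^sup>2)"
  proof (cases "norm ?x \<le> norm ?y")
    case True
    then have "rad k \<le> rad l" unfolding rad_def jap_def using A_nonneg by (intro powr_mono2) auto
    moreover have "(norm ?x)\<^sup>2 \<le> (norm ?y)\<^sup>2" using True by (intro power_mono) auto
    ultimately show ?thesis by (intro mult_nonpos_nonpos) auto
  next
    case False
    then have "rad l \<le> rad k" unfolding rad_def jap_def using A_nonneg by (intro powr_mono2) auto
    moreover have "(norm ?y)\<^sup>2 \<le> (norm ?x)\<^sup>2" using False by (intro power_mono) auto
    ultimately show ?thesis by (intro mult_nonneg_nonneg) auto
  qed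
  ultimately have "(rad k + rad l) / 2 * (norm (?x - ?y))\<^sup>2 \<le> (cen k - cen l) \<bullet> (?x - ?y)" by simp
  also have "\<dots> \<le> norm (cen k - cen l) * norm (?x - ?y)" by (rule norm_cauchy_schwarz)
  finally have "((rad k + rad l) / 2 * norm (?x - ?y)) * norm (?x - ?y) \<le> norm (cen k - cen l) * norm (?x - ?y)"
    by (simp add: power2_eq_square mult.assoc)
  then show ?thesis using False by (simp add: mult_le_cancel_right)
qed simp

lemma eta_schwartz: "\<eta> k \<in> schwartz"
  using dec by (simp add: alpha_decomposition_def)

lemma eta_support: "closure {\<xi>. \<eta> k \<xi> \<noteq> 0} \<subseteq> cball (cen k) (C * rad k)"
proof -
  have "closure {\<xi>. \<eta> k \<xi> \<noteq> 0} \<subseteq> {\<xi>. norm (\<xi> - cen k) \<le> C * rad k}"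
    using dec by (simp add: alpha_decomposition_def cen_def rad_def A_def)
  then show ?thesis by (auto simp: dist_norm norm_minus_commute)
qed

lemma eta_zero: "\<xi> \<notin> cball (cen k) (C * rad k) \<Longrightarrow> \<eta> k \<xi> = 0"
  using subsetD[OF closure_subset, of \<xi> "{\<xi>. \<eta> k \<xi> \<noteq> 0}"] subsetD[OF eta_support[of k], of \<xi>] by (auto simp del: mem_cball)

lemma eta_sum: "((\<lambda>k. \<eta> k \<xi>) has_sum 1) UNIV"
  using dec by (simp add: alpha_decomposition_def)

lemma eta_bounds: "\<exists>B>0. \<forall>k. bump_bounds N (rad k) B (cen k) (C * rad k) (\<eta> k)"
proof -
  have "\<exists>B. \<forall>k \<xi>. norm (mderiv (msingle j b) (\<eta> k) \<xi>) \<le> B * jap (ivec k) powr (- real (morder (msingle j b)) * \<alpha> / (1 - \<alpha>))" for j :: 'n and b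
    using dec unfolding alpha_decomposition_def by blast
  then obtain B where B: "\<And>j b k \<xi>. norm (mderiv (msingle j b) (\<eta> k) \<xi>) \<le> B j b * jap (ivec k) powr (- real b * \<alpha> / (1 - \<alpha>))"
    unfolding morder_msingle by metis
  define K where "K = 1 + (\<Sum>j\<in>UNIV. \<Sum>b\<le>N. \<bar>B j b\<bar>)"
  have K: "B j b \<le> K" if "b \<le> N" for j b
  proof -
    have "\<bar>B j b\<bar> \<le> (\<Sum>b\<le>N. \<bar>B j b\<bar>)" using that by (intro member_le_sum) auto
    also have "\<dots> \<le> (\<Sum>j\<in>UNIV. \<Sum>b\<le>N. \<bar>B j b\<bar>)"
      by (rule member_le_sum[of j UNIV "\<lambda>j. \<Sum>b\<le>N. \<bar>B j b\<bar>"]) (auto intro: sum_nonneg)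
    finally show ?thesis unfolding K_def by linarith
  qed
  have Kp: "0 < K" unfolding K_def by (intro add_pos_nonneg sum_nonneg) auto
  have "bump_bounds N (rad k) K (cen k) (C * rad k) (\<eta> k)" for k
    unfolding bump_bounds_def
  proof
    fix v :: "real ^ 'n" assume v: "v \<in> Basis"
    show "deriv_bounds N v (rad k) (\<lambda>\<xi>. K * indicator (cball (cen k) (C * rad k)) \<xi>) (\<eta> k)"
    proof (rule deriv_bounds_funpow)
      show "(partial_deriv v ^^ b) (\<eta> k) differentiable (at x)" for b x
        using eta_schwartz[of k] v by (intro smooth_funpow) (auto simp: schwartz_def)
      fix b \<xi> assume b: "b \<le> N"
      show "norm ((partial_deriv v ^^ b) (\<eta> k) \<xi>) \<le> K * indicator (cball (cen k) (C * rad k)) \<xi> / rad k ^ b"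
      proof (cases "\<xi> \<in> cball (cen k) (C * rad k)")
        case True
        obtain j where j: "v = axis j 1" using v by (rule Basis_vec_cases)
        have "jap (ivec k) powr (- real b * \<alpha> / (1 - \<alpha>)) = rad k powr (- real b)"
          by (simp add: rad_def powr_powr A_def mult.commute)
        also have "\<dots> = 1 / rad k ^ b"
          using rad_pos[of k] by (simp add: powr_minus powr_realpow inverse_eq_divide)
        finally have "norm ((partial_deriv v ^^ b) (\<eta> k) \<xi>) \<le> B j b * (1 / rad k ^ b)"
          using B[of j b k \<xi>] by (simp add: j mderiv_def mderiv_dir_msingle)
        also have "\<dots> \<le> K * (1 / rad k ^ b)"
          using K[OF b] rad_pos[of k] by (intro mult_right_mono) auto
        finally show ?thesis using True by simp
      next
        case False
        \<comment> \<open>Outside the closed ball the function vanishes on an open set, hence so do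
          all its derivatives; this puts the indicator into the bound.\<close>
        have "(partial_deriv v ^^ b) (\<eta> k) \<xi> = 0"
        proof (rule partial_deriv_zero_on_open)
          show "open (- cball (cen k) (C * rad k))" by (rule open_Compl[OF closed_cball])
          show "\<eta> k x = 0" if "x \<in> - cball (cen k) (C * rad k)" for x using that eta_zero by auto
        qed (use False in auto)
        with False show ?thesis by simp
      qed
    qed
  qed
  with Kp show ?thesis by blast
qed

section \<open>Enlarged cutoffs\<close>

text \<open>Neighbours are defined by actual overlap of the functions and not by distance, so that
  at a point where \<open>\<eta> l\<close> is nonzero all nonzero terms of the partition of unity
  have their index in \<open>near l\<close>.\<close>

definition near :: "int ^ 'n \<Rightarrow> (int ^ 'n) set" where
  "near l = {l'. \<exists>\<xi>. \<eta> l \<xi> \<noteq> 0 \<and> \<eta> l' \<xi> \<noteq> 0}"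
text \<open>A fattened cutoff, equal to 1 wherever \<open>\<eta> l\<close> is nonzero. Inserting it
  next to the symbol localises the symbol without changing the block.\<close>

definition etas :: "int ^ 'n \<Rightarrow> real ^ 'n \<Rightarrow> complex" where
  "etas l \<xi> = (\<Sum>l'\<in>near l. \<eta> l' \<xi>)"
text \<open>Bounds the ratio of the radii of overlapping blocks, whose lattice distance is at most 2
  C. \<open>C2\<close> then covers all neighbours of a block: C (rad l' + rad l) for the centres
  plus C rad l' for the ball.\<close>

definition \<rho> :: real where "\<rho> = (1 + 2 * C) ^ e"
definition C2 :: real where "C2 = C * (1 + 2 * \<rho>)"

lemma rho_ge_1: "1 \<le> \<rho>" using C by (simp add: \<rho>_def)

lemma C2_pos: "0 < C2" unfolding C2_def using C rho_ge_1 by (intro mult_pos_pos) auto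

lemma near_cen: "l' \<in> near l \<Longrightarrow> norm (cen l' - cen l) \<le> C * (rad l' + rad l)"
proof -
  assume "l' \<in> near l"
  then obtain \<xi> where "\<eta> l \<xi> \<noteq> 0" "\<eta> l' \<xi> \<noteq> 0" by (auto simp: near_def)
  then have "\<xi> \<in> cball (cen l) (C * rad l)" "\<xi> \<in> cball (cen l') (C * rad l')" using eta_zero by blast+
  then have "dist (cen l') \<xi> + dist \<xi> (cen l) \<le> C * (rad l' + rad l)" by (simp add: dist_commute algebra_simps)
  then show ?thesis using dist_triangle[of "cen l'" "cen l" \<xi>] by (simp add: dist_norm)
qed

text \<open>Overlap gives |cen l' - cen l| <= C (rad l' + rad l), and the separation of the centres
  carries the same sum of radii as a factor. It cancels, so the bound is uniform over all blocks,
  however large.\<close>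

lemma near_dist:
  assumes "l' \<in> near l"
  shows "norm (ivec l' - ivec l) \<le> 2 * C"
proof -
  have "(rad l' + rad l) / 2 * norm (ivec l' - ivec l) \<le> (rad l' + rad l) / 2 * (2 * C)"
    using cen_separation[of l' l] near_cen[OF assms] by (simp add: algebra_simps)
  then show ?thesis using rad_pos[of l] rad_pos[of l'] by (simp add: mult_le_cancel_left)
qed

lemma near_finite: "finite (near l)" "real (card (near l)) \<le> (4 * C + 1) ^ CARD('n)"
proof -
  have sub: "near l \<subseteq> {l'. norm (ivec l' - ivec l) \<le> 2 * C}" using near_dist by auto
  have fin: "finite {l'. norm (ivec l' - ivec l) \<le> 2 * C}" using C by (intro lattice_ball_shift) auto
  show "finite (near l)" using sub fin by (rule finite_subset)
  have "real (card (near l)) \<le> real (card {l'. norm (ivec l' - ivec l) \<le> 2 * C})"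
    using card_mono[OF fin sub] by simp
  also have "\<dots> \<le> (2 * (2 * C) + 1) ^ CARD('n)" using C by (intro lattice_ball_shift) auto
  finally show "real (card (near l)) \<le> (4 * C + 1) ^ CARD('n)" by simp
qed

lemma near_rad:
  assumes "l' \<in> near l"
  shows "rad l' \<le> \<rho> * rad l" "rad l \<le> \<rho> * rad l'"
proof -
  have d: "dst l' l \<le> 1 + 2 * C" using near_dist[OF assms] by (simp add: dst_def jap_def)
  then have p: "dst l' l ^ e \<le> \<rho>" unfolding \<rho>_def using dst_pos[of l' l] by (intro power_mono) auto
  have "dst l' l ^ e * rad l \<le> \<rho> * rad l" "dst l' l ^ e * rad l' \<le> \<rho> * rad l'"
    using p rad_pos[of l] rad_pos[of l'] by (auto intro: mult_right_mono)
  then show "rad l' \<le> \<rho> * rad l" "rad l \<le> \<rho> * rad l'"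
    using rad_compare[of l' l] rad_compare[of l l'] dst_commute[of l l'] by auto
qed

lemma near_cball:
  assumes "l' \<in> near l"
  shows "cball (cen l') (C * rad l') \<subseteq> cball (cen l) (C2 * rad l)"
proof
  fix \<xi> assume \<xi>: "\<xi> \<in> cball (cen l') (C * rad l')"
  have "dist (cen l) \<xi> \<le> dist (cen l) (cen l') + dist (cen l') \<xi>" by (rule dist_triangle)
  also have "\<dots> \<le> C * (rad l' + rad l) + C * rad l'"
    using near_cen[OF assms] \<xi> by (intro add_mono) (auto simp: dist_norm norm_minus_commute)
  also have "\<dots> = C * (2 * rad l' + rad l)" by (simp add: algebra_simps)
  also have "\<dots> \<le> C * (2 * (\<rho> * rad l) + rad l)"
    using near_rad(1)[OF assms] C by (intro mult_left_mono) auto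
  also have "\<dots> = C2 * rad l" by (simp add: C2_def algebra_simps)
  finally show "\<xi> \<in> cball (cen l) (C2 * rad l)" by simp
qed

lemma etas_eq_1:
  assumes "\<eta> l \<xi> \<noteq> 0"
  shows "etas l \<xi> = 1"
proof -
  have "((\<lambda>k. \<eta> k \<xi>) has_sum 1) UNIV \<longleftrightarrow> ((\<lambda>k. \<eta> k \<xi>) has_sum 1) (near l)"
    using assms by (intro has_sum_cong_neutral) (auto simp: near_def)
  with eta_sum[of \<xi>] have "((\<lambda>k. \<eta> k \<xi>) has_sum 1) (near l)" by simp
  moreover have "((\<lambda>k. \<eta> k \<xi>) has_sum (etas l \<xi>)) (near l)"
    unfolding etas_def using near_finite(1) by (rule has_sum_finite)
  ultimately show ?thesis using has_sum_unique by blast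
qed

lemma etas_mult: "etas l \<xi> * (\<eta> l \<xi> * z) = \<eta> l \<xi> * z"
  using etas_eq_1[of l \<xi>] by (cases "\<eta> l \<xi> = 0") auto

text \<open>At most (4 C + 1)^n summands, each rescaled from its own radius to that of
  \<open>l\<close> at the cost of \<open>\<rho> ^ N\<close>.\<close>

lemma etas_bounds: "\<exists>B>0. \<forall>l. bump_bounds N (rad l) B (cen l) (C2 * rad l) (etas l)"
proof -
  obtain B0 where B0: "B0 > 0" "\<And>k. bump_bounds N (rad k) B0 (cen k) (C * rad k) (\<eta> k)" using eta_bounds by blast
  define B where "B = (4 * C + 1) ^ CARD('n) * (\<rho> ^ N * B0)"
  have "bump_bounds N (rad l) B (cen l) (C2 * rad l) (etas l)" for l
    unfolding bump_bounds_def
  proof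
    fix v :: "real ^ 'n" assume v: "v \<in> Basis"
    let ?I = "indicator (cball (cen l) (C2 * rad l)) :: real ^ 'n \<Rightarrow> real"
    have "deriv_bounds N v (rad l) (\<lambda>\<xi>. \<rho> ^ N * B0 * ?I \<xi>) (\<eta> l')" if l': "l' \<in> near l" for l'
    proof (rule deriv_bounds_mono)
      have "deriv_bounds N v (rad l') (\<lambda>\<xi>. B0 * indicator (cball (cen l') (C * rad l')) \<xi>) (\<eta> l')"
        using B0(2) v by (simp add: bump_bounds_def)
      then show "deriv_bounds N v (rad l) (\<lambda>\<xi>. \<rho> ^ N * (B0 * indicator (cball (cen l') (C * rad l')) \<xi>)) (\<eta> l')"
        by (rule deriv_bounds_rescale[OF _ rad_pos rad_pos near_rad(2)[OF l'] rho_ge_1])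
      show "\<rho> ^ N * (B0 * indicator (cball (cen l') (C * rad l')) \<xi>) \<le> \<rho> ^ N * B0 * ?I \<xi>" for \<xi>
        using near_cball[OF l'] B0(1) rho_ge_1 by (auto simp: indicator_def subset_iff)
    qed (rule rad_pos)
    then have "deriv_bounds N v (rad l) (\<lambda>\<xi>. \<Sum>l'\<in>near l. \<rho> ^ N * B0 * ?I \<xi>) (\<lambda>\<xi>. \<Sum>l'\<in>near l. \<eta> l' \<xi>)"
      by (intro deriv_bounds_sum near_finite rad_pos)
    then show "deriv_bounds N v (rad l) (\<lambda>\<xi>. B * ?I \<xi>) (etas l)"
      unfolding etas_def[abs_def]
    proof (rule deriv_bounds_mono[OF _ _ rad_pos])
      fix \<xi>
      have "0 \<le> \<rho> ^ N * B0 * ?I \<xi>" using B0(1) rho_ge_1 by simp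
      from mult_right_mono[OF near_finite(2)[of l] this]
      show "(\<Sum>l'\<in>near l. \<rho> ^ N * B0 * ?I \<xi>) \<le> B * ?I \<xi>" by (simp add: B_def mult.assoc)
    qed
  qed
  moreover have "0 < B" unfolding B_def using B0(1) rho_ge_1 C by (intro mult_pos_pos zero_less_power) auto
  ultimately show ?thesis by blast
qed

section \<open>Symbols restricted to a block\<close>

text \<open>Since (A + 1) alpha = A, the radius is X^alpha with X = <l>^(A+1), so it suffices that
  <\<xi>> is comparable with X. The upper bound is the triangle inequality; the lower one is
  delicate only where the ball of radius C2 rad l may reach the origin.\<close>

lemma jap_compare:
  "\<exists>Q\<ge>1. \<forall>l. \<forall>\<xi>\<in>cball (cen l) (C2 * rad l). rad l \<le> Q * jap \<xi> powr \<alpha> \<and> jap \<xi> powr \<alpha> \<le> Q * rad l"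
proof -
  \<comment> \<open>The two entries answer the two cases of the lower bound: 2 for large <l>, and
    the largest possible value of X for small <l>.\<close>
  define Y where "Y = max 2 ((2 * C2 + 2) powr (A + 1))"
  define Q where "Q = max ((1 + C2) powr \<alpha>) (Y powr \<alpha>)"
  have Y: "2 \<le> Y" "(2 * C2 + 2) powr (A + 1) \<le> Y" by (auto simp: Y_def)
  have "1 \<le> Y powr \<alpha>" using Y(1) \<alpha> by (intro ge_one_powr_ge_zero) auto
  then have Q: "1 \<le> Q" by (simp add: Q_def)
  have "(A + 1) * \<alpha> = A" using \<alpha> by (simp add: A_def field_simps)
  have main: "rad l \<le> Q * jap \<xi> powr \<alpha> \<and> jap \<xi> powr \<alpha> \<le> Q * rad l" if \<xi>: "\<xi> \<in> cball (cen l) (C2 * rad l)" for l \<xi>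
  proof -
    let ?J = "jap (ivec l)"
    define X where "X = ?J powr (A + 1)"
    have J: "1 \<le> ?J" by (rule jap_ge_1)
    have Xr: "X = rad l * ?J" using J by (simp add: X_def rad_def powr_add)
    have rX: "rad l = X powr \<alpha>" by (simp add: X_def rad_def powr_powr \<open>(A + 1) * \<alpha> = A\<close>)
    have X0: "0 < X" using J by (simp add: X_def)
    have nc: "norm (cen l) = rad l * (?J - 1)" using rad_pos[of l] by (simp add: cen_def jap_def)
    have d: "norm (\<xi> - cen l) \<le> C2 * rad l" using \<xi> by (simp add: dist_norm norm_minus_commute)
    have rX': "rad l \<le> X" unfolding Xr using J rad_pos[of l] by simp
    have "jap \<xi> \<le> 1 + norm (cen l) + C2 * rad l"
      using d norm_triangle_ineq[of "cen l" "\<xi> - cen l"] by (simp add: jap_def)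
    also have "\<dots> = 1 - rad l + X + C2 * rad l" unfolding nc Xr by (simp add: algebra_simps)
    also have "\<dots> \<le> X + C2 * X" using rad_ge_1[of l] rX' C2_pos by (intro add_mono mult_left_mono) auto
    finally have up: "jap \<xi> \<le> (1 + C2) * X" by (simp add: algebra_simps)
    have "jap \<xi> powr \<alpha> \<le> ((1 + C2) * X) powr \<alpha>"
      using up \<alpha> jap_pos[of \<xi>] by (intro powr_mono2) auto
    also have "\<dots> = (1 + C2) powr \<alpha> * rad l" unfolding rX using C2_pos X0 by (simp add: powr_mult)
    also have "\<dots> \<le> Q * rad l" using rad_pos[of l] by (intro mult_right_mono) (auto simp: Q_def)
    finally have 1: "jap \<xi> powr \<alpha> \<le> Q * rad l" .
    have low: "X \<le> Y * jap \<xi>"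
    \<comment> \<open>Beyond this threshold |cen l| = rad l (<l> - 1) exceeds C2 rad l by at least
      rad l <l> / 2, which is X / 2. Below it X is bounded and <\<xi>> >= 1 suffices.\<close>
    proof (cases "2 * C2 + 2 \<le> ?J")
      case True
      have "norm (cen l) \<le> norm \<xi> + C2 * rad l"
        using d norm_triangle_ineq4[of \<xi> "\<xi> - cen l"] by simp
      then have "rad l * (?J - 1 - C2) \<le> norm \<xi>" unfolding nc by (simp add: algebra_simps)
      moreover have "rad l * (?J / 2) \<le> rad l * (?J - 1 - C2)" using True rad_pos[of l] by (intro mult_left_mono) auto
      ultimately have "X \<le> 2 * norm \<xi>" unfolding Xr by simp
      also have "\<dots> \<le> Y * jap \<xi>" using Y by (intro mult_mono) (auto simp: jap_def)
      finally show ?thesis .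
    next
      case False
      then have "X \<le> (2 * C2 + 2) powr (A + 1)" unfolding X_def using J A_nonneg by (intro powr_mono2) auto
      also have "\<dots> \<le> Y * 1" using Y by simp
      also have "\<dots> \<le> Y * jap \<xi>" using Y jap_ge_1[of \<xi>] by (intro mult_left_mono) auto
      finally show ?thesis .
    qed
    have "rad l \<le> (Y * jap \<xi>) powr \<alpha>" unfolding rX using low X0 \<alpha> by (intro powr_mono2) auto
    also have "\<dots> = Y powr \<alpha> * jap \<xi> powr \<alpha>" using Y jap_pos[of \<xi>] by (simp add: powr_mult)
    also have "\<dots> \<le> Q * jap \<xi> powr \<alpha>" by (intro mult_right_mono) (auto simp: Q_def)
    finally show ?thesis using 1 by blast
  qed
  with Q show ?thesis by blast
qed

text \<open>On the enlarged block each power of <\<xi>>^alpha is exchanged for a power of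
  \<open>rad l\<close> at the price of one factor \<open>Q\<close>, in the numerator as in the
  denominator; hence \<open>Q ^ (M + L)\<close>.\<close>

lemma symbol_derivative_bound:
  assumes \<sigma>: "\<sigma> \<in> symbol_class 0 \<alpha> \<alpha>"
  shows "\<exists>K\<ge>0. \<forall>l a b. \<forall>w\<in>Basis. \<forall>v\<in>Basis. \<forall>z. \<forall>\<xi>\<in>cball (cen l) (C2 * rad l). a \<le> M \<longrightarrow> b \<le> L \<longrightarrow>
     norm ((partial_deriv (0, v) ^^ b) ((partial_deriv (w, 0) ^^ a) \<sigma>) (z, \<xi>)) \<le> K * rad l ^ a / rad l ^ b"
proof -
  obtain Q where Q: "Q \<ge> 1" "\<And>l \<xi>. \<xi> \<in> cball (cen l) (C2 * rad l) \<Longrightarrow> rad l \<le> Q * jap \<xi> powr \<alpha>"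
    "\<And>l \<xi>. \<xi> \<in> cball (cen l) (C2 * rad l) \<Longrightarrow> jap \<xi> powr \<alpha> \<le> Q * rad l"
    using jap_compare by metis
  have sm: "smooth \<sigma>" using \<sigma> by (simp add: symbol_class_def)
  have ex: "\<exists>B. \<forall>x \<xi>. norm (mderiv_fst (msingle j a) (mderiv_snd (msingle i b) \<sigma>) (x, \<xi>))
      \<le> B * jap \<xi> powr (0 + \<alpha> * real (morder (msingle j a)) - \<alpha> * real (morder (msingle i b)))" for j i :: 'n and a b
    using \<sigma> unfolding symbol_class_def by blast
  define B where "B j i a b = (SOME B. \<forall>x \<xi>. norm (mderiv_fst (msingle j a) (mderiv_snd (msingle i b) \<sigma>) (x, \<xi>))
      \<le> B * jap \<xi> powr (0 + \<alpha> * real (morder (msingle j a)) - \<alpha> * real (morder (msingle i b))))" for j i :: 'n and a b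
  have B: "norm (mderiv_fst (msingle j a) (mderiv_snd (msingle i b) \<sigma>) (x, \<xi>))
      \<le> B j i a b * jap \<xi> powr (\<alpha> * real a - \<alpha> * real b)" for j i :: 'n and a b x \<xi>
    using someI_ex[OF ex, of j a i b] unfolding B_def by (simp add: morder_msingle)
  define K0 where "K0 = (\<Sum>(j, i, a, b)\<in>UNIV \<times> UNIV \<times> {..M} \<times> {..L}. \<bar>B j i a b\<bar>)"
  have K0: "B j i a b \<le> K0" if "a \<le> M" "b \<le> L" for j i a b
  proof -
    have "(\<lambda>(j, i, a, b). \<bar>B j i a b\<bar>) (j, i, a, b) \<le> K0"
      unfolding K0_def using that by (intro member_le_sum) auto
    then show ?thesis by simp
  qed
  have K0p: "0 \<le> K0" unfolding K0_def by (intro sum_nonneg) auto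
  have main: "norm ((partial_deriv (0, v) ^^ b) ((partial_deriv (w, 0) ^^ a) \<sigma>) (z, \<xi>)) \<le> K0 * Q ^ (M + L) * rad l ^ a / rad l ^ b"
    if w: "w \<in> Basis" and v: "v \<in> Basis" and \<xi>: "\<xi> \<in> cball (cen l) (C2 * rad l)" and ab: "a \<le> M" "b \<le> L" for l a b w v z \<xi>
  proof -
    obtain j i where j: "w = axis j 1" and i: "v = axis i 1" using Basis_vec_cases w v by metis
    let ?p = "jap \<xi> powr \<alpha>"
    have p0: "0 < ?p" using jap_pos[of \<xi>] by simp
    have "(partial_deriv (0, v) ^^ b) ((partial_deriv (w, 0) ^^ a) \<sigma>) = mderiv_fst (msingle j a) (mderiv_snd (msingle i b) \<sigma>)"
      using smooth_commute_funpow[OF sm, of "(w, 0)" "(0, v)" b a] w v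
      by (simp add: mderiv_fst_def mderiv_snd_def mderiv_dir_msingle i j Basis_prod_def)
    then have "norm ((partial_deriv (0, v) ^^ b) ((partial_deriv (w, 0) ^^ a) \<sigma>) (z, \<xi>)) \<le> K0 * jap \<xi> powr (\<alpha> * real a - \<alpha> * real b)"
      using order_trans[OF B mult_right_mono[OF K0[OF ab]]] by simp
    also have "jap \<xi> powr (\<alpha> * real a - \<alpha> * real b) = ?p ^ a / ?p ^ b"
      using p0 by (simp add: powr_diff powr_powr[symmetric] powr_realpow)
    also have "K0 * (?p ^ a / ?p ^ b) \<le> K0 * ((Q * rad l) ^ a / (rad l / Q) ^ b)"
    proof (intro mult_left_mono frac_le power_mono)
      show "rad l / Q \<le> ?p" using Q(2)[OF \<xi>] Q(1) by (simp add: pos_divide_le_eq mult.commute)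
    qed (use K0p p0 Q(3)[OF \<xi>] Q(1) rad_pos[of l] in auto)
    also have "\<dots> = K0 * (Q ^ (a + b) * (rad l ^ a / rad l ^ b))"
      using Q(1) rad_pos[of l] by (simp add: power_mult_distrib power_divide power_add)
    also have "\<dots> \<le> K0 * (Q ^ (M + L) * (rad l ^ a / rad l ^ b))"
      using Q(1) ab K0p rad_pos[of l] by (intro mult_left_mono mult_right_mono power_increasing) auto
    finally show ?thesis by (simp add: mult.assoc)
  qed
  have "0 \<le> K0 * Q ^ (M + L)" using K0p Q(1) by simp
  with main show ?thesis by (intro exI[of _ "K0 * Q ^ (M + L)"]) simp
qed

lemma symbol_localized:
  assumes \<sigma>: "\<sigma> \<in> symbol_class 0 \<alpha> \<alpha>"
  shows "\<exists>K\<ge>0. \<forall>l. \<forall>w\<in>Basis. symbol_bounds M L w (rad l) (\<lambda>x. K * indicator (cball (cen l) (C2 * rad l)) (snd x)) (\<lambda>x. etas l (snd x) * \<sigma> x)"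
proof -
  have sm: "smooth \<sigma>" using \<sigma> by (simp add: symbol_class_def)
  obtain K where K0: "K \<ge> 0" and Kall: "\<forall>l a b. \<forall>w\<in>Basis. \<forall>v\<in>Basis. \<forall>z. \<forall>\<xi>\<in>cball (cen l) (C2 * rad l). a \<le> M \<longrightarrow> b \<le> L \<longrightarrow>
     norm ((partial_deriv (0, v) ^^ b) ((partial_deriv (w, 0) ^^ a) \<sigma>) (z, \<xi>)) \<le> K * rad l ^ a / rad l ^ b"
    using symbol_derivative_bound[OF \<sigma>, of M L] by (elim exE conjE) (rule that)
  obtain Be where Be: "Be > 0" "\<And>l. bump_bounds L (rad l) Be (cen l) (C2 * rad l) (etas l)" using etas_bounds by metis
  define n where "n = real (Suc M) * real (Suc L) * real DIM(real ^ 'n)"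
  define K1 where "K1 = 2 ^ L * Be * (n * K)"
  have "symbol_bounds M L w (rad l) (\<lambda>x. K1 * indicator (cball (cen l) (C2 * rad l)) (snd x)) (\<lambda>x. etas l (snd x) * \<sigma> x)"
    if w: "w \<in> Basis" for l w
  proof -
    let ?r = "rad l" and ?S = "cball (cen l) (C2 * rad l)"
    let ?D = "\<lambda>a b v x. norm ((partial_deriv (0, v) ^^ b) ((partial_deriv (w, 0) ^^ a) \<sigma>) x)"
    \<comment> \<open>\<open>symbol_bounds\<close> requires a majorant at every frequency, while the
      symbol obeys the scale \<open>rad l\<close> only near the block. The sum of the normalised
      derivatives is a majorant by construction; it is estimated by a constant on the ball of
      \<open>etas l\<close> after the product has been formed.\<close>
    define Bf where "Bf x = (\<Sum>a\<le>M. \<Sum>b\<le>L. \<Sum>v\<in>Basis. ?r ^ b / ?r ^ a * ?D a b v x)" for x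
    have r: "0 < ?r" by (rule rad_pos)
    have "symbol_bounds M L w ?r Bf \<sigma>"
    proof (rule symbol_bounds_smooth[OF sm w])
      fix a b x and v :: "real ^ 'n" assume ab: "a \<le> M" "b \<le> L" and v: "v \<in> Basis"
      let ?g = "\<lambda>a b v. ?r ^ b / ?r ^ a * ?D a b v x"
      have g0: "0 \<le> ?g a b v" for a b v using r by simp
      have "?g a b v \<le> (\<Sum>v\<in>Basis. ?g a b v)" using v g0 by (intro member_le_sum) auto
      also have "\<dots> \<le> (\<Sum>b\<le>L. \<Sum>v\<in>Basis. ?g a b v)"
        using ab g0 by (intro member_le_sum[of b "{..L}" "\<lambda>b. \<Sum>v\<in>Basis. ?g a b v"] sum_nonneg) auto
      also have "\<dots> \<le> Bf x"
        unfolding Bf_def using ab g0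
        by (intro member_le_sum[of a "{..M}" "\<lambda>a. \<Sum>b\<le>L. \<Sum>v\<in>Basis. ?g a b v"] sum_nonneg) auto
      finally show "?D a b v x \<le> Bf x * ?r ^ a / ?r ^ b" using r by (simp add: field_simps)
    qed
    moreover have "deriv_bounds L (0, v) ?r (\<lambda>x. Be * indicator ?S (snd x)) (\<lambda>x. etas l (snd x))" if "v \<in> Basis" for v
      using deriv_bounds_snd[of L v ?r "\<lambda>\<xi>. Be * indicator ?S \<xi>" "etas l" 0] Be(2) that by (simp add: bump_bounds_def)
    moreover have "dirderiv (w, 0) (\<lambda>x. etas l (snd x)) (\<lambda>_. 0)" by (simp add: dirderiv_def)
    ultimately have "symbol_bounds M L w ?r (\<lambda>x. 2 ^ L * (Be * indicator ?S (snd x)) * Bf x) (\<lambda>x. etas l (snd x) * \<sigma> x)"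
      by (intro symbol_bounds_mult r)
    then show ?thesis
    proof (rule symbol_bounds_mono[OF _ _ r])
      fix x
      show "2 ^ L * (Be * indicator ?S (snd x)) * Bf x \<le> K1 * indicator ?S (snd x)"
      proof (cases "snd x \<in> ?S")
        case True
        have "Bf x \<le> (\<Sum>a\<le>M. \<Sum>b\<le>L. \<Sum>v\<in>(Basis :: (real ^ 'n) set). K)"
          unfolding Bf_def
        proof (intro sum_mono)
          fix a b and v :: "real ^ 'n" assume "a \<in> {..M}" "b \<in> {..L}" "v \<in> Basis"
          then have "?D a b v (fst x, snd x) \<le> K * ?r ^ a / ?r ^ b" using Kall w True by blast
          then have "?r ^ b / ?r ^ a * ?D a b v x \<le> ?r ^ b / ?r ^ a * (K * ?r ^ a / ?r ^ b)"
            using r by (intro mult_left_mono) auto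
          then show "?r ^ b / ?r ^ a * ?D a b v x \<le> K" using r by simp
        qed
        also have "\<dots> = n * K" by (simp add: n_def)
        finally have "2 ^ L * Be * Bf x \<le> K1" unfolding K1_def using Be(1) by (intro mult_left_mono) auto
        with True show ?thesis by simp
      qed simp
    qed
  qed
  moreover have "0 \<le> K1" unfolding K1_def n_def using Be(1) K0 by simp
  ultimately show ?thesis by blast
qed

text \<open>Some coordinate direction carries at least 1/d of the distance of the centres. If |k -
  l| > 4 d C, the radius C rad k of the support uses up at most half of the resulting lower bound;
  for closer indices the trivial bound 1 is enough.\<close>

lemma damp_on_support:
  "\<exists>E>0. \<forall>k l. \<exists>w\<in>Basis. \<forall>\<theta>\<in>cball (cen k) (C * rad k). norm (damp (cen l) w (rad l) \<theta>) \<le> E / dst k l"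
proof -
  let ?d = "real DIM(real ^ 'n)"
  have d: "1 \<le> ?d" by (simp add: Suc_leI)
  \<comment> \<open>For close indices \<open>dst k l\<close> is at most this number, so the claimed
    bound is at least 1. For distant ones 4 d C < |k - l| turns 4 d / |k - l| into E / (1 + |k -
    l|).\<close>
  define E where "E = 1 + 4 * ?d * C"
  have E: "4 * ?d < E" "1 + 4 * ?d * C \<le> E" "0 < E"
  proof -
    have "4 * ?d * 1 \<le> 4 * ?d * C" using C d by (intro mult_left_mono) auto
    with d show "4 * ?d < E" "1 + 4 * ?d * C \<le> E" "0 < E" unfolding E_def by linarith+
  qed
  have "\<exists>w\<in>Basis. \<forall>\<theta>\<in>cball (cen k) (C * rad k). norm (damp (cen l) w (rad l) \<theta>) \<le> E / dst k l" for k l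
  proof (cases "norm (ivec k - ivec l) \<le> 4 * ?d * C")
    case True
    obtain w :: "real ^ 'n" where "w \<in> Basis" using nonempty_Basis by blast
    moreover have "1 \<le> E / dst k l" using True E dst_pos[of k l] by (simp add: dst_def jap_def)
    ultimately show ?thesis using norm_damp_le_1 order_trans by blast
  next
    case False
    let ?N = "norm (ivec k - ivec l)"
    have "\<exists>w\<in>Basis. norm (cen k - cen l) / ?d \<le> \<bar>(cen k - cen l) \<bullet> w\<bar>"
    proof (rule ccontr)
      assume "\<not> ?thesis"
      then have "(\<Sum>w\<in>Basis. \<bar>(cen k - cen l) \<bullet> w\<bar>) < (\<Sum>w\<in>(Basis :: (real ^ 'n) set). norm (cen k - cen l) / ?d)"
        by (intro sum_strict_mono) (auto simp: not_le)
      then show False using norm_le_l1[of "cen k - cen l"] d by simp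
    qed
    then obtain w where w: "w \<in> Basis" "norm (cen k - cen l) / ?d \<le> \<bar>(cen k - cen l) \<bullet> w\<bar>" by blast
    have s0: "0 < ?N / (4 * ?d)" using False C d by (smt (verit) divide_pos_pos mult_pos_pos)
    have "norm (damp (cen l) w (rad l) \<theta>) \<le> E / dst k l" if \<theta>: "\<theta> \<in> cball (cen k) (C * rad k)" for \<theta>
    proof -
      have "\<bar>(\<theta> - cen k) \<bullet> w\<bar> \<le> C * rad k"
        using \<theta> Basis_le_norm[OF w(1), of "\<theta> - cen k"] by (simp add: dist_norm norm_minus_commute)
      moreover have "C * rad k \<le> (rad k + rad l) * ?N / (4 * ?d)"
      proof -
        have "C * (4 * ?d) \<le> ?N" using False by (simp add: mult_ac)
        then have "C \<le> ?N / (4 * ?d)" using d by (simp add: pos_le_divide_eq)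
        then have "C * rad k \<le> ?N / (4 * ?d) * (rad k + rad l)"
          using s0 rad_pos[of k] rad_pos[of l] by (intro mult_mono) auto
        then show ?thesis by (simp add: mult_ac)
      qed
      moreover have "(rad k + rad l) * ?N / (2 * ?d) \<le> \<bar>(cen k - cen l) \<bullet> w\<bar>"
      proof -
        have "(rad k + rad l) / 2 * ?N / ?d \<le> norm (cen k - cen l) / ?d"
          using cen_separation d by (intro divide_right_mono) auto
        with w(2) show ?thesis by simp
      qed
      moreover have "(cen k - cen l) \<bullet> w = (\<theta> - cen l) \<bullet> w - (\<theta> - cen k) \<bullet> w" by (simp add: inner_diff_left)
      moreover have "(rad k + rad l) * ?N / (2 * ?d) = 2 * ((rad k + rad l) * ?N / (4 * ?d))" by simp
      ultimately have "(rad k + rad l) * ?N / (4 * ?d) \<le> \<bar>(\<theta> - cen l) \<bullet> w\<bar>" by linarith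
      moreover have "rad l * (?N / (4 * ?d)) \<le> (rad k + rad l) * ?N / (4 * ?d)"
        using rad_pos[of k] d by (simp add: divide_right_mono mult_right_mono)
      ultimately have "rad l * (?N / (4 * ?d)) \<le> \<bar>(\<theta> - cen l) \<bullet> w\<bar>" by linarith
      then have "?N / (4 * ?d) \<le> \<bar>(\<theta> - cen l) \<bullet> w\<bar> / rad l"
        by (simp only: pos_le_divide_eq[OF rad_pos] mult.commute[of _ "rad l"])
      then have "?N / (4 * ?d) \<le> \<bar>(\<theta> - cen l) \<bullet> w / rad l\<bar>"
        using rad_pos[of l] by (simp only: abs_divide abs_of_pos)
      from norm_damp_le[OF s0 this] have "norm (damp (cen l) w (rad l) \<theta>) \<le> 4 * ?d / ?N" by simp
      also have "4 * ?d / ?N \<le> E / dst k l"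
      proof -
        have "4 * ?d * (1 + ?N) \<le> E * ?N"
        proof -
          have "4 * ?d * C < ?N" using False by simp
          moreover have dC: "4 * ?d \<le> 4 * ?d * C" using C d by simp
          moreover have "4 * ?d * ?N \<le> 4 * ?d * C * ?N" by (rule mult_right_mono[OF dC]) simp
          moreover have "4 * ?d * (1 + ?N) = 4 * ?d + 4 * ?d * ?N" "E * ?N = ?N + 4 * ?d * C * ?N"
            by (simp_all only: E_def distrib_left distrib_right mult_1_left mult_1_right)
          ultimately show ?thesis by linarith
        qed
        moreover have "0 < ?N" using s0 d by (simp add: zero_less_divide_iff)
        moreover have p: "0 < 1 + ?N" by (simp add: add_pos_nonneg)
        ultimately have "4 * ?d \<le> E / (1 + ?N) * ?N" by (simp only: pos_le_divide_eq[OF p] times_divide_eq_left)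
        then show ?thesis using \<open>0 < ?N\<close> by (simp only: pos_divide_le_eq dst_def jap_def)
      qed
      finally show ?thesis .
    qed
    with w(1) show ?thesis by blast
  qed
  with E(3) show ?thesis by blast
qed

end

section \<open>Almost orthogonality of the frequency blocks\<close>

context alpha_partition
begin

text \<open>Measuring the derivatives of \<open>\<eta> k\<close> at scale \<open>rad l\<close> costs
  \<open>dst\<close> to the power e L, and replacing rad k by rad l in the volume of its support
  costs the power e d. The surplus e L + e d factors of \<open>damp\<close> pay for both, and
  \<open>N\<close> powers of decay remain. The first conjunct, with an unspecific constant, provides
  the integrability of the kernel of \<open>\<eta> k\<close>.\<close>

lemma osc_kernel_bound:
  "\<exists>D>0. \<forall>k l. \<exists>w\<in>Basis. \<forall>x. bump_bounds (DIM(real ^ 'n) + 2) (rad l) ((dst k l ^ e) ^ L * D) (cen k) (C * rad k) (\<eta> k) \<and>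
     norm (osc (\<lambda>\<theta>. \<eta> k \<theta> * damp (cen l) w (rad l) \<theta> ^ (N + e * L + e * DIM(real ^ 'n))) x) \<le>
       (D / dst k l ^ N) * rad l ^ DIM(real ^ 'n) / (1 + rad l * norm x) ^ L"
  if L: "DIM(real ^ 'n) + 2 \<le> L"
proof -
  let ?d = "DIM(real ^ 'n)"
  define N1 where "N1 = N + e * L + e * ?d"
  obtain B where B: "B > 0" "\<And>k. bump_bounds L (rad k) B (cen k) (C * rad k) (\<eta> k)" using eta_bounds by metis
  obtain E where E: "E > 0" "\<And>k l. \<exists>w\<in>Basis. \<forall>\<theta>\<in>cball (cen k) (C * rad k). norm (damp (cen l) w (rad l) \<theta>) \<le> E / dst k l"
    using damp_on_support by blast
  show ?thesis
  proof (rule bump_bounds_mult_damp_power[where 'a="real ^ 'n" and L=L and N=N1])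
    fix K assume K: "0 \<le> K" and H: "\<And>r c w B E c1 R m. r > 0 \<Longrightarrow> w \<in> Basis \<Longrightarrow> B \<ge> 0 \<Longrightarrow> bump_bounds L r B c1 R m \<Longrightarrow>
       (\<And>\<theta>. \<theta> \<in> cball c1 R \<Longrightarrow> norm (damp c w r \<theta>) \<le> E) \<Longrightarrow> 0 \<le> E \<Longrightarrow>
       bump_bounds L r (K * B * E ^ N1) c1 R (\<lambda>\<theta>::real ^ 'n. m \<theta> * damp c w r \<theta> ^ N1)"
    define G where "G = (1 + real ?d) ^ Suc L"
    define D0 where "D0 = G * (K * B * E ^ N1 * (2 * C) ^ ?d)"
    have G: "0 \<le> G" by (simp add: G_def)
    have D0: "0 \<le> D0" unfolding D0_def using G K B(1) E(1) C by simp
    have main: "\<exists>w\<in>Basis. \<forall>x. bump_bounds L (rad l) ((dst k l ^ e) ^ L * B) (cen k) (C * rad k) (\<eta> k) \<and>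
      norm (osc (\<lambda>\<theta>. \<eta> k \<theta> * damp (cen l) w (rad l) \<theta> ^ N1) x) \<le> (D0 / dst k l ^ N) * rad l ^ ?d / (1 + rad l * norm x) ^ L" for k l
    proof -
      let ?J = "dst k l" and ?r = "rad l"
      have J: "1 \<le> ?J" "0 < ?J" by (rule dst_ge_1, rule dst_pos)
      have Je: "1 \<le> ?J ^ e" using J(1) by (rule one_le_power)
      have bb: "bump_bounds L ?r ((?J ^ e) ^ L * B) (cen k) (C * rad k) (\<eta> k)"
        unfolding bump_bounds_def
      proof
        fix v :: "real ^ 'n" assume "v \<in> Basis"
        then have "deriv_bounds L v (rad k) (\<lambda>\<xi>. B * indicator (cball (cen k) (C * rad k)) \<xi>) (\<eta> k)"
          using B(2) by (simp add: bump_bounds_def)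
        from deriv_bounds_rescale[OF this rad_pos rad_pos[of l] _ Je] rad_compare[of l k]
        show "deriv_bounds L v ?r (\<lambda>\<xi>. (?J ^ e) ^ L * B * indicator (cball (cen k) (C * rad k)) \<xi>) (\<eta> k)"
          by (simp add: dst_commute[of l k] mult.assoc)
      qed
      obtain w where w: "w \<in> Basis" "\<And>\<theta>. \<theta> \<in> cball (cen k) (C * rad k) \<Longrightarrow> norm (damp (cen l) w ?r \<theta>) \<le> E / ?J"
        using E(2) by blast
      let ?B' = "K * ((?J ^ e) ^ L * B) * (E / ?J) ^ N1"
      have m: "bump_bounds L ?r ?B' (cen k) (C * rad k) (\<lambda>\<theta>. \<eta> k \<theta> * damp (cen l) w ?r \<theta> ^ N1)"
        by (rule H[OF rad_pos w(1) _ bb w(2)]) (use B(1) J E(1) in auto)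
      have B'0: "0 \<le> ?B'" using K B(1) J E(1) by simp
      have "norm (osc (\<lambda>\<theta>. \<eta> k \<theta> * damp (cen l) w ?r \<theta> ^ N1) x) \<le> (D0 / ?J ^ N) * ?r ^ ?d / (1 + ?r * norm x) ^ L" for x
      proof -
        have "norm (osc (\<lambda>\<theta>. \<eta> k \<theta> * damp (cen l) w ?r \<theta> ^ N1) x) \<le> G * (?B' * (2 * (C * rad k)) ^ ?d) / (1 + ?r * norm x) ^ L"
          unfolding G_def by (rule osc_decay[OF m rad_pos _ B'0]) (use C rad_pos[of k] in simp)
        also have "\<dots> \<le> G * (?B' * (2 * (C * (?J ^ e * ?r))) ^ ?d) / (1 + ?r * norm x) ^ L"
          using rad_compare[of k l] C rad_pos[of k] rad_pos[of l] G B'0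
          by (intro divide_right_mono mult_left_mono power_mono) auto
        also have "G * (?B' * (2 * (C * (?J ^ e * ?r))) ^ ?d) = (D0 / ?J ^ N) * ?r ^ ?d"
        proof -
          have "?J ^ N1 = ?J ^ N * (?J ^ e) ^ L * (?J ^ e) ^ ?d" by (simp add: N1_def power_add power_mult)
          then show ?thesis using J(2) by (simp add: D0_def power_mult_distrib power_divide field_simps)
        qed
        finally show ?thesis .
      qed
      with bb w(1) show ?thesis by blast
    qed
    \<comment> \<open>One constant for the kernel bound and for the bump bound.\<close>
    define D where "D = D0 + B"
    have "\<exists>w\<in>Basis. \<forall>x. bump_bounds (?d + 2) (rad l) ((dst k l ^ e) ^ L * D) (cen k) (C * rad k) (\<eta> k) \<and>
      norm (osc (\<lambda>\<theta>. \<eta> k \<theta> * damp (cen l) w (rad l) \<theta> ^ N1) x) \<le> (D / dst k l ^ N) * rad l ^ ?d / (1 + rad l * norm x) ^ L" for k l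
    proof -
      obtain w where w: "w \<in> Basis" "bump_bounds L (rad l) ((dst k l ^ e) ^ L * B) (cen k) (C * rad k) (\<eta> k)"
        "\<And>x. norm (osc (\<lambda>\<theta>. \<eta> k \<theta> * damp (cen l) w (rad l) \<theta> ^ N1) x) \<le> (D0 / dst k l ^ N) * rad l ^ ?d / (1 + rad l * norm x) ^ L"
        using main by blast
      have b2: "bump_bounds (?d + 2) (rad l) ((dst k l ^ e) ^ L * D) (cen k) (C * rad k) (\<eta> k)"
        unfolding bump_bounds_def
      proof
        fix v :: "real ^ 'n" assume "v \<in> Basis"
        with bump_bounds_le[OF w(2) L] have "deriv_bounds (?d + 2) v (rad l) (\<lambda>\<xi>. (dst k l ^ e) ^ L * B * indicator (cball (cen k) (C * rad k)) \<xi>) (\<eta> k)"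
          by (simp add: bump_bounds_def)
        then show "deriv_bounds (?d + 2) v (rad l) (\<lambda>\<xi>. (dst k l ^ e) ^ L * D * indicator (cball (cen k) (C * rad k)) \<xi>) (\<eta> k)"
          by (rule deriv_bounds_mono[OF _ _ rad_pos])
             (use D0 dst_pos[of k l] in \<open>auto simp: D_def intro!: mult_right_mono mult_left_mono\<close>)
      qed
      have "(D0 / dst k l ^ N) * rad l ^ ?d / (1 + rad l * norm x) ^ L \<le> (D / dst k l ^ N) * rad l ^ ?d / (1 + rad l * norm x) ^ L" for x
        using B(1) dst_pos[of k l] rad_pos[of l]
        by (intro divide_right_mono mult_right_mono) (auto simp: D_def)
      then show ?thesis using w(1) w(3) b2 order_trans by blast
    qed
    moreover have "0 < D" using D0 B(1) by (simp add: D_def)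
    ultimately show ?thesis unfolding N1_def by blast
  qed
qed

text \<open>After \<open>N1\<close> integrations by parts the expression is a double convolution of
  the block function with kernels that both have scale \<open>rad l\<close> and decay L = M + d + 2.
  Each convolution preserves the Peetre weight, so the maximal function at \<open>x\<close> controls
  the result.\<close>

lemma core_estimate:
  assumes \<sigma>: "\<sigma> \<in> symbol_class 0 \<alpha> \<alpha>"
  shows "\<exists>K>0. \<forall>k l g F x. integrable lborel g \<longrightarrow> 0 \<le> F \<longrightarrow> (\<forall>y. norm (complex_of_real (1 / (2 * pi) ^ DIM(real ^ 'n)) * osc g y) \<le> F * (1 + rad l * norm (x - y)) ^ M) \<longrightarrow>
    norm (LINT z|lborel. osc (\<eta> k) (x - z) * osc (\<lambda>\<xi>. etas l \<xi> * \<sigma> (z, \<xi>) * g \<xi>) z) \<le> K * F / dst k l ^ N"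
proof -
  let ?d = "DIM(real ^ 'n)"
  define L where "L = M + (?d + 2)"
  define N1 where "N1 = N + e * L + e * ?d"
  have Ld: "?d + 2 \<le> L" by (simp add: L_def)
  obtain D where D0: "D > 0" and Dall: "\<forall>k l. \<exists>w\<in>Basis. \<forall>x. bump_bounds (?d + 2) (rad l) ((dst k l ^ e) ^ L * D) (cen k) (C * rad k) (\<eta> k) \<and>
     norm (osc (\<lambda>\<theta>. \<eta> k \<theta> * damp (cen l) w (rad l) \<theta> ^ N1) x) \<le> (D / dst k l ^ N) * rad l ^ ?d / (1 + rad l * norm x) ^ L"
    using osc_kernel_bound[OF Ld, of N, folded N1_def] by (elim exE conjE) (rule that)
  obtain Ks where Ks: "Ks \<ge> 0" and Kall: "\<forall>l. \<forall>w\<in>Basis. symbol_bounds N1 L w (rad l) (\<lambda>x. Ks * indicator (cball (cen l) (C2 * rad l)) (snd x)) (\<lambda>x. etas l (snd x) * \<sigma> x)"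
    using symbol_localized[OF \<sigma>, of N1 L] by (elim exE conjE) (rule that)
  obtain Kw where Kw0: "Kw > 0" and Kwall: "\<forall>r>0. \<forall>D\<ge>0. \<forall>F\<ge>0. \<forall>k f x z. (\<forall>w. norm (k w) \<le> D * r ^ ?d / (1 + r * norm w) ^ (M + (?d + 2))) \<longrightarrow>
     (\<forall>y. norm (f y) \<le> F * (1 + r * norm (x - y)) ^ M) \<longrightarrow>
     norm (LINT y|lborel. k (z - y) * (f y :: complex)) \<le> Kw * D * F * (1 + r * norm (x - z :: real ^ 'n)) ^ M"
    using convolution_weight_bound[of M] by (elim exE conjE) (rule that)
  define Q where "Q = (2 + 2 ^ L * (1 + C2)) ^ N1 * Ks"
  define Di where "Di = (1 + real ?d) ^ Suc L * (Q * (2 * C2) ^ ?d)"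
  have Q0: "0 \<le> Q" unfolding Q_def using Ks C2_pos by simp
  have Di0: "0 \<le> Di" unfolding Di_def using Q0 C2_pos by simp
  define K where "K = Kw * D * (Kw * Di) + 1"
  have K0: "0 < K" unfolding K_def using Kw0 D0 Di0 by (simp add: add_nonneg_pos)
  have "norm (LINT z|lborel. osc (\<eta> k) (x - z) * osc (\<lambda>\<xi>. etas l \<xi> * \<sigma> (z, \<xi>) * g \<xi>) z) \<le> K * F / dst k l ^ N"
    if g: "integrable lborel g" and F: "0 \<le> F" and f: "\<And>y. norm (complex_of_real (1 / (2 * pi) ^ DIM(real ^ 'n)) * osc g y) \<le> F * (1 + rad l * norm (x - y)) ^ M" for k l g F x
  proof -
    let ?r = "rad l"
    obtain w where w: "w \<in> Basis" "bump_bounds (?d + 2) ?r ((dst k l ^ e) ^ L * D) (cen k) (C * rad k) (\<eta> k)"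
      "\<And>x. norm (osc (\<lambda>\<theta>. \<eta> k \<theta> * damp (cen l) w ?r \<theta> ^ N1) x) \<le> (D / dst k l ^ N) * ?r ^ ?d / (1 + ?r * norm x) ^ L"
      using Dall by blast
    have sb: "symbol_bounds N1 L w ?r (\<lambda>x. Ks * indicator (cball (cen l) (C2 * ?r)) (snd x)) (\<lambda>x. etas l (snd x) * \<sigma> x)"
      using Kall w(1) by blast
    have pos: "0 \<le> (dst k l ^ e) ^ L * D" "0 \<le> C * rad k" "0 \<le> C2 * ?r"
      using D0 dst_pos[of k l] C C2_pos rad_pos[of k] rad_pos[of l] by simp_all
    obtain b where b: "symbol_bounds 0 L w ?r (\<lambda>x. Q * indicator (cball (cen l) (C2 * ?r)) (snd x)) b"
      "(LINT z|lborel. osc (\<eta> k) (x - z) * osc (\<lambda>\<xi>. etas l \<xi> * \<sigma> (z, \<xi>) * g \<xi>) z) =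
       (LINT z|lborel. osc (\<lambda>\<theta>. \<eta> k \<theta> * damp (cen l) w ?r \<theta> ^ N1) (x - z) * osc (\<lambda>\<xi>. b (z, \<xi>) * g \<xi>) z)"
      using osc_by_parts[OF sb w(2) pos(1) Ks rad_pos w(1) less_imp_le[OF C2_pos] g pos(2)]
      unfolding snd_conv Q_def by blast
    \<comment> \<open>Inner convolution: for fixed \<open>z\<close> the symbol is an ordinary cutoff
      with its own kernel, and the block function carries the weight centred at
      \<open>x\<close>.\<close>
    have T: "norm (osc (\<lambda>\<xi>. b (z, \<xi>) * g \<xi>) z) \<le> Kw * Di * F * (1 + ?r * norm (x - z)) ^ M" for z
    proof -
      have bz: "bump_bounds L ?r Q (cen l) (C2 * ?r) (\<lambda>\<xi>. b (z, \<xi>))"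
        unfolding bump_bounds_def using b(1) deriv_bounds_slice[of L _ ?r _ b z] by fastforce
      have "norm (osc (\<lambda>\<xi>. b (z, \<xi>)) y) \<le> Di * ?r ^ ?d / (1 + ?r * norm y) ^ (M + (?d + 2))" for y
      proof -
        have "norm (osc (\<lambda>\<xi>. b (z, \<xi>)) y) \<le> (1 + real ?d) ^ Suc L * (Q * (2 * (C2 * ?r)) ^ ?d) / (1 + ?r * norm y) ^ L"
          by (rule osc_decay[OF bz rad_pos pos(3) Q0])
        also have "(1 + real ?d) ^ Suc L * (Q * (2 * (C2 * ?r)) ^ ?d) = Di * ?r ^ ?d"
          by (simp add: Di_def power_mult_distrib mult_ac)
        finally show ?thesis unfolding L_def .
      qed
      then have "norm (LINT y|lborel. osc (\<lambda>\<xi>. b (z, \<xi>)) (z - y) * (complex_of_real (1 / (2 * pi) ^ DIM(real ^ 'n)) * osc g y)) \<le> Kw * Di * F * (1 + ?r * norm (x - z)) ^ M"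
        by (intro Kwall[rule_format] rad_pos Di0 F) (use f in auto)
      then show ?thesis by (simp only: osc_reproducing[OF bump_bounds_le[OF bz Ld] rad_pos pos(3) Q0 g])
    qed
    \<comment> \<open>Outer convolution, evaluated at the centre \<open>x\<close> of the weight,
      where the weight is 1.\<close>
    have "norm (LINT z|lborel. osc (\<lambda>\<theta>. \<eta> k \<theta> * damp (cen l) w ?r \<theta> ^ N1) (x - z) * osc (\<lambda>\<xi>. b (z, \<xi>) * g \<xi>) z)
        \<le> Kw * (D / dst k l ^ N) * (Kw * Di * F) * (1 + ?r * norm (x - x)) ^ M"
    proof -
      have "\<forall>y. norm (osc (\<lambda>\<theta>. \<eta> k \<theta> * damp (cen l) w ?r \<theta> ^ N1) y) \<le> (D / dst k l ^ N) * ?r ^ ?d / (1 + ?r * norm y) ^ (M + (?d + 2))"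
        using w(3) unfolding L_def by blast
      then show ?thesis
        using D0 dst_pos[of k l] Kw0 Di0 F T by (intro Kwall[rule_format] rad_pos) auto
    qed
    also have "\<dots> = (Kw * D * (Kw * Di)) * F / dst k l ^ N" by simp
    also have "\<dots> \<le> K * F / dst k l ^ N"
      unfolding K_def using F dst_pos[of k l] by (intro divide_right_mono mult_right_mono) auto
    finally show ?thesis unfolding b(2) .
  qed
  with K0 show ?thesis by blast
qed

text \<open>A function with frequencies in the l-th block is reproduced by the kernel of
  \<open>etas l\<close>, which decays at scale \<open>rad l\<close> with a constant independent of
  \<open>l\<close>. This is the hypothesis of \<open>peetre_maximal\<close>; the factor (2 pi)^-d <=
  1 is dropped.\<close>

lemma peetre_band_limited:
  assumes p: "0 < p"
  shows "\<exists>K>0. \<forall>l g x. integrable lborel g \<longrightarrow> (\<forall>\<xi>. etas l \<xi> * g \<xi> = g \<xi>) \<longrightarrow>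
    (\<exists>F\<ge>0. (\<forall>y. norm (complex_of_real (1 / (2 * pi) ^ DIM(real ^ 'n)) * osc g y) \<le> F * (1 + rad l * norm (x - y)) ^ M) \<and>
      ennreal (F powr p) \<le> ennreal (K * rad l ^ DIM(real ^ 'n)) *
        (\<integral>\<^sup>+y. ennreal ((norm (complex_of_real (1 / (2 * pi) ^ DIM(real ^ 'n)) * osc g y) / (1 + rad l * norm (x - y)) ^ M) powr p) \<partial>lborel))"
proof -
  let ?d = "DIM(real ^ 'n)"
  define L where "L = M + (?d + 2)"
  have Ld: "?d + 2 \<le> L" by (simp add: L_def)
  obtain Be where Be: "Be > 0" "\<And>l. bump_bounds L (rad l) Be (cen l) (C2 * rad l) (etas l)" using etas_bounds by metis
  define D where "D = (1 + real ?d) ^ Suc L * (Be * (2 * C2) ^ ?d)"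
  have D: "0 < D" unfolding D_def using Be(1) C2_pos by (intro mult_pos_pos zero_less_power) auto
  obtain K where K0: "K > 0" and Kall: "\<forall>r>0. \<forall>f x. f \<in> borel_measurable borel \<longrightarrow> (\<exists>B. \<forall>y. norm (f y) \<le> B) \<longrightarrow>
     (\<forall>z. ennreal (norm (f z)) \<le> (\<integral>\<^sup>+y. ennreal (D * r ^ ?d / (1 + r * norm (z - y)) ^ (M + (?d + 2)) * norm (f y)) \<partial>lborel)) \<longrightarrow>
     (\<exists>F\<ge>0. (\<forall>y. norm (f y) \<le> F * (1 + r * norm (x - y)) ^ M) \<and>
       ennreal (F powr p) \<le> ennreal (K * r ^ ?d) * (\<integral>\<^sup>+y. ennreal ((norm (f y :: complex) / (1 + r * norm (x - y :: real ^ 'n)) ^ M) powr p) \<partial>lborel))"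
    using peetre_maximal[OF p D, of M] by (elim exE conjE) (rule that)
  have cp: "norm (complex_of_real (1 / (2 * pi) ^ DIM(real ^ 'n))) \<le> 1"
  proof -
    have "1 \<le> (2 * pi) ^ ?d" using pi_gt3 by (intro one_le_power) simp
    then show ?thesis by (simp only: norm_of_real) simp
  qed
  have "\<exists>F\<ge>0. (\<forall>y. norm (complex_of_real (1 / (2 * pi) ^ DIM(real ^ 'n)) * osc g y) \<le> F * (1 + rad l * norm (x - y)) ^ M) \<and>
      ennreal (F powr p) \<le> ennreal (K * rad l ^ ?d) *
        (\<integral>\<^sup>+y. ennreal ((norm (complex_of_real (1 / (2 * pi) ^ DIM(real ^ 'n)) * osc g y) / (1 + rad l * norm (x - y)) ^ M) powr p) \<partial>lborel)"
    if g: "integrable lborel g" and eg: "\<And>\<xi>. etas l \<xi> * g \<xi> = g \<xi>" for l g x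
  proof -
    let ?f = "\<lambda>y. complex_of_real (1 / (2 * pi) ^ DIM(real ^ 'n)) * osc g y" and ?r = "rad l"
    have [measurable]: "osc g \<in> borel_measurable borel" by (rule osc_measurable(1)[OF g])
    have fm: "?f \<in> borel_measurable borel" by measurable
    have fb: "norm (?f y) \<le> norm (complex_of_real (1 / (2 * pi) ^ DIM(real ^ 'n))) * (LINT \<xi>|lborel. norm (g \<xi>))" for y
    proof -
      have "norm (osc g y) \<le> (LINT \<xi>|lborel. norm (g \<xi>))"
        unfolding osc_def
        by (rule norm_integral_bound[where B="\<lambda>\<xi>. norm (g \<xi>)"])
           (use g in \<open>auto simp: norm_mult nn_integral_eq_integral\<close>)
      then show ?thesis unfolding norm_mult by (intro mult_left_mono) auto
    qed
    have rep: "ennreal (norm (?f z)) \<le> (\<integral>\<^sup>+y. ennreal (D * ?r ^ ?d / (1 + ?r * norm (z - y)) ^ (M + (?d + 2)) * norm (?f y)) \<partial>lborel)" for z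
    proof -
      have pos: "0 \<le> C2 * ?r" "0 \<le> Be" using C2_pos rad_pos[of l] Be(1) by simp_all
      have "osc g z = osc (\<lambda>\<xi>. etas l \<xi> * g \<xi>) z" by (simp only: eg)
      also have "\<dots> = (LINT y|lborel. osc (etas l) (z - y) * ?f y)"
        by (rule osc_reproducing[OF bump_bounds_le[OF Be(2) Ld] rad_pos pos g])
      finally have eq: "osc g z = (LINT y|lborel. osc (etas l) (z - y) * ?f y)" .
      have "norm (?f z) \<le> 1 * norm (osc g z)" unfolding norm_mult by (intro mult_right_mono cp) auto
      then have "ennreal (norm (?f z)) \<le> ennreal (norm (osc g z))" by (intro ennreal_leI) simp
      also have "\<dots> \<le> (\<integral>\<^sup>+y. ennreal (norm (osc (etas l) (z - y) * ?f y)) \<partial>lborel)"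
        unfolding eq by (rule norm_integral_le_nn_integral)
      also have "\<dots> \<le> (\<integral>\<^sup>+y. ennreal (D * ?r ^ ?d / (1 + ?r * norm (z - y)) ^ (M + (?d + 2)) * norm (?f y)) \<partial>lborel)"
      proof (intro nn_integral_mono ennreal_leI)
        fix y
        have "norm (osc (etas l) (z - y)) \<le> (1 + real ?d) ^ Suc L * (Be * (2 * (C2 * ?r)) ^ ?d) / (1 + ?r * norm (z - y)) ^ L"
          by (rule osc_decay[OF Be(2) rad_pos pos])
        also have "(1 + real ?d) ^ Suc L * (Be * (2 * (C2 * ?r)) ^ ?d) = D * ?r ^ ?d"
          by (simp add: D_def power_mult_distrib mult_ac)
        finally show "norm (osc (etas l) (z - y) * ?f y) \<le> D * ?r ^ ?d / (1 + ?r * norm (z - y)) ^ (M + (?d + 2)) * norm (?f y)"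
          unfolding norm_mult[of "osc _ _"] L_def by (intro mult_right_mono) auto
      qed
      finally show ?thesis .
    qed
    show ?thesis using Kall[rule_format, OF rad_pos[of l] fm, of x] fb rep by blast
  qed
  with K0 show ?thesis by blast
qed

end

section \<open>Splitting a function and its image into blocks\<close>

lemma inv_fourier_osc_DIM: "inv_fourier a x = complex_of_real (1 / (2 * pi) ^ DIM(real ^ 'n)) * osc a (x :: real ^ 'n::finite)"
  by (simp add: inv_fourier_osc)

lemma inv_const_le_1: "norm (complex_of_real (1 / (2 * pi) ^ m)) \<le> 1"
proof -
  have "1 \<le> (2 * pi) ^ m" using pi_gt3 by (intro one_le_power) simp
  then show ?thesis by (simp only: norm_of_real) simp
qed

text \<open>Majorant for the partial sums of the partition of unity, which are only bounded
  polynomially.\<close>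

lemma fourier_poly_integrable:
  fixes f :: "real ^ 'n::finite \<Rightarrow> complex"
  assumes f: "f \<in> schwartz"
  shows "integrable lborel (\<lambda>\<xi>. complex_of_real ((1 + norm \<xi>) ^ m) * fourier f \<xi>)"
proof -
  let ?M = "DIM(real ^ 'n) + 2"
  obtain K where K: "K > 0" "\<And>\<xi>. norm (fourier f \<xi>) \<le> K / (1 + norm \<xi>) ^ (?M + m)"
    using fourier_decay[OF f] by blast
  have c: "continuous_on UNIV (fourier f)" by (rule continuous_fourier[OF schwartz_integrable[OF f]])
  show ?thesis
  proof (rule integrable_poly_decay)
    show "(\<lambda>\<xi>. complex_of_real ((1 + norm \<xi>) ^ m) * fourier f \<xi>) \<in> borel_measurable borel"
      by (intro borel_measurable_continuous_onI continuous_intros c)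
    fix \<xi> :: "real ^ 'n"
    have p: "0 < (1 + norm \<xi>) ^ (?M + m)" by (intro zero_less_power add_pos_nonneg) auto
    have "(1 + norm \<xi>) ^ ?M * norm (complex_of_real ((1 + norm \<xi>) ^ m) * fourier f \<xi>) = (1 + norm \<xi>) ^ (?M + m) * norm (fourier f \<xi>)"
      unfolding norm_mult norm_of_real power_add by (simp add: mult.assoc)
    also have "\<dots> \<le> K" using K(2)[of \<xi>] p by (simp only: pos_le_divide_eq mult.commute)
    finally show "(1 + norm \<xi>) ^ ?M * norm (complex_of_real ((1 + norm \<xi>) ^ m) * fourier f \<xi>) \<le> K" .
  qed
qed

lemma fourier_integrable: "f \<in> schwartz \<Longrightarrow> integrable lborel (fourier f)"
  using fourier_poly_integrable[of f 0] by simp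

lemma convolve_inv_fourier:
  fixes f :: "real ^ 'n::finite \<Rightarrow> complex"
  assumes \<eta>: "\<eta> \<in> schwartz" and f: "f \<in> schwartz"
  shows "convolve (inv_fourier \<eta>) f y = inv_fourier (\<lambda>\<xi>. \<eta> \<xi> * fourier f \<xi>) y"
proof -
  note [measurable] = schwartz_measurable[OF \<eta>] schwartz_measurable[OF f]
  define c where "c = complex_of_real (1 / (2 * pi) ^ CARD('n))"
  let ?H = "\<lambda>x \<xi>. c * (exp (\<i> * complex_of_real ((y - x) \<bullet> \<xi>)) * \<eta> \<xi>) * f x"
  have "convolve (inv_fourier \<eta>) f y = (LINT x|lborel. LINT \<xi>|lborel. ?H x \<xi>)"
    unfolding convolve_def inv_fourier_def by (simp only: integral_mult_right_zero integral_mult_left_zero c_def)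
  also have "\<dots> = (LINT \<xi>|lborel. LINT x|lborel. ?H x \<xi>)"
    by (rule Fubini_prod_bound(1)[symmetric, where A="\<lambda>x. norm (f x)" and B="\<lambda>\<xi>. norm (c * \<eta> \<xi>)"])
       (use integrable_norm[OF schwartz_integrable[OF f]] integrable_norm[OF integrable_mult_right[OF schwartz_integrable[OF \<eta>], of c]]
         in \<open>auto simp: norm_mult\<close>)
  also have "\<dots> = (LINT \<xi>|lborel. c * (exp (\<i> * complex_of_real (y \<bullet> \<xi>)) * (\<eta> \<xi> * fourier f \<xi>)))"
  proof (intro Bochner_Integration.integral_cong refl)
    fix \<xi> :: "real ^ 'n"
    have "?H x \<xi> = (c * exp (\<i> * complex_of_real (y \<bullet> \<xi>)) * \<eta> \<xi>) * (exp (- \<i> * complex_of_real (\<xi> \<bullet> x)) * f x)" for x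
    proof -
      have "exp (\<i> * complex_of_real ((y - x) \<bullet> \<xi>)) = exp (\<i> * complex_of_real (y \<bullet> \<xi>)) * exp (- \<i> * complex_of_real (\<xi> \<bullet> x))"
        by (simp add: exp_add[symmetric] inner_diff_left inner_commute algebra_simps)
      then show ?thesis by simp
    qed
    then show "(LINT x|lborel. ?H x \<xi>) = c * (exp (\<i> * complex_of_real (y \<bullet> \<xi>)) * (\<eta> \<xi> * fourier f \<xi>))"
      by (simp only: integral_mult_right_zero fourier_def mult.assoc)
  qed
  also have "\<dots> = inv_fourier (\<lambda>\<xi>. \<eta> \<xi> * fourier f \<xi>) y"
    unfolding inv_fourier_def by (simp only: integral_mult_right_zero c_def)
  finally show ?thesis .
qed

lemma morder_finite: "finite {\<beta> :: nat ^ 'n::finite. morder \<beta> \<le> N}"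
proof -
  have "{\<beta> :: nat ^ 'n. morder \<beta> \<le> N} \<subseteq> (\<lambda>f. \<chi> j. f j) ` (PiE UNIV (\<lambda>_. {..N}))"
  proof
    fix \<beta> :: "nat ^ 'n" assume "\<beta> \<in> {\<beta>. morder \<beta> \<le> N}"
    then have "\<beta> $ j \<le> N" for j
      using member_le_sum[of j UNIV "\<lambda>j. \<beta> $ j"] by (simp add: morder_def)
    then show "\<beta> \<in> (\<lambda>f. \<chi> j. f j) ` (PiE UNIV (\<lambda>_. {..N}))"
      by (intro image_eqI[where x="\<lambda>j. \<beta> $ j"]) auto
  qed
  moreover have "finite (PiE (UNIV :: 'n set) (\<lambda>_. {..N}))" by (intro finite_PiE) auto
  ultimately show ?thesis using finite_surj by blast
qed

text \<open>One seminorm without derivatives, of weight d + 2, already controls the pairing; it is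
  one of the summands in the definition.\<close>

lemma bounded_tempered_function:
  fixes g :: "real ^ 'n::finite \<Rightarrow> complex"
  assumes m[measurable]: "g \<in> borel_measurable borel" and b: "\<And>x. norm (g x) \<le> M"
  shows "tempered_function g"
proof -
  let ?D = "DIM(real ^ 'n) + 2"
  have M: "0 \<le> M" using b norm_ge_zero order_trans by blast
  have int: "integrable lborel (\<lambda>x. g x * \<phi> x)" if "\<phi> \<in> schwartz" for \<phi>
    by (rule integrable_mult_bounded[OF schwartz_integrable[OF that] m b])
  have rep: "represents g (dist_of g)"
    using int by (simp add: represents_def dist_of_def)
  have "dist_of g \<in> tempered_distributions"
    unfolding tempered_distributions_def
  proof (intro CollectI conjI ballI allI)
    fix \<phi> \<psi> :: "real ^ 'n \<Rightarrow> complex" assume "\<phi> \<in> schwartz" "\<psi> \<in> schwartz"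
    then show "dist_of g (\<lambda>x. \<phi> x + \<psi> x) = dist_of g \<phi> + dist_of g \<psi>"
      using int unfolding dist_of_def by (simp add: distrib_left)
  next
    fix c and \<phi> :: "real ^ 'n \<Rightarrow> complex"
    have "(\<lambda>x. g x * (c * \<phi> x)) = (\<lambda>x. c * (g x * \<phi> x))" by (auto simp: mult_ac)
    then show "dist_of g (\<lambda>x. c * \<phi> x) = c * dist_of g \<phi>" unfolding dist_of_def by (simp only: integral_mult_right_zero)
  next
    define I where "I = (LINT x|lborel. 1 / (1 + norm (x :: real ^ 'n)) ^ ?D)"
    have I0: "0 \<le> I" unfolding I_def by (intro Bochner_Integration.integral_nonneg) auto
    show "\<exists>N B. \<forall>\<phi>\<in>schwartz. norm (dist_of g \<phi>) \<le> B * (\<Sum>\<beta> | morder \<beta> \<le> N. schwartz_seminorm N \<beta> \<phi>)"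
    proof (intro exI ballI)
      fix \<phi> :: "real ^ 'n \<Rightarrow> complex" assume \<phi>: "\<phi> \<in> schwartz"
      have bdd: "bdd_above (range (\<lambda>x. jap x ^ ?D * norm (mderiv \<beta> \<phi> x)))" for \<beta>
      proof -
        obtain B where "\<forall>x. jap x ^ ?D * norm (mderiv \<beta> \<phi> x) \<le> B" using \<phi> unfolding schwartz_def by blast
        then show ?thesis by (auto intro!: bdd_aboveI[of _ B])
      qed
      have up: "jap x ^ ?D * norm (mderiv \<beta> \<phi> x) \<le> schwartz_seminorm ?D \<beta> \<phi>" for \<beta> x
        unfolding schwartz_seminorm_def by (rule cSUP_upper[OF _ bdd]) simp
      have s0: "0 \<le> schwartz_seminorm ?D \<beta> \<phi>" for \<beta>
        using up[of 0 \<beta>] jap_pos[of "0 :: real ^ 'n"] by (meson mult_nonneg_nonneg norm_ge_zero order_trans zero_le_power less_imp_le)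
      \<comment> \<open>Any coordinate: \<open>msingle j 0\<close> is the zero multi-index, written
        so that \<open>mderiv_dir_msingle\<close> evaluates the derivative to
        \<open>\<phi>\<close>.\<close>
      obtain j :: 'n where True by blast
      let ?S = "schwartz_seminorm ?D (msingle j 0) \<phi>"
      have \<phi>b: "norm (\<phi> x) \<le> ?S * (1 / (1 + norm x) ^ ?D)" for x
      proof -
        have "0 < (1 + norm x) ^ ?D" by (intro zero_less_power add_pos_nonneg) auto
        then show ?thesis
          using up[of x "msingle j 0"] by (simp add: mderiv_def mderiv_dir_msingle jap_def pos_le_divide_eq mult.commute)
      qed
      have "norm (dist_of g \<phi>) \<le> M * ?S * I"
        unfolding dist_of_def
      proof (rule norm_integral_bound)
        show "norm (g x * \<phi> x) \<le> M * ?S * (1 / (1 + norm x) ^ ?D)" for x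
          using mult_mono[OF b \<phi>b M norm_ge_zero] by (simp add: norm_mult mult.assoc)
        have "(\<integral>\<^sup>+x. ennreal (M * ?S * (1 / (1 + norm (x :: real ^ 'n)) ^ ?D)) \<partial>lborel) = ennreal (LINT x|lborel. M * ?S * (1 / (1 + norm (x :: real ^ 'n)) ^ ?D))"
          using M s0 by (intro nn_integral_eq_integral integrable_mult_right integrable_decay AE_I2 mult_nonneg_nonneg) auto
        also have "(LINT x|lborel. M * ?S * (1 / (1 + norm (x :: real ^ 'n)) ^ ?D)) = M * ?S * I"
          unfolding I_def by (rule integral_mult_right_zero)
        finally show "(\<integral>\<^sup>+x. ennreal (M * ?S * (1 / (1 + norm (x :: real ^ 'n)) ^ ?D)) \<partial>lborel) \<le> ennreal (M * ?S * I)" by simp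
      qed (use M s0 I0 in simp)
      also have "M * ?S * I = (M * I) * ?S" by simp
      also have "\<dots> \<le> (M * I) * (\<Sum>\<beta> | morder \<beta> \<le> ?D. schwartz_seminorm ?D \<beta> \<phi>)"
        using M I0 s0 morder_finite by (intro mult_left_mono member_le_sum) (auto simp: morder_msingle)
      finally show "norm (dist_of g \<phi>) \<le> (M * I) * (\<Sum>\<beta> | morder \<beta> \<le> ?D. schwartz_seminorm ?D \<beta> \<phi>)" .
    qed
  qed
  with rep show ?thesis by (simp add: tempered_function_def)
qed

lemma symbol_bounded:
  assumes "\<sigma> \<in> symbol_class 0 \<alpha> \<alpha>"
  shows "\<exists>B>0. \<forall>x. norm (\<sigma> x) \<le> B"
proof -
  obtain j :: 'a where True by blast
  obtain B where H: "\<forall>x \<xi>. norm (mderiv_fst (msingle j 0) (mderiv_snd (msingle j 0) \<sigma>) (x, \<xi>))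
      \<le> B * jap \<xi> powr (0 + \<alpha> * real (morder (msingle j 0)) - \<alpha> * real (morder (msingle j 0)))"
    using assms unfolding symbol_class_def by blast
  have "norm (\<sigma> (x, \<xi>)) \<le> B" for x \<xi>
    using H[rule_format, of x \<xi>] less_imp_neq[OF jap_pos[of \<xi>]]
    by (simp add: mderiv_fst_def mderiv_snd_def mderiv_dir_msingle)
  then show ?thesis by (intro exI[of _ "max B 1"]) (auto simp: le_max_iff_disj)
qed

lemma symbol_continuous:
  assumes "\<sigma> \<in> symbol_class b r d"
  shows "continuous_on UNIV \<sigma>"
  using assms smooth_differentiable
  by (auto simp: symbol_class_def intro!: continuous_at_imp_continuous_on differentiable_imp_continuous_within)

lemma osc_symbol_continuous:
  fixes \<sigma> :: "'a::euclidean_space \<times> 'a \<Rightarrow> complex"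
  assumes \<sigma>: "continuous_on UNIV \<sigma>" "\<And>x. norm (\<sigma> x) \<le> B" and g: "integrable lborel g" 
  shows "continuous_on UNIV (\<lambda>x. osc (\<lambda>\<xi>. \<sigma> (x, \<xi>) * g \<xi>) x)"
    and "norm (osc (\<lambda>\<xi>. \<sigma> (x, \<xi>) * g \<xi>) x) \<le> B * (LINT \<xi>|lborel. norm (g \<xi>))"
proof -
  have [measurable]: "g \<in> borel_measurable borel" using borel_measurable_integrable[OF g] by simp
  have [measurable]: "(\<lambda>\<xi>. \<sigma> (x, \<xi>)) \<in> borel_measurable borel" for x
    by (intro borel_measurable_continuous_onI continuous_on_comp_Pair \<sigma>)
  have B: "0 \<le> B" using \<sigma>(2) norm_ge_zero order_trans by blast
  have b: "norm (exp (\<i> * complex_of_real (x \<bullet> \<xi>)) * (\<sigma> (x, \<xi>) * g \<xi>)) \<le> B * norm (g \<xi>)" for x \<xi>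
    using mult_right_mono[OF \<sigma>(2)[of "(x, \<xi>)"], of "norm (g \<xi>)"] by (simp add: norm_mult)
  have cz: "continuous_on UNIV (\<lambda>x. \<sigma> (x, \<xi>))" for \<xi>
    by (rule continuous_on_compose2[OF \<sigma>(1)]) (auto intro!: continuous_intros)
  have ig: "integrable lborel (\<lambda>\<xi>. B * norm (g \<xi>))" using g by auto
  show "continuous_on UNIV (\<lambda>x. osc (\<lambda>\<xi>. \<sigma> (x, \<xi>) * g \<xi>) x)"
    unfolding osc_def
    by (rule continuous_integral_dominated[OF _ _ b ig]) (auto intro!: continuous_intros cz)
  show "norm (osc (\<lambda>\<xi>. \<sigma> (x, \<xi>) * g \<xi>) x) \<le> B * (LINT \<xi>|lborel. norm (g \<xi>))"
    unfolding osc_def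
  proof (rule norm_integral_bound[OF b])
    have "(\<integral>\<^sup>+\<xi>. ennreal (B * norm (g \<xi>)) \<partial>lborel) = ennreal (LINT \<xi>|lborel. B * norm (g \<xi>))"
      using B by (intro nn_integral_eq_integral ig) auto
    then show "(\<integral>\<^sup>+\<xi>. ennreal (B * norm (g \<xi>)) \<partial>lborel) \<le> ennreal (B * (LINT \<xi>|lborel. norm (g \<xi>)))" by simp
  qed (use B in simp)
qed

context alpha_partition
begin

text \<open>As \<open>rad l >= 1\<close>, dividing |cen l| <= |\<xi>| + C rad l by the radius leaves
  |l| <= |\<xi>| + C. Hence only finitely many cutoffs are nonzero at a given frequency, and their
  number grows polynomially.\<close>

lemma eta_support_index:
  assumes "\<eta> l \<xi> \<noteq> 0"
  shows "norm (ivec l) \<le> norm \<xi> + C"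
proof -
  have "norm (\<xi> - cen l) \<le> C * rad l" using eta_zero[of \<xi> l] assms by (auto simp: dist_norm norm_minus_commute)
  then have "rad l * norm (ivec l) \<le> norm \<xi> + C * rad l"
    using norm_triangle_ineq4[of \<xi> "\<xi> - cen l"] rad_pos[of l] by (simp add: cen_def)
  also have "\<dots> \<le> rad l * norm \<xi> + C * rad l" using rad_ge_1[of l] by (simp add: mult_le_cancel_right1 mult_right_mono)
  also have "\<dots> = rad l * (norm \<xi> + C)" by (simp add: algebra_simps)
  finally show ?thesis using rad_pos[of l] by simp
qed

text \<open>Finite exhaustion of the lattice, so that the splitting into blocks is a limit of finite
  sums.\<close>

definition idx :: "nat \<Rightarrow> (int ^ 'n) set" where "idx m = {l. norm (ivec l) \<le> real m}"

lemma idx_finite: "finite (idx m)"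
  unfolding idx_def by (rule lattice_ball) simp

lemma eta_partial_sum: "(\<lambda>m. \<Sum>l\<in>idx m. \<eta> l \<xi>) \<longlonglongrightarrow> 1"
proof (rule tendsto_eventually)
  show "\<forall>\<^sub>F m in sequentially. (\<Sum>l\<in>idx m. \<eta> l \<xi>) = 1"
    unfolding eventually_sequentially
  proof (intro exI allI impI)
    fix m assume m: "nat \<lceil>norm \<xi> + C\<rceil> \<le> m"
    then have "norm \<xi> + C \<le> real m" by linarith
    then have "\<eta> k \<xi> = 0" if "k \<notin> idx m" for k
      using eta_support_index[of k \<xi>] that by (auto simp: idx_def)
    then have "((\<lambda>k. \<eta> k \<xi>) has_sum 1) UNIV \<longleftrightarrow> ((\<lambda>k. \<eta> k \<xi>) has_sum 1) (idx m)"
      by (intro has_sum_cong_neutral) auto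
    with eta_sum[of \<xi>] have "((\<lambda>k. \<eta> k \<xi>) has_sum 1) (idx m)" by simp
    moreover have "((\<lambda>k. \<eta> k \<xi>) has_sum (\<Sum>l\<in>idx m. \<eta> l \<xi>)) (idx m)" by (rule has_sum_finite[OF idx_finite])
    ultimately show "(\<Sum>l\<in>idx m. \<eta> l \<xi>) = 1" using has_sum_unique by blast
  qed
qed

lemma eta_partial_sum_bound:
  "\<exists>B>0. \<forall>m \<xi>. norm (\<Sum>l\<in>idx m. \<eta> l \<xi>) \<le> B * (1 + norm \<xi>) ^ CARD('n)"
proof -
  obtain B0 where B0: "B0 > 0" "\<And>k. bump_bounds 0 (rad k) B0 (cen k) (C * rad k) (\<eta> k)" using eta_bounds by metis
  have n: "norm (\<eta> k \<xi>) \<le> B0" for k \<xi> using bump_bounds_base(3)[OF B0(2)] B0(1) by simp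
  define B where "B = B0 * (2 * C + 1) ^ CARD('n)"
  have "norm (\<Sum>l\<in>idx m. \<eta> l \<xi>) \<le> B * (1 + norm \<xi>) ^ CARD('n)" for m \<xi>
  proof -
    let ?T = "{l :: int ^ 'n. norm (ivec l) \<le> norm \<xi> + C}"
    have R: "0 \<le> norm \<xi> + C" using C by (simp add: add_nonneg_nonneg)
    have "(\<Sum>l\<in>idx m. \<eta> l \<xi>) = (\<Sum>l\<in>idx m \<inter> ?T. \<eta> l \<xi>)"
      using eta_support_index by (intro sum.mono_neutral_right idx_finite) auto
    also have "norm \<dots> \<le> (\<Sum>l\<in>idx m \<inter> ?T. B0)" by (intro sum_norm_le n)
    also have "\<dots> = real (card (idx m \<inter> ?T)) * B0" by simp
    also have "\<dots> \<le> real (card ?T) * B0"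
      using B0(1) lattice_ball(1)[OF R] by (intro mult_right_mono of_nat_mono card_mono) auto
    also have "\<dots> \<le> (2 * (norm \<xi> + C) + 1) ^ CARD('n) * B0"
      using B0(1) by (intro mult_right_mono lattice_ball(2) R) auto
    also have "\<dots> \<le> ((2 * C + 1) * (1 + norm \<xi>)) ^ CARD('n) * B0"
    proof -
      have "norm \<xi> \<le> C * norm \<xi>" using C by (simp add: mult_le_cancel_right1)
      moreover define u where "u = C * norm \<xi>"
      ultimately have "norm \<xi> \<le> u" by simp
      then have "norm \<xi> + norm \<xi> \<le> u + u + norm \<xi>" using norm_ge_zero[of \<xi>] by (intro add_increasing2 add_mono) auto
      then have "2 * (norm \<xi> + C) + 1 \<le> 2 * C + 1 + 2 * u + norm \<xi>" by (simp add: algebra_simps)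
      also have "\<dots> = (2 * C + 1) * (1 + norm \<xi>)" by (simp add: u_def algebra_simps)
      finally have "2 * (norm \<xi> + C) + 1 \<le> (2 * C + 1) * (1 + norm \<xi>)" .
      then show ?thesis using R B0(1) by (intro mult_right_mono power_mono) auto
    qed
    finally show ?thesis by (simp add: B_def power_mult_distrib mult_ac)
  qed
  moreover have "0 < B" unfolding B_def using B0(1) C by simp
  ultimately show ?thesis by blast
qed

text \<open>The Fourier transform of the l-th block of \<open>f\<close>; its inverse transform is
  the representative through which the block is estimated.\<close>

definition blk :: "(real ^ 'n \<Rightarrow> complex) \<Rightarrow> int ^ 'n \<Rightarrow> real ^ 'n \<Rightarrow> complex" where
  "blk f l \<xi> = \<eta> l \<xi> * fourier f \<xi>"

lemma blk_integrable:
  assumes "f \<in> schwartz"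
  shows "integrable lborel (blk f l)"
proof -
  obtain K where "\<And>x. norm (\<eta> l x) \<le> K" using schwartz_bounded[OF eta_schwartz] by blast
  then show ?thesis
    unfolding blk_def[abs_def]
    by (intro integrable_mult_bounded[OF fourier_integrable[OF assms] schwartz_measurable[OF eta_schwartz]])
qed

lemma represents_block:
  assumes "f \<in> schwartz"
  shows "represents (inv_fourier (blk f l)) (fourier_multiplier (\<eta> l) (dist_of f))"
proof -
  obtain K where K: "\<And>x. norm (f x) \<le> K" using schwartz_bounded[OF assms] by blast
  have "inv_fourier (blk f l) = convolve (inv_fourier (\<eta> l)) f"
    using convolve_inv_fourier[OF eta_schwartz assms] unfolding blk_def[abs_def] by auto
  with represents_fourier_multiplier[OF eta_schwartz schwartz_measurable[OF assms] K] show ?thesis by simp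
qed

lemma pseudo_diff_op_osc:
  "pseudo_diff_op \<sigma> f x = complex_of_real (1 / (2 * pi) ^ DIM(real ^ 'n)) * osc (\<lambda>\<xi>. \<sigma> (x, \<xi>) * fourier f \<xi>) (x :: real ^ 'n)"
  by (simp add: pseudo_diff_op_def osc_def mult.assoc)

lemma pseudo_diff_op_bounded:
  fixes f :: "real ^ 'n \<Rightarrow> complex"
  assumes \<sigma>: "\<sigma> \<in> symbol_class 0 \<alpha> \<alpha>" and f: "f \<in> schwartz"
  shows "pseudo_diff_op \<sigma> f \<in> borel_measurable borel" "\<exists>M. \<forall>x. norm (pseudo_diff_op \<sigma> f x) \<le> M"
proof -
  obtain B where B: "B > 0" "\<And>x. norm (\<sigma> x) \<le> B" using symbol_bounded[OF \<sigma>] by blast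
  note o = osc_symbol_continuous[OF symbol_continuous[OF \<sigma>] B(2) fourier_integrable[OF f]]
  have "continuous_on UNIV (pseudo_diff_op \<sigma> f)"
  proof -
    have "pseudo_diff_op \<sigma> f = (\<lambda>x. complex_of_real (1 / (2 * pi) ^ DIM(real ^ 'n)) * osc (\<lambda>\<xi>. \<sigma> (x, \<xi>) * fourier f \<xi>) x)"
      by (rule ext) (simp only: pseudo_diff_op_osc)
    then show ?thesis by (simp only:) (intro continuous_intros o(1))
  qed
  then show "pseudo_diff_op \<sigma> f \<in> borel_measurable borel" by (rule borel_measurable_continuous_onI)
  show "\<exists>M. \<forall>x. norm (pseudo_diff_op \<sigma> f x) \<le> M"
  proof (intro exI allI)
    fix x
    show "norm (pseudo_diff_op \<sigma> f x) \<le> 1 * (B * (LINT \<xi>|lborel. norm (fourier f \<xi>)))"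
      unfolding pseudo_diff_op_osc norm_mult by (intro mult_mono inv_const_le_1 o(2)) auto
  qed
qed

lemma pseudo_diff_op_tempered:
  fixes f :: "real ^ 'n \<Rightarrow> complex"
  assumes "\<sigma> \<in> symbol_class 0 \<alpha> \<alpha>" "f \<in> schwartz"
  shows "tempered_function (pseudo_diff_op \<sigma> f)"
  using pseudo_diff_op_bounded[OF assms] bounded_tempered_function by blast

text \<open>Dominated convergence twice: in the frequency, where the partial sums are dominated by a
  polynomial times |fourier f|, and then in \<open>z\<close>, where the bound \<open>W\<close> is
  uniform in \<open>m\<close> and \<open>z\<close> and the kernel is integrable.\<close>

lemma convolve_pseudo_diff_op_limit:
  assumes \<sigma>: "\<sigma> \<in> symbol_class 0 \<alpha> \<alpha>" and f: "f \<in> schwartz"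
  shows "(\<lambda>m. \<Sum>l\<in>idx m. convolve (inv_fourier (\<eta> k)) (\<lambda>z. complex_of_real (1 / (2 * pi) ^ DIM(real ^ 'n)) * osc (\<lambda>\<xi>. \<sigma> (z, \<xi>) * blk f l \<xi>) z) x)
    \<longlonglongrightarrow> convolve (inv_fourier (\<eta> k)) (pseudo_diff_op \<sigma> f) x"
proof -
  define c where "c = complex_of_real (1 / (2 * pi) ^ DIM(real ^ 'n))"
  have c1: "norm c \<le> 1" unfolding c_def by (rule inv_const_le_1)
  obtain B where B: "B > 0" "\<And>x. norm (\<sigma> x) \<le> B" using symbol_bounded[OF \<sigma>] by blast
  have cs: "continuous_on UNIV \<sigma>" by (rule symbol_continuous[OF \<sigma>])
  obtain E where E: "E > 0" "\<And>m \<xi>. norm (\<Sum>l\<in>idx m. \<eta> l \<xi>) \<le> E * (1 + norm \<xi>) ^ CARD('n)"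
    using eta_partial_sum_bound by metis
  let ?w = "\<lambda>\<xi>. norm (complex_of_real ((1 + norm \<xi>) ^ CARD('n)) * fourier f \<xi>)"
  have iw: "integrable lborel (\<lambda>\<xi>. E * ?w \<xi>)" using integrable_norm[OF fourier_poly_integrable[OF f]] by auto
  have fm[measurable]: "fourier f \<in> borel_measurable borel"
    using borel_measurable_integrable[OF fourier_integrable[OF f]] by simp
  note [measurable] = schwartz_measurable[OF eta_schwartz]
  have ik: "integrable lborel (inv_fourier (\<eta> k))" by (rule integrable_inv_fourier[OF eta_schwartz])
  have [measurable]: "inv_fourier (\<eta> k) \<in> borel_measurable borel" using borel_measurable_integrable[OF ik] by simp
  define S where "S m \<xi> = (\<Sum>l\<in>idx m. \<eta> l \<xi>) * fourier f \<xi>" for m \<xi>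
  have Sb: "norm (S m \<xi>) \<le> E * ?w \<xi>" for m \<xi>
    unfolding S_def norm_mult norm_of_real mult.assoc[symmetric]
    using E(2)[of \<xi> m] by (intro mult_right_mono) auto
  have iS: "integrable lborel (S m)" for m
    by (rule Bochner_Integration.integrable_bound[OF iw])
       (use Sb E(1) in \<open>auto simp: S_def[abs_def] intro!: AE_I2 order_trans[OF Sb] mult_nonneg_nonneg\<close>)
  have [measurable]: "(\<lambda>\<xi>. \<sigma> (z, \<xi>)) \<in> borel_measurable borel" for z
    by (intro borel_measurable_continuous_onI continuous_on_comp_Pair cs)
  let ?G = "\<lambda>m z. c * osc (\<lambda>\<xi>. \<sigma> (z, \<xi>) * S m \<xi>) z"
  have Gsum: "?G m z = (\<Sum>l\<in>idx m. c * osc (\<lambda>\<xi>. \<sigma> (z, \<xi>) * blk f l \<xi>) z)" for m z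
  proof -
    have ib: "integrable lborel (\<lambda>\<xi>. exp (\<i> * complex_of_real (z \<bullet> \<xi>)) * (\<sigma> (z, \<xi>) * blk f l \<xi>))" for l
      using integrable_mult_bounded[OF blk_integrable[OF f, of l], of "\<lambda>\<xi>. exp (\<i> * complex_of_real (z \<bullet> \<xi>)) * \<sigma> (z, \<xi>)" B] B(2)
      by (simp add: norm_mult mult.assoc)
    have "osc (\<lambda>\<xi>. \<sigma> (z, \<xi>) * S m \<xi>) z = (LINT \<xi>|lborel. (\<Sum>l\<in>idx m. exp (\<i> * complex_of_real (z \<bullet> \<xi>)) * (\<sigma> (z, \<xi>) * blk f l \<xi>)))"
      unfolding osc_def S_def blk_def by (simp only: sum_distrib_left sum_distrib_right)
    also have "\<dots> = (\<Sum>l\<in>idx m. osc (\<lambda>\<xi>. \<sigma> (z, \<xi>) * blk f l \<xi>) z)"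
      unfolding osc_def by (rule Bochner_Integration.integral_sum[OF ib])
    finally show ?thesis by (simp only: sum_distrib_left)
  qed
  have ob: "norm (c * osc (\<lambda>\<xi>. \<sigma> (z, \<xi>) * g \<xi>) z) \<le> B * (LINT \<xi>|lborel. norm (g \<xi>))"
    "continuous_on UNIV (\<lambda>z. c * osc (\<lambda>\<xi>. \<sigma> (z, \<xi>) * g \<xi>) z)" if g: "integrable lborel g" for g z
  proof -
    note o = osc_symbol_continuous[OF cs B(2) g]
    have "norm (c * osc (\<lambda>\<xi>. \<sigma> (z, \<xi>) * g \<xi>) z) \<le> 1 * (B * (LINT \<xi>|lborel. norm (g \<xi>)))"
      unfolding norm_mult by (intro mult_mono c1 o(2)) auto
    then show "norm (c * osc (\<lambda>\<xi>. \<sigma> (z, \<xi>) * g \<xi>) z) \<le> B * (LINT \<xi>|lborel. norm (g \<xi>))" by simp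
    show "continuous_on UNIV (\<lambda>z. c * osc (\<lambda>\<xi>. \<sigma> (z, \<xi>) * g \<xi>) z)" by (intro continuous_intros o(1))
  qed
  define W where "W = B * (LINT \<xi>|lborel. E * ?w \<xi>)"
  have Gb: "norm (?G m z) \<le> W" for m z
  proof -
    have "(LINT \<xi>|lborel. norm (S m \<xi>)) \<le> (LINT \<xi>|lborel. E * ?w \<xi>)"
      by (intro integral_mono integrable_norm iS iw Sb)
    then show ?thesis using ob(1)[OF iS] B(1) unfolding W_def by (meson mult_left_mono less_imp_le order_trans)
  qed
  have Glim: "(\<lambda>m. ?G m z) \<longlonglongrightarrow> pseudo_diff_op \<sigma> f z" for z
    unfolding pseudo_diff_op_osc c_def[symmetric] osc_def
  proof (intro tendsto_mult tendsto_const integral_dominated_convergence[where w="\<lambda>\<xi>. B * (E * ?w \<xi>)"])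
    show "integrable lborel (\<lambda>\<xi>. B * (E * ?w \<xi>))" using iw by (rule integrable_mult_right)
    show "AE \<xi> in lborel. (\<lambda>m. exp (\<i> * complex_of_real (z \<bullet> \<xi>)) * (\<sigma> (z, \<xi>) * S m \<xi>)) \<longlonglongrightarrow> exp (\<i> * complex_of_real (z \<bullet> \<xi>)) * (\<sigma> (z, \<xi>) * fourier f \<xi>)"
    proof (rule AE_I2)
      fix \<xi>
      have "(\<lambda>m. S m \<xi>) \<longlonglongrightarrow> 1 * fourier f \<xi>"
        unfolding S_def by (intro tendsto_mult tendsto_const eta_partial_sum)
      then show "(\<lambda>m. exp (\<i> * complex_of_real (z \<bullet> \<xi>)) * (\<sigma> (z, \<xi>) * S m \<xi>)) \<longlonglongrightarrow> exp (\<i> * complex_of_real (z \<bullet> \<xi>)) * (\<sigma> (z, \<xi>) * fourier f \<xi>)"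
        by (intro tendsto_mult tendsto_const) simp
    qed
    show "AE \<xi> in lborel. norm (exp (\<i> * complex_of_real (z \<bullet> \<xi>)) * (\<sigma> (z, \<xi>) * S m \<xi>)) \<le> B * (E * ?w \<xi>)" for m
    proof (rule AE_I2)
      fix \<xi>
      have "norm (\<sigma> (z, \<xi>)) * norm (S m \<xi>) \<le> B * (E * ?w \<xi>)" using B(1) by (intro mult_mono B(2) Sb) auto
      then show "norm (exp (\<i> * complex_of_real (z \<bullet> \<xi>)) * (\<sigma> (z, \<xi>) * S m \<xi>)) \<le> B * (E * ?w \<xi>)"
        by (simp only: norm_mult norm_exp_i_times mult_1_left)
    qed
  qed (auto simp: S_def)
  have Gm: "?G m \<in> borel_measurable borel" for m
    by (rule borel_measurable_continuous_onI[OF ob(2)[OF iS]])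
  have iconv: "integrable lborel (\<lambda>z. inv_fourier (\<eta> k) (x - z) * u z)" if "continuous_on UNIV u" "\<And>z. norm (u z) \<le> b" for u b
    using integrable_mult_bounded[OF integrable_reflect[OF ik, of x] borel_measurable_continuous_onI[OF that(1)] that(2)]
    by (simp add: mult.commute)
  have "convolve (inv_fourier (\<eta> k)) (?G m) x = (\<Sum>l\<in>idx m. convolve (inv_fourier (\<eta> k)) (\<lambda>z. c * osc (\<lambda>\<xi>. \<sigma> (z, \<xi>) * blk f l \<xi>) z) x)" for m
    unfolding convolve_def Gsum sum_distrib_left
    by (rule Bochner_Integration.integral_sum[OF iconv[OF ob(2)[OF blk_integrable[OF f]] ob(1)[OF blk_integrable[OF f]]]])
  moreover have "(\<lambda>m. convolve (inv_fourier (\<eta> k)) (?G m) x) \<longlonglongrightarrow> convolve (inv_fourier (\<eta> k)) (pseudo_diff_op \<sigma> f) x"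
    unfolding convolve_def
  proof (rule integral_dominated_convergence[where w="\<lambda>z. norm (inv_fourier (\<eta> k) (x - z)) * W"])
    show "integrable lborel (\<lambda>z. norm (inv_fourier (\<eta> k) (x - z)) * W)"
      using integrable_norm[OF integrable_reflect[OF ik, of x]] by (rule integrable_mult_left)
    show "AE z in lborel. (\<lambda>m. inv_fourier (\<eta> k) (x - z) * ?G m z) \<longlonglongrightarrow> inv_fourier (\<eta> k) (x - z) * pseudo_diff_op \<sigma> f z"
      by (intro AE_I2 tendsto_mult tendsto_const Glim)
    show "AE z in lborel. norm (inv_fourier (\<eta> k) (x - z) * ?G m z) \<le> norm (inv_fourier (\<eta> k) (x - z)) * W" for m
      unfolding norm_mult[of "inv_fourier _ _"] by (intro AE_I2 mult_left_mono Gb) auto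
    show "(\<lambda>z. inv_fourier (\<eta> k) (x - z) * ?G m z) \<in> borel_measurable lborel" for m using Gm[of m] by measurable
    show "(\<lambda>z. inv_fourier (\<eta> k) (x - z) * pseudo_diff_op \<sigma> f z) \<in> borel_measurable lborel"
      using pseudo_diff_op_bounded(1)[OF \<sigma> f] by measurable
  qed
  ultimately show ?thesis unfolding c_def by simp
qed

text \<open>Of the N + n + 2 powers of decay from \<open>core_estimate\<close>, n + 2 are spent on
  replacing the sum over l by a supremum times a convergent lattice sum. The majorants
  \<open>Fl\<close> are left open: norms of the blocks for p infinite, Peetre maximal functions
  otherwise.\<close>

lemma pointwise_estimate:
  assumes \<sigma>: "\<sigma> \<in> symbol_class 0 \<alpha> \<alpha>"
  shows "\<exists>K>0. \<forall>f\<in>schwartz. \<forall>k x Fl. (\<forall>l. 0 \<le> Fl l \<and> (\<forall>y. norm (inv_fourier (blk f l) y) \<le> Fl l * (1 + rad l * norm (x - y)) ^ M)) \<longrightarrow>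
    ennreal (norm (convolve (inv_fourier (\<eta> k)) (pseudo_diff_op \<sigma> f) x)) \<le> ennreal K * (SUP l. ennreal (Fl l / dst k l ^ N))"
proof -
  let ?n = "CARD('n) + 2"
  define c where "c = complex_of_real (1 / (2 * pi) ^ DIM(real ^ 'n))"
  have c1: "norm c \<le> 1" unfolding c_def by (rule inv_const_le_1)
  obtain K where K0: "K > 0" and Kall: "\<forall>k l g F x. integrable lborel g \<longrightarrow> 0 \<le> F \<longrightarrow> (\<forall>y. norm (c * osc g y) \<le> F * (1 + rad l * norm (x - y)) ^ M) \<longrightarrow>
    norm (LINT z|lborel. osc (\<eta> k) (x - z) * osc (\<lambda>\<xi>. etas l \<xi> * \<sigma> (z, \<xi>) * g \<xi>) z) \<le> K * F / dst k l ^ (N + ?n)"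
    using core_estimate[OF \<sigma>, of M "N + ?n", folded c_def] by (elim exE conjE) (rule that)
  obtain Kl where Kl: "Kl > 0" "\<And>k. (\<integral>\<^sup>+l. ennreal (1 / jap (ivec l - ivec k :: real ^ 'n) ^ ?n) \<partial>count_space UNIV) \<le> ennreal Kl"
    using lattice_sum by blast
  have main: "ennreal (norm (convolve (inv_fourier (\<eta> k)) (pseudo_diff_op \<sigma> f) x)) \<le> ennreal (K * Kl) * (SUP l. ennreal (Fl l / dst k l ^ N))"
    if f: "f \<in> schwartz" and F0: "\<And>l. 0 \<le> Fl l" and F: "\<And>l y. norm (inv_fourier (blk f l) y) \<le> Fl l * (1 + rad l * norm (x - y)) ^ M" for f k x Fl
  proof -
    let ?h = "\<lambda>l. convolve (inv_fourier (\<eta> k)) (\<lambda>z. c * osc (\<lambda>\<xi>. \<sigma> (z, \<xi>) * blk f l \<xi>) z) x"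
    let ?S = "SUP l. ennreal (Fl l / dst k l ^ N)"
    have hb: "norm (?h l) \<le> K * Fl l / dst k l ^ (N + ?n)" for l
    proof -
      have "(\<lambda>\<xi>. \<sigma> (z, \<xi>) * blk f l \<xi>) = (\<lambda>\<xi>. etas l \<xi> * \<sigma> (z, \<xi>) * blk f l \<xi>)" for z
      proof
        fix \<xi>
        have "etas l \<xi> * \<sigma> (z, \<xi>) * blk f l \<xi> = \<sigma> (z, \<xi>) * (etas l \<xi> * (\<eta> l \<xi> * fourier f \<xi>))"
          by (simp add: blk_def mult_ac)
        also have "\<dots> = \<sigma> (z, \<xi>) * blk f l \<xi>" by (simp only: etas_mult blk_def)
        finally show "\<sigma> (z, \<xi>) * blk f l \<xi> = etas l \<xi> * \<sigma> (z, \<xi>) * blk f l \<xi>" by simp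
      qed
      moreover have "inv_fourier (\<eta> k) w = c * osc (\<eta> k) w" for w by (simp only: inv_fourier_osc_DIM c_def)
      ultimately have "?h l = (LINT z|lborel. (c * c) * (osc (\<eta> k) (x - z) * osc (\<lambda>\<xi>. etas l \<xi> * \<sigma> (z, \<xi>) * blk f l \<xi>) z))"
        unfolding convolve_def by (simp only: mult_ac)
      then have "norm (?h l) = norm (c * c) * norm (LINT z|lborel. osc (\<eta> k) (x - z) * osc (\<lambda>\<xi>. etas l \<xi> * \<sigma> (z, \<xi>) * blk f l \<xi>) z)"
        by (simp only: integral_mult_right_zero norm_mult)
      also have "\<dots> \<le> 1 * (K * Fl l / dst k l ^ (N + ?n))"
      proof (rule mult_mono)
        show "norm (c * c) \<le> 1" unfolding norm_mult using c1 by (intro mult_le_one) auto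
        show "norm (LINT z|lborel. osc (\<eta> k) (x - z) * osc (\<lambda>\<xi>. etas l \<xi> * \<sigma> (z, \<xi>) * blk f l \<xi>) z) \<le> K * Fl l / dst k l ^ (N + ?n)"
          using F by (intro Kall[rule_format] blk_integrable f F0) (simp only: inv_fourier_osc_DIM c_def)
      qed auto
      finally show ?thesis by simp
    qed
    have dk: "0 < dst k l" for l by (rule dst_pos)
    have part: "ennreal (norm (\<Sum>l\<in>idx m. ?h l)) \<le> ennreal (K * Kl) * ?S" for m
    proof -
      have "ennreal (norm (\<Sum>l\<in>idx m. ?h l)) \<le> ennreal (\<Sum>l\<in>idx m. K * Fl l / dst k l ^ (N + ?n))"
        by (intro ennreal_leI sum_norm_le hb)
      also have "\<dots> = (\<Sum>l\<in>idx m. ennreal (K * Fl l / dst k l ^ (N + ?n)))"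
        using K0 F0 dk by (intro sum_ennreal[symmetric]) (simp add: less_imp_le)
      also have "\<dots> \<le> (\<Sum>l\<in>idx m. ennreal K * ?S * ennreal (1 / jap (ivec l - ivec k) ^ ?n))"
      proof (rule sum_mono)
        fix l
        have "K * Fl l / dst k l ^ (N + ?n) = K * (Fl l / dst k l ^ N) * (1 / dst k l ^ ?n)" by (simp add: power_add)
        then have "ennreal (K * Fl l / dst k l ^ (N + ?n)) = ennreal K * ennreal (Fl l / dst k l ^ N) * ennreal (1 / dst k l ^ ?n)"
          using K0 F0[of l] dk[of l] by (simp only: ennreal_mult less_imp_le mult_nonneg_nonneg divide_nonneg_nonneg zero_le_power zero_le_one)
        also have "\<dots> \<le> ennreal K * ?S * ennreal (1 / dst k l ^ ?n)"
          by (intro mult_right_mono mult_left_mono SUP_upper) auto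
        finally show "ennreal (K * Fl l / dst k l ^ (N + ?n)) \<le> ennreal K * ?S * ennreal (1 / jap (ivec l - ivec k) ^ ?n)"
          by (simp only: dst_commute[of k l] dst_def[of l k])
      qed
      also have "\<dots> = (\<integral>\<^sup>+l. ennreal K * ?S * ennreal (1 / jap (ivec l - ivec k :: real ^ 'n) ^ ?n) \<partial>count_space (idx m))"
        by (rule nn_integral_count_space_finite[OF idx_finite, symmetric])
      also have "\<dots> \<le> (\<integral>\<^sup>+l. ennreal K * ?S * ennreal (1 / jap (ivec l - ivec k :: real ^ 'n) ^ ?n) \<partial>count_space UNIV)"
        by (subst nn_integral_count_space_indicator) (auto intro!: nn_integral_mono simp: indicator_def)
      also have "\<dots> = ennreal K * ?S * (\<integral>\<^sup>+l. ennreal (1 / jap (ivec l - ivec k :: real ^ 'n) ^ ?n) \<partial>count_space UNIV)"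
        by (intro nn_integral_cmult) auto
      also have "\<dots> \<le> ennreal K * ?S * ennreal Kl" by (intro mult_left_mono Kl(2)) auto
      also have "\<dots> = ennreal (K * Kl) * ?S" using K0 Kl(1) by (simp add: ennreal_mult mult_ac)
      finally show ?thesis .
    qed
    have "(\<lambda>m. ennreal (norm (\<Sum>l\<in>idx m. ?h l))) \<longlonglongrightarrow> ennreal (norm (convolve (inv_fourier (\<eta> k)) (pseudo_diff_op \<sigma> f) x))"
      using convolve_pseudo_diff_op_limit[OF \<sigma> f, of k x] unfolding c_def[symmetric] by (intro tendsto_ennrealI tendsto_norm)
    then show ?thesis by (rule LIMSEQ_le_const2) (use part in auto)
  qed
  have "0 < K * Kl" using K0 Kl(1) by simp
  with main show ?thesis by (intro exI[of _ "K * Kl"]) blast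
qed

end

section \<open>Quasi-norms\<close>

lemma epowr_ennreal: "0 \<le> r \<Longrightarrow> epowr (ennreal r) a = ennreal (r powr a)"
  by (simp add: epowr_def)

lemma epowr_mono: "0 \<le> a \<Longrightarrow> x \<le> y \<Longrightarrow> epowr x a \<le> epowr y a"
  by (cases x; cases y) (auto simp: epowr_def powr_mono2 ennreal_leI top_unique)

lemma epowr_mult: "0 < a \<Longrightarrow> epowr (x * y) a = epowr x a * epowr y a"
  by (cases x; cases y)
     (auto simp: epowr_def ennreal_mult[symmetric] powr_mult ennreal_mult_top ennreal_top_mult)

lemma epowr_epowr: "0 < a \<Longrightarrow> a * b = 1 \<Longrightarrow> epowr (epowr x a) b = x"
  by (cases x) (auto simp: epowr_def powr_powr)

text \<open>Each term is at most the a-th root of the sum of the powers. This takes the place of the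
  triangle inequality and holds for exponents on both sides of 1.\<close>

lemma epowr_SUP_le:
  assumes "0 < a"
  shows "epowr (SUP l. s l) a \<le> (\<integral>\<^sup>+l. epowr (s l) a \<partial>count_space UNIV)"
proof -
  let ?I = "\<integral>\<^sup>+l. epowr (s l) a \<partial>count_space UNIV"
  have "s l \<le> epowr ?I (1 / a)" for l
  proof -
    have "epowr (epowr (s l) a) (1 / a) \<le> epowr ?I (1 / a)"
      using assms by (intro epowr_mono nn_integral_ge_point) auto
    then show ?thesis using assms by (simp add: epowr_epowr)
  qed
  then have "epowr (SUP l. s l) a \<le> epowr (epowr ?I (1 / a)) a"
    using assms by (intro epowr_mono SUP_least) auto
  then show ?thesis using assms by (simp add: epowr_epowr)
qed

lemma powr_le_moderate:
  assumes "0 < x" "0 < y" "1 \<le> d" "x \<le> d * y" "y \<le> d * x" "\<bar>\<tau>\<bar> \<le> real S"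
  shows "x powr \<tau> \<le> d ^ S * y powr \<tau>"
proof -
  have "x powr \<tau> \<le> d powr \<bar>\<tau>\<bar> * y powr \<tau>"
  proof (cases "0 \<le> \<tau>")
    case True
    then have "x powr \<tau> \<le> (d * y) powr \<tau>" using assms by (intro powr_mono2) auto
    then show ?thesis using True assms by (simp add: powr_mult)
  next
    case False
    have "d powr \<tau> * x powr \<tau> \<le> y powr \<tau>"
      using False assms powr_mono2'[of \<tau> y "d * x"] by (simp add: powr_mult)
    then have "d powr (- \<tau>) * (d powr \<tau> * x powr \<tau>) \<le> d powr (- \<tau>) * y powr \<tau>" by (intro mult_left_mono) auto
    moreover have "d powr (- \<tau>) * (d powr \<tau> * x powr \<tau>) = x powr \<tau>"
      using assms by (simp add: mult.assoc[symmetric] powr_add[symmetric])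
    ultimately show ?thesis using False by simp
  qed
  also have "\<dots> \<le> d ^ S * y powr \<tau>"
    using assms by (intro mult_right_mono) (auto simp: powr_realpow[symmetric] intro!: powr_mono)
  finally show ?thesis .
qed

lemma inverse_power_powr_le:
  assumes "1 \<le> (x::real)" "real n \<le> real N * P"
  shows "(1 / x ^ N) powr P \<le> 1 / x ^ n"
proof -
  have "x ^ n \<le> x powr (real N * P)"
    using assms by (simp add: powr_realpow[symmetric] powr_mono)
  moreover have "(1 / x ^ N) powr P = 1 / x powr (real N * P)"
    using assms by (simp add: powr_divide powr_realpow[symmetric] powr_powr)
  ultimately show ?thesis using assms by (simp add: frac_le)
qed

text \<open>A closed set of full Lebesgue measure is the whole space. For p infinite it makes the
  norm of a block a pointwise majorant.\<close>

lemma continuous_le_esssup: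
  fixes g :: "'a::euclidean_space \<Rightarrow> complex"
  assumes "continuous_on UNIV g" "esssup lborel (\<lambda>x. ennreal (norm (g x))) \<le> ennreal c" "0 \<le> c"
  shows "norm (g y) \<le> c"
proof -
  have "AE x in lborel. ennreal (norm (g x)) \<le> ennreal c"
    using esssup_AE[of "\<lambda>x. ennreal (norm (g x))" lborel] by (rule eventually_mono) (rule order_trans[OF _ assms(2)])
  then have "AE x in lborel. x \<in> {x. norm (g x) \<le> c}" using assms(3) by simp
  then have "AE x in lebesgue. x \<in> {x. norm (g x) \<le> c}" by (rule AE_completion)
  moreover have "closed {x. norm (g x) \<le> c}"
    by (intro closed_Collect_le continuous_on_norm assms(1) continuous_on_const)
  ultimately have "y \<in> {x. norm (g x) \<le> c}"
    by (intro mem_closed_if_AE_lebesgue)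
  then show ?thesis by simp
qed

context alpha_partition
begin

section \<open>Estimates in the sequence and Lebesgue quasi-norms\<close>

lemma dst_power_sum: "\<exists>K>0. \<forall>N P. real (CARD('n) + 2) \<le> real N * P \<longrightarrow> (\<forall>k. (\<integral>\<^sup>+l. ennreal ((1 / dst k l ^ N) powr P) \<partial>count_space UNIV) \<le> ennreal K)"
proof -
  let ?n = "CARD('n) + 2"
  obtain K where K: "K > 0" "\<And>k. (\<integral>\<^sup>+l. ennreal (1 / jap (ivec l - ivec k :: real ^ 'n) ^ ?n) \<partial>count_space UNIV) \<le> ennreal K"
    using lattice_sum by blast
  have "(\<integral>\<^sup>+l. ennreal ((1 / dst k l ^ N) powr P) \<partial>count_space UNIV) \<le> ennreal K" if N: "real ?n \<le> real N * P" for N P k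
  proof -
    have "ennreal ((1 / dst k l ^ N) powr P) \<le> ennreal (1 / jap (ivec l - ivec k) ^ ?n)" for l
      using inverse_power_powr_le[OF dst_ge_1[of k l] N]
      by (intro ennreal_leI) (simp only: dst_commute[of k l] dst_def[of l k])
    then show ?thesis by (intro order_trans[OF nn_integral_mono K(2)]) auto
  qed
  with K(1) show ?thesis by blast
qed

lemma weight_moderate:
  assumes "\<bar>\<tau>\<bar> \<le> real S"
  shows "jap (ivec k :: real ^ 'n) powr \<tau> \<le> dst k l ^ S * jap (ivec l :: real ^ 'n) powr \<tau>"
  using assms jap_triangle[of "ivec k :: real ^ 'n" "ivec l"] jap_triangle[of "ivec l :: real ^ 'n" "ivec k"]
  by (intro powr_le_moderate jap_pos dst_ge_1)
     (auto simp: dst_def[symmetric] dst_commute[of l k])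

text \<open>A Schur test in supremum form: raise to the power q, replace the power of the supremum
  by a sum, and exchange the two sums; the decay is symmetric in k and l and summable. For q
  infinite \<open>N = 0\<close> suffices.\<close>

lemma Lp_count_space_estimate:
  assumes q: "0 < q"
  shows "\<exists>N. \<exists>K>0. \<forall>c\<ge>0. \<forall>a b :: int ^ 'n \<Rightarrow> ennreal. (\<forall>k. b k \<le> ennreal c * (SUP l. ennreal (1 / dst k l ^ N) * a l)) \<longrightarrow>
    Lp_norm (count_space UNIV) q b \<le> ennreal (K * c) * Lp_norm (count_space UNIV) q a"
proof (cases "q = \<infinity>")
  case True
  have "esssup (count_space UNIV) b \<le> ennreal (1 * c) * esssup (count_space UNIV) a"
    if "0 \<le> c" and ab: "\<And>k. b k \<le> ennreal c * (SUP l. ennreal (1 / dst k l ^ 0) * a l)" for c and a b :: "int ^ 'n \<Rightarrow> ennreal"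
  proof (rule esssup_I)
    have al: "a l \<le> esssup (count_space UNIV) a" for l
      using esssup_AE[of a "count_space UNIV"] by (simp add: AE_count_space)
    have "b k \<le> ennreal (1 * c) * esssup (count_space UNIV) a" for k
      by (rule order_trans[OF ab]) (use al in \<open>auto intro!: mult_left_mono SUP_least\<close>)
    then show "AE k in count_space UNIV. b k \<le> ennreal (1 * c) * esssup (count_space UNIV) a" by (simp add: AE_count_space)
  qed simp
  then show ?thesis using True unfolding Lp_norm_def by (intro exI[where x=0] exI[where x="1::real"]) auto
next
  case False
  define Q where "Q = enn2real q"
  have Q: "0 < Q" using q False unfolding Q_def by (simp add: enn2real_positive_iff less_top)
  \<comment> \<open>Smallest decay for which the q-th power of dst^-N is dominated by the summable
    power n + 2; it grows as q tends to 0.\<close>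
  define N where "N = nat \<lceil>real (CARD('n) + 2) / Q\<rceil>"
  have N: "real (CARD('n) + 2) \<le> real N * Q"
    using Q real_nat_ceiling_ge[of "real (CARD('n) + 2) / Q"] unfolding N_def by (simp only: pos_divide_le_eq)
  obtain K where K: "K > 0" "\<And>k. (\<integral>\<^sup>+l. ennreal ((1 / dst k l ^ N) powr Q) \<partial>count_space UNIV) \<le> ennreal K"
    using dst_power_sum N by metis
  have "Lp_norm (count_space UNIV) q b \<le> ennreal (K powr (1 / Q) * c) * Lp_norm (count_space UNIV) q a"
    if c: "0 \<le> c" and ab: "\<And>k. b k \<le> ennreal c * (SUP l. ennreal (1 / dst k l ^ N) * a l)" for c and a b :: "int ^ 'n \<Rightarrow> ennreal"
  proof -
    let ?I = "\<integral>\<^sup>+l. epowr (a l) Q \<partial>count_space UNIV"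
    have d0: "0 \<le> 1 / dst k l ^ N" for k l using dst_pos[of k l] by simp
    have "epowr (b k) Q \<le> epowr (ennreal c) Q * (\<integral>\<^sup>+l. ennreal ((1 / dst k l ^ N) powr Q) * epowr (a l) Q \<partial>count_space UNIV)" for k
    proof -
      have "epowr (b k) Q \<le> epowr (ennreal c) Q * epowr (SUP l. ennreal (1 / dst k l ^ N) * a l) Q"
        using epowr_mono[OF less_imp_le[OF Q] ab[of k]] Q by (simp only: epowr_mult)
      also have "\<dots> \<le> epowr (ennreal c) Q * (\<integral>\<^sup>+l. epowr (ennreal (1 / dst k l ^ N) * a l) Q \<partial>count_space UNIV)"
        by (intro mult_left_mono epowr_SUP_le Q) auto
      finally show ?thesis by (simp only: epowr_mult[OF Q] epowr_ennreal[OF d0])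
    qed
    then have "(\<integral>\<^sup>+k. epowr (b k) Q \<partial>count_space UNIV) \<le>
        (\<integral>\<^sup>+k. epowr (ennreal c) Q * (\<integral>\<^sup>+l. ennreal ((1 / dst k l ^ N) powr Q) * epowr (a l) Q \<partial>count_space UNIV) \<partial>count_space UNIV)"
      by (intro nn_integral_mono)
    also have "\<dots> = epowr (ennreal c) Q * (\<integral>\<^sup>+k. \<integral>\<^sup>+l. ennreal ((1 / dst k l ^ N) powr Q) * epowr (a l) Q \<partial>count_space UNIV \<partial>count_space UNIV)"
      by (rule nn_integral_cmult) simp
    also have "(\<integral>\<^sup>+k. \<integral>\<^sup>+l. ennreal ((1 / dst k l ^ N) powr Q) * epowr (a l) Q \<partial>count_space UNIV \<partial>count_space UNIV) =
        (\<integral>\<^sup>+l. \<integral>\<^sup>+k. ennreal ((1 / dst l k ^ N) powr Q) * epowr (a l) Q \<partial>count_space UNIV \<partial>count_space UNIV)"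
      by (subst nn_integral_count_space_nn_integral) (simp_all add: dst_commute)
    also have "\<dots> = (\<integral>\<^sup>+l. (\<integral>\<^sup>+k. ennreal ((1 / dst l k ^ N) powr Q) \<partial>count_space UNIV) * epowr (a l) Q \<partial>count_space UNIV)"
      by (simp add: nn_integral_multc)
    also have "\<dots> \<le> (\<integral>\<^sup>+l. ennreal K * epowr (a l) Q \<partial>count_space UNIV)"
      by (intro nn_integral_mono mult_right_mono K(2)) auto
    also have "\<dots> = ennreal K * ?I" by (rule nn_integral_cmult) simp
    finally have "(\<integral>\<^sup>+k. epowr (b k) Q \<partial>count_space UNIV) \<le> epowr (ennreal c) Q * (ennreal K * ?I)" by (simp add: mult_left_mono)
    then have "epowr (\<integral>\<^sup>+k. epowr (b k) Q \<partial>count_space UNIV) (1 / Q) \<le> epowr (epowr (ennreal c) Q * (ennreal K * ?I)) (1 / Q)"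
      using Q by (intro epowr_mono) auto
    also have "\<dots> = ennreal c * (ennreal (K powr (1 / Q)) * epowr ?I (1 / Q))"
      using Q K(1) by (simp add: epowr_mult epowr_epowr epowr_ennreal)
    finally show ?thesis using False c unfolding Lp_norm_def Q_def[symmetric]
      by (simp add: ennreal_mult mult_ac)
  qed
  moreover have "0 < K powr (1 / Q)" using K(1) by simp
  ultimately show ?thesis by (intro exI[where x=N] exI[where x="K powr (1 / Q)"]) blast
qed

text \<open>All representatives agree almost everywhere, so every competitor in the infimum has the
  same norm as \<open>g\<close>.\<close>

lemma Lp_norm_le_dist_Lp_norm:
  assumes "represents g T"
  shows "Lp_norm lborel p (\<lambda>x. ennreal (norm (g x))) \<le> dist_Lp_norm p T"
  unfolding dist_Lp_norm_def
proof (rule INF_greatest)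
  fix h assume "h \<in> {g. represents g T}"
  then have h: "represents h T" by simp
  have [measurable]: "g \<in> borel_measurable lborel" "h \<in> borel_measurable lborel"
    using assms h by (auto simp: represents_def)
  have ae: "AE x in lborel. g x = h x" by (rule represents_unique_AE[OF assms h])
  have "Lp_norm lborel p (\<lambda>x. ennreal (norm (g x))) = Lp_norm lborel p (\<lambda>x. ennreal (norm (h x)))"
    unfolding Lp_norm_def using ae
    by (auto intro!: esssup_AE_cong arg_cong[where f="\<lambda>z. epowr z (1 / enn2real p)"] nn_integral_cong_AE elim!: eventually_mono)
  then show "Lp_norm lborel p (\<lambda>x. ennreal (norm (g x))) \<le> Lp_norm lborel p (\<lambda>x. ennreal (norm (h x)))" by simp
qed

text \<open>The case p infinite: with weight exponent 0 the majorant of a block is the constant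
  given by its essential supremum.\<close>

lemma block_Lp_sup:
  assumes \<sigma>: "\<sigma> \<in> symbol_class 0 \<alpha> \<alpha>"
  shows "\<exists>K>0. \<forall>f\<in>schwartz. \<forall>k. esssup lborel (\<lambda>x. ennreal (norm (convolve (inv_fourier (\<eta> k)) (pseudo_diff_op \<sigma> f) x)))
    \<le> ennreal K * (SUP l. ennreal (1 / dst k l ^ N) * esssup lborel (\<lambda>x. ennreal (norm (inv_fourier (blk f l) x))))"
proof -
  obtain K where K: "K > 0" and est: "\<forall>f\<in>schwartz. \<forall>k x Fl. (\<forall>l. 0 \<le> Fl l \<and> (\<forall>y. norm (inv_fourier (blk f l) y) \<le> Fl l * (1 + rad l * norm (x - y)) ^ 0)) \<longrightarrow>
    ennreal (norm (convolve (inv_fourier (\<eta> k)) (pseudo_diff_op \<sigma> f) x)) \<le> ennreal K * (SUP l. ennreal (Fl l / dst k l ^ N))"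
    using pointwise_estimate[OF \<sigma>, where M=0 and N=N] by (elim exE conjE) (rule that)
  have "esssup lborel (\<lambda>x. ennreal (norm (convolve (inv_fourier (\<eta> k)) (pseudo_diff_op \<sigma> f) x)))
    \<le> ennreal K * (SUP l. ennreal (1 / dst k l ^ N) * esssup lborel (\<lambda>x. ennreal (norm (inv_fourier (blk f l) x))))"
    (is "_ \<le> _ * (SUP l. _ * ?a l)")
    if f: "f \<in> schwartz" for f k
  proof (cases "\<exists>l. ?a l = \<infinity>")
    \<comment> \<open>\<open>enn2real\<close> maps infinity to 0, so an infinite norm cannot serve
      as a majorant; in that case the right-hand side is infinite.\<close>
    case True
    then obtain l where l: "?a l = \<infinity>" by blast
    have "ennreal (1 / dst k l ^ N) * ?a l = \<infinity>" using l dst_pos[of k l] by (simp add: ennreal_mult_top)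
    then have top: "(SUP l. ennreal (1 / dst k l ^ N) * ?a l) = \<infinity>"
      using SUP_upper[of l UNIV "\<lambda>l. ennreal (1 / dst k l ^ N) * ?a l"] by (simp add: top_unique)
    show ?thesis unfolding top using K by (simp add: ennreal_mult_top)
  next
    case False
    have a: "?a l = ennreal (enn2real (?a l))" for l using False by (simp add: less_top)
    show ?thesis
    proof (rule esssup_I)
      obtain B where "\<And>x. norm (pseudo_diff_op \<sigma> f x) \<le> B" using pseudo_diff_op_bounded(2)[OF \<sigma> f] by blast
      from represents_fourier_multiplier[OF eta_schwartz pseudo_diff_op_bounded(1)[OF \<sigma> f] this, of k]
      have [measurable]: "convolve (inv_fourier (\<eta> k)) (pseudo_diff_op \<sigma> f) \<in> borel_measurable borel"
        by (simp add: represents_def)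
      show "(\<lambda>x. ennreal (norm (convolve (inv_fourier (\<eta> k)) (pseudo_diff_op \<sigma> f) x))) \<in> borel_measurable lborel"
        by measurable
      show "AE x in lborel. ennreal (norm (convolve (inv_fourier (\<eta> k)) (pseudo_diff_op \<sigma> f) x)) \<le> ennreal K * (SUP l. ennreal (1 / dst k l ^ N) * ?a l)"
      proof (rule AE_I2)
        fix x
        have "norm (inv_fourier (blk f l) y) \<le> enn2real (?a l)" for l y
          by (rule continuous_le_esssup[OF continuous_inv_fourier[OF blk_integrable[OF f]]]) (use a[of l] in auto)
        then have "ennreal (norm (convolve (inv_fourier (\<eta> k)) (pseudo_diff_op \<sigma> f) x)) \<le> ennreal K * (SUP l. ennreal (enn2real (?a l) / dst k l ^ N))"
          by (intro est[rule_format] f) auto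
        moreover have "ennreal (enn2real (?a l) / dst k l ^ N) = ennreal (1 / dst k l ^ N) * ?a l" for l
          using dst_pos[of k l] by (subst (2) a) (simp add: ennreal_mult[symmetric])
        ultimately show "ennreal (norm (convolve (inv_fourier (\<eta> k)) (pseudo_diff_op \<sigma> f) x)) \<le> ennreal K * (SUP l. ennreal (1 / dst k l ^ N) * ?a l)"
          by (simp only:)
      qed
    qed
  qed
  with K show ?thesis by blast
qed

text \<open>The condition on \<open>M\<close> makes the P-th power of the weight decay at least like
  the integrable kernel of exponent n + 2, so the maximal function is controlled by a convolution of
  |f_l|^P.\<close>

lemma peetre_block:
  assumes P: "0 < P" and M: "real (CARD('n) + 2) \<le> real M * P"
  shows "\<exists>K>0. \<forall>f\<in>schwartz. \<forall>l x. \<exists>F\<ge>0. (\<forall>y. norm (inv_fourier (blk f l) y) \<le> F * (1 + rad l * norm (x - y)) ^ M) \<and>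
    ennreal (F powr P) \<le> ennreal (K * rad l ^ CARD('n)) * (\<integral>\<^sup>+y. ennreal (norm (inv_fourier (blk f l) y) powr P) * ennreal (1 / (1 + rad l * norm (x - y)) ^ (CARD('n) + 2)) \<partial>lborel)"
proof -
  obtain K where K: "K > 0" and est: "\<forall>l g x. integrable lborel g \<longrightarrow> (\<forall>\<xi>. etas l \<xi> * g \<xi> = g \<xi>) \<longrightarrow>
    (\<exists>F\<ge>0. (\<forall>y. norm (complex_of_real (1 / (2 * pi) ^ DIM(real ^ 'n)) * osc g y) \<le> F * (1 + rad l * norm (x - y)) ^ M) \<and>
      ennreal (F powr P) \<le> ennreal (K * rad l ^ DIM(real ^ 'n)) *
        (\<integral>\<^sup>+y. ennreal ((norm (complex_of_real (1 / (2 * pi) ^ DIM(real ^ 'n)) * osc g y) / (1 + rad l * norm (x - y)) ^ M) powr P) \<partial>lborel))"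
    using peetre_band_limited[OF P, of M] by (elim exE conjE) (rule that)
  have "\<exists>F\<ge>0. (\<forall>y. norm (inv_fourier (blk f l) y) \<le> F * (1 + rad l * norm (x - y)) ^ M) \<and>
    ennreal (F powr P) \<le> ennreal (K * rad l ^ CARD('n)) * (\<integral>\<^sup>+y. ennreal (norm (inv_fourier (blk f l) y) powr P) * ennreal (1 / (1 + rad l * norm (x - y)) ^ (CARD('n) + 2)) \<partial>lborel)"
    if f: "f \<in> schwartz" for f l x
  proof -
    have "\<forall>\<xi>. etas l \<xi> * blk f l \<xi> = blk f l \<xi>" unfolding blk_def by (simp add: etas_mult)
    then obtain F where F: "F \<ge> 0" "\<And>y. norm (inv_fourier (blk f l) y) \<le> F * (1 + rad l * norm (x - y)) ^ M"
      "ennreal (F powr P) \<le> ennreal (K * rad l ^ CARD('n)) * (\<integral>\<^sup>+y. ennreal ((norm (inv_fourier (blk f l) y) / (1 + rad l * norm (x - y)) ^ M) powr P) \<partial>lborel)"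
      using est[rule_format, OF blk_integrable[OF f], of l l x] unfolding inv_fourier_osc_DIM by auto
    have "ennreal ((norm (inv_fourier (blk f l) y) / (1 + rad l * norm (x - y)) ^ M) powr P)
        \<le> ennreal (norm (inv_fourier (blk f l) y) powr P) * ennreal (1 / (1 + rad l * norm (x - y)) ^ (CARD('n) + 2))" for y
    proof -
      have r: "1 \<le> 1 + rad l * norm (x - y)" using rad_pos[of l] by (simp add: less_imp_le)
      have "(norm (inv_fourier (blk f l) y) * (1 / (1 + rad l * norm (x - y)) ^ M)) powr P
          = norm (inv_fourier (blk f l) y) powr P * (1 / (1 + rad l * norm (x - y)) ^ M) powr P"
        by (rule powr_mult)
      also have "\<dots> \<le> norm (inv_fourier (blk f l) y) powr P * (1 / (1 + rad l * norm (x - y)) ^ (CARD('n) + 2))"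
        by (intro mult_left_mono inverse_power_powr_le r M) auto
      finally have "(norm (inv_fourier (blk f l) y) / (1 + rad l * norm (x - y)) ^ M) powr P
          \<le> norm (inv_fourier (blk f l) y) powr P * (1 / (1 + rad l * norm (x - y)) ^ (CARD('n) + 2))"
        by (simp only: times_divide_eq_right mult_1_right)
      then have "ennreal ((norm (inv_fourier (blk f l) y) / (1 + rad l * norm (x - y)) ^ M) powr P)
          \<le> ennreal (norm (inv_fourier (blk f l) y) powr P * (1 / (1 + rad l * norm (x - y)) ^ (CARD('n) + 2)))"
        by (rule ennreal_leI)
      then show ?thesis by (simp only: ennreal_mult' powr_ge_zero)
    qed
    then have "ennreal (F powr P) \<le> ennreal (K * rad l ^ CARD('n)) * (\<integral>\<^sup>+y. ennreal (norm (inv_fourier (blk f l) y) powr P) * ennreal (1 / (1 + rad l * norm (x - y)) ^ (CARD('n) + 2)) \<partial>lborel)"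
      by (intro order_trans[OF F(3)] mult_left_mono nn_integral_mono) auto
    with F(1,2) show ?thesis by blast
  qed
  with K show ?thesis by blast
qed

text \<open>Insert the maximal functions into the pointwise estimate, raise it to the power P, pass
  from the supremum to a sum over l and integrate in x term by term. The supremum of the right-hand
  side is recovered from dst^-N, while the remaining dst^-M makes the sum over l converge.\<close>

lemma block_Lp_finite:
  assumes \<sigma>: "\<sigma> \<in> symbol_class 0 \<alpha> \<alpha>" and P: "0 < P"
  shows "\<exists>K>0. \<forall>f\<in>schwartz. \<forall>k. epowr (\<integral>\<^sup>+x. epowr (ennreal (norm (convolve (inv_fourier (\<eta> k)) (pseudo_diff_op \<sigma> f) x))) P \<partial>lborel) (1 / P)
    \<le> ennreal K * (SUP l. ennreal (1 / dst k l ^ N) * epowr (\<integral>\<^sup>+x. epowr (ennreal (norm (inv_fourier (blk f l) x))) P \<partial>lborel) (1 / P))"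
proof -
  let ?n = "CARD('n) + 2"
  \<comment> \<open>\<open>M\<close> serves twice: as exponent of the Peetre weight, whose P-th
    power must be integrable, and as surplus decay, whose P-th power must be summable over the
    lattice. Both follow from n + 2 <= M P.\<close>
  define M where "M = nat \<lceil>real ?n / P\<rceil>"
  have M: "real ?n \<le> real M * P"
    using P real_nat_ceiling_ge[of "real ?n / P"] unfolding M_def by (simp only: pos_divide_le_eq)
  obtain K1 where K1: "K1 > 0" and est: "\<forall>f\<in>schwartz. \<forall>k x Fl. (\<forall>l. 0 \<le> Fl l \<and> (\<forall>y. norm (inv_fourier (blk f l) y) \<le> Fl l * (1 + rad l * norm (x - y)) ^ M)) \<longrightarrow>
    ennreal (norm (convolve (inv_fourier (\<eta> k)) (pseudo_diff_op \<sigma> f) x)) \<le> ennreal K1 * (SUP l. ennreal (Fl l / dst k l ^ (N + M)))"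
    using pointwise_estimate[OF \<sigma>, where M=M and N="N + M"] by (elim exE conjE) (rule that)
  define G where "G f l x = (\<integral>\<^sup>+y. ennreal (norm (inv_fourier (blk f l) y) powr P) * ennreal (1 / (1 + rad l * norm (x - y)) ^ ?n) \<partial>lborel)" for f l x
  obtain K2 where K2: "K2 > 0" and pee: "\<forall>f\<in>schwartz. \<forall>l x. \<exists>F\<ge>0. (\<forall>y. norm (inv_fourier (blk f l) y) \<le> F * (1 + rad l * norm (x - y)) ^ M) \<and>
    ennreal (F powr P) \<le> ennreal (K2 * rad l ^ CARD('n)) * G f l x"
    using peetre_block[OF P M] by (elim exE conjE) (rule that[unfolded G_def])
  obtain K3 where K3: "K3 > 0" "\<And>r. r > 0 \<Longrightarrow> (\<integral>\<^sup>+x. ennreal (1 / (1 + r * norm (x :: real ^ 'n)) ^ ?n) \<partial>lborel) \<le> ennreal (K3 / r ^ CARD('n))"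
    using nn_integral_decay[where 'a="real ^ 'n"] by auto
  obtain K4 where K4: "K4 > 0" "\<And>k. (\<integral>\<^sup>+l. ennreal ((1 / dst k l ^ M) powr P) \<partial>count_space UNIV) \<le> ennreal K4"
    using dst_power_sum M by metis
  \<comment> \<open>\<open>K1\<close> comes from the pointwise estimate, \<open>K2\<close> from the
    maximal inequality, \<open>K3\<close> is the mass of the kernel and \<open>K4\<close> the
    lattice sum.\<close>
  define K where "K = (K1 powr P * (K2 * K3) * K4) powr (1 / P)"
  have K0: "0 < K" using K1 K2 K3(1) K4(1) by (simp add: K_def)
  have "epowr (\<integral>\<^sup>+x. epowr (ennreal (norm (convolve (inv_fourier (\<eta> k)) (pseudo_diff_op \<sigma> f) x))) P \<partial>lborel) (1 / P)
    \<le> ennreal K * (SUP l. ennreal (1 / dst k l ^ N) * epowr (\<integral>\<^sup>+x. epowr (ennreal (norm (inv_fourier (blk f l) x))) P \<partial>lborel) (1 / P))"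
    if f: "f \<in> schwartz" for f k
  proof -
    let ?h = "\<lambda>x. ennreal (norm (convolve (inv_fourier (\<eta> k)) (pseudo_diff_op \<sigma> f) x))"
    define I where "I l = (\<integral>\<^sup>+x. epowr (ennreal (norm (inv_fourier (blk f l) x))) P \<partial>lborel)" for l
    let ?S = "SUP l. ennreal (1 / dst k l ^ N) * epowr (I l) (1 / P)"
    have [measurable]: "inv_fourier (blk f l) \<in> borel_measurable borel" for l
      by (intro borel_measurable_continuous_onI continuous_inv_fourier blk_integrable f)
    have Gm[measurable]: "G f l \<in> borel_measurable borel" for l unfolding G_def by measurable
    \<comment> \<open>By Tonelli the convolution integrates to the product of the masses; that of
      the kernel is of order rad l^-n and compensates the factor rad l^n of the maximal
      inequality.\<close>
    have GI: "(\<integral>\<^sup>+x. ennreal (K2 * rad l ^ CARD('n)) * G f l x \<partial>lborel) \<le> ennreal (K2 * K3) * I l" for l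
    proof -
      let ?u = "\<lambda>y. ennreal (norm (inv_fourier (blk f l) y) powr P)"
      let ?v = "\<lambda>z. ennreal (1 / (1 + rad l * norm (z :: real ^ 'n)) ^ ?n)"
      have "(\<integral>\<^sup>+x. G f l x \<partial>lborel) = (\<integral>\<^sup>+y. \<integral>\<^sup>+x. ?u y * ?v (x - y) \<partial>lborel \<partial>lborel)"
        unfolding G_def by (rule lborel_pair.Fubini') measurable
      also have "\<dots> = (\<integral>\<^sup>+y. ?u y * (\<integral>\<^sup>+x. ?v (x - y) \<partial>lborel) \<partial>lborel)"
        by (intro nn_integral_cong nn_integral_cmult) measurable
      also have "\<dots> = (\<integral>\<^sup>+y. ?u y * (\<integral>\<^sup>+x. ?v x \<partial>lborel) \<partial>lborel)"
      proof (rule nn_integral_cong)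
        fix y
        have "(\<integral>\<^sup>+x. ?v (x - y) \<partial>lborel) = (\<integral>\<^sup>+x. ?v x \<partial>lborel)"
          using nn_integral_shift[of ?v "- y"] by simp
        then show "?u y * (\<integral>\<^sup>+x. ?v (x - y) \<partial>lborel) = ?u y * (\<integral>\<^sup>+x. ?v x \<partial>lborel)" by (simp only:)
      qed
      also have "\<dots> \<le> (\<integral>\<^sup>+y. ?u y * ennreal (K3 / rad l ^ CARD('n)) \<partial>lborel)"
        by (intro nn_integral_mono mult_left_mono K3(2) rad_pos) auto
      also have "\<dots> = I l * ennreal (K3 / rad l ^ CARD('n))"
        unfolding I_def by (simp add: epowr_ennreal nn_integral_multc)
      finally have "(\<integral>\<^sup>+x. G f l x \<partial>lborel) \<le> I l * ennreal (K3 / rad l ^ CARD('n))" .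
      then have "ennreal (K2 * rad l ^ CARD('n)) * (\<integral>\<^sup>+x. G f l x \<partial>lborel) \<le> ennreal (K2 * rad l ^ CARD('n)) * (I l * ennreal (K3 / rad l ^ CARD('n)))"
        by (rule mult_left_mono) simp
      also have "\<dots> = (ennreal (K2 * rad l ^ CARD('n)) * ennreal (K3 / rad l ^ CARD('n))) * I l" by (simp only: mult_ac)
      also have "ennreal (K2 * rad l ^ CARD('n)) * ennreal (K3 / rad l ^ CARD('n)) = ennreal (K2 * K3)"
        using K2 K3(1) rad_pos[of l] by (simp add: ennreal_mult[symmetric])
      finally show ?thesis by (simp add: nn_integral_cmult)
    qed
    have d0: "0 \<le> 1 / dst k l ^ m" for l m using dst_pos[of k l] by simp
    have dm: "ennreal ((1 / dst k l ^ (N + M)) powr P) = ennreal ((1 / dst k l ^ N) powr P) * ennreal ((1 / dst k l ^ M) powr P)" for l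
      using dst_pos[of k l] by (simp add: ennreal_mult[symmetric] powr_mult[symmetric] power_add)
    have IS: "ennreal ((1 / dst k l ^ N) powr P) * I l \<le> epowr ?S P" for l
    proof -
      have "epowr (ennreal (1 / dst k l ^ N) * epowr (I l) (1 / P)) P \<le> epowr ?S P"
        using P by (intro epowr_mono SUP_upper) auto
      then show ?thesis using P d0[of l N] by (simp only: epowr_mult epowr_ennreal) (simp add: epowr_epowr)
    qed
    have pt: "epowr (?h x) P \<le> ennreal (K1 powr P) * (\<integral>\<^sup>+l. ennreal ((1 / dst k l ^ (N + M)) powr P) * (ennreal (K2 * rad l ^ CARD('n)) * G f l x) \<partial>count_space UNIV)" for x
    proof -
      have "\<forall>l. \<exists>F. F \<ge> 0 \<and> (\<forall>y. norm (inv_fourier (blk f l) y) \<le> F * (1 + rad l * norm (x - y)) ^ M) \<and>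
          ennreal (F powr P) \<le> ennreal (K2 * rad l ^ CARD('n)) * G f l x"
        using pee f by blast
      from choice[OF this] obtain Fl where Fl: "\<And>l. Fl l \<ge> 0" "\<And>l y. norm (inv_fourier (blk f l) y) \<le> Fl l * (1 + rad l * norm (x - y)) ^ M"
        "\<And>l. ennreal (Fl l powr P) \<le> ennreal (K2 * rad l ^ CARD('n)) * G f l x"
        by blast
      have "?h x \<le> ennreal K1 * (SUP l. ennreal (Fl l / dst k l ^ (N + M)))" using Fl(1,2) by (intro est[rule_format] f) auto
      then have "epowr (?h x) P \<le> ennreal (K1 powr P) * epowr (SUP l. ennreal (Fl l / dst k l ^ (N + M))) P"
        using epowr_mono[of P "?h x" "ennreal K1 * (SUP l. ennreal (Fl l / dst k l ^ (N + M)))"] P K1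
        by (simp add: epowr_mult epowr_ennreal)
      also have "\<dots> \<le> ennreal (K1 powr P) * (\<integral>\<^sup>+l. epowr (ennreal (Fl l / dst k l ^ (N + M))) P \<partial>count_space UNIV)"
        by (intro mult_left_mono epowr_SUP_le P) auto
      also have "\<dots> \<le> ennreal (K1 powr P) * (\<integral>\<^sup>+l. ennreal ((1 / dst k l ^ (N + M)) powr P) * (ennreal (K2 * rad l ^ CARD('n)) * G f l x) \<partial>count_space UNIV)"
      proof (intro mult_left_mono nn_integral_mono)
        fix l
        have "epowr (ennreal (Fl l / dst k l ^ (N + M))) P = epowr (ennreal (1 / dst k l ^ (N + M)) * ennreal (Fl l)) P"
          using Fl(1)[of l] dst_pos[of k l] by (simp add: ennreal_mult[symmetric])
        also have "\<dots> = ennreal ((1 / dst k l ^ (N + M)) powr P) * ennreal (Fl l powr P)"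
          by (simp only: epowr_mult[OF P] epowr_ennreal d0 Fl(1))
        also have "\<dots> \<le> ennreal ((1 / dst k l ^ (N + M)) powr P) * (ennreal (K2 * rad l ^ CARD('n)) * G f l x)"
          by (intro mult_left_mono Fl(3)) auto
        finally show "epowr (ennreal (Fl l / dst k l ^ (N + M))) P \<le> \<dots>" .
      qed simp
      finally show ?thesis .
    qed
    have "(\<integral>\<^sup>+x. epowr (?h x) P \<partial>lborel) \<le> (\<integral>\<^sup>+x. ennreal (K1 powr P) * (\<integral>\<^sup>+l. ennreal ((1 / dst k l ^ (N + M)) powr P) * (ennreal (K2 * rad l ^ CARD('n)) * G f l x) \<partial>count_space UNIV) \<partial>lborel)"
      by (intro nn_integral_mono pt)
    also have "\<dots> = (\<integral>\<^sup>+x. \<integral>\<^sup>+l. ennreal (K1 powr P) * (ennreal ((1 / dst k l ^ (N + M)) powr P) * (ennreal (K2 * rad l ^ CARD('n)) * G f l x)) \<partial>count_space UNIV \<partial>lborel)"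
      by (intro nn_integral_cong nn_integral_cmult[symmetric]) simp
    also have "\<dots> = (\<integral>\<^sup>+l. \<integral>\<^sup>+x. ennreal (K1 powr P) * (ennreal ((1 / dst k l ^ (N + M)) powr P) * (ennreal (K2 * rad l ^ CARD('n)) * G f l x)) \<partial>lborel \<partial>count_space UNIV)"
      by (intro nn_integral_count_space_nn_integral) auto
    also have "\<dots> = (\<integral>\<^sup>+l. ennreal (K1 powr P) * (ennreal ((1 / dst k l ^ (N + M)) powr P) * (\<integral>\<^sup>+x. ennreal (K2 * rad l ^ CARD('n)) * G f l x \<partial>lborel)) \<partial>count_space UNIV)"
      by (simp add: nn_integral_cmult)
    also have "\<dots> \<le> (\<integral>\<^sup>+l. (ennreal (K1 powr P) * ennreal (K2 * K3) * epowr ?S P) * ennreal ((1 / dst k l ^ M) powr P) \<partial>count_space UNIV)"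
    proof (intro nn_integral_mono)
      fix l
      have "ennreal (K1 powr P) * (ennreal ((1 / dst k l ^ (N + M)) powr P) * (\<integral>\<^sup>+x. ennreal (K2 * rad l ^ CARD('n)) * G f l x \<partial>lborel))
          \<le> ennreal (K1 powr P) * (ennreal ((1 / dst k l ^ (N + M)) powr P) * (ennreal (K2 * K3) * I l))"
        by (intro mult_left_mono GI) auto
      also have "\<dots> = ennreal (K1 powr P) * ennreal (K2 * K3) * (ennreal ((1 / dst k l ^ N) powr P) * I l) * ennreal ((1 / dst k l ^ M) powr P)"
        by (simp only: dm mult_ac)
      also have "\<dots> \<le> ennreal (K1 powr P) * ennreal (K2 * K3) * epowr ?S P * ennreal ((1 / dst k l ^ M) powr P)"
        by (intro mult_left_mono mult_right_mono IS) auto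
      finally show "ennreal (K1 powr P) * (ennreal ((1 / dst k l ^ (N + M)) powr P) * (\<integral>\<^sup>+x. ennreal (K2 * rad l ^ CARD('n)) * G f l x \<partial>lborel)) \<le> \<dots>" .
    qed
    also have "\<dots> = (ennreal (K1 powr P) * ennreal (K2 * K3) * epowr ?S P) * (\<integral>\<^sup>+l. ennreal ((1 / dst k l ^ M) powr P) \<partial>count_space UNIV)"
      by (rule nn_integral_cmult) simp
    also have "\<dots> \<le> (ennreal (K1 powr P) * ennreal (K2 * K3) * epowr ?S P) * ennreal K4" by (intro mult_left_mono K4(2)) auto
    also have "\<dots> = ennreal (K1 powr P * (K2 * K3) * K4) * epowr ?S P"
      using K1 K2 K3(1) K4(1) by (simp add: ennreal_mult mult_ac)
    finally have "epowr (\<integral>\<^sup>+x. epowr (?h x) P \<partial>lborel) (1 / P) \<le> epowr (ennreal (K1 powr P * (K2 * K3) * K4) * epowr ?S P) (1 / P)"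
      using P by (intro epowr_mono) auto
    also have "\<dots> = ennreal K * ?S"
      using P K1 K2 K3(1) K4(1) unfolding K_def by (simp add: epowr_mult epowr_ennreal epowr_epowr)
    finally show ?thesis unfolding I_def .
  qed
  with K0 show ?thesis by blast
qed

lemma block_Lp_estimate:
  assumes \<sigma>: "\<sigma> \<in> symbol_class 0 \<alpha> \<alpha>" and p: "0 < p"
  shows "\<exists>K>0. \<forall>f\<in>schwartz. \<forall>k. Lp_norm lborel p (\<lambda>x. ennreal (norm (convolve (inv_fourier (\<eta> k)) (pseudo_diff_op \<sigma> f) x)))
    \<le> ennreal K * (SUP l. ennreal (1 / dst k l ^ N) * Lp_norm lborel p (\<lambda>x. ennreal (norm (inv_fourier (blk f l) x))))"
proof (cases "p = \<infinity>")
  case True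
  then show ?thesis using block_Lp_sup[OF \<sigma>, of N] unfolding Lp_norm_def by simp
next
  case False
  then have "0 < enn2real p" using p by (simp add: enn2real_positive_iff less_top)
  from block_Lp_finite[OF \<sigma> this, of N] False show ?thesis unfolding Lp_norm_def by simp
qed

end

theorem theorem1p1:
  fixes \<alpha> s C :: real and p q :: ennreal
    and \<eta> :: "int ^ 'n::finite \<Rightarrow> real ^ 'n \<Rightarrow> complex"
    and \<sigma> :: "(real ^ 'n) \<times> (real ^ 'n) \<Rightarrow> complex"
  assumes "0 \<le> \<alpha>" and "\<alpha> < 1"
    and "0 < p" and "0 < q"
    and "1 < C" and "alpha_decomposition \<alpha> C \<eta>"
    and "\<sigma> \<in> symbol_class 0 \<alpha> \<alpha>"
  shows "bounded_alpha_mod \<eta> \<alpha> p q s s \<sigma>"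
proof -
  interpret alpha_partition \<alpha> C \<eta> by unfold_locales (use assms in auto)
  note \<sigma> = \<open>\<sigma> \<in> symbol_class 0 \<alpha> \<alpha>\<close>
  define \<tau> where "\<tau> = s / (1 - \<alpha>)"
  define S where "S = nat \<lceil>\<bar>\<tau>\<bar>\<rceil>"
  have S: "\<bar>\<tau>\<bar> \<le> real S" unfolding S_def by (rule real_nat_ceiling_ge)
  define w where "w k = jap (ivec k :: real ^ 'n) powr \<tau>" for k
  have w: "w k \<le> dst k l ^ S * w l" "0 \<le> w k" for k l
    using weight_moderate[OF S] by (auto simp: w_def)
  obtain N Kq where Kq: "Kq > 0" and lq: "\<forall>c\<ge>0. \<forall>a b :: int ^ 'n \<Rightarrow> ennreal. (\<forall>k. b k \<le> ennreal c * (SUP l. ennreal (1 / dst k l ^ N) * a l)) \<longrightarrow>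
    Lp_norm (count_space UNIV) q b \<le> ennreal (Kq * c) * Lp_norm (count_space UNIV) q a"
    using Lp_count_space_estimate[OF \<open>0 < q\<close>] by (elim exE conjE) (rule that)
  \<comment> \<open>\<open>N\<close> powers of decay are for the summation over the lattice,
    \<open>S\<close> further ones for moving the weight from k to l.\<close>
  obtain K where K: "K > 0" and Lp: "\<forall>f\<in>schwartz. \<forall>k. Lp_norm lborel p (\<lambda>x. ennreal (norm (convolve (inv_fourier (\<eta> k)) (pseudo_diff_op \<sigma> f) x)))
    \<le> ennreal K * (SUP l. ennreal (1 / dst k l ^ (N + S)) * Lp_norm lborel p (\<lambda>x. ennreal (norm (inv_fourier (blk f l) x))))"
    using block_Lp_estimate[OF \<sigma> \<open>0 < p\<close>, of "N + S"] by (elim exE conjE) (rule that)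
  have "alpha_mod_norm \<eta> \<alpha> p q s (dist_of (pseudo_diff_op \<sigma> f)) \<le> ennreal (Kq * K) * alpha_mod_norm \<eta> \<alpha> p q s (dist_of f)"
    if f: "f \<in> schwartz" for f
    unfolding alpha_mod_norm_def \<tau>_def[symmetric] w_def[symmetric]
  proof (rule lq[rule_format])
    show "0 \<le> K" using K by simp
    fix k
    let ?a = "\<lambda>l. dist_Lp_norm p (fourier_multiplier (\<eta> l) (dist_of f))"
    obtain B where "\<And>x. norm (pseudo_diff_op \<sigma> f x) \<le> B" using pseudo_diff_op_bounded(2)[OF \<sigma> f] by blast
    from represents_fourier_multiplier[OF eta_schwartz pseudo_diff_op_bounded(1)[OF \<sigma> f] this]
    \<comment> \<open>For the image one representative bounds the infimum from above; for the blocks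
      of \<open>f\<close> the converse inequality is used, which rests on uniqueness of the
      representative.\<close>
    have "dist_Lp_norm p (fourier_multiplier (\<eta> k) (dist_of (pseudo_diff_op \<sigma> f)))
        \<le> Lp_norm lborel p (\<lambda>x. ennreal (norm (convolve (inv_fourier (\<eta> k)) (pseudo_diff_op \<sigma> f) x)))"
      unfolding dist_Lp_norm_def by (intro INF_lower) simp
    also have "\<dots> \<le> ennreal K * (SUP l. ennreal (1 / dst k l ^ (N + S)) * Lp_norm lborel p (\<lambda>x. ennreal (norm (inv_fourier (blk f l) x))))"
      using Lp f by blast
    also have "\<dots> \<le> ennreal K * (SUP l. ennreal (1 / dst k l ^ (N + S)) * ?a l)"
      by (intro mult_left_mono SUP_mono' Lp_norm_le_dist_Lp_norm represents_block f) auto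
    finally have "ennreal (w k) * dist_Lp_norm p (fourier_multiplier (\<eta> k) (dist_of (pseudo_diff_op \<sigma> f)))
        \<le> ennreal (w k) * (ennreal K * (SUP l. ennreal (1 / dst k l ^ (N + S)) * ?a l))"
      by (rule mult_left_mono) simp
    also have "\<dots> = ennreal K * (SUP l. ennreal (w k) * (ennreal (1 / dst k l ^ (N + S)) * ?a l))"
      by (simp only: SUP_mult_left_ennreal mult_ac)
    also have "\<dots> \<le> ennreal K * (SUP l. ennreal (1 / dst k l ^ N) * (ennreal (w l) * ?a l))"
    proof (intro mult_left_mono SUP_mono')
      fix l
      have "w k * (1 / dst k l ^ (N + S)) \<le> dst k l ^ S * w l * (1 / dst k l ^ (N + S))"
        using dst_pos[of k l] by (intro mult_right_mono w) auto
      also have "\<dots> = 1 / dst k l ^ N * w l" using dst_pos[of k l] by (simp add: power_add)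
      finally have "ennreal (w k * (1 / dst k l ^ (N + S))) * ?a l \<le> ennreal (1 / dst k l ^ N * w l) * ?a l"
        by (intro mult_right_mono ennreal_leI) auto
      then show "ennreal (w k) * (ennreal (1 / dst k l ^ (N + S)) * ?a l) \<le> ennreal (1 / dst k l ^ N) * (ennreal (w l) * ?a l)"
        using w(2) dst_pos[of k l]
        by (simp only: ennreal_mult zero_le_divide_1_iff zero_le_power less_imp_le mult.assoc)
    qed auto
    finally show "ennreal (w k) * dist_Lp_norm p (fourier_multiplier (\<eta> k) (dist_of (pseudo_diff_op \<sigma> f)))
        \<le> ennreal K * (SUP l. ennreal (1 / dst k l ^ N) * (ennreal (w l) * ?a l))" .
  qed
  with pseudo_diff_op_tempered[OF \<sigma>] show ?thesis
    unfolding bounded_alpha_mod_def by (intro exI[where x="Kq * K"]) blast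
qed

end
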